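(* Let $\varphi:(M,g)\to(N,h)$ be a homothetic local diffeomorphism between Riemannian manifolds, $M$ compact. (i) If $\dim M\in\{2,3,4\}$, then $\varphi$ is a stable $\sigma_2$-critical map. (ii) If $\varphi$ is a stable map for the Dirichlet energy, then it is a stable $\sigma_2$-critical map too.
   Context: A local diffeomorphism $\varphi:(M,g)\to(N,h)$ is homothetic of dilation $\lambda$ if $\varphi^*h=\lambda^2g$ with $\mathrm{grad}\,\lambda=0$, $\lambda>0$. With $\lambda_i^2$ the eigenvalues of $\varphi^*h$ with respect to $g$, $\sigma_2(\varphi)=\sum_{i<j}\lambda_i^2\lambda_j^2$ and $\mathcal{E}_{\sigma_2}(\varphi)=\frac12\int_M\sigma_2(\varphi)\nu_g$. A map is $\sigma_2$-critical if the first variation of $\mathcal{E}_{\sigma_2}$ vanishes for every smooth variation; a $\sigma_2$-critical map is (weakly) stable if the bilinear form $\mathrm{Hess}^{\sigma_2}_\varphi(v,w)=\frac{\partial^2}{\partial t\partial s}\mathcal{E}_{\sigma_2}(\varphi_{t,s})|_{(0,0)}$, for two-parameter variations with variation fields $v,w\in\Gamma(\varphi^{-1}TN)$, is positive semi-definite. Stability for the Dirichlet energy $\frac12\int_M|\mathrm{d}\varphi|^2\nu_g$ (of a harmonic map) is defined in the same way. *)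

theory Defs
  imports "HOL-Analysis.Analysis"
begin

section \<open>Smooth maps between open subsets of Euclidean spaces\<close>

text \<open>
  \<open>Ck_on k S f\<close> is only meant for open \<open>S\<close>. The domain being finite-dimensional, continuity of
  all iterated directional derivatives is the usual notion of a \<open>C\<^sup>k\<close> map.
\<close>

primrec Ck_on :: "nat \<Rightarrow> 'a::euclidean_space set \<Rightarrow> ('a \<Rightarrow> 'b::real_normed_vector) \<Rightarrow> bool" where
  "Ck_on 0 S f \<longleftrightarrow> continuous_on S f"
| "Ck_on (Suc k) S f \<longleftrightarrow>
     (\<forall>x\<in>S. f differentiable (at x)) \<and> (\<forall>v. Ck_on k S (\<lambda>x. frechet_derivative f (at x) v))"

definition smooth_on :: "'a::euclidean_space set \<Rightarrow> ('a \<Rightarrow> 'b::real_normed_vector) \<Rightarrow> bool" where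
  "smooth_on S f \<longleftrightarrow> (\<forall>k. Ck_on k S f)"


section \<open>Smooth manifolds and smooth maps\<close>

text \<open>
  A manifold without boundary is a Hausdorff second countable space, given as a whole type \<open>'m\<close>,
  together with a smooth atlas (not necessarily maximal); the dimension is \<open>CARD('a)\<close>.
  A chart is a pair of its domain and its coordinate map; the values of the latter outside the
  domain are irrelevant.
\<close>

type_synonym ('m, 'a) chart = "'m set \<times> ('m \<Rightarrow> real ^ 'a)"

definition chart_inv :: "('m, 'a) chart \<Rightarrow> real ^ 'a \<Rightarrow> 'm" where
  "chart_inv \<kappa> = inv_into (fst \<kappa>) (snd \<kappa>)"

definition smooth_atlas ::
    "('m::{t2_space, second_countable_topology}, 'a::finite) chart set \<Rightarrow> bool" where
  "smooth_atlas A \<longleftrightarrow>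
     (\<forall>\<kappa>\<in>A. open (fst \<kappa>) \<and> open (snd \<kappa> ` fst \<kappa>) \<and>
        homeomorphism (fst \<kappa>) (snd \<kappa> ` fst \<kappa>) (snd \<kappa>) (chart_inv \<kappa>)) \<and>
     (\<Union>\<kappa>\<in>A. fst \<kappa>) = UNIV \<and>
     (\<forall>\<kappa>\<in>A. \<forall>\<kappa>'\<in>A. smooth_on (snd \<kappa> ` (fst \<kappa> \<inter> fst \<kappa>')) (snd \<kappa>' \<circ> chart_inv \<kappa>))"

definition chart_at :: "('m, 'a) chart set \<Rightarrow> 'm \<Rightarrow> ('m, 'a) chart" where
  "chart_at A p = (SOME \<kappa>. \<kappa> \<in> A \<and> p \<in> fst \<kappa>)"

definition smooth_map_on ::
    "('m::topological_space, 'a::finite) chart set \<Rightarrow> ('n::topological_space, 'b::finite) chart set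
       \<Rightarrow> 'm set \<Rightarrow> ('m \<Rightarrow> 'n) \<Rightarrow> bool" where
  "smooth_map_on A B S f \<longleftrightarrow>
     continuous_on S f \<and>
     (\<forall>\<kappa>\<in>A. \<forall>\<kappa>'\<in>B.
        smooth_on (snd \<kappa> ` (fst \<kappa> \<inter> S \<inter> f -` fst \<kappa>')) (snd \<kappa>' \<circ> f \<circ> chart_inv \<kappa>))"

definition smooth_function :: "('m::topological_space, 'a::finite) chart set \<Rightarrow> ('m \<Rightarrow> real) \<Rightarrow> bool" where
  "smooth_function A f \<longleftrightarrow> (\<forall>\<kappa>\<in>A. smooth_on (snd \<kappa> ` fst \<kappa>) (f \<circ> chart_inv \<kappa>))"

definition local_diffeomorphism ::
    "('m::topological_space, 'a::finite) chart set \<Rightarrow> ('n::topological_space, 'b::finite) chart set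
       \<Rightarrow> ('m \<Rightarrow> 'n) \<Rightarrow> bool" where
  "local_diffeomorphism A B \<phi> \<longleftrightarrow>
     (\<forall>p. \<exists>S. open S \<and> p \<in> S \<and> open (\<phi> ` S) \<and> inj_on \<phi> S \<and>
        smooth_map_on A B S \<phi> \<and> smooth_map_on B A (\<phi> ` S) (inv_into S \<phi>))"

text \<open>The matrix of the differential of \<open>f\<close> at \<open>p\<close> in the charts \<open>\<kappa>\<close> (source) and \<open>\<kappa>'\<close> (target).\<close>

definition differential_matrix ::
    "('m, 'a::finite) chart \<Rightarrow> ('n, 'b::finite) chart \<Rightarrow> ('m \<Rightarrow> 'n) \<Rightarrow> 'm \<Rightarrow> real ^ 'a ^ 'b" where
  "differential_matrix \<kappa> \<kappa>' f p = jacobian (snd \<kappa>' \<circ> f \<circ> chart_inv \<kappa>) (at (snd \<kappa> p))"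


section \<open>Riemannian metrics\<close>

text \<open>
  A metric is given by its Gram matrices \<open>g \<kappa> p\<close> with respect to the coordinate frames of the charts
  of the atlas, related by the transformation law of covariant 2-tensors. Only values with \<open>\<kappa>\<close> in
  the atlas and \<open>p\<close> in the domain of \<open>\<kappa>\<close> are relevant.
\<close>

type_synonym ('m, 'a) metric = "('m, 'a) chart \<Rightarrow> 'm \<Rightarrow> real ^ 'a ^ 'a"

definition riemannian_metric :: "('m::topological_space, 'a::finite) chart set \<Rightarrow> ('m, 'a) metric \<Rightarrow> bool" where
  "riemannian_metric A g \<longleftrightarrow>
     (\<forall>\<kappa>\<in>A. \<forall>p\<in>fst \<kappa>. transpose (g \<kappa> p) = g \<kappa> p \<and> (\<forall>u. u \<noteq> 0 \<longrightarrow> u \<bullet> (g \<kappa> p *v u) > 0)) \<and>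
     (\<forall>\<kappa>\<in>A. smooth_on (snd \<kappa> ` fst \<kappa>) (\<lambda>x. g \<kappa> (chart_inv \<kappa> x))) \<and>
     (\<forall>\<kappa>\<in>A. \<forall>\<kappa>'\<in>A. \<forall>p\<in>fst \<kappa> \<inter> fst \<kappa>'.
        g \<kappa> p = transpose (differential_matrix \<kappa> \<kappa>' id p) ** g \<kappa>' p ** differential_matrix \<kappa> \<kappa>' id p)"

definition riemannian_manifold ::
    "('m::{t2_space, second_countable_topology}, 'a::finite) chart set \<Rightarrow> ('m, 'a) metric \<Rightarrow> bool" where
  "riemannian_manifold A g \<longleftrightarrow> smooth_atlas A \<and> riemannian_metric A g"

text \<open>
  The Riemannian measure \<open>\<nu>\<^sub>g\<close>: the Borel measure given by \<open>sqrt (det g) dx\<close> in every chart. Since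
  countably many charts cover the manifold, exactly one measure has this property.
\<close>

definition is_riemannian_measure ::
    "('m::topological_space, 'a::finite) chart set \<Rightarrow> ('m, 'a) metric \<Rightarrow> 'm measure \<Rightarrow> bool" where
  "is_riemannian_measure A g \<nu> \<longleftrightarrow>
     sets \<nu> = sets borel \<and>
     (\<forall>\<kappa>\<in>A. \<forall>X\<in>sets borel. X \<subseteq> fst \<kappa> \<longrightarrow>
        emeasure \<nu> X =
          (\<integral>\<^sup>+ x. ennreal (sqrt (det (g \<kappa> (chart_inv \<kappa> x)))) * indicator (snd \<kappa> ` X) x \<partial>lborel))"

definition riemannian_measure ::
    "('m::topological_space, 'a::finite) chart set \<Rightarrow> ('m, 'a) metric \<Rightarrow> 'm measure" where
  "riemannian_measure A g = (SOME \<nu>. is_riemannian_measure A g \<nu>)"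

text \<open>The components of \<open>grad f\<close> at \<open>p\<close> in the chart \<open>\<kappa>\<close>, i.e. \<open>g\<^sup>i\<^sup>j \<partial>\<^sub>j f\<close>.\<close>

definition gradient :: "('m, 'a::finite) metric \<Rightarrow> ('m \<Rightarrow> real) \<Rightarrow> ('m, 'a) chart \<Rightarrow> 'm \<Rightarrow> real ^ 'a" where
  "gradient g f \<kappa> p =
     matrix_inv (g \<kappa> p) *v
       (\<chi> j. frechet_derivative (f \<circ> chart_inv \<kappa>) (at (snd \<kappa> p)) (axis j 1))"

text \<open>The Gram matrix at \<open>p\<close> of \<open>f\<^sup>*h\<close> in the chart \<open>\<kappa>\<close>, computed through the chart \<open>\<kappa>'\<close> around \<open>f p\<close>.\<close>

definition pullback_metric ::
    "('n, 'b::finite) metric \<Rightarrow> ('m, 'a::finite) chart \<Rightarrow> ('n, 'b) chart \<Rightarrow> ('m \<Rightarrow> 'n) \<Rightarrow> 'm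
       \<Rightarrow> real ^ 'a ^ 'a" where
  "pullback_metric h \<kappa> \<kappa>' f p =
     transpose (differential_matrix \<kappa> \<kappa>' f p) ** h \<kappa>' (f p) ** differential_matrix \<kappa> \<kappa>' f p"

definition homothetic ::
    "('m::topological_space, 'a::finite) chart set \<Rightarrow> ('m, 'a) metric \<Rightarrow>
     ('n::topological_space, 'b::finite) chart set \<Rightarrow> ('n, 'b) metric \<Rightarrow> ('m \<Rightarrow> 'n) \<Rightarrow> bool" where
  "homothetic A g B h \<phi> \<longleftrightarrow>
     (\<exists>dil. smooth_function A dil \<and> (\<forall>p. dil p > 0) \<and>
        (\<forall>\<kappa>\<in>A. \<forall>p\<in>fst \<kappa>. gradient g dil \<kappa> p = 0) \<and>
        (\<forall>\<kappa>\<in>A. \<forall>\<kappa>'\<in>B. \<forall>p\<in>fst \<kappa> \<inter> \<phi> -` fst \<kappa>'.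
           pullback_metric h \<kappa> \<kappa>' \<phi> p = (dil p)\<^sup>2 *\<^sub>R g \<kappa> p))"


section \<open>Energies\<close>

text \<open>
  Frames and eigenvalues are indexed by the numbers below the dimension, as \<open>\<sigma>\<^sub>2\<close> refers to an order
  of the indices. A list of eigenvalues of a symmetric bilinear form \<open>P\<close> with respect to an inner
  product \<open>G\<close>, repeated according to multiplicity, is one belonging to a \<open>G\<close>-orthonormal basis of
  eigenvectors; it is unique up to permutation. For \<open>P = f\<^sup>*h\<close> its entries are the \<open>\<lambda>\<^sub>i\<^sup>2\<close>.
\<close>

definition orthonormal_frame :: "real ^ 'a ^ 'a \<Rightarrow> (nat \<Rightarrow> real ^ 'a) \<Rightarrow> bool" where
  "orthonormal_frame G e \<longleftrightarrow>
     (\<forall>i<CARD('a). \<forall>j<CARD('a). e i \<bullet> (G *v e j) = (if i = j then 1 else 0))"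

definition is_eigenvalue_list :: "real ^ 'a ^ 'a \<Rightarrow> real ^ 'a ^ 'a \<Rightarrow> (nat \<Rightarrow> real) \<Rightarrow> bool" where
  "is_eigenvalue_list G P \<mu> \<longleftrightarrow>
     (\<exists>e. orthonormal_frame G e \<and> (\<forall>i<CARD('a). P *v e i = \<mu> i *\<^sub>R (G *v e i)))"

definition eigenvalue_list :: "real ^ 'a ^ 'a \<Rightarrow> real ^ 'a ^ 'a \<Rightarrow> nat \<Rightarrow> real" where
  "eigenvalue_list G P = (SOME \<mu>. is_eigenvalue_list G P \<mu>)"

definition sigma2 ::
    "('m, 'a::finite) chart set \<Rightarrow> ('m, 'a) metric \<Rightarrow> ('n, 'b::finite) chart set \<Rightarrow> ('n, 'b) metric
       \<Rightarrow> ('m \<Rightarrow> 'n) \<Rightarrow> 'm \<Rightarrow> real" where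
  "sigma2 A g B h f p =
     (let \<kappa> = chart_at A p; \<kappa>' = chart_at B (f p);
          \<mu> = eigenvalue_list (g \<kappa> p) (pullback_metric h \<kappa> \<kappa>' f p)
      in \<Sum>j<CARD('a). \<Sum>i<j. \<mu> i * \<mu> j)"

definition sigma2_energy ::
    "('m::topological_space, 'a::finite) chart set \<Rightarrow> ('m, 'a) metric \<Rightarrow>
     ('n, 'b::finite) chart set \<Rightarrow> ('n, 'b) metric \<Rightarrow> ('m \<Rightarrow> 'n) \<Rightarrow> real" where
  "sigma2_energy A g B h f = 1 / 2 * (\<integral>p. sigma2 A g B h f p \<partial>riemannian_measure A g)"

text \<open>\<open>|df|\<^sup>2 = \<Sum>\<^sub>i h(df e\<^sub>i, df e\<^sub>i)\<close> for an orthonormal frame \<open>(e\<^sub>i)\<close>.\<close>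

definition differential_norm_sq ::
    "('m, 'a::finite) chart set \<Rightarrow> ('m, 'a) metric \<Rightarrow> ('n, 'b::finite) chart set \<Rightarrow> ('n, 'b) metric
       \<Rightarrow> ('m \<Rightarrow> 'n) \<Rightarrow> 'm \<Rightarrow> real" where
  "differential_norm_sq A g B h f p =
     (let \<kappa> = chart_at A p; \<kappa>' = chart_at B (f p);
          D = differential_matrix \<kappa> \<kappa>' f p;
          e = (SOME e. orthonormal_frame (g \<kappa> p) e)
      in \<Sum>i<CARD('a). (D *v e i) \<bullet> (h \<kappa>' (f p) *v (D *v e i)))"

definition dirichlet_energy ::
    "('m::topological_space, 'a::finite) chart set \<Rightarrow> ('m, 'a) metric \<Rightarrow>
     ('n, 'b::finite) chart set \<Rightarrow> ('n, 'b) metric \<Rightarrow> ('m \<Rightarrow> 'n) \<Rightarrow> real" where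
  "dirichlet_energy A g B h f =
     1 / 2 * (\<integral>p. differential_norm_sq A g B h f p \<partial>riemannian_measure A g)"


section \<open>Variations, critical maps and stability\<close>

text \<open>Smoothness of \<open>(t, p) \<mapsto> \<Phi> t p\<close> on the product of an open parameter set \<open>T\<close> with the manifold.\<close>

definition smooth_family ::
    "'t::euclidean_space set \<Rightarrow> ('m::topological_space, 'a::finite) chart set \<Rightarrow>
     ('n::topological_space, 'b::finite) chart set \<Rightarrow> ('t \<Rightarrow> 'm \<Rightarrow> 'n) \<Rightarrow> bool" where
  "smooth_family T A B \<Phi> \<longleftrightarrow>
     continuous_on (T \<times> UNIV) (\<lambda>(t, p). \<Phi> t p) \<and>
     (\<forall>\<kappa>\<in>A. \<forall>\<kappa>'\<in>B.
        smooth_on {(t, x). t \<in> T \<and> x \<in> snd \<kappa> ` fst \<kappa> \<and> \<Phi> t (chart_inv \<kappa> x) \<in> fst \<kappa>'}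
          (\<lambda>(t, x). snd \<kappa>' (\<Phi> t (chart_inv \<kappa> x))))"

text \<open>
  A smooth section of \<open>\<phi>\<^sup>-\<^sup>1TN\<close>, given by its components \<open>v \<kappa>' p\<close> in the coordinate frames of the
  charts of the target around \<open>\<phi> p\<close>.
\<close>

definition section_along ::
    "('m::topological_space, 'a::finite) chart set \<Rightarrow> ('n::topological_space, 'b::finite) chart set
       \<Rightarrow> ('m \<Rightarrow> 'n) \<Rightarrow> (('n, 'b) chart \<Rightarrow> 'm \<Rightarrow> real ^ 'b) \<Rightarrow> bool" where
  "section_along A B \<phi> v \<longleftrightarrow>
     (\<forall>\<kappa>\<in>A. \<forall>\<kappa>'\<in>B. smooth_on (snd \<kappa> ` (fst \<kappa> \<inter> \<phi> -` fst \<kappa>')) (v \<kappa>' \<circ> chart_inv \<kappa>)) \<and>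
     (\<forall>\<kappa>'\<in>B. \<forall>\<kappa>''\<in>B. \<forall>p\<in>\<phi> -` (fst \<kappa>' \<inter> fst \<kappa>'').
        v \<kappa>'' p = differential_matrix \<kappa>' \<kappa>'' id (\<phi> p) *v v \<kappa>' p)"

definition one_parameter_variation ::
    "('m::topological_space, 'a::finite) chart set \<Rightarrow> ('n::topological_space, 'b::finite) chart set
       \<Rightarrow> ('m \<Rightarrow> 'n) \<Rightarrow> (real \<Rightarrow> 'm \<Rightarrow> 'n) \<Rightarrow> bool" where
  "one_parameter_variation A B \<phi> \<Phi> \<longleftrightarrow>
     (\<exists>\<epsilon>>0. smooth_family {-\<epsilon><..<\<epsilon>} A B \<Phi>) \<and> \<Phi> 0 = \<phi>"

text \<open>Two-parameter variations of \<open>\<phi>\<close> with variation fields \<open>v = \<partial>\<^sub>t\<Phi>\<close> and \<open>w = \<partial>\<^sub>s\<Phi>\<close> at \<open>(0, 0)\<close>.\<close>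

definition two_parameter_variation ::
    "('m::topological_space, 'a::finite) chart set \<Rightarrow> ('n::topological_space, 'b::finite) chart set
       \<Rightarrow> ('m \<Rightarrow> 'n) \<Rightarrow> (('n, 'b) chart \<Rightarrow> 'm \<Rightarrow> real ^ 'b) \<Rightarrow> (('n, 'b) chart \<Rightarrow> 'm \<Rightarrow> real ^ 'b)
       \<Rightarrow> (real \<times> real \<Rightarrow> 'm \<Rightarrow> 'n) \<Rightarrow> bool" where
  "two_parameter_variation A B \<phi> v w \<Phi> \<longleftrightarrow>
     (\<exists>\<epsilon>>0. smooth_family ({-\<epsilon><..<\<epsilon>} \<times> {-\<epsilon><..<\<epsilon>}) A B \<Phi>) \<and> \<Phi> (0, 0) = \<phi> \<and>
     (\<forall>\<kappa>'\<in>B. \<forall>p\<in>\<phi> -` fst \<kappa>'.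
        ((\<lambda>t. snd \<kappa>' (\<Phi> (t, 0) p)) has_vector_derivative v \<kappa>' p) (at 0) \<and>
        ((\<lambda>s. snd \<kappa>' (\<Phi> (0, s) p)) has_vector_derivative w \<kappa>' p) (at 0))"

definition critical_map ::
    "(('m \<Rightarrow> 'n) \<Rightarrow> real) \<Rightarrow> ('m::topological_space, 'a::finite) chart set \<Rightarrow>
     ('n::topological_space, 'b::finite) chart set \<Rightarrow> ('m \<Rightarrow> 'n) \<Rightarrow> bool" where
  "critical_map E A B \<phi> \<longleftrightarrow>
     smooth_map_on A B UNIV \<phi> \<and>
     (\<forall>\<Phi>. one_parameter_variation A B \<phi> \<Phi> \<longrightarrow>
        ((\<lambda>t. E (\<Phi> t)) has_real_derivative 0) (at 0))"

text \<open>
  \<open>r\<close> is the value at \<open>(v, w)\<close> of the Hessian of \<open>E\<close> at \<open>\<phi>\<close>. For a critical map of one of the energies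
  above, it does not depend on the choice of the variation.
\<close>

definition hessian_value ::
    "(('m \<Rightarrow> 'n) \<Rightarrow> real) \<Rightarrow> ('m::topological_space, 'a::finite) chart set \<Rightarrow>
     ('n::topological_space, 'b::finite) chart set \<Rightarrow> ('m \<Rightarrow> 'n) \<Rightarrow>
     (('n, 'b) chart \<Rightarrow> 'm \<Rightarrow> real ^ 'b) \<Rightarrow> (('n, 'b) chart \<Rightarrow> 'm \<Rightarrow> real ^ 'b) \<Rightarrow> real \<Rightarrow> bool" where
  "hessian_value E A B \<phi> v w r \<longleftrightarrow>
     (\<exists>\<Phi>. two_parameter_variation A B \<phi> v w \<Phi> \<and> r = deriv (\<lambda>t. deriv (\<lambda>s. E (\<Phi> (t, s))) 0) 0)"

definition stable_critical_map ::
    "(('m \<Rightarrow> 'n) \<Rightarrow> real) \<Rightarrow> ('m::topological_space, 'a::finite) chart set \<Rightarrow>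
     ('n::topological_space, 'b::finite) chart set \<Rightarrow> ('m \<Rightarrow> 'n) \<Rightarrow> bool" where
  "stable_critical_map E A B \<phi> \<longleftrightarrow>
     critical_map E A B \<phi> \<and>
     (\<forall>v r. section_along A B \<phi> v \<longrightarrow> hessian_value E A B \<phi> v v r \<longrightarrow> r \<ge> 0)"

end

theory Submission
  imports Defs
begin

text \<open>
  Let \<open>P\<close> be the pullback metric of a map, \<open>A = G\<inverse>P\<close> and \<open>J = sqrt (det A)\<close> its Jacobian, so that
  \<open>\<sigma>\<^sub>2 = ((tr A)\<^sup>2 - tr (A\<^sup>2)) / 2\<close> and \<open>|d\<phi>|\<^sup>2 = tr A\<close>. The weighted volume \<open>\<integral> c J \<nu>\<^sub>g\<close>, with
  \<open>c = \<lambda>\<^sup>4\<^sup>-\<^sup>n\<close> locally constant, is constant along variations of \<open>\<phi>\<close>: it is the integral over the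
  target of the weighted number of preimages. At \<open>\<phi>\<close>, where \<open>A = \<lambda>\<^sup>2 I\<close>, the first variation of
  \<open>\<sigma>\<^sub>2\<close> is that of \<open>2(n - 1) c J\<close>, so \<open>\<phi>\<close> is critical. If two directions have the same variation
  field, with \<open>Q\<close> the common first derivative and \<open>R\<close> the mixed second derivative of \<open>A\<close>, then
  \<open>\<sigma>\<^sub>2'' - 2(n - 1) c J'' = (n - 2) tr (Q\<^sup>2) - (n - 3)/2 (tr Q)\<^sup>2\<close>, which is nonnegative for
  \<open>n \<le> 4\<close> by Cauchy--Schwarz, and \<open>\<sigma>\<^sub>2'' - 2 c J'' = (n - 2) \<lambda>\<^sup>2 tr R + (tr Q)\<^sup>2/2\<close>, whose first
  term integrates to \<open>2(n - 2)\<close> times the Dirichlet Hessian at the field \<open>\<lambda> v\<close>.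
  As \<open>M\<close> may be disconnected, \<open>\<lambda>\<close> is only locally constant.
\<close>

section \<open>Smooth maps\<close>

text \<open>A Hessian contains the uncontrolled second-order part of the variation, here tr R.
  Removing it by a Jacobi operator would call for connections and the divergence theorem; instead a
  multiple of a functional that is constant along variations is subtracted. The exponent in c is
  forced: at \<phi> the derivative of J is \<lambda>^(n-2)/2 tr Q and that of sigma_2 is (n-1)
  \<lambda>^2 tr Q, so c = \<lambda>^(4-n) makes the two proportional at every point. The multiple
  2(n-1) cancels tr R altogether; the multiple 2 leaves a square next to the Dirichlet term. For n
  \<ge> 2, Cauchy--Schwarz bounds the first difference below by -(n-1)(n-4)/(2n) (tr Q)^2, whence n
  \<le> 4. Volume is shown constant without degree theory: over each fixed target point the weighted
  number of preimages is locally constant in the parameter, as M is compact and all slices are local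
  diffeomorphisms. The field \<lambda> v is realised by letting each point p run through the given
  variation at speed \<lambda>(p), which multiplies the second derivative of the Dirichlet density
  by \<lambda>^2.\<close>

lemma frechet_derivative_eqI: "(f has_derivative D) (at x) \<Longrightarrow> frechet_derivative f (at x) = D"
  by (metis frechet_derivative_at)

lemma frechet_derivative_cong_open:
  assumes "open S" "x \<in> S" "\<And>y. y \<in> S \<Longrightarrow> f y = g y" "f differentiable (at x)"
  shows "g differentiable (at x)" "frechet_derivative g (at x) = frechet_derivative f (at x)"
proof -
  have "(f has_derivative frechet_derivative f (at x)) (at x)"
    using assms(4) by (simp flip: frechet_derivative_works)
  then have "(g has_derivative frechet_derivative f (at x)) (at x)"
    using has_derivative_transform_within_open[OF _ assms(1-3)] by simp
  then show "g differentiable (at x)" "frechet_derivative g (at x) = frechet_derivative f (at x)"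
    using frechet_derivative_eqI[of g] differentiable_def[of g] by auto
qed

text \<open>A derivative at a point sees a whole neighbourhood, so agreement on \<open>S\<close>
  passes to derivatives because \<open>S\<close> is open. This is what makes chart expressions
  usable, as their values off the chart image are arbitrary.\<close>

lemma Ck_on_cong:
  assumes "open S" "\<And>x. x \<in> S \<Longrightarrow> f x = g x" "Ck_on k S f"
  shows "Ck_on k S g"
  using assms(2,3)
proof (induction k arbitrary: f g)
  case 0
  then show ?case by (simp add: continuous_on_eq)
next
  case (Suc k)
  have "Ck_on k S (\<lambda>x. frechet_derivative g (at x) v)" for v
  proof (rule Suc.IH[of "\<lambda>x. frechet_derivative f (at x) v"])
    show "frechet_derivative f (at x) v = frechet_derivative g (at x) v" if "x \<in> S" for x
      using Suc.prems frechet_derivative_cong_open(2)[OF assms(1) that, of f g] that by simp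
    show "Ck_on k S (\<lambda>x. frechet_derivative f (at x) v)" using Suc.prems by simp
  qed
  moreover have "g differentiable (at x)" if "x \<in> S" for x
    using Suc.prems frechet_derivative_cong_open(1)[OF assms(1) that] that by auto
  ultimately show ?case by simp
qed

lemma Ck_on_SucD: "Ck_on (Suc k) S f \<Longrightarrow> Ck_on k S f"
proof (induction k arbitrary: f)
  case 0
  then show ?case
    by (auto intro: differentiable_imp_continuous_within continuous_at_imp_continuous_on)
next
  case (Suc k)
  from Suc.prems have 1: "\<forall>x\<in>S. f differentiable (at x)" by simp
  have "Ck_on k S (\<lambda>x. frechet_derivative f (at x) v)" for v
    using Suc.prems by (intro Suc.IH) simp
  with 1 show ?case by simp
qed

lemma Ck_on_subset: "Ck_on k T f \<Longrightarrow> S \<subseteq> T \<Longrightarrow> Ck_on k S f"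
  by (induction k arbitrary: f) (auto intro: continuous_on_subset)

lemma Ck_on_SucI:
  assumes "open S" "\<And>x. x \<in> S \<Longrightarrow> (f has_derivative D x) (at x)" "\<And>v. Ck_on k S (\<lambda>x. D x v)"
  shows "Ck_on (Suc k) S f"
proof -
  have "Ck_on k S (\<lambda>x. frechet_derivative f (at x) v)" for v
    by (rule Ck_on_cong[OF assms(1) _ assms(3)]) (simp add: frechet_derivative_eqI[OF assms(2)])
  then show ?thesis using assms(2) by (auto simp: differentiable_def)
qed

lemma Ck_on_SucE:
  assumes "Ck_on (Suc k) S f"
  shows "x \<in> S \<Longrightarrow> (f has_derivative frechet_derivative f (at x)) (at x)"
    and "Ck_on k S (\<lambda>x. frechet_derivative f (at x) v)" and "Ck_on k S f"
  using assms Ck_on_SucD[OF assms] by (simp_all flip: frechet_derivative_works)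

text \<open>A chart expression makes sense only where the map lands in one fixed target chart, so
  smoothness is first obtained on small open sets and then patched together.\<close>

lemma Ck_on_local:
  assumes "\<And>x. x \<in> S \<Longrightarrow> \<exists>U. open U \<and> x \<in> U \<and> Ck_on k U f"
  shows "Ck_on k S f"
  using assms
proof (induction k arbitrary: f)
  case 0
  have "isCont f x" if x: "x \<in> S" for x
  proof -
    obtain U where "open U" "x \<in> U" "continuous_on U f" using 0[OF x] by auto
    then show ?thesis by (simp add: continuous_on_eq_continuous_at)
  qed
  then show ?case by (simp add: continuous_at_imp_continuous_on)
next
  case (Suc k)
  have "Ck_on k S (\<lambda>x. frechet_derivative f (at x) v)" for v
  proof (rule Suc.IH)
    fix x assume x: "x \<in> S"
    obtain U where "open U" "x \<in> U" "Ck_on (Suc k) U f" using Suc.prems[OF x] by blast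
    then show "\<exists>U. open U \<and> x \<in> U \<and> Ck_on k U (\<lambda>x. frechet_derivative f (at x) v)"
      by (intro exI[of _ U]) simp
  qed
  moreover have "f differentiable (at x)" if x: "x \<in> S" for x
  proof -
    obtain U where "open U" "x \<in> U" "Ck_on (Suc k) U f" using Suc.prems[OF x] by blast
    then show ?thesis by simp
  qed
  ultimately show ?case by simp
qed

lemma Ck_on_const: "Ck_on k S (\<lambda>x. c)"
  by (induction k arbitrary: c) auto

lemma Ck_on_bounded_linear:
  assumes "bounded_linear f" "open S" shows "Ck_on k S f"
proof (cases k)
  case 0
  then show ?thesis using assms by (simp add: linear_continuous_on)
next
  case (Suc l)
  then show ?thesis
    using Ck_on_SucI[OF assms(2) bounded_linear_imp_has_derivative[OF assms(1)]] Ck_on_const by blast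
qed

lemma Ck_on_add:
  assumes "open S" "Ck_on k S f" "Ck_on k S g" shows "Ck_on k S (\<lambda>x. f x + g x)"
  using assms(2,3)
proof (induction k arbitrary: f g)
  case 0 then show ?case by (simp add: continuous_on_add)
next
  case (Suc k)
  show ?case
    by (rule Ck_on_SucI[OF assms(1) has_derivative_add[OF Ck_on_SucE(1)[OF Suc.prems(1)] Ck_on_SucE(1)[OF Suc.prems(2)]]
          Suc.IH[OF Ck_on_SucE(2)[OF Suc.prems(1)] Ck_on_SucE(2)[OF Suc.prems(2)]]])
qed

lemma Ck_on_bilinear:
  assumes "bounded_bilinear h" "open S" "Ck_on k S f" "Ck_on k S g" shows "Ck_on k S (\<lambda>x. h (f x) (g x))"
  using assms(3,4)
proof (induction k arbitrary: f g)
  case 0 then show ?case using assms(1) by (simp add: bounded_bilinear.continuous_on)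
next
  case (Suc k)
  note f = Ck_on_SucE[OF Suc.prems(1)] and g = Ck_on_SucE[OF Suc.prems(2)]
  show ?case
    by (rule Ck_on_SucI[OF assms(2) bounded_bilinear.FDERIV[OF assms(1) f(1) g(1)]
          Ck_on_add[OF assms(2) Suc.IH[OF f(3) g(2)] Suc.IH[OF f(2) g(3)]]])
qed

lemma Ck_on_sum:
  assumes "open S" "finite I" "\<And>i. i \<in> I \<Longrightarrow> Ck_on k S (f i)" shows "Ck_on k S (\<lambda>x. \<Sum>i\<in>I. f i x)"
  using assms(2,3) by (induction I) (auto simp: Ck_on_const intro: Ck_on_add[OF assms(1)])

text \<open>Expanded over \<open>Basis\<close>, the derivative of the composite is a sum of products
  of a component of the derivative of \<open>f\<close> with a directional derivative of
  \<open>g\<close>, taken in a fixed direction and composed with \<open>f\<close>. The latter falls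
  under the induction hypothesis, so operator-valued maps are avoided.\<close>

lemma Ck_on_compose:
  fixes f :: "'a::euclidean_space \<Rightarrow> 'b::euclidean_space" and g :: "'b \<Rightarrow> 'c::real_normed_vector"
  assumes "open S" "f ` S \<subseteq> T" "Ck_on k S f" "Ck_on k T g"
  shows "Ck_on k S (\<lambda>x. g (f x))"
  using assms(3,4)
proof (induction k arbitrary: g)
  case 0 then show ?case using assms(2) by (auto intro: continuous_on_compose2)
next
  case (Suc k)
  let ?D = "\<lambda>x v. \<Sum>b\<in>Basis. (frechet_derivative f (at x) v \<bullet> b) *\<^sub>R frechet_derivative g (at (f x)) b"
  note f = Ck_on_SucE[OF Suc.prems(1)] and g = Ck_on_SucE[OF Suc.prems(2)]
  have d: "((\<lambda>x. g (f x)) has_derivative ?D x) (at x)" if "x \<in> S" for x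
  proof -
    have gx: "(g has_derivative frechet_derivative g (at (f x))) (at (f x))"
      using that assms(2) by (intro g(1)) auto
    have lin: "linear (frechet_derivative g (at (f x)))"
      by (rule has_derivative_linear[OF gx])
    have "frechet_derivative g (at (f x)) y = (\<Sum>b\<in>Basis. (y \<bullet> b) *\<^sub>R frechet_derivative g (at (f x)) b)" for y
    proof -
      have "frechet_derivative g (at (f x)) (\<Sum>b\<in>Basis. (y \<bullet> b) *\<^sub>R b) = (\<Sum>b\<in>Basis. (y \<bullet> b) *\<^sub>R frechet_derivative g (at (f x)) b)"
        by (simp only: linear_sum[OF lin] linear_scale[OF lin])
      then show ?thesis by (simp only: euclidean_representation)
    qed
    then have "frechet_derivative g (at (f x)) \<circ> frechet_derivative f (at x) = ?D x"
      unfolding o_def by (intro ext)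
    then show ?thesis
      using diff_chain_at[OF f(1)[OF that] gx] unfolding o_def by (simp only:)
  qed
  show ?case
  proof (rule Ck_on_SucI[OF assms(1) d])
    have "Ck_on k S (\<lambda>x. frechet_derivative f (at x) v \<bullet> b)" for b v
      by (rule Ck_on_bilinear[OF bounded_bilinear_inner assms(1) f(2) Ck_on_const])
    moreover have "Ck_on k S (\<lambda>x. frechet_derivative g (at (f x)) b)" for b
      by (rule Suc.IH[OF f(3) g(2)])
    ultimately show "Ck_on k S (\<lambda>x. ?D x v)" for v
      by (intro Ck_on_sum Ck_on_bilinear[OF bounded_bilinear_scaleR] assms(1)) auto
  qed
qed

lemma smooth_on_subset: "smooth_on T f \<Longrightarrow> S \<subseteq> T \<Longrightarrow> smooth_on S f"
  by (auto simp: smooth_on_def intro: Ck_on_subset)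

lemma smooth_on_cong:
  "open S \<Longrightarrow> (\<And>x. x \<in> S \<Longrightarrow> f x = g x) \<Longrightarrow> smooth_on S f \<Longrightarrow> smooth_on S g"
  unfolding smooth_on_def using Ck_on_cong[of S f g] by blast

lemma smooth_on_local:
  "(\<And>x. x \<in> S \<Longrightarrow> \<exists>U. open U \<and> x \<in> U \<and> smooth_on U f) \<Longrightarrow> smooth_on S f"
  unfolding smooth_on_def
proof (intro allI Ck_on_local)
  fix k x assume *: "\<And>x. x \<in> S \<Longrightarrow> \<exists>U. open U \<and> x \<in> U \<and> (\<forall>k. Ck_on k U f)" and "x \<in> S"
  from *[OF this(2)] show "\<exists>U. open U \<and> x \<in> U \<and> Ck_on k U f" by auto
qed

lemma smooth_on_const [simp]: "smooth_on S (\<lambda>x. c)"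
  by (simp add: smooth_on_def Ck_on_const)

lemma smooth_on_bounded_linear: "bounded_linear f \<Longrightarrow> open S \<Longrightarrow> smooth_on S f"
  by (simp add: smooth_on_def Ck_on_bounded_linear)

lemma smooth_on_bilinear:
  "bounded_bilinear h \<Longrightarrow> open S \<Longrightarrow> smooth_on S f \<Longrightarrow> smooth_on S g \<Longrightarrow> smooth_on S (\<lambda>x. h (f x) (g x))"
  by (simp add: smooth_on_def Ck_on_bilinear)

lemma smooth_on_sum:
  "open S \<Longrightarrow> finite I \<Longrightarrow> (\<And>i. i \<in> I \<Longrightarrow> smooth_on S (f i)) \<Longrightarrow> smooth_on S (\<lambda>x. \<Sum>i\<in>I. f i x)"
  by (simp add: smooth_on_def Ck_on_sum)

lemma smooth_on_compose:
  fixes f :: "'a::euclidean_space \<Rightarrow> 'b::euclidean_space" and g :: "'b \<Rightarrow> 'c::real_normed_vector"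
  shows "open S \<Longrightarrow> smooth_on T g \<Longrightarrow> smooth_on S f \<Longrightarrow> f ` S \<subseteq> T \<Longrightarrow> smooth_on S (\<lambda>x. g (f x))"
  by (simp add: smooth_on_def Ck_on_compose)

lemma smooth_on_linear_compose:
  fixes f :: "'a::euclidean_space \<Rightarrow> 'b::euclidean_space" and g :: "'b \<Rightarrow> 'c::real_normed_vector"
  shows "open S \<Longrightarrow> bounded_linear g \<Longrightarrow> smooth_on S f \<Longrightarrow> smooth_on S (\<lambda>x. g (f x))"
  by (rule smooth_on_compose[of S UNIV g f]) (auto intro: smooth_on_bounded_linear)

lemma smooth_on_mult:
  fixes f g :: "'a::euclidean_space \<Rightarrow> real"
  shows "open S \<Longrightarrow> smooth_on S f \<Longrightarrow> smooth_on S g \<Longrightarrow> smooth_on S (\<lambda>x. f x * g x)"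
  by (rule smooth_on_bilinear[OF bounded_bilinear_mult])

lemma smooth_on_add: "open S \<Longrightarrow> smooth_on S f \<Longrightarrow> smooth_on S g \<Longrightarrow> smooth_on S (\<lambda>x. f x + g x)"
  by (simp add: smooth_on_def Ck_on_add)

lemma smooth_on_diff:
  fixes f g :: "'a::euclidean_space \<Rightarrow> real"
  shows "open S \<Longrightarrow> smooth_on S f \<Longrightarrow> smooth_on S g \<Longrightarrow> smooth_on S (\<lambda>x. f x - g x)"
  using smooth_on_add[of S f "\<lambda>x. (-1) * g x"] smooth_on_mult[of S "\<lambda>x. -1" g] by simp

lemma smooth_on_prod:
  fixes f :: "'i \<Rightarrow> 'a::euclidean_space \<Rightarrow> real"
  assumes "open S" "finite I" "\<And>i. i \<in> I \<Longrightarrow> smooth_on S (f i)" shows "smooth_on S (\<lambda>x. \<Prod>i\<in>I. f i x)"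
  using assms(2,3) by (induction I) (auto intro: smooth_on_mult[OF assms(1)])

lemma smooth_on_vecI:
  fixes f :: "'a::euclidean_space \<Rightarrow> ('b::euclidean_space)^'n"
  assumes "open S" "\<And>i. smooth_on S (\<lambda>x. f x $ i)" shows "smooth_on S f"
proof -
  have lin: "bounded_linear (axis i :: 'b \<Rightarrow> 'b^'n)" for i
    unfolding linear_conv_bounded_linear[symmetric]
    by (rule linearI) (simp_all add: axis_def vec_eq_iff)
  have "smooth_on S (\<lambda>x. \<Sum>i\<in>UNIV. axis i (f x $ i) :: 'b^'n)"
    by (rule smooth_on_sum[OF assms(1) finite smooth_on_linear_compose[OF assms(1) lin assms(2)]])
  moreover have "f x = (\<Sum>i\<in>UNIV. axis i (f x $ i))" for x
    by (simp add: vec_eq_iff axis_def if_distrib cong: if_cong)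
  ultimately show ?thesis by simp
qed

lemma smooth_on_vec_nth:
  fixes f :: "'a::euclidean_space \<Rightarrow> ('b::euclidean_space)^'n"
  assumes "open S" "smooth_on S f" shows "smooth_on S (\<lambda>x. f x $ i)"
  by (rule smooth_on_linear_compose[OF assms(1) bounded_linear_vec_nth assms(2)])

lemma smooth_on_frechet:
  assumes "smooth_on S f" shows "smooth_on S (\<lambda>x. frechet_derivative f (at x) v)"
  unfolding smooth_on_def
proof
  fix k
  have "Ck_on (Suc k) S f" using assms unfolding smooth_on_def ..
  then show "Ck_on k S (\<lambda>x. frechet_derivative f (at x) v)" by (rule Ck_on_SucE(2))
qed

lemma smooth_on_continuous:
  assumes "smooth_on S f" shows "continuous_on S f"
proof -
  have "Ck_on 0 S f" using assms unfolding smooth_on_def ..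
  then show ?thesis by simp
qed

lemma smooth_on_has_derivative:
  assumes "smooth_on S f" "x \<in> S" shows "(f has_derivative frechet_derivative f (at x)) (at x)"
proof -
  have "Ck_on (Suc 0) S f" using assms unfolding smooth_on_def by (rule_tac allE)
  then show ?thesis using assms(2) by (rule Ck_on_SucE(1))
qed

lemma smooth_on_differentiable: "smooth_on S f \<Longrightarrow> x \<in> S \<Longrightarrow> f differentiable (at x)"
  using smooth_on_has_derivative[of S f x] by (auto simp: differentiable_def)

text \<open>Differentiation stays within the multiples of real powers, so the induction runs over
  \<open>c * x powr a\<close> with both constants free. The exponents 1/2 and -1 yield square roots
  and reciprocals.\<close>

lemma smooth_on_powr: "smooth_on {0<..} (\<lambda>x::real. x powr a)"
proof -
  have "Ck_on k {0<..} (\<lambda>x::real. c * x powr a)" for k c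
  proof (induction k arbitrary: a c)
    case 0 show ?case by (auto intro!: continuous_intros)
  next
    case (Suc k)
    have d: "((\<lambda>x::real. c * x powr a) has_derivative (\<lambda>v. (v * (c * a)) * x powr (a - 1))) (at x)" if "x > 0" for x
      using that by (auto intro!: derivative_eq_intros simp: powr_diff field_simps)
    show ?case
      by (rule Ck_on_SucI[OF open_greaterThan d Suc.IH]) simp
  qed
  from this[of _ 1] show ?thesis by (simp add: smooth_on_def)
qed

lemma smooth_on_sqrt:
  assumes "open S" "smooth_on S f" "\<And>x. x \<in> S \<Longrightarrow> f x > 0" shows "smooth_on S (\<lambda>x. sqrt (f x))"
  by (rule smooth_on_cong[OF assms(1) _ smooth_on_compose[OF assms(1) smooth_on_powr[of "1/2"] assms(2)]])
     (use assms in \<open>auto simp: powr_half_sqrt less_imp_le\<close>)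

lemma smooth_on_inverse:
  assumes "open S" "smooth_on S f" "\<And>x. x \<in> S \<Longrightarrow> f x > (0::real)" shows "smooth_on S (\<lambda>x. inverse (f x))"
  by (rule smooth_on_cong[OF assms(1) _ smooth_on_compose[OF assms(1) smooth_on_powr[of "-1"] assms(2)]])
     (use assms in \<open>auto simp: powr_minus less_imp_le\<close>)

lemma smooth_on_det:
  fixes M :: "'a::euclidean_space \<Rightarrow> real^'n^'n"
  assumes "open S" "smooth_on S M" shows "smooth_on S (\<lambda>x. det (M x))"
  unfolding det_def
  by (intro smooth_on_sum smooth_on_mult smooth_on_prod smooth_on_vec_nth assms) (auto simp: finite_permutations assms)

lemma smooth_on_matrix_mult:
  fixes M :: "'a::euclidean_space \<Rightarrow> real^'n^'m" and N :: "'a \<Rightarrow> real^'k^'n"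
  assumes "open S" "smooth_on S M" "smooth_on S N" shows "smooth_on S (\<lambda>x. M x ** N x)"
  by (intro smooth_on_vecI smooth_on_sum assms)
    (auto simp: matrix_matrix_mult_def intro!: smooth_on_sum smooth_on_mult smooth_on_vec_nth assms)

lemma smooth_on_transpose:
  fixes M :: "'a::euclidean_space \<Rightarrow> real^'n^'m"
  assumes "open S" "smooth_on S M" shows "smooth_on S (\<lambda>x. transpose (M x))"
  by (intro smooth_on_vecI smooth_on_sum assms)
    (auto simp: transpose_def intro!: smooth_on_vec_nth assms)

lemma smooth_on_trace:
  fixes M :: "'a::euclidean_space \<Rightarrow> real^'n^'n"
  assumes "open S" "smooth_on S M" shows "smooth_on S (\<lambda>x. trace (M x))"
  unfolding trace_def by (intro smooth_on_sum smooth_on_vec_nth assms) auto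

text \<open>Cramer's rule writes every entry of the inverse as a quotient of polynomials in the
  entries of \<open>A\<close>, from which smoothness of inversion is read off.\<close>

lemma matrix_inv_cramer:
  fixes A :: "real^'n^'n"
  assumes "det A \<noteq> 0"
  shows "matrix_inv A = (\<chi> i j. det (\<chi> k l. if l = i then (if k = j then 1 else 0) else A$k$l) / det A)"
proof -
  have "\<exists>B. A ** B = mat 1 \<and> B ** A = mat 1"
    using assms by (simp flip: invertible_det_nz add: invertible_def)
  then have "A ** matrix_inv A = mat 1"
    unfolding matrix_inv_def by (rule someI2_ex) simp
  then have "A *v (matrix_inv A *v axis j 1) = axis j 1" for j
    by (simp add: matrix_vector_mul_assoc)
  then have "matrix_inv A *v axis j 1 = (\<chi> i. det (\<chi> k l. if l = i then (axis j 1::real^'n)$k else A$k$l) / det A)" for j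
    using cramer[OF assms] by blast
  then have "(matrix_inv A *v axis j 1) $ i = (\<chi> i. det (\<chi> k l. if l = i then (axis j 1::real^'n)$k else A$k$l) / det A) $ i" for i j
    by simp
  moreover have "(axis j (1::real) :: real^'n) $ k = (if k = j then 1 else 0)" for j k
    by (simp add: axis_def)
  ultimately show ?thesis
    by (simp add: vec_eq_iff matrix_vector_mul_component inner_axis cong: if_cong)
qed

lemma smooth_on_matrix_inv:
  fixes M :: "'a::euclidean_space \<Rightarrow> real^'n^'n"
  assumes "open S" "smooth_on S M" "\<And>x. x \<in> S \<Longrightarrow> det (M x) > 0" shows "smooth_on S (\<lambda>x. matrix_inv (M x))"
proof -
  have "smooth_on S (\<lambda>x. \<chi> i j. det (\<chi> k l. if l = i then (if k = j then 1 else 0) else M x$k$l) * inverse (det (M x)) :: real^'n^'n)"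
  proof (intro smooth_on_vecI assms(1), simp)
    fix i j
    have "smooth_on S (\<lambda>x. (\<chi> k l. if l = i then (if k = j then 1 else 0) else M x$k$l) :: real^'n^'n)"
    proof (intro smooth_on_vecI assms(1))
      fix k l
      show "smooth_on S (\<lambda>x. ((\<chi> k l. if l = i then if k = j then 1 else 0 else M x $ k $ l)::real^'n^'n) $ k $ l)"
        by (cases "l = i") (auto intro!: smooth_on_vec_nth assms)
    qed
    then show "smooth_on S (\<lambda>x. det (\<chi> k l. if l = i then (if k = j then 1 else 0) else M x$k$l) * inverse (det (M x)))"
      by (intro smooth_on_mult smooth_on_det smooth_on_inverse assms) auto
  qed
  then show ?thesis
  proof (rule smooth_on_cong[OF assms(1), rotated])
    fix x assume "x \<in> S"
    then have "det (M x) \<noteq> 0" using assms(3) by force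
    from matrix_inv_cramer[OF this] show "(\<chi> i j. det (\<chi> k l. if l = i then (if k = j then 1 else 0) else M x$k$l) * inverse (det (M x))) = matrix_inv (M x)"
      by (simp only: divide_inverse)
  qed
qed

section \<open>Symmetry of second directional derivatives\<close>

text \<open>By the mean value theorem along \<open>v\<close> and then along \<open>w\<close>, the
  second difference over a small parallelogram is \<open>h^2\<close> times a value of the iterated
  derivative at an inner point; continuity of that derivative finishes. The second difference itself
  does not see the order of \<open>v\<close> and \<open>w\<close>.\<close>

lemma frechet_mixed_real:
  fixes f :: "'a::euclidean_space \<Rightarrow> real"
  assumes S: "open S" and f: "smooth_on S f" and x: "x \<in> S" and e: "e > 0"
  shows "\<exists>d>0. \<forall>h. 0 < h \<and> h < d \<longrightarrow>
    \<bar>(f (x + h *\<^sub>R v + h *\<^sub>R w) - f (x + h *\<^sub>R v) - f (x + h *\<^sub>R w) + f x) / h\<^sup>2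
       - frechet_derivative (\<lambda>y. frechet_derivative f (at y) v) (at x) w\<bar> < e"
proof -
  define F where "F y = frechet_derivative f (at y) v" for y
  define H where "H y = frechet_derivative F (at y) w" for y
  have F: "smooth_on S F" unfolding F_def by (rule smooth_on_frechet[OF f])
  have "continuous_on S H" unfolding H_def by (rule smooth_on_continuous[OF smooth_on_frechet[OF F]])
  then have "isCont H x" using S x continuous_on_eq_continuous_at by blast
  then obtain d0 where d0: "d0 > 0" "\<And>y. dist y x < d0 \<Longrightarrow> \<bar>H y - H x\<bar> < e"
    using e unfolding continuous_at dist_real_def LIM_def isCont_def
    by (metis abs_zero diff_self)
  obtain d1 where d1: "d1 > 0" "ball x d1 \<subseteq> S" using S x open_contains_ball by blast
  \<comment> \<open>Steps shorter than \<open>d\<close> along \<open>v\<close> and \<open>w\<close>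
    keep the whole parallelogram within \<open>S\<close> and within the ball on which
    \<open>H\<close> varies by less than \<open>e\<close>.\<close>
  define d where "d = min d0 d1 / (norm v + norm w + 1)"
  have pos: "norm v + norm w + 1 > 0" by (smt (verit) norm_ge_zero)
  have d: "d > 0" using d0 d1 pos by (simp add: d_def)
  have near: "dist (x + r *\<^sub>R v + s *\<^sub>R w) x < min d0 d1" if "0 \<le> r" "r < d" "0 \<le> s" "s < d" for r s
  proof -
    have "dist (x + r *\<^sub>R v + s *\<^sub>R w) x \<le> r * norm v + s * norm w"
      using that norm_triangle_ineq[of "r *\<^sub>R v" "s *\<^sub>R w"] by (simp add: dist_norm)
    also have "\<dots> \<le> d * norm v + d * norm w"
      using that by (intro add_mono mult_right_mono) auto
    also have "\<dots> < d * (norm v + norm w + 1)" using d by (simp add: algebra_simps)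
    also have "\<dots> = min d0 d1" using pos by (simp add: d_def)
    finally show ?thesis .
  qed
  have inS: "x + r *\<^sub>R v + s *\<^sub>R w \<in> S" if "0 \<le> r" "r < d" "0 \<le> s" "s < d" for r s
    using near[OF that] d1(2) by (auto simp: subset_iff dist_commute)
  have "\<bar>(f (x + h *\<^sub>R v + h *\<^sub>R w) - f (x + h *\<^sub>R v) - f (x + h *\<^sub>R w) + f x) / h\<^sup>2 - H x\<bar> < e"
    if h: "0 < h" "h < d" for h
  proof -
    \<comment> \<open>\<open>p r\<close> is the increment along \<open>w\<close> at the point moved
      by \<open>r\<close> along \<open>v\<close>; its increment from 0 to \<open>h\<close> is the
      second difference.\<close>
    define p where "p r = f (x + r *\<^sub>R v + h *\<^sub>R w) - f (x + r *\<^sub>R v)" for r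
    have fd: "((\<lambda>r. f (x + r *\<^sub>R v + s *\<^sub>R w)) has_real_derivative F (x + r *\<^sub>R v + s *\<^sub>R w)) (at r)"
      if "0 \<le> r" "r < d" "0 \<le> s" "s < d" for r s
    proof -
      have "((\<lambda>r. x + r *\<^sub>R v + s *\<^sub>R w) has_derivative (\<lambda>t. t *\<^sub>R v)) (at r)"
        by (auto intro!: derivative_eq_intros)
      from has_derivative_compose[OF this smooth_on_has_derivative[OF f inS[OF that]]]
      have "((\<lambda>r. f (x + r *\<^sub>R v + s *\<^sub>R w)) has_derivative (\<lambda>t. frechet_derivative f (at (x + r *\<^sub>R v + s *\<^sub>R w)) (t *\<^sub>R v))) (at r)" .
      moreover have "(\<lambda>t. frechet_derivative f (at (x + r *\<^sub>R v + s *\<^sub>R w)) (t *\<^sub>R v)) = (*) (F (x + r *\<^sub>R v + s *\<^sub>R w))"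
        using linear_scale[OF linear_frechet_derivative[OF smooth_on_differentiable[OF f inS[OF that]]]]
        by (auto simp: F_def)
      ultimately show ?thesis by (simp add: has_field_derivative_def)
    qed
    have Fd: "((\<lambda>s. F (x + r *\<^sub>R v + s *\<^sub>R w)) has_real_derivative H (x + r *\<^sub>R v + s *\<^sub>R w)) (at s)"
      if "0 \<le> r" "r < d" "0 \<le> s" "s < d" for r s
    proof -
      have "((\<lambda>s. x + r *\<^sub>R v + s *\<^sub>R w) has_derivative (\<lambda>t. t *\<^sub>R w)) (at s)"
        by (auto intro!: derivative_eq_intros)
      from has_derivative_compose[OF this smooth_on_has_derivative[OF F inS[OF that]]]
      have "((\<lambda>s. F (x + r *\<^sub>R v + s *\<^sub>R w)) has_derivative (\<lambda>t. frechet_derivative F (at (x + r *\<^sub>R v + s *\<^sub>R w)) (t *\<^sub>R w))) (at s)" .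
      moreover have "(\<lambda>t. frechet_derivative F (at (x + r *\<^sub>R v + s *\<^sub>R w)) (t *\<^sub>R w)) = (*) (H (x + r *\<^sub>R v + s *\<^sub>R w))"
        using linear_scale[OF linear_frechet_derivative[OF smooth_on_differentiable[OF F inS[OF that]]]]
        by (auto simp: H_def)
      ultimately show ?thesis by (simp add: has_field_derivative_def)
    qed
    have "\<exists>z>0. z < h \<and> p h - p 0 = (h - 0) * (F (x + z *\<^sub>R v + h *\<^sub>R w) - F (x + z *\<^sub>R v + 0 *\<^sub>R w))"
      using h fd[of _ h] fd[of _ 0] d unfolding p_def
      by (intro MVT2) (auto intro!: derivative_eq_intros)
    then obtain z where z: "0 < z" "z < h" "p h - p 0 = h * (F (x + z *\<^sub>R v + h *\<^sub>R w) - F (x + z *\<^sub>R v + 0 *\<^sub>R w))"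
      by auto
    have "\<exists>y>0. y < h \<and> F (x + z *\<^sub>R v + h *\<^sub>R w) - F (x + z *\<^sub>R v + 0 *\<^sub>R w) = (h - 0) * H (x + z *\<^sub>R v + y *\<^sub>R w)"
      using h z Fd[of z] by (intro MVT2) auto
    then obtain y where y: "0 < y" "y < h" "F (x + z *\<^sub>R v + h *\<^sub>R w) - F (x + z *\<^sub>R v + 0 *\<^sub>R w) = h * H (x + z *\<^sub>R v + y *\<^sub>R w)"
      by auto
    have "(p h - p 0) / h\<^sup>2 = H (x + z *\<^sub>R v + y *\<^sub>R w)"
      using z y h by (simp add: power2_eq_square)
    moreover have "\<bar>H (x + z *\<^sub>R v + y *\<^sub>R w) - H x\<bar> < e"
      using near[of z y] z y h by (intro d0) auto
    ultimately show ?thesis by (simp add: p_def algebra_simps)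
  qed
  then show ?thesis using d unfolding H_def F_def by blast
qed

text \<open>One and the same difference quotient approximates both iterated derivatives. For
  vector-valued \<open>f\<close> the components \<open>f z \<bullet> b\<close> reduce the claim to
  real functions.\<close>

lemma frechet_mixed_symmetric:
  fixes f :: "'a::euclidean_space \<Rightarrow> 'b::euclidean_space"
  assumes S: "open S" and f: "smooth_on S f" and x: "x \<in> S"
  shows "frechet_derivative (\<lambda>y. frechet_derivative f (at y) v) (at x) w
       = frechet_derivative (\<lambda>y. frechet_derivative f (at y) w) (at x) v"
proof -
  have real: "frechet_derivative (\<lambda>y. frechet_derivative g (at y) v) (at x) w
       = frechet_derivative (\<lambda>y. frechet_derivative g (at y) w) (at x) v" (is "?a = ?b")
    if g: "smooth_on S g" for g :: "'a \<Rightarrow> real"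
  proof (rule ccontr)
    assume ne: "?a \<noteq> ?b"
    define e where "e = \<bar>?a - ?b\<bar> / 2"
    have e: "e > 0" using ne by (simp add: e_def)
    obtain d1 where d1: "d1 > 0" "\<And>h. 0 < h \<and> h < d1 \<Longrightarrow>
       \<bar>(g (x + h *\<^sub>R v + h *\<^sub>R w) - g (x + h *\<^sub>R v) - g (x + h *\<^sub>R w) + g x) / h\<^sup>2 - ?a\<bar> < e"
      using frechet_mixed_real[OF S g x e, of v w] by blast
    obtain d2 where d2: "d2 > 0" "\<And>h. 0 < h \<and> h < d2 \<Longrightarrow>
       \<bar>(g (x + h *\<^sub>R w + h *\<^sub>R v) - g (x + h *\<^sub>R w) - g (x + h *\<^sub>R v) + g x) / h\<^sup>2 - ?b\<bar> < e"
      using frechet_mixed_real[OF S g x e, of w v] by blast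
    define h where "h = min d1 d2 / 2"
    have "0 < h \<and> h < d1" "0 < h \<and> h < d2" using d1 d2 by (auto simp: h_def)
    note * = d1(2)[OF this(1)] d2(2)[OF this(2)]
    define q where "q = (g (x + h *\<^sub>R v + h *\<^sub>R w) - g (x + h *\<^sub>R v) - g (x + h *\<^sub>R w) + g x) / h\<^sup>2"
    have "(g (x + h *\<^sub>R w + h *\<^sub>R v) - g (x + h *\<^sub>R w) - g (x + h *\<^sub>R v) + g x) / h\<^sup>2 = q"
      by (simp add: q_def algebra_simps)
    with * have "\<bar>q - ?a\<bar> < e" "\<bar>q - ?b\<bar> < e" by (simp_all add: q_def)
    moreover have "2 * e = \<bar>?a - ?b\<bar>" by (simp add: e_def)
    ultimately show False by linarith
  qed
  have comp: "frechet_derivative (\<lambda>y. frechet_derivative (\<lambda>z. f z \<bullet> b) (at y) u) (at x) t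
      = frechet_derivative (\<lambda>y. frechet_derivative f (at y) u) (at x) t \<bullet> b" for u t b
  proof -
    have 1: "frechet_derivative (\<lambda>z. f z \<bullet> b) (at y) u = frechet_derivative f (at y) u \<bullet> b" if "y \<in> S" for y u
      by (rule fun_cong[OF frechet_derivative_eqI[OF has_derivative_inner_left[OF smooth_on_has_derivative[OF f that]]]])
    have 2: "((\<lambda>y. frechet_derivative f (at y) u \<bullet> b) has_derivative
        (\<lambda>t. frechet_derivative (\<lambda>y. frechet_derivative f (at y) u) (at x) t \<bullet> b)) (at x)"
      by (rule has_derivative_inner_left[OF smooth_on_has_derivative[OF smooth_on_frechet[OF f] x]])
    show ?thesis
      by (rule fun_cong[OF frechet_derivative_eqI[OF has_derivative_transform_within_open[OF 2 S x]]]) (simp add: 1)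
  qed
  show ?thesis
  proof (rule euclidean_eqI)
    fix b :: 'b assume "b \<in> Basis"
    have "smooth_on S (\<lambda>z. f z \<bullet> b)"
      by (rule smooth_on_linear_compose[OF S bounded_linear_inner_left f])
    from real[OF this] show "frechet_derivative (\<lambda>y. frechet_derivative f (at y) v) (at x) w \<bullet> b
       = frechet_derivative (\<lambda>y. frechet_derivative f (at y) w) (at x) v \<bullet> b"
      by (simp only: comp)
  qed
qed

section \<open>Symmetric forms, traces and determinants\<close>

lemma inner_matrix_vector: "x \<bullet> (A *v y) = (transpose A *v x) \<bullet> y"
  for A :: "real^'n^'m"
  by (simp add: dot_lmul_matrix)

lemma matrix_inv_unique:
  fixes A B :: "real^'n^'n"
  assumes "A ** B = mat 1" shows "matrix_inv A = B"
proof -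
  have "\<exists>C. A ** C = mat 1 \<and> C ** A = mat 1"
    using assms matrix_left_right_inverse[of A B] by blast
  then have "A ** matrix_inv A = mat 1 \<and> matrix_inv A ** A = mat 1"
    unfolding matrix_inv_def by (rule someI_ex)
  then show ?thesis using assms
    by (metis matrix_mul_assoc matrix_mul_lid matrix_mul_rid)
qed

lemma matrix_inv_cancel:
  fixes A :: "real^'n^'n"
  assumes "det A \<noteq> 0" shows "A ** matrix_inv A = mat 1" "matrix_inv A ** A = mat 1"
proof -
  obtain B where B: "A ** B = mat 1"
    using assms by (auto simp flip: invertible_det_nz simp: invertible_def)
  then show "A ** matrix_inv A = mat 1" using matrix_inv_unique[OF B] by simp
  then show "matrix_inv A ** A = mat 1" using matrix_left_right_inverse[of A] by simp
qed

definition posdef :: "real^'a^'a \<Rightarrow> bool" where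
  "posdef G \<longleftrightarrow> transpose G = G \<and> (\<forall>u. u \<noteq> 0 \<longrightarrow> u \<bullet> (G *v u) > 0)"

lemma symmetric_inner: "transpose P = P \<Longrightarrow> u \<bullet> (P *v v) = v \<bullet> (P *v u)"
  for P :: "real^'a^'a"
  by (metis inner_matrix_vector inner_commute)

text \<open>This is the first-order condition at a maximum: for small t the linear term dominates
  the quadratic one.\<close>

lemma quadratic_nonpos_linear_zero:
  fixes a b :: real
  assumes "\<And>t. 2 * t * a + t\<^sup>2 * b \<le> 0" shows "a = 0"
proof (rule ccontr)
  assume a: "a \<noteq> 0"
  \<comment> \<open>The choice makes 2 c + b positive, so the value at t = a / c, which is (a / c)^2
    (2 c + b), is positive.\<close>
  define c where "c = \<bar>b\<bar> + 1"
  have c: "c > 0" "b > - 2 * c" by (auto simp: c_def)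
  have "2 * (a / c) * a + (a / c)\<^sup>2 * b = (a / c)\<^sup>2 * (2 * c + b)"
    using c by (simp add: field_simps power2_eq_square)
  moreover have "(a / c)\<^sup>2 * (2 * c + b) > 0"
    using a c by (intro mult_pos_pos) auto
  ultimately show False using assms[of "a / c"] by linarith
qed

section \<open>Simultaneous diagonalisation of two symmetric forms\<close>

text \<open>Eigenvectors are found one at a time: the next one maximises the Rayleigh quotient of
  \<open>P\<close> with respect to \<open>G\<close> on the \<open>G\<close>-orthogonal complement of
  those already found. The bound on \<open>k\<close> keeps this complement nonzero.\<close>

lemma partial_eigenframe:
  fixes G P :: "real^'a^'a"
  assumes G: "posdef G" and P: "transpose P = P" and "k \<le> CARD('a)"
  shows "\<exists>e \<mu>. (\<forall>i<k. \<forall>j<k. e i \<bullet> (G *v e j) = (if i = j then 1 else 0)) \<and>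
    (\<forall>i<k. P *v e i = \<mu> i *\<^sub>R (G *v e i))"
  using assms(3)
proof (induction k)
  case 0 then show ?case by simp
next
  case (Suc k)
  then obtain e \<mu> where e: "\<And>i j. i < k \<Longrightarrow> j < k \<Longrightarrow> e i \<bullet> (G *v e j) = (if i = j then 1 else 0)"
    and \<mu>: "\<And>i. i < k \<Longrightarrow> P *v e i = \<mu> i *\<^sub>R (G *v e i)" by fastforce
  have Gs: "transpose G = G" and Gp: "u \<noteq> 0 \<Longrightarrow> u \<bullet> (G *v u) > 0" for u using G by (auto simp: posdef_def)
  \<comment> \<open>\<open>W\<close> is that complement; a dimension count provides a nonzero
    element \<open>x0\<close>, so that its unit sphere \<open>K\<close> is nonempty and
    compact.\<close>
  define W where "W = {x. \<forall>i<k. (G *v e i) \<bullet> x = 0}"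
  have Wadd: "x + t *\<^sub>R y \<in> W" if "x \<in> W" "y \<in> W" for x y t
    using that by (simp add: W_def inner_right_distrib)
  have Wscale: "t *\<^sub>R y \<in> W" if "y \<in> W" for y t
    using that by (simp add: W_def)
  let ?S = "(\<lambda>i. G *v e i) ` {..<k}"
  have "dim ?S \<le> card ?S" by (rule dim_le_card') simp
  also have "\<dots> \<le> k" using card_image_le[of "{..<k}"] by simp
  finally have "dim ?S < DIM(real^'a)" using Suc.prems by simp
  then obtain x0 where x0: "x0 \<noteq> 0" "\<And>y. y \<in> span ?S \<Longrightarrow> orthogonal x0 y"
    by (rule orthogonal_to_subspace_exists) blast
  have "x0 \<in> W"
    unfolding W_def using x0(2)[OF span_base] by (simp add: orthogonal_def inner_commute[of _ x0])
  define K where "K = W \<inter> sphere 0 1"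
  have "W = (\<Inter>i<k. {x. (G *v e i) \<bullet> x = 0})" by (auto simp: W_def)
  then have "closed W" by (auto intro!: closed_INT closed_hyperplane)
  then have K: "compact K" unfolding K_def by (simp add: closed_Int_compact)
  define f where "f x = (x \<bullet> (P *v x)) / (x \<bullet> (G *v x))" for x
  have "(1 / norm x0) *\<^sub>R x0 \<in> K" using x0(1) Wscale[OF \<open>x0 \<in> W\<close>] by (simp add: K_def)
  then have "K \<noteq> {}" by auto
  have "y \<bullet> (G *v y) \<noteq> 0" if "y \<in> K" for y
  proof -
    have "y \<noteq> 0" using that by (auto simp: K_def)
    from Gp[OF this] show ?thesis by simp
  qed
  then have "continuous_on K f" unfolding f_def
    by (intro continuous_intros) auto
  with \<open>K \<noteq> {}\<close> obtain x where x: "x \<in> K" "\<And>y. y \<in> K \<Longrightarrow> f y \<le> f x"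
    using continuous_attains_sup[OF K, of f] by auto
  have xW: "x \<in> W" and xn: "x \<noteq> 0" using x by (auto simp: K_def)
  \<comment> \<open>The maximiser \<open>x\<close> is an eigenvector with eigenvalue
    \<open>f x\<close> exactly when the residual \<open>N *v x\<close> vanishes. By maximality the
    form \<open>N\<close> is nonpositive on \<open>W\<close> and takes the value 0 at
    \<open>x\<close>.\<close>
  define N where "N = P - f x *\<^sub>R G"
  have Nv: "N *v u = P *v u - f x *\<^sub>R (G *v u)" for u
    by (simp add: N_def matrix_vector_mult_diff_rdistrib scaleR_matrix_vector_assoc)
  have Ns: "u \<bullet> (N *v v) = v \<bullet> (N *v u)" for u v
    using symmetric_inner[OF P, of u v] symmetric_inner[OF Gs, of u v] by (simp add: Nv inner_diff_right)
  have q: "w \<bullet> (N *v w) \<le> 0" if w: "w \<in> W" for w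
  proof (cases "w = 0")
    case False
    have "(1 / norm w) *\<^sub>R w \<in> K" using False Wscale[OF w] by (simp add: K_def)
    from x(2)[OF this] have "f w \<le> f x"
      using False by (simp add: f_def matrix_vector_mult_scaleR)
    then have "w \<bullet> (P *v w) \<le> f x * (w \<bullet> (G *v w))"
      using Gp[OF False] unfolding f_def[of w] by (simp add: pos_divide_le_eq)
    then show ?thesis by (simp add: Nv inner_diff_right)
  qed simp
  have q0: "x \<bullet> (N *v x) = 0"
    using Gp[OF xn] by (simp add: Nv inner_diff_right f_def)
  have orth: "w \<bullet> (N *v x) = 0" if w: "w \<in> W" for w
  proof (rule quadratic_nonpos_linear_zero)
    fix t :: real
    have "(x + t *\<^sub>R w) \<bullet> (N *v (x + t *\<^sub>R w)) \<le> 0" using q Wadd[OF xW w] by blast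
    then show "2 * t * (w \<bullet> (N *v x)) + t\<^sup>2 * (w \<bullet> (N *v w)) \<le> 0"
      using q0 Ns[of x w] by (simp add: matrix_vector_right_distrib matrix_vector_mult_scaleR inner_add_left inner_add_right power2_eq_square algebra_simps)
  qed
  have xe: "x \<bullet> (G *v e i) = 0" if "i < k" for i
    using xW that by (simp add: W_def inner_commute)
  have eN: "e i \<bullet> (N *v x) = 0" if "i < k" for i
    using Ns[of "e i" x] xe[OF that] \<mu>[OF that] by (simp add: Nv inner_diff_right)
  have "N *v x = 0"
  proof -
    define u where "u = N *v x"
    \<comment> \<open>\<open>w\<close> is the \<open>G\<close>-orthogonal projection of the residual
      \<open>u\<close> to \<open>W\<close>. The residual is orthogonal, in the Euclidean sense, to
      \<open>W\<close> and to every \<open>e j\<close>, hence to itself.\<close>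
    define w where "w = u - (\<Sum>j<k. (e j \<bullet> (G *v u)) *\<^sub>R e j)"
    have "(G *v e i) \<bullet> w = 0" if i: "i < k" for i
    proof -
      have "(G *v e i) \<bullet> (\<Sum>j<k. (e j \<bullet> (G *v u)) *\<^sub>R e j) = (\<Sum>j<k. (e j \<bullet> (G *v u)) * (if j = i then 1 else 0))"
        using e i by (auto simp: inner_sum_right inner_commute intro!: sum.cong)
      also have "\<dots> = e i \<bullet> (G *v u)" using i by (simp add: if_distrib cong: if_cong)
      finally show ?thesis unfolding w_def
        using symmetric_inner[OF Gs, of "e i" u] by (simp add: inner_diff_right inner_commute)
    qed
    then have "w \<in> W" by (simp add: W_def)
    then have "w \<bullet> u = 0" using orth by (simp add: u_def)
    moreover have "(\<Sum>j<k. (e j \<bullet> (G *v u)) *\<^sub>R e j) \<bullet> u = 0"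
      using eN by (simp add: inner_sum_left u_def)
    ultimately have "u \<bullet> u = 0" by (simp add: w_def inner_diff_left)
    then show ?thesis by (simp add: u_def)
  qed
  have ex: "e i \<bullet> (G *v x) = 0" if "i < k" for i
    using xe[OF that] symmetric_inner[OF Gs, of x "e i"] by simp
  define c where "c = 1 / sqrt (x \<bullet> (G *v x))"
  define e' where "e' i = (if i < k then e i else c *\<^sub>R x)" for i
  define \<mu>' where "\<mu>' i = (if i < k then \<mu> i else f x)" for i
  have cc: "c * (c * (x \<bullet> (G *v x))) = 1" using Gp[OF xn] by (simp add: c_def field_simps)
  have "e' i \<bullet> (G *v e' j) = (if i = j then 1 else 0)" if "i < Suc k" "j < Suc k" for i j
    using that e cc xe ex by (auto simp: e'_def less_Suc_eq matrix_vector_mult_scaleR)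
  moreover have "P *v e' i = \<mu>' i *\<^sub>R (G *v e' i)" if "i < Suc k" for i
    using that \<mu> \<open>N *v x = 0\<close> by (auto simp: e'_def \<mu>'_def less_Suc_eq matrix_vector_mult_scaleR Nv)
  ultimately show ?case by blast
qed

lemma eigenvalue_list_exists:
  fixes G P :: "real^'a^'a"
  assumes "posdef G" "transpose P = P"
  shows "\<exists>\<mu>. is_eigenvalue_list G P \<mu>"
  using partial_eigenframe[OF assms order_refl] unfolding is_eigenvalue_list_def orthonormal_frame_def by blast

lemma matrix_entry: "A $ i $ j = axis i 1 \<bullet> (A *v axis j 1)" for A :: "real^'n^'m"
  by (simp add: matrix_vector_mul_component inner_axis inner_axis')

text \<open>With the frame vectors as columns of \<open>E\<close>, orthonormality reads
  \<open>transpose E ** G ** E = mat 1\<close>, which gives both the inverse of \<open>G\<close> and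
  the sign of its determinant. The bijection \<open>b\<close> reconciles the numbering of frames by
  naturals with the index type of matrices.\<close>

lemma orthonormal_frame_matrix:
  fixes G :: "real^'a^'a"
  assumes "orthonormal_frame G e"
  obtains b :: "'a \<Rightarrow> nat" and E :: "real^'a^'a"
  where "bij_betw b UNIV {..<CARD('a)}" "matrix_inv G = E ** transpose E" "det G > 0"
    "\<And>M i j. (transpose E ** M ** E) $ i $ j = e (b i) \<bullet> (M *v e (b j))"
proof -
  obtain b where b: "bij_betw b (UNIV::'a set) {..<CARD('a)}"
    using ex_bij_betw_finite_nat[of "UNIV::'a set"] by (auto simp: atLeast0LessThan)
  define E :: "real^'a^'a" where "E = (\<chi> i j. e (b j) $ i)"
  have Ea: "E *v axis j 1 = e (b j)" for j
    by (simp add: E_def vec_eq_iff matrix_vector_mul_component inner_axis)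
  have ent: "(transpose E ** M ** E) $ i $ j = e (b i) \<bullet> (M *v e (b j))" for M i j
  proof -
    have "(transpose E ** M ** E) $ i $ j = axis i 1 \<bullet> (transpose E *v (M *v (E *v axis j 1)))"
      by (subst matrix_entry) (simp only: matrix_vector_mul_assoc matrix_mul_assoc)
    also have "\<dots> = e (b i) \<bullet> (M *v e (b j))"
      by (subst inner_matrix_vector) (simp only: transpose_transpose Ea)
    finally show ?thesis .
  qed
  have bl: "b i < CARD('a)" for i using b by (auto simp: bij_betw_def)
  have "b i = b j \<longleftrightarrow> i = j" for i j using b by (auto simp: bij_betw_def inj_on_def)
  then have I: "transpose E ** G ** E = mat 1"
    using assms bl unfolding orthonormal_frame_def vec_eq_iff by (auto simp: ent mat_def)
  then have "E ** (transpose E ** G) = mat 1" by (simp add: matrix_left_right_inverse)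
  then have "(E ** transpose E) ** G = mat 1" by (simp add: matrix_mul_assoc)
  then have "G ** (E ** transpose E) = mat 1" by (simp add: matrix_left_right_inverse)
  then have inv: "matrix_inv G = E ** transpose E" by (rule matrix_inv_unique)
  have "det (transpose E ** G ** E) = 1" by (simp add: I)
  then have "(det E)\<^sup>2 * det G = 1" by (simp add: det_mul det_transpose power2_eq_square mult_ac)
  then have "det G > 0"
    by (metis mult_zero_left mult_zero_right not_less_iff_gr_or_eq zero_less_mult_iff zero_less_one zero_less_power2 not_square_less_zero power2_less_0)
  from that[OF b inv this ent] show thesis .
qed

lemma orthonormal_frame_exists:
  fixes G :: "real^'a^'a"
  assumes "posdef G" shows "\<exists>e. orthonormal_frame G e"
  using eigenvalue_list_exists[OF assms, of "mat 1"] by (auto simp: is_eigenvalue_list_def)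

lemma posdef_det_pos: "posdef G \<Longrightarrow> det G > 0"
  using orthonormal_frame_exists orthonormal_frame_matrix by metis

lemma trace_frame:
  fixes G :: "real^'a^'a"
  assumes "orthonormal_frame G e"
  shows "trace (matrix_inv G ** P) = (\<Sum>i<CARD('a). e i \<bullet> (P *v e i))"
proof -
  obtain b and E where b: "bij_betw b (UNIV::'a set) {..<CARD('a)}" and inv: "matrix_inv G = E ** transpose E"
    and ent: "\<And>M i j. (transpose E ** M ** E) $ i $ j = e (b i) \<bullet> (M *v e (b j))"
    using orthonormal_frame_matrix[OF assms] by metis
  have "trace (matrix_inv G ** P) = trace (E ** (transpose E ** P))" by (simp add: inv matrix_mul_assoc)
  also have "\<dots> = trace (transpose E ** P ** E)" by (subst trace_mul_sym) simp
  also have "\<dots> = (\<Sum>i\<in>UNIV. e (b i) \<bullet> (P *v e (b i)))" unfolding trace_def ent ..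
  also have "\<dots> = (\<Sum>i<CARD('a). e i \<bullet> (P *v e i))"
    using sum.reindex_bij_betw[OF b, of "\<lambda>i. e i \<bullet> (P *v e i)"] by simp
  finally show ?thesis .
qed

lemma trace_eigenvalues:
  fixes G :: "real^'a^'a"
  assumes "is_eigenvalue_list G P \<mu>"
  shows "trace (matrix_inv G ** P) = (\<Sum>i<CARD('a). \<mu> i)"
    and "trace ((matrix_inv G ** P) ** (matrix_inv G ** P)) = (\<Sum>i<CARD('a). (\<mu> i)\<^sup>2)"
proof -
  obtain e where e: "orthonormal_frame G e" and P: "\<And>i. i < CARD('a) \<Longrightarrow> P *v e i = \<mu> i *\<^sub>R (G *v e i)"
    using assms unfolding is_eigenvalue_list_def by blast
  have Gij: "e i \<bullet> (G *v e j) = (if i = j then 1 else 0)" if "i < CARD('a)" "j < CARD('a)" for i j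
    using e that unfolding orthonormal_frame_def by blast
  show "trace (matrix_inv G ** P) = (\<Sum>i<CARD('a). \<mu> i)"
    unfolding trace_frame[OF e] using P Gij by (intro sum.cong) auto
  have "det G \<noteq> 0" using orthonormal_frame_matrix[OF e] by (metis less_irrefl)
  then have "matrix_inv G ** G = mat 1" by (rule matrix_inv_cancel)
  then have "(P ** (matrix_inv G ** P)) *v e i = (\<mu> i)\<^sup>2 *\<^sub>R (G *v e i)" if "i < CARD('a)" for i
    using P[OF that] by (simp add: matrix_vector_mul_assoc[symmetric] matrix_vector_mult_scaleR power2_eq_square)
      (simp add: matrix_vector_mul_assoc P[OF that])
  moreover have "trace ((matrix_inv G ** P) ** (matrix_inv G ** P)) = trace (matrix_inv G ** (P ** (matrix_inv G ** P)))"
    by (simp add: matrix_mul_assoc)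
  ultimately show "trace ((matrix_inv G ** P) ** (matrix_inv G ** P)) = (\<Sum>i<CARD('a). (\<mu> i)\<^sup>2)"
    using Gij unfolding trace_frame[OF e] by (auto intro!: sum.cong)
qed

lemma sum_pairs_power2:
  fixes \<mu> :: "nat \<Rightarrow> real"
  shows "(\<Sum>j<n. \<Sum>i<j. \<mu> i * \<mu> j) = ((\<Sum>i<n. \<mu> i)\<^sup>2 - (\<Sum>i<n. (\<mu> i)\<^sup>2)) / 2"
proof (induction n)
  case (Suc n)
  have "(\<Sum>i<n. \<mu> i * \<mu> n) = (\<Sum>i<n. \<mu> i) * \<mu> n" by (simp add: sum_distrib_right)
  with Suc show ?case by (simp only: sum.lessThan_Suc) (simp add: power2_sum field_simps)
qed simp

text \<open>Newton's identity expresses the second elementary symmetric polynomial of the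
  eigenvalues through traces. Unlike a list of eigenvalues, which is an arbitrary choice, this is a
  polynomial in the matrix entries and can be differentiated.\<close>

definition elem2 :: "real^'a^'a \<Rightarrow> real" where
  "elem2 A = ((trace A)\<^sup>2 - trace (A ** A)) / 2"

lemma eigenvalue_list_elem2:
  fixes G P :: "real^'a^'a"
  assumes "posdef G" "transpose P = P"
  shows "(\<Sum>j<CARD('a). \<Sum>i<j. eigenvalue_list G P i * eigenvalue_list G P j) = elem2 (matrix_inv G ** P)"
proof -
  have "is_eigenvalue_list G P (eigenvalue_list G P)"
    unfolding eigenvalue_list_def using eigenvalue_list_exists[OF assms] by (rule someI_ex)
  from trace_eigenvalues[OF this] show ?thesis
    by (simp add: sum_pairs_power2 elem2_def)
qed

text \<open>\<open>matrix_inv G ** P\<close> is self-adjoint for \<open>G\<close>, so it has a full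
  list of real eigenvalues, to which Cauchy--Schwarz applies. For a general matrix the trace of the
  square may be negative.\<close>

lemma trace_square_ge:
  fixes G P :: "real^'a^'a"
  assumes "posdef G" "transpose P = P"
  shows "(trace (matrix_inv G ** P))\<^sup>2 \<le> real CARD('a) * trace ((matrix_inv G ** P) ** (matrix_inv G ** P))"
proof -
  obtain \<mu> where "is_eigenvalue_list G P \<mu>" using eigenvalue_list_exists[OF assms] by blast
  from trace_eigenvalues[OF this] show ?thesis
    using sum_squared_le_sum_of_squares[of \<mu> "{..<CARD('a)}"] by (simp add: mult.commute)
qed

section \<open>Derivative of the determinant\<close>

text \<open>In the Leibniz formula a permutation other than the identity moves at least two indices,
  so its product contains two off-diagonal entries and vanishes to second order at r = 0.\<close>

lemma det_line_derivative:
  fixes K :: "real^'n^'n"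
  shows "((\<lambda>r. det (mat 1 + r *\<^sub>R K)) has_real_derivative trace K) (at 0)"
proof -
  define I where "I = (mat 1 :: real^'n^'n)"
  have d: "((\<lambda>r. \<Prod>i\<in>UNIV. (I + r *\<^sub>R K) $ i $ p i) has_real_derivative
      (\<Sum>i\<in>UNIV. K $ i $ p i * (\<Prod>j\<in>UNIV - {i}. I $ j $ p j))) (at 0)" for p
    by (rule DERIV_cong[OF has_field_derivative_prod[where f'="\<lambda>i. K $ i $ p i"]])
       (auto intro!: derivative_eq_intros)
  have z: "(\<Prod>j\<in>UNIV - {i}. I $ j $ p j) = (if p = id then 1 else 0)" if p: "p permutes UNIV" for i p
  proof (cases "p = id")
    case False
    have "\<exists>j. j \<noteq> i \<and> p j \<noteq> j"
    proof (rule ccontr)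
      assume "\<not> ?thesis"
      then have *: "p j = j" if "j \<noteq> i" for j using that by blast
      have "p i = i"
      proof (rule ccontr)
        assume "p i \<noteq> i"
        from *[OF this] show False using permutes_inj[OF p] \<open>p i \<noteq> i\<close> by (auto dest: injD)
      qed
      with * have "p = id" by (metis ext id_apply)
      with False show False by simp
    qed
    then obtain j where "j \<noteq> i" "p j \<noteq> j" by blast
    then have "\<exists>j\<in>UNIV - {i}. I $ j $ p j = 0"
      by (intro bexI[of _ j]) (auto simp: I_def mat_def)
    then have "(\<Prod>j\<in>UNIV - {i}. I $ j $ p j) = 0"
      by (intro prod_zero) auto
    with False show ?thesis by simp
  qed (auto simp: I_def mat_def intro!: prod.neutral)
  have "((\<lambda>r. \<Sum>p\<in>{p. p permutes UNIV}. of_int (sign p) * (\<Prod>i\<in>UNIV. (I + r *\<^sub>R K) $ i $ p i)) has_real_derivative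
     (\<Sum>p\<in>{p. p permutes UNIV}. of_int (sign p) * (\<Sum>i\<in>UNIV. K $ i $ p i * (\<Prod>j\<in>UNIV - {i}. I $ j $ p j)))) (at 0)"
    by (intro DERIV_sum DERIV_cmult d)
  moreover have "(\<Sum>p\<in>{p. p permutes UNIV}. of_int (sign p) * (\<Sum>i\<in>UNIV. K $ i $ p i * (\<Prod>j\<in>UNIV - {i}. I $ j $ p j)))
    = (\<Sum>p\<in>{p. p permutes (UNIV::'n set)}. if p = id then trace K else 0)"
  proof (rule sum.cong[OF refl])
    fix p assume "p \<in> {p. p permutes (UNIV::'n set)}"
    then have "p permutes UNIV" by simp
    from z[OF this] show "of_int (sign p) * (\<Sum>i\<in>UNIV. K $ i $ p i * (\<Prod>j\<in>UNIV - {i}. I $ j $ p j)) = (if p = id then trace K else 0)"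
      by (simp add: trace_def sign_id)
  qed
  moreover have "\<dots> = trace K" by (simp add: finite_permutations permutes_id)
  ultimately show ?thesis unfolding det_def I_def by simp
qed

text \<open>Jacobi's formula. The determinant is differentiable because it is a polynomial; its
  derivative in direction \<open>H\<close> is then read off along the line A + r H = A (1 + r A^-1
  H).\<close>

lemma has_derivative_det:
  fixes A :: "real^'n^'n"
  assumes "det A \<noteq> 0"
  shows "(det has_derivative (\<lambda>H. det A * trace (matrix_inv A ** H))) (at A)"
proof -
  have "smooth_on UNIV (\<lambda>A::real^'n^'n. det A)"
    by (rule smooth_on_det[OF open_UNIV smooth_on_bounded_linear[OF bounded_linear_ident open_UNIV]])
  from smooth_on_has_derivative[OF this, of A]
  have D: "(det has_derivative frechet_derivative det (at A)) (at A)" by simp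
  have "frechet_derivative det (at A) H = det A * trace (matrix_inv A ** H)" for H
  proof -
    have "((\<lambda>r. A + r *\<^sub>R H) has_derivative (\<lambda>r. r *\<^sub>R H)) (at 0)"
      by (auto intro!: derivative_eq_intros)
    from has_derivative_compose[OF this, of det "frechet_derivative det (at A)"] D
    have "((\<lambda>r. det (A + r *\<^sub>R H)) has_derivative (\<lambda>r. frechet_derivative det (at A) (r *\<^sub>R H))) (at 0)" by simp
    moreover have "(\<lambda>r. frechet_derivative det (at A) (r *\<^sub>R H)) = (*) (frechet_derivative det (at A) H)"
      using linear_scale[OF has_derivative_linear[OF D]] by auto
    ultimately have 1: "((\<lambda>r. det (A + r *\<^sub>R H)) has_real_derivative frechet_derivative det (at A) H) (at 0)"
      by (simp add: has_field_derivative_def)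
    have "A ** (mat 1 + r *\<^sub>R (matrix_inv A ** H)) = A + r *\<^sub>R H" for r
      using matrix_inv_cancel(1)[OF assms]
      by (simp add: matrix_add_ldistrib matrix_mul_assoc matrix_scalar_ac flip: scalar_matrix_assoc)
    then have "det (A + r *\<^sub>R H) = det A * det (mat 1 + r *\<^sub>R (matrix_inv A ** H))" for r
      by (metis det_mul)
    then have 2: "((\<lambda>r. det (A + r *\<^sub>R H)) has_real_derivative det A * trace (matrix_inv A ** H)) (at 0)"
      using DERIV_cmult[OF det_line_derivative] by simp
    from DERIV_unique[OF 1 2] show ?thesis .
  qed
  with D show ?thesis by (metis (no_types, lifting) ext)
qed

lemma similar_invariants:
  fixes A T :: "real^'a^'a"
  assumes "det T \<noteq> 0"
  shows "trace (matrix_inv T ** A ** T) = trace A" "det (matrix_inv T ** A ** T) = det A"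
    "elem2 (matrix_inv T ** A ** T) = elem2 A"
proof -
  note T = matrix_inv_cancel[OF assms]
  have tr: "trace (matrix_inv T ** B ** T) = trace B" for B :: "real^'a^'a"
    by (subst trace_mul_sym) (simp add: matrix_mul_assoc T)
  show "trace (matrix_inv T ** A ** T) = trace A" by (rule tr)
  have "det (matrix_inv T) * det T = 1" using T(2) by (metis det_I det_mul)
  then show "det (matrix_inv T ** A ** T) = det A" by (simp add: det_mul)
  have "(matrix_inv T ** A ** T) ** (matrix_inv T ** A ** T) = matrix_inv T ** A ** (T ** matrix_inv T) ** A ** T"
    by (simp only: matrix_mul_assoc)
  also have "\<dots> = matrix_inv T ** (A ** A) ** T" by (simp add: T matrix_mul_assoc)
  finally show "elem2 (matrix_inv T ** A ** T) = elem2 A" by (simp add: elem2_def tr)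
qed

text \<open>A change of source chart acts on both Gram matrices by congruence with the same
  \<open>T\<close>, hence on their quotient by conjugation. The conjugation invariants of the
  quotient thereby become functions on the manifold.\<close>

lemma congruence_operator:
  fixes G P T :: "real^'a^'a"
  assumes "det T \<noteq> 0" "det G \<noteq> 0"
  shows "matrix_inv (transpose T ** G ** T) ** (transpose T ** P ** T) = matrix_inv T ** (matrix_inv G ** P) ** T"
proof -
  note T = matrix_inv_cancel[OF assms(1)] and G = matrix_inv_cancel[OF assms(2)]
  have T': "transpose T ** transpose (matrix_inv T) = mat 1" "transpose (matrix_inv T) ** transpose T = mat 1"
    by (simp_all flip: matrix_transpose_mul add: T)
  have "(transpose T ** G ** T) ** (matrix_inv T ** matrix_inv G ** transpose (matrix_inv T))
    = transpose T ** (G ** ((T ** matrix_inv T) ** matrix_inv G)) ** transpose (matrix_inv T)"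
    by (simp only: matrix_mul_assoc)
  then have "(transpose T ** G ** T) ** (matrix_inv T ** matrix_inv G ** transpose (matrix_inv T)) = mat 1"
    by (simp add: T G T')
  then have "matrix_inv (transpose T ** G ** T) = matrix_inv T ** matrix_inv G ** transpose (matrix_inv T)"
    by (rule matrix_inv_unique)
  then have "matrix_inv (transpose T ** G ** T) ** (transpose T ** P ** T)
    = matrix_inv T ** matrix_inv G ** (transpose (matrix_inv T) ** transpose T) ** P ** T"
    by (simp only: matrix_mul_assoc)
  then show ?thesis by (simp add: T' matrix_mul_assoc)
qed

section \<open>Charts and pullback metrics\<close>

lemma chart_props:
  assumes "smooth_atlas A" "\<kappa> \<in> A"
  shows "open (fst \<kappa>)" "open (snd \<kappa> ` fst \<kappa>)"
    "p \<in> fst \<kappa> \<Longrightarrow> chart_inv \<kappa> (snd \<kappa> p) = p"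
    "x \<in> snd \<kappa> ` fst \<kappa> \<Longrightarrow> snd \<kappa> (chart_inv \<kappa> x) = x"
    "x \<in> snd \<kappa> ` fst \<kappa> \<Longrightarrow> chart_inv \<kappa> x \<in> fst \<kappa>"
    "continuous_on (fst \<kappa>) (snd \<kappa>)" "continuous_on (snd \<kappa> ` fst \<kappa>) (chart_inv \<kappa>)"
    "inj_on (snd \<kappa>) (fst \<kappa>)"
proof -
  have *: "open (fst \<kappa>)" "open (snd \<kappa> ` fst \<kappa>)"
    "homeomorphism (fst \<kappa>) (snd \<kappa> ` fst \<kappa>) (snd \<kappa>) (chart_inv \<kappa>)"
    using assms unfolding smooth_atlas_def by auto
  then show "open (fst \<kappa>)" "open (snd \<kappa> ` fst \<kappa>)"
    "p \<in> fst \<kappa> \<Longrightarrow> chart_inv \<kappa> (snd \<kappa> p) = p"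
    "x \<in> snd \<kappa> ` fst \<kappa> \<Longrightarrow> snd \<kappa> (chart_inv \<kappa> x) = x"
    "x \<in> snd \<kappa> ` fst \<kappa> \<Longrightarrow> chart_inv \<kappa> x \<in> fst \<kappa>"
    "continuous_on (fst \<kappa>) (snd \<kappa>)" "continuous_on (snd \<kappa> ` fst \<kappa>) (chart_inv \<kappa>)"
    unfolding homeomorphism_def by auto
  show "inj_on (snd \<kappa>) (fst \<kappa>)"
    using *(3) unfolding homeomorphism_def by (metis inj_on_inverseI)
qed

lemma chart_open_image:
  assumes "smooth_atlas A" "\<kappa> \<in> A" "open V"
  shows "open (snd \<kappa> ` (fst \<kappa> \<inter> V))"
proof -
  note c = chart_props[OF assms(1,2)]
  have "snd \<kappa> ` (fst \<kappa> \<inter> V) = snd \<kappa> ` fst \<kappa> \<inter> chart_inv \<kappa> -` V"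
    using c(3-5) by (auto simp: image_iff)
  then show ?thesis using continuous_open_preimage[OF c(7,2) assms(3)] by simp
qed

lemma chart_at_props:
  assumes "smooth_atlas A" shows "chart_at A p \<in> A" "p \<in> fst (chart_at A p)"
proof -
  have "(\<Union>\<kappa>\<in>A. fst \<kappa>) = UNIV" using assms unfolding smooth_atlas_def by blast
  then have "p \<in> (\<Union>\<kappa>\<in>A. fst \<kappa>)" by simp
  then have "\<exists>\<kappa>. \<kappa> \<in> A \<and> p \<in> fst \<kappa>" by blast
  then have "chart_at A p \<in> A \<and> p \<in> fst (chart_at A p)"
    unfolding chart_at_def by (rule someI_ex)
  then show "chart_at A p \<in> A" "p \<in> fst (chart_at A p)" by auto
qed

text \<open>The chart-change rules concern first derivatives of a single map; this notion applies
  alike to \<open>id\<close> and to the slices of a family.\<close>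

definition differentiable_map ::
    "('m::topological_space, 'a::finite) chart set \<Rightarrow> ('n::topological_space, 'b::finite) chart set \<Rightarrow> ('m \<Rightarrow> 'n) \<Rightarrow> bool" where
  "differentiable_map A B f \<longleftrightarrow> continuous_on UNIV f \<and>
     (\<forall>\<kappa>\<in>A. \<forall>\<kappa>'\<in>B. \<forall>p\<in>fst \<kappa>. f p \<in> fst \<kappa>' \<longrightarrow>
        (snd \<kappa>' \<circ> f \<circ> chart_inv \<kappa>) differentiable (at (snd \<kappa> p)))"

lemma differentiable_map_id: "smooth_atlas A \<Longrightarrow> differentiable_map A A id"
  unfolding differentiable_map_def
proof (intro conjI ballI impI)
  fix \<kappa> \<kappa>' p assume A: "smooth_atlas A" and k: "\<kappa> \<in> A" "\<kappa>' \<in> A" "p \<in> fst \<kappa>" "id p \<in> fst \<kappa>'"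
  have "smooth_on (snd \<kappa> ` (fst \<kappa> \<inter> fst \<kappa>')) (snd \<kappa>' \<circ> chart_inv \<kappa>)"
    using A k unfolding smooth_atlas_def by blast
  then have "(snd \<kappa>' \<circ> chart_inv \<kappa>) differentiable (at (snd \<kappa> p))"
    using k by (auto intro: smooth_on_differentiable)
  then show "(snd \<kappa>' \<circ> id \<circ> chart_inv \<kappa>) differentiable (at (snd \<kappa> p))" by (simp add: o_def)
qed (simp add: continuous_on_id[unfolded id_def[symmetric]])

lemma differential_matrix_has_derivative:
  assumes "(snd \<kappa>' \<circ> f \<circ> chart_inv \<kappa>) differentiable (at (snd \<kappa> p))"
  shows "((snd \<kappa>' \<circ> f \<circ> chart_inv \<kappa>) has_derivative (\<lambda>v. differential_matrix \<kappa> \<kappa>' f p *v v)) (at (snd \<kappa> p))"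
  using assms unfolding differential_matrix_def by (simp flip: jacobian_works)

lemma differential_matrix_eqI:
  assumes "((snd \<kappa>' \<circ> f \<circ> chart_inv \<kappa>) has_derivative D) (at (snd \<kappa> p))"
  shows "differential_matrix \<kappa> \<kappa>' f p = matrix D"
  unfolding differential_matrix_def jacobian_def frechet_derivative_eqI[OF assms] ..

lemma differential_matrix_compose:
  assumes A: "smooth_atlas A" "\<kappa> \<in> A" "p \<in> fst \<kappa>" and B: "smooth_atlas B" "\<kappa>' \<in> B" "f p \<in> fst \<kappa>'"
    and f: "differentiable_map A B f"
    and C: "\<kappa>'' \<in> C" "g (f p) \<in> fst \<kappa>''" and g: "differentiable_map B C g"
  shows "differential_matrix \<kappa> \<kappa>'' (g \<circ> f) p = differential_matrix \<kappa>' \<kappa>'' g (f p) ** differential_matrix \<kappa> \<kappa>' f p"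
proof -
  note cA = chart_props[OF A(1,2)] and cB = chart_props[OF B(1,2)]
  let ?u = "snd \<kappa>' \<circ> f \<circ> chart_inv \<kappa>" and ?w = "snd \<kappa>'' \<circ> g \<circ> chart_inv \<kappa>'"
  let ?O = "snd \<kappa> ` (fst \<kappa> \<inter> f -` fst \<kappa>')"
  have "continuous_on UNIV f" using f by (simp add: differentiable_map_def)
  then have O: "open ?O" by (intro chart_open_image[OF A(1,2)] open_vimage cB(1))
  have pO: "snd \<kappa> p \<in> ?O" using A B by auto
  have u: "(?u has_derivative (\<lambda>v. differential_matrix \<kappa> \<kappa>' f p *v v)) (at (snd \<kappa> p))"
    using f A B by (intro differential_matrix_has_derivative) (simp add: differentiable_map_def)
  have w: "(?w has_derivative (\<lambda>v. differential_matrix \<kappa>' \<kappa>'' g (f p) *v v)) (at (snd \<kappa>' (f p)))"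
    using g B C by (intro differential_matrix_has_derivative) (simp add: differentiable_map_def)
  have "?u (snd \<kappa> p) = snd \<kappa>' (f p)" using cA(3)[OF A(3)] by simp
  with w have w': "(?w has_derivative (\<lambda>v. differential_matrix \<kappa>' \<kappa>'' g (f p) *v v)) (at (?u (snd \<kappa> p)))" by simp
  have "((\<lambda>x. ?w (?u x)) has_derivative (\<lambda>v. differential_matrix \<kappa>' \<kappa>'' g (f p) *v (differential_matrix \<kappa> \<kappa>' f p *v v))) (at (snd \<kappa> p))"
    by (rule has_derivative_compose[OF u w'])
  then have "((snd \<kappa>'' \<circ> (g \<circ> f) \<circ> chart_inv \<kappa>) has_derivative (\<lambda>v. differential_matrix \<kappa>' \<kappa>'' g (f p) *v (differential_matrix \<kappa> \<kappa>' f p *v v))) (at (snd \<kappa> p))"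
    by (rule has_derivative_transform_within_open[OF _ O pO]) (auto simp: cA(3) cB(3))
  from differential_matrix_eqI[OF this] show ?thesis
    by (simp add: matrix_vector_mul_assoc matrix_of_matrix_vector_mul)
qed

lemma metric_props:
  assumes "riemannian_metric A g" "\<kappa> \<in> A" "p \<in> fst \<kappa>"
  shows "posdef (g \<kappa> p)" "transpose (g \<kappa> p) = g \<kappa> p" "det (g \<kappa> p) > 0"
    "\<kappa>' \<in> A \<Longrightarrow> p \<in> fst \<kappa>' \<Longrightarrow>
        g \<kappa> p = transpose (differential_matrix \<kappa> \<kappa>' id p) ** g \<kappa>' p ** differential_matrix \<kappa> \<kappa>' id p"
proof -
  show *: "posdef (g \<kappa> p)" using assms unfolding riemannian_metric_def posdef_def by blast
  then show "transpose (g \<kappa> p) = g \<kappa> p" "det (g \<kappa> p) > 0" by (auto simp: posdef_def posdef_det_pos[OF *])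
  show "\<kappa>' \<in> A \<Longrightarrow> p \<in> fst \<kappa>' \<Longrightarrow>
        g \<kappa> p = transpose (differential_matrix \<kappa> \<kappa>' id p) ** g \<kappa>' p ** differential_matrix \<kappa> \<kappa>' id p"
    using assms unfolding riemannian_metric_def by blast
qed

lemma pullback_symmetric:
  "transpose (h \<kappa>' (f p)) = h \<kappa>' (f p) \<Longrightarrow> transpose (pullback_metric h \<kappa> \<kappa>' f p) = pullback_metric h \<kappa> \<kappa>' f p"
  by (simp add: pullback_metric_def matrix_transpose_mul matrix_mul_assoc)

lemma pullback_target_chart:
  assumes A: "smooth_atlas A" "\<kappa> \<in> A" "p \<in> fst \<kappa>" and B: "smooth_atlas B" "\<kappa>' \<in> B" "f p \<in> fst \<kappa>'" "\<kappa>'' \<in> B" "f p \<in> fst \<kappa>''"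
    and f: "differentiable_map A B f" and h: "riemannian_metric B h"
  shows "pullback_metric h \<kappa> \<kappa>' f p = pullback_metric h \<kappa> \<kappa>'' f p"
proof -
  have "differential_matrix \<kappa> \<kappa>'' f p = differential_matrix \<kappa>' \<kappa>'' id (f p) ** differential_matrix \<kappa> \<kappa>' f p"
    using differential_matrix_compose[OF A B(1-3) f B(4) _ differentiable_map_id[OF B(1)]] B(5) by simp
  moreover have "h \<kappa>' (f p) = transpose (differential_matrix \<kappa>' \<kappa>'' id (f p)) ** h \<kappa>'' (f p) ** differential_matrix \<kappa>' \<kappa>'' id (f p)"
    using metric_props(4)[OF h B(2,3,4,5)] .
  ultimately show ?thesis
    unfolding pullback_metric_def by (simp only: matrix_transpose_mul matrix_mul_assoc)
qed

lemma pullback_source_chart: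
  assumes A: "smooth_atlas A" "\<kappa> \<in> A" "p \<in> fst \<kappa>" "\<kappa>'' \<in> A" "p \<in> fst \<kappa>''" and B: "smooth_atlas B" "\<kappa>' \<in> B" "f p \<in> fst \<kappa>'"
    and f: "differentiable_map A B f"
  shows "pullback_metric h \<kappa> \<kappa>' f p = transpose (differential_matrix \<kappa> \<kappa>'' id p) ** pullback_metric h \<kappa>'' \<kappa>' f p ** differential_matrix \<kappa> \<kappa>'' id p"
proof -
  have "differential_matrix \<kappa> \<kappa>' f p = differential_matrix \<kappa>'' \<kappa>' f p ** differential_matrix \<kappa> \<kappa>'' id p"
    using differential_matrix_compose[OF A(1-3,1,4) _ differentiable_map_id[OF A(1)] B(2) _ f] A(5) B(3) by simp
  then show ?thesis
    unfolding pullback_metric_def by (simp only: matrix_transpose_mul matrix_mul_assoc)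
qed

definition pullback_op ::
    "('m, 'a) metric \<Rightarrow> ('n, 'b::finite) metric \<Rightarrow> ('m, 'a::finite) chart \<Rightarrow> ('n, 'b) chart \<Rightarrow> ('m \<Rightarrow> 'n) \<Rightarrow> 'm \<Rightarrow> real ^ 'a ^ 'a" where
  "pullback_op g h \<kappa> \<kappa>' f p = matrix_inv (g \<kappa> p) ** pullback_metric h \<kappa> \<kappa>' f p"

definition conj_invariant :: "(real ^ 'a ^ 'a \<Rightarrow> real) \<Rightarrow> bool" where
  "conj_invariant I \<longleftrightarrow> (\<forall>T M. det T \<noteq> 0 \<longrightarrow> I (matrix_inv T ** M ** T) = I M)"

lemma conj_invariant_basic: "conj_invariant trace" "conj_invariant det" "conj_invariant elem2"
  by (simp_all add: conj_invariant_def similar_invariants)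

text \<open>A change of target chart leaves the pullback metric unchanged, because the Gram matrix
  of \<open>h\<close> absorbs the transition matrix; a change of source chart conjugates the
  operator. The transition matrix is invertible since both Gram determinants are positive.\<close>

lemma pullback_op_invariant:
  assumes A: "riemannian_manifold A g" "\<kappa> \<in> A" "p \<in> fst \<kappa>" "\<kappa>2 \<in> A" "p \<in> fst \<kappa>2"
    and B: "riemannian_manifold B h" "\<kappa>' \<in> B" "f p \<in> fst \<kappa>'" "\<kappa>2' \<in> B" "f p \<in> fst \<kappa>2'"
    and f: "differentiable_map A B f" and I: "conj_invariant I"
  shows "I (pullback_op g h \<kappa> \<kappa>' f p) = I (pullback_op g h \<kappa>2 \<kappa>2' f p)"
proof -
  have g: "smooth_atlas A" "riemannian_metric A g" and h: "smooth_atlas B" "riemannian_metric B h"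
    using A(1) B(1) by (auto simp: riemannian_manifold_def)
  let ?T = "differential_matrix \<kappa> \<kappa>2 id p"
  have G: "g \<kappa> p = transpose ?T ** g \<kappa>2 p ** ?T" by (rule metric_props(4)[OF g(2) A(2-5)])
  have P: "pullback_metric h \<kappa> \<kappa>' f p = transpose ?T ** pullback_metric h \<kappa>2 \<kappa>2' f p ** ?T"
    using pullback_source_chart[OF g(1) A(2-5) h(1) B(2,3) f, of h]
      pullback_target_chart[OF g(1) A(4,5) h(1) B(2-5) f h(2)] by simp
  have dg: "det (g \<kappa> p) > 0" "det (g \<kappa>2 p) > 0"
    using metric_props(3)[OF g(2)] A by auto
  then have T: "det ?T \<noteq> 0" using G by (metis det_mul less_irrefl mult_zero_right)
  have "pullback_op g h \<kappa> \<kappa>' f p = matrix_inv ?T ** pullback_op g h \<kappa>2 \<kappa>2' f p ** ?T"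
    unfolding pullback_op_def P by (subst G) (rule congruence_operator[OF T], use dg in simp)
  then show ?thesis using I T by (simp add: conj_invariant_def)
qed

text \<open>The charts are those of \<open>chart_at\<close>, as in the energies. They may jump from
  point to point, so the matrix need not be continuous in \<open>p\<close>; its conjugation
  invariants carry the meaning.\<close>

definition map_op ::
    "('m::topological_space, 'a::finite) chart set \<Rightarrow> ('m, 'a) metric \<Rightarrow> ('n::topological_space, 'b::finite) chart set \<Rightarrow> ('n, 'b) metric
       \<Rightarrow> ('m \<Rightarrow> 'n) \<Rightarrow> 'm \<Rightarrow> real ^ 'a ^ 'a" where
  "map_op A g B h f p = pullback_op g h (chart_at A p) (chart_at B (f p)) f p"

lemma sigma2_eq:
  assumes "riemannian_manifold A g" "riemannian_manifold B h"
  shows "sigma2 A g B h f p = elem2 (map_op A g B h f p)"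
proof -
  have g: "smooth_atlas A" "riemannian_metric A g" and h: "smooth_atlas B" "riemannian_metric B h"
    using assms by (auto simp: riemannian_manifold_def)
  note cA = chart_at_props[OF g(1), of p] and cB = chart_at_props[OF h(1), of "f p"]
  show ?thesis unfolding sigma2_def Let_def map_op_def pullback_op_def
    by (rule eigenvalue_list_elem2[OF metric_props(1)[OF g(2) cA] pullback_symmetric[of h "chart_at B (f p)" f p, OF metric_props(2)[OF h(2) cB]]])
qed

lemma differential_norm_sq_eq:
  assumes "riemannian_manifold A g" "riemannian_manifold B h"
  shows "differential_norm_sq A g B h f p = trace (map_op A g B h f p)"
proof -
  have g: "smooth_atlas A" "riemannian_metric A g" and h: "smooth_atlas B" "riemannian_metric B h"
    using assms by (auto simp: riemannian_manifold_def)
  note cA = chart_at_props[OF g(1), of p]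
  let ?e = "SOME e. orthonormal_frame (g (chart_at A p) p) e"
  have "orthonormal_frame (g (chart_at A p) p) ?e"
    by (rule someI_ex[OF orthonormal_frame_exists[OF metric_props(1)[OF g(2) cA]]])
  from trace_frame[OF this] show ?thesis
    unfolding differential_norm_sq_def Let_def map_op_def pullback_op_def pullback_metric_def
    by (simp only: matrix_vector_mul_assoc[symmetric] inner_matrix_vector transpose_transpose matrix_transpose_mul matrix_mul_assoc[symmetric])
qed

section \<open>Smooth families\<close>

definition fam_expr :: "('m, 'a::finite) chart \<Rightarrow> ('n, 'b::finite) chart \<Rightarrow> ('t \<Rightarrow> 'm \<Rightarrow> 'n) \<Rightarrow> 't \<times> (real ^ 'a) \<Rightarrow> real ^ 'b" where
  "fam_expr \<kappa> \<kappa>' \<Phi> = (\<lambda>(t, x). snd \<kappa>' (\<Phi> t (chart_inv \<kappa> x)))"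

definition fam_dom :: "'t set \<Rightarrow> ('m, 'a::finite) chart \<Rightarrow> ('n, 'b::finite) chart \<Rightarrow> ('t \<Rightarrow> 'm \<Rightarrow> 'n) \<Rightarrow> ('t \<times> (real ^ 'a)) set" where
  "fam_dom T \<kappa> \<kappa>' \<Phi> = {(t, x). t \<in> T \<and> x \<in> snd \<kappa> ` fst \<kappa> \<and> \<Phi> t (chart_inv \<kappa> x) \<in> fst \<kappa>'}"

lemma smooth_family_props:
  assumes "smooth_family T A B \<Phi>"
  shows "continuous_on (T \<times> UNIV) (\<lambda>(t, p). \<Phi> t p)"
    "\<kappa> \<in> A \<Longrightarrow> \<kappa>' \<in> B \<Longrightarrow> smooth_on (fam_dom T \<kappa> \<kappa>' \<Phi>) (fam_expr \<kappa> \<kappa>' \<Phi>)"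
  using assms unfolding smooth_family_def fam_dom_def fam_expr_def by auto

lemma continuous_on_chart_inv_pair:
  assumes "smooth_atlas A" "\<kappa> \<in> A" "continuous_on (T \<times> UNIV) (\<lambda>(t, p). F t p)"
  shows "continuous_on (T \<times> snd \<kappa> ` fst \<kappa>) (\<lambda>(t, x). F t (chart_inv \<kappa> x))"
proof -
  note c = chart_props[OF assms(1,2)]
  have "continuous_on (T \<times> snd \<kappa> ` fst \<kappa>) (\<lambda>z. chart_inv \<kappa> (snd z))"
    by (rule continuous_on_compose2[OF c(7) continuous_on_snd[OF continuous_on_id]]) auto
  then have "continuous_on (T \<times> snd \<kappa> ` fst \<kappa>) (\<lambda>z. (fst z, chart_inv \<kappa> (snd z)))"
    by (intro continuous_on_Pair continuous_on_fst continuous_on_id)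
  from continuous_on_compose2[OF assms(3) this] show ?thesis
    by (simp add: case_prod_unfold image_subset_iff)
qed

lemma fam_dom_open:
  assumes "smooth_atlas A" "\<kappa> \<in> A" "smooth_atlas B" "\<kappa>' \<in> B" "open T" "smooth_family T A B \<Phi>"
  shows "open (fam_dom T \<kappa> \<kappa>' \<Phi>)"
proof -
  note c = chart_props[OF assms(1,2)] and c' = chart_props[OF assms(3,4)]
  have "open (T \<times> snd \<kappa> ` fst \<kappa>)" using assms(5) c(2) by (rule open_Times)
  from continuous_open_preimage[OF continuous_on_chart_inv_pair[OF assms(1,2) smooth_family_props(1)[OF assms(6)]] this c'(1)]
  have "open (T \<times> snd \<kappa> ` fst \<kappa> \<inter> (\<lambda>(t, x). \<Phi> t (chart_inv \<kappa> x)) -` fst \<kappa>')" .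
  moreover have "fam_dom T \<kappa> \<kappa>' \<Phi> = T \<times> snd \<kappa> ` fst \<kappa> \<inter> (\<lambda>(t, x). \<Phi> t (chart_inv \<kappa> x)) -` fst \<kappa>'"
    by (auto simp: fam_dom_def)
  ultimately show ?thesis by simp
qed

lemma fam_slice_derivative:
  assumes "smooth_on (fam_dom T \<kappa> \<kappa>' \<Phi>) (fam_expr \<kappa> \<kappa>' \<Phi>)" "(\<tau>, x) \<in> fam_dom T \<kappa> \<kappa>' \<Phi>"
  shows "((snd \<kappa>' \<circ> \<Phi> \<tau> \<circ> chart_inv \<kappa>) has_derivative (\<lambda>v. frechet_derivative (fam_expr \<kappa> \<kappa>' \<Phi>) (at (\<tau>, x)) (0, v))) (at x)"
proof -
  have "((\<lambda>y. (\<tau>, y)) has_derivative (\<lambda>v. (0, v))) (at x)"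
    by (auto intro!: derivative_eq_intros)
  from has_derivative_compose[OF this smooth_on_has_derivative[OF assms]]
  show ?thesis by (simp add: fam_expr_def o_def)
qed

lemma family_differentiable_map:
  assumes "smooth_atlas A" "smooth_family T A B \<Phi>" "\<tau> \<in> T"
  shows "differentiable_map A B (\<Phi> \<tau>)"
  unfolding differentiable_map_def
proof (intro conjI ballI impI)
  have "continuous_on UNIV (\<lambda>p. (\<tau>, p))" by (intro continuous_intros)
  from continuous_on_compose2[OF smooth_family_props(1)[OF assms(2)] this] assms(3)
  show "continuous_on UNIV (\<Phi> \<tau>)" by auto
next
  fix \<kappa> \<kappa>' p assume k: "\<kappa> \<in> A" "\<kappa>' \<in> B" "p \<in> fst \<kappa>" "\<Phi> \<tau> p \<in> fst \<kappa>'"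
  then have "(\<tau>, snd \<kappa> p) \<in> fam_dom T \<kappa> \<kappa>' \<Phi>"
    using assms(3) chart_props(3)[OF assms(1) k(1,3)] by (auto simp: fam_dom_def)
  from fam_slice_derivative[OF smooth_family_props(2)[OF assms(2) k(1,2)] this]
  show "(snd \<kappa>' \<circ> \<Phi> \<tau> \<circ> chart_inv \<kappa>) differentiable (at (snd \<kappa> p))"
    by (auto simp: differentiable_def)
qed

lemma smooth_on_matrix_columns:
  fixes L :: "'a::euclidean_space \<Rightarrow> real^'n \<Rightarrow> real^'m"
  assumes "open S" "\<And>v. smooth_on S (\<lambda>x. L x v)" shows "smooth_on S (\<lambda>x. matrix (L x))"
proof (intro smooth_on_vecI[OF assms(1)])
  fix i j
  show "smooth_on S (\<lambda>x. matrix (L x) $ i $ j)"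
    unfolding matrix_def using smooth_on_vec_nth[OF assms(1) assms(2)[of "axis j 1"], of i] by simp
qed

text \<open>The differential of a slice collects the derivatives of the joint chart expression in
  the directions (0, v), so it is smooth in the parameter and the point together.\<close>

lemma family_differential_smooth:
  assumes A: "smooth_atlas A" "\<kappa> \<in> A" and B: "smooth_atlas B" "\<kappa>' \<in> B" and T: "open T" and \<Phi>: "smooth_family T A B \<Phi>"
  shows "smooth_on (fam_dom T \<kappa> \<kappa>' \<Phi>) (\<lambda>(t, x). differential_matrix \<kappa> \<kappa>' (\<Phi> t) (chart_inv \<kappa> x))"
proof -
  note op = fam_dom_open[OF A B T \<Phi>] and sm = smooth_family_props(2)[OF \<Phi> A(2) B(2)]
  have "smooth_on (fam_dom T \<kappa> \<kappa>' \<Phi>) (\<lambda>z. matrix (\<lambda>v. frechet_derivative (fam_expr \<kappa> \<kappa>' \<Phi>) (at z) (0, v)))"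
    by (intro smooth_on_matrix_columns[OF op] smooth_on_frechet[OF sm])
  then show ?thesis
  proof (rule smooth_on_cong[OF op, rotated])
    fix z assume z: "z \<in> fam_dom T \<kappa> \<kappa>' \<Phi>"
    obtain t x where zt: "z = (t, x)" by fastforce
    have x: "snd \<kappa> (chart_inv \<kappa> x) = x" using z chart_props(4)[OF A] by (auto simp: zt fam_dom_def)
    show "matrix (\<lambda>v. frechet_derivative (fam_expr \<kappa> \<kappa>' \<Phi>) (at z) (0, v)) = (case z of (t, x) \<Rightarrow> differential_matrix \<kappa> \<kappa>' (\<Phi> t) (chart_inv \<kappa> x))"
      using differential_matrix_eqI[of \<kappa>' "\<Phi> t" \<kappa> _ "chart_inv \<kappa> x", unfolded x, OF fam_slice_derivative[OF sm z[unfolded zt]]]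
      by (simp add: zt)
  qed
qed

lemma metric_smooth:
  assumes "riemannian_metric A g" "\<kappa> \<in> A"
  shows "smooth_on (snd \<kappa> ` fst \<kappa>) (\<lambda>x. g \<kappa> (chart_inv \<kappa> x))"
  using assms unfolding riemannian_metric_def by blast

lemma smooth_on_snd_compose:
  fixes f :: "'b::euclidean_space \<Rightarrow> 'c::real_normed_vector"
  assumes "open (S :: ('a::euclidean_space \<times> 'b) set)" "smooth_on U f" "snd ` S \<subseteq> U"
  shows "smooth_on S (\<lambda>z. f (snd z))"
  by (rule smooth_on_compose[OF assms(1,2) smooth_on_bounded_linear[OF bounded_linear_snd assms(1)] assms(3)])

lemma family_op_smooth:
  assumes A: "riemannian_manifold A g" "\<kappa> \<in> A" and B: "riemannian_manifold B h" "\<kappa>' \<in> B"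
    and T: "open T" and \<Phi>: "smooth_family T A B \<Phi>"
  shows "smooth_on (fam_dom T \<kappa> \<kappa>' \<Phi>) (\<lambda>(t, x). pullback_op g h \<kappa> \<kappa>' (\<Phi> t) (chart_inv \<kappa> x))"
    and "smooth_on (fam_dom T \<kappa> \<kappa>' \<Phi>) (\<lambda>(t, x). pullback_metric h \<kappa> \<kappa>' (\<Phi> t) (chart_inv \<kappa> x))"
proof -
  have g: "smooth_atlas A" "riemannian_metric A g" and h: "smooth_atlas B" "riemannian_metric B h"
    using A(1) B(1) by (auto simp: riemannian_manifold_def)
  let ?S = "fam_dom T \<kappa> \<kappa>' \<Phi>"
  note op = fam_dom_open[OF g(1) A(2) h(1) B(2) T \<Phi>] and sm = smooth_family_props(2)[OF \<Phi> A(2) B(2)]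
  define D where "D = (\<lambda>z. differential_matrix \<kappa> \<kappa>' (\<Phi> (fst z)) (chart_inv \<kappa> (snd z)))"
  have D: "smooth_on ?S D"
    using family_differential_smooth[OF g(1) A(2) h(1) B(2) T \<Phi>] by (simp add: D_def case_prod_unfold)
  have sub: "fam_expr \<kappa> \<kappa>' \<Phi> ` ?S \<subseteq> snd \<kappa>' ` fst \<kappa>'" by (auto simp: fam_expr_def fam_dom_def)
  have "smooth_on ?S (\<lambda>z. h \<kappa>' (chart_inv \<kappa>' (fam_expr \<kappa> \<kappa>' \<Phi> z)))"
    by (rule smooth_on_compose[OF op metric_smooth[OF h(2) B(2)] sm sub])
  then have H: "smooth_on ?S (\<lambda>z. h \<kappa>' (\<Phi> (fst z) (chart_inv \<kappa> (snd z))))"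
    by (rule smooth_on_cong[OF op, rotated]) (auto simp: fam_expr_def fam_dom_def chart_props(3)[OF h(1) B(2)])
  have P: "smooth_on ?S (\<lambda>z. transpose (D z) ** h \<kappa>' (\<Phi> (fst z) (chart_inv \<kappa> (snd z))) ** D z)"
    by (rule smooth_on_matrix_mult[OF op smooth_on_matrix_mult[OF op smooth_on_transpose[OF op D] H] D])
  then show "smooth_on ?S (\<lambda>(t, x). pullback_metric h \<kappa> \<kappa>' (\<Phi> t) (chart_inv \<kappa> x))"
    by (simp add: pullback_metric_def D_def case_prod_unfold)
  have sub2: "snd ` ?S \<subseteq> snd \<kappa> ` fst \<kappa>" by (auto simp: fam_dom_def)
  have "smooth_on ?S (\<lambda>z. matrix_inv (g \<kappa> (chart_inv \<kappa> (snd z))))"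
    by (rule smooth_on_matrix_inv[OF op smooth_on_snd_compose[OF op metric_smooth[OF g(2) A(2)] sub2]])
      (use sub2 metric_props(3)[OF g(2) A(2)] chart_props(5)[OF g(1) A(2)] in \<open>auto simp: fam_dom_def\<close>)
  from smooth_on_matrix_mult[OF op this P]
  show "smooth_on ?S (\<lambda>(t, x). pullback_op g h \<kappa> \<kappa>' (\<Phi> t) (chart_inv \<kappa> x))"
    by (simp add: pullback_op_def pullback_metric_def D_def case_prod_unfold)
qed

definition smooth_functions :: "'t::euclidean_space set \<Rightarrow> ('m::topological_space, 'a::finite) chart set \<Rightarrow> ('t \<Rightarrow> 'm \<Rightarrow> real) \<Rightarrow> bool" where
  "smooth_functions T A F \<longleftrightarrow> (\<forall>\<kappa>\<in>A. smooth_on (T \<times> snd \<kappa> ` fst \<kappa>) (\<lambda>(t, x). F t (chart_inv \<kappa> x)))"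

text \<open>The argument of type \<open>'t itself\<close> fixes the parameter space, because a
  definition cannot quantify over the type of \<open>S\<close>.\<close>

definition smooth_invariant :: "'t::euclidean_space itself \<Rightarrow> (real ^ 'a ^ 'a \<Rightarrow> real) \<Rightarrow> bool" where
  "smooth_invariant _ I \<longleftrightarrow> conj_invariant I \<and>
     (\<forall>(S :: ('t \<times> (real ^ 'a)) set) M. open S \<longrightarrow> smooth_on S M \<longrightarrow> smooth_on S (\<lambda>z. I (M z)))"

lemma smooth_on_elem2:
  fixes M :: "'a::euclidean_space \<Rightarrow> real^'n^'n"
  assumes S: "open S" and M: "smooth_on S M" shows "smooth_on S (\<lambda>z. elem2 (M z))"
proof -
  have t: "smooth_on S (\<lambda>z. trace (M z))" by (rule smooth_on_trace[OF S M])
  have "smooth_on S (\<lambda>z. (1/2) * (trace (M z) * trace (M z) - trace (M z ** M z)))"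
    by (rule smooth_on_mult[OF S smooth_on_const smooth_on_diff[OF S smooth_on_mult[OF S t t] smooth_on_trace[OF S smooth_on_matrix_mult[OF S M M]]]])
  then show ?thesis by (simp add: elem2_def power2_eq_square)
qed

lemma smooth_invariant_basic:
  "smooth_invariant t trace" "smooth_invariant t det" "smooth_invariant t elem2"
  by (auto simp: smooth_invariant_def conj_invariant_basic smooth_on_trace smooth_on_det smooth_on_elem2)

lemma map_op_chart:
  assumes A: "riemannian_manifold A g" "\<kappa> \<in> A" "p \<in> fst \<kappa>" and B: "riemannian_manifold B h" "\<kappa>' \<in> B" "f p \<in> fst \<kappa>'"
    and f: "differentiable_map A B f" and I: "conj_invariant I"
  shows "I (map_op A g B h f p) = I (pullback_op g h \<kappa> \<kappa>' f p)"
proof -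
  have g: "smooth_atlas A" and h: "smooth_atlas B"
    using A(1) B(1) by (auto simp: riemannian_manifold_def)
  show ?thesis unfolding map_op_def
    by (rule pullback_op_invariant[OF A(1) chart_at_props[OF g] A(2,3) B(1) chart_at_props[OF h] B(2,3) f I])
qed

text \<open>Smoothness is local, so around each point the jumping charts of \<open>chart_at\<close>
  may be replaced by one fixed pair; conjugation invariance keeps the value unaffected.\<close>

lemma smooth_functions_op:
  fixes T :: "'t::euclidean_space set"
  assumes A: "riemannian_manifold A g" and B: "riemannian_manifold B h"
    and T: "open T" and \<Phi>: "smooth_family T A B \<Phi>" and I: "smooth_invariant TYPE('t) I"
  shows "smooth_functions T A (\<lambda>\<tau> p. I (map_op A g B h (\<Phi> \<tau>) p))"
  unfolding smooth_functions_def
proof (intro ballI smooth_on_local)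
  have g: "smooth_atlas A" and h: "smooth_atlas B"
    using A(1) B(1) by (auto simp: riemannian_manifold_def)
  fix \<kappa> z assume k: "\<kappa> \<in> A" and z: "z \<in> T \<times> snd \<kappa> ` fst \<kappa>"
  obtain t x where zt: "z = (t, x)" "t \<in> T" "x \<in> snd \<kappa> ` fst \<kappa>" using z by auto
  define \<kappa>' where "\<kappa>' = chart_at B (\<Phi> t (chart_inv \<kappa> x))"
  have k': "\<kappa>' \<in> B" "\<Phi> t (chart_inv \<kappa> x) \<in> fst \<kappa>'" using chart_at_props[OF h] by (auto simp: \<kappa>'_def)
  let ?S = "fam_dom T \<kappa> \<kappa>' \<Phi>"
  have op: "open ?S" by (rule fam_dom_open[OF g k h k'(1) T \<Phi>])
  have "smooth_on ?S (\<lambda>z. I ((\<lambda>(t, x). pullback_op g h \<kappa> \<kappa>' (\<Phi> t) (chart_inv \<kappa> x)) z))"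
    using I op family_op_smooth(1)[OF A k B k'(1) T \<Phi>] unfolding smooth_invariant_def by blast
  then have "smooth_on ?S (\<lambda>(t, x). I (map_op A g B h (\<Phi> t) (chart_inv \<kappa> x)))"
  proof (rule smooth_on_cong[OF op, rotated])
    fix z assume "z \<in> ?S"
    then obtain t x where w: "z = (t, x)" "t \<in> T" "x \<in> snd \<kappa> ` fst \<kappa>" "\<Phi> t (chart_inv \<kappa> x) \<in> fst \<kappa>'" by (auto simp: fam_dom_def)
    show "I ((\<lambda>(t, x). pullback_op g h \<kappa> \<kappa>' (\<Phi> t) (chart_inv \<kappa> x)) z) = (case z of (t, x) \<Rightarrow> I (map_op A g B h (\<Phi> t) (chart_inv \<kappa> x)))"
      using map_op_chart[OF A k chart_props(5)[OF g k w(3)] B k'(1) w(4) family_differentiable_map[OF g \<Phi> w(2)], of I] I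
      by (simp add: w smooth_invariant_def)
  qed
  then show "\<exists>U. open U \<and> z \<in> U \<and> smooth_on U (\<lambda>(t, x). I (map_op A g B h (\<Phi> t) (chart_inv \<kappa> x)))"
    using op zt k' by (intro exI[of _ ?S]) (auto simp: fam_dom_def)
qed

section \<open>Change of variables\<close>

text \<open>The change of variables theorem of the library needs a well-ordered index type.\<close>

typedef 'a ranked = "UNIV :: 'a set" morphisms of_ranked to_ranked ..

definition rank_of :: "'a::finite \<Rightarrow> nat" where "rank_of = (SOME f. inj f)"

lemma inj_rank_of: "inj (rank_of :: 'a::finite \<Rightarrow> nat)"
proof -
  obtain f :: "'a \<Rightarrow> nat" where "bij_betw f UNIV {0..<CARD('a)}"
    using ex_bij_betw_finite_nat[of "UNIV::'a set"] by auto
  then have "\<exists>f :: 'a \<Rightarrow> nat. inj f" by (auto simp: bij_betw_def)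
  then show ?thesis unfolding rank_of_def by (rule someI_ex)
qed

instance ranked :: (finite) finite
proof
  have "(UNIV :: 'a ranked set) = range to_ranked"
    by (metis UNIV_eq_I of_ranked_inverse rangeI)
  then show "finite (UNIV :: 'a ranked set)" by (metis finite finite_imageI)
qed

instantiation ranked :: (finite) wellorder
begin

definition less_eq_ranked :: "'a ranked \<Rightarrow> 'a ranked \<Rightarrow> bool" where
  "less_eq_ranked x y \<longleftrightarrow> rank_of (of_ranked x) \<le> rank_of (of_ranked y)"

definition less_ranked :: "'a ranked \<Rightarrow> 'a ranked \<Rightarrow> bool" where
  "less_ranked x y \<longleftrightarrow> rank_of (of_ranked x) < rank_of (of_ranked y)"

instance
proof
  fix x y :: "'a ranked"
  assume "x \<le> y" "y \<le> x"
  then have "rank_of (of_ranked x) = rank_of (of_ranked y)" by (simp add: less_eq_ranked_def)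
  then have "of_ranked x = of_ranked y" using inj_rank_of by (auto dest: injD)
  then show "x = y" by (simp add: of_ranked_inject)
next
  fix P :: "'a ranked \<Rightarrow> bool" and a
  assume step: "\<And>x. (\<And>y. y < x \<Longrightarrow> P y) \<Longrightarrow> P x"
  show "P a"
  proof (induction a rule: measure_induct_rule[where f="\<lambda>x. rank_of (of_ranked x)"])
    case (less x)
    show ?case by (rule step, rule less.IH, simp only: less_ranked_def)
  qed
qed (auto simp: less_eq_ranked_def less_ranked_def)

end

section \<open>Lebesgue measure and determinants under a bijection of index types\<close>

definition reindex_vec :: "('m \<Rightarrow> 'n) \<Rightarrow> 'b^'n \<Rightarrow> 'b^'m" where
  "reindex_vec \<sigma> y = (\<chi> i. y $ \<sigma> i)"

lemma reindex_vec_inverse: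
  "bij \<sigma> \<Longrightarrow> reindex_vec \<sigma> (reindex_vec (inv \<sigma>) y) = y" "bij \<sigma> \<Longrightarrow> reindex_vec (inv \<sigma>) (reindex_vec \<sigma> z) = z"
  by (simp_all add: reindex_vec_def vec_eq_iff bij_is_inj bij_is_surj surj_f_inv_f)

lemma bounded_linear_reindex_vec: "bounded_linear (reindex_vec \<sigma> :: real^'n \<Rightarrow> real^'m)"
  unfolding linear_conv_bounded_linear[symmetric]
  by (rule linearI) (simp_all add: reindex_vec_def vec_eq_iff)

lemma borel_measurable_reindex_vec [measurable]: "(reindex_vec \<sigma> :: real^'n \<Rightarrow> real^'m) \<in> borel_measurable borel"
  by (intro borel_measurable_continuous_onI linear_continuous_on bounded_linear_reindex_vec)

text \<open>Renaming coordinates maps boxes to boxes with the same side lengths, and Lebesgue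
  measure is determined by its values on boxes.\<close>

lemma lborel_reindex_vec:
  fixes \<sigma> :: "'m::finite \<Rightarrow> 'n::finite"
  assumes \<sigma>: "bij \<sigma>"
  shows "distr lborel borel (reindex_vec \<sigma> :: real^'n \<Rightarrow> real^'m) = lborel"
proof (rule lborel_eqI[symmetric])
  fix l u :: "real^'m"
  assume le: "\<And>b. b \<in> Basis \<Longrightarrow> l \<bullet> b \<le> u \<bullet> b"
  have le': "l $ i \<le> u $ i" for i
    using le[of "axis i 1"] by (simp add: inner_axis axis_in_Basis_iff)
  have bx: "box a b = {x. \<forall>i. a $ i < x $ i \<and> x $ i < b $ i}" for a b :: "real^'k"
    by (auto simp: box_def Basis_vec_def inner_axis)
  have pr: "(\<Prod>b\<in>Basis. x \<bullet> b) = (\<Prod>i\<in>UNIV. x $ i)" for x :: "real^'k"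
  proof -
    have B: "(Basis :: (real^'k) set) = range (\<lambda>i. axis i 1)" by (auto simp: Basis_vec_def)
    have I: "inj (\<lambda>i. axis i 1 :: real^'k)" by (auto simp: inj_on_def axis_eq_axis)
    have "(\<Prod>b\<in>Basis. x \<bullet> b) = prod ((\<lambda>b. x \<bullet> b) \<circ> (\<lambda>i. axis i 1)) UNIV"
      unfolding B by (rule prod.reindex[OF I])
    then show ?thesis by (simp add: inner_axis o_def)
  qed
  have "reindex_vec \<sigma> -` box l u = box (reindex_vec (inv \<sigma>) l) (reindex_vec (inv \<sigma>) u)"
    unfolding bx reindex_vec_def using \<sigma>
    by (auto simp: bij_is_surj surj_f_inv_f) (metis \<sigma> bij_inv_eq_iff)+
  then have "emeasure (distr lborel borel (reindex_vec \<sigma>)) (box l u) = emeasure lborel (box (reindex_vec (inv \<sigma>) l) (reindex_vec (inv \<sigma>) u))"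
    by (subst emeasure_distr) auto
  also have "\<dots> = (\<Prod>b\<in>Basis. (reindex_vec (inv \<sigma>) u - reindex_vec (inv \<sigma>) l) \<bullet> b)"
    using le' by (intro emeasure_lborel_box) (auto simp: Basis_vec_def inner_axis reindex_vec_def)
  also have "\<dots> = (\<Prod>i\<in>UNIV. u $ inv \<sigma> i - l $ inv \<sigma> i)"
    by (simp add: pr reindex_vec_def)
  also have "\<dots> = (\<Prod>i\<in>UNIV. u $ i - l $ i)"
    using prod.reindex_bij_betw[OF bij_imp_bij_inv[OF \<sigma>], of "\<lambda>i. u $ i - l $ i"] by simp
  finally show "emeasure (distr lborel borel (reindex_vec \<sigma>)) (box l u) = (\<Prod>b\<in>Basis. (u - l) \<bullet> b)"
    by (simp add: pr)
qed simp

lemma nn_integral_reindex_vec: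
  fixes \<sigma> :: "'m::finite \<Rightarrow> 'n::finite"
  assumes \<sigma>: "bij \<sigma>" and [measurable]: "F \<in> borel_measurable borel"
  shows "(\<integral>\<^sup>+y. F y \<partial>lborel) = (\<integral>\<^sup>+z. F (reindex_vec \<sigma> z) \<partial>(lborel :: (real^'n) measure))"
proof -
  have "(\<integral>\<^sup>+y. F y \<partial>lborel) = (\<integral>\<^sup>+y. F y \<partial>distr (lborel :: (real^'n) measure) borel (reindex_vec \<sigma>))"
    by (simp add: lborel_reindex_vec[OF \<sigma>])
  also have "\<dots> = (\<integral>\<^sup>+z. F (reindex_vec \<sigma> z) \<partial>(lborel :: (real^'n) measure))"
    by (subst nn_integral_distr) auto
  finally show ?thesis .
qed

text \<open>\<open>\<sigma>\<close> joins two different types, so the conjugate permutes another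
  type. The induction builds \<open>p\<close> from transpositions, and each of them is conjugated
  into a transposition.\<close>

lemma sign_conjugate:
  fixes \<sigma> :: "'m::finite \<Rightarrow> 'n::finite"
  assumes \<sigma>: "bij \<sigma>" and p: "p permutes UNIV"
  shows "sign (\<sigma> \<circ> p \<circ> inv \<sigma>) = sign p"
  using p finite
proof (induction rule: permutes_induct)
  case id
  then show ?case using \<sigma> by (simp add: bij_is_surj surj_iff[THEN iffD1])
next
  case (swap a b p)
  have pu: "p permutes UNIV" using swap.hyps by blast
  then have pp: "permutation p" by (simp add: permutation permutes_bij)
  have s: "\<sigma> x = \<sigma> y \<longleftrightarrow> x = y" for x y using bij_is_inj[OF \<sigma>] by (rule inj_eq)
  have "\<sigma> (Transposition.transpose a b x) = Transposition.transpose (\<sigma> a) (\<sigma> b) (\<sigma> x)" for x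
    by (cases "x = a"; cases "x = b") (simp_all add: Transposition.transpose_def s)
  then have conj: "\<sigma> \<circ> (Transposition.transpose a b \<circ> p) \<circ> inv \<sigma> = Transposition.transpose (\<sigma> a) (\<sigma> b) \<circ> (\<sigma> \<circ> p \<circ> inv \<sigma>)"
    unfolding o_def by (intro ext)
  have "bij (\<sigma> \<circ> p \<circ> inv \<sigma>)"
    by (intro bij_comp bij_imp_bij_inv \<sigma> permutes_bij[OF pu])
  then have "permutation (\<sigma> \<circ> p \<circ> inv \<sigma>)" by (simp add: permutation)
  then have "sign (\<sigma> \<circ> (Transposition.transpose a b \<circ> p) \<circ> inv \<sigma>) = sign (Transposition.transpose (\<sigma> a) (\<sigma> b)) * sign (\<sigma> \<circ> p \<circ> inv \<sigma>)"
    unfolding conj by (intro sign_compose permutation_swap_id)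
  also have "\<dots> = sign (Transposition.transpose a b) * sign p"
    using swap.IH by (simp only: sign_swap_id s)
  also have "\<dots> = sign (Transposition.transpose a b \<circ> p)"
    by (intro sign_compose[symmetric] permutation_swap_id pp)
  finally show ?case .
qed

text \<open>Conjugation by \<open>\<sigma>\<close> is a sign-preserving bijection between the
  permutations of the two index types; it matches the two Leibniz sums term by term.\<close>

lemma det_reindex:
  fixes \<sigma> :: "'m::finite \<Rightarrow> 'n::finite" and M :: "real^'n^'n"
  assumes \<sigma>: "bij \<sigma>"
  shows "det (\<chi> i j. M $ \<sigma> i $ \<sigma> j) = det M"
proof -
  let ?c = "\<lambda>p. \<sigma> \<circ> p \<circ> inv \<sigma>"
  have inv: "inv \<sigma> (\<sigma> i) = i" "\<sigma> (inv \<sigma> j) = j" for i j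
    using \<sigma> by (simp_all add: bij_is_inj bij_is_surj surj_f_inv_f)
  have "bij_betw ?c {p. p permutes UNIV} {p. p permutes UNIV}"
  proof (rule bij_betw_byWitness[where f'="\<lambda>q. inv \<sigma> \<circ> q \<circ> \<sigma>"])
    show "?c ` {p. p permutes UNIV} \<subseteq> {p. p permutes UNIV}"
      using \<sigma> by (auto intro!: bij_imp_permutes bij_comp bij_imp_bij_inv dest: permutes_bij)
    show "(\<lambda>q. inv \<sigma> \<circ> q \<circ> \<sigma>) ` {p. p permutes UNIV} \<subseteq> {p. p permutes UNIV}"
      using \<sigma> by (auto intro!: bij_imp_permutes bij_comp bij_imp_bij_inv dest: permutes_bij)
  qed (auto simp: fun_eq_iff inv)
  then have "det M = (\<Sum>p | p permutes UNIV. of_int (sign (?c p)) * (\<Prod>i\<in>UNIV. M $ i $ ?c p i))"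
    unfolding det_def by (rule sum.reindex_bij_betw[symmetric])
  also have "\<dots> = (\<Sum>p | p permutes UNIV. of_int (sign p) * (\<Prod>i\<in>UNIV. M $ \<sigma> i $ \<sigma> (p i)))"
  proof (rule sum.cong[OF refl])
    fix p :: "'m \<Rightarrow> 'm" assume "p \<in> {p. p permutes UNIV}"
    then have "sign (?c p) = sign p" using sign_conjugate[OF \<sigma>] by blast
    moreover have "(\<Prod>i\<in>UNIV. M $ i $ ?c p i) = (\<Prod>i\<in>UNIV. M $ \<sigma> i $ \<sigma> (p i))"
      using prod.reindex_bij_betw[OF \<sigma>, of "\<lambda>i. M $ i $ ?c p i"] by (simp add: inv)
    ultimately show "of_int (sign (?c p)) * (\<Prod>i\<in>UNIV. M $ i $ ?c p i) = of_int (sign p) * (\<Prod>i\<in>UNIV. M $ \<sigma> i $ \<sigma> (p i))"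
      by simp
  qed
  finally show ?thesis by (simp add: det_def)
qed

section \<open>Substitution in nonnegative integrals\<close>

text \<open>A bridge between the gauge integral, in which the substitution theorem is stated, and
  the nonnegative Lebesgue integral, in which measures are given.\<close>

lemma nn_integral_absolutely_integrable_iff:
  fixes f :: "'a::euclidean_space \<Rightarrow> real"
  assumes nn: "\<And>x. x \<in> S \<Longrightarrow> 0 \<le> f x" and m: "(\<lambda>x. indicator S x * f x) \<in> borel_measurable borel"
  shows "(f absolutely_integrable_on S \<and> integral S f = b) \<longleftrightarrow>
    (0 \<le> b \<and> (\<integral>\<^sup>+x. ennreal (f x) * indicator S x \<partial>lborel) = ennreal b)"
proof -
  let ?F = "\<lambda>x. indicator S x * f x"
  have "(f absolutely_integrable_on S \<and> integral S f = b) \<longleftrightarrow> (f has_integral b) S"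
    using absolutely_integrable_on_iff_nonneg[of S f] nn by (auto simp: has_integral_integrable_integral)
  also have "\<dots> \<longleftrightarrow> (?F has_integral b) UNIV"
    by (subst has_integral_restrict_UNIV[symmetric]) (simp add: indicator_def of_bool_def if_distrib[of "\<lambda>x. x * _"] cong: if_cong)
  also have "\<dots> \<longleftrightarrow> (?F \<in> lebesgue \<rightarrow>\<^sub>M borel \<and> integral\<^sup>N lebesgue ?F = b \<and> 0 \<le> b)"
    using nn by (intro has_integral_iff_nn_integral_lebesgue) (auto simp: indicator_def)
  also have "\<dots> \<longleftrightarrow> integral\<^sup>N lborel ?F = b \<and> 0 \<le> b"
    using m by (simp add: nn_integral_completion measurable_completion)
  also have "integral\<^sup>N lborel ?F = (\<integral>\<^sup>+x. ennreal (f x) * indicator S x \<partial>lborel)"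
    by (intro nn_integral_cong) (auto simp: indicator_def)
  finally show ?thesis by blast
qed

text \<open>The substitution theorem compares finite values. This suffices: if one side is finite,
  the premise transfers its value to the other side, and otherwise both are infinite.\<close>

lemma ennreal_eqI_finite:
  assumes "\<And>b. 0 \<le> b \<and> x = ennreal b \<longleftrightarrow> 0 \<le> b \<and> y = ennreal b" shows "x = y"
  using assms[of "enn2real x"] assms[of "enn2real y"] by (cases x; cases y) auto

text \<open>The integrand is regarded as a map to one-dimensional vectors, the form to which the
  substitution theorem applies. Its equivalence speaks of integrability and value together, hence it
  settles infinite integrals too.\<close>

lemma nn_integral_change_of_variables_wellorder:
  fixes u :: "real^'m::{finite,wellorder} \<Rightarrow> real^'m::_" and f :: "real^'m::_ \<Rightarrow> real"
  assumes S: "S \<in> sets borel" and der: "\<And>x. x \<in> S \<Longrightarrow> (u has_derivative u' x) (at x within S)"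
    and inj: "inj_on u S" and nn: "\<And>y. 0 \<le> f y"
    and m1: "(\<lambda>y. indicator (u ` S) y * f y) \<in> borel_measurable borel"
    and m2: "(\<lambda>x. indicator S x * (\<bar>det (matrix (u' x))\<bar> * f (u x))) \<in> borel_measurable borel"
  shows "(\<integral>\<^sup>+y. ennreal (f y) * indicator (u ` S) y \<partial>lborel)
    = (\<integral>\<^sup>+x. ennreal (\<bar>det (matrix (u' x))\<bar> * f (u x)) * indicator S x \<partial>lborel)"
proof (rule ennreal_eqI_finite)
  fix b
  have Sl: "S \<in> sets lebesgue" using S by simp
  have "(\<lambda>x. \<bar>det (matrix (u' x))\<bar> *\<^sub>R (vec (f (u x)) :: real^1)) absolutely_integrable_on S \<and>
           integral S (\<lambda>x. \<bar>det (matrix (u' x))\<bar> *\<^sub>R (vec (f (u x)) :: real^1)) = vec b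
     \<longleftrightarrow> (\<lambda>y. vec (f y) :: real^1) absolutely_integrable_on (u ` S) \<and> integral (u ` S) (\<lambda>y. vec (f y) :: real^1) = vec b"
    by (rule has_absolute_integral_change_of_variables[OF Sl der inj])
  then have "(\<lambda>x. \<bar>det (matrix (u' x))\<bar> * f (u x)) absolutely_integrable_on S \<and>
           integral S (\<lambda>x. \<bar>det (matrix (u' x))\<bar> * f (u x)) = b
     \<longleftrightarrow> f absolutely_integrable_on (u ` S) \<and> integral (u ` S) f = b"
    by (simp add: absolutely_integrable_on_1_iff integral_on_1_eq)
  then show "0 \<le> b \<and> (\<integral>\<^sup>+y. ennreal (f y) * indicator (u ` S) y \<partial>lborel) = ennreal b \<longleftrightarrow>
    0 \<le> b \<and> (\<integral>\<^sup>+x. ennreal (\<bar>det (matrix (u' x))\<bar> * f (u x)) * indicator S x \<partial>lborel) = ennreal b"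
    using nn_integral_absolutely_integrable_iff[of S "\<lambda>x. \<bar>det (matrix (u' x))\<bar> * f (u x)" b]
      nn_integral_absolutely_integrable_iff[of "u ` S" f b] nn m1 m2 by auto
qed

text \<open>\<open>D x\<close> is a matrix between different index types and has no determinant, so
  the Jacobian factor cannot be written as |det D|. Kept inside the Gram determinant of the pulled
  back form it makes sense, and it is then exactly the volume density of a pullback metric.\<close>

lemma nn_integral_change_of_variables_metric:
  fixes u :: "real^'a::finite \<Rightarrow> real^'b::finite" and D :: "real^'a \<Rightarrow> real^'a^'b" and H :: "real^'b \<Rightarrow> real^'b^'b"
  assumes card: "CARD('a) = CARD('b)"
    and S: "S \<in> sets borel" and der: "\<And>x. x \<in> S \<Longrightarrow> (u has_derivative (\<lambda>v. D x *v v)) (at x)"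
    and inj: "inj_on u S" and nn: "\<And>y. 0 \<le> det (H y)"
    and m1: "(\<lambda>y. indicator (u ` S) y * sqrt (det (H y))) \<in> borel_measurable borel"
    and m2: "(\<lambda>x. indicator S x * sqrt (det (transpose (D x) ** H (u x) ** D x))) \<in> borel_measurable borel"
  shows "(\<integral>\<^sup>+y. ennreal (sqrt (det (H y))) * indicator (u ` S) y \<partial>lborel)
    = (\<integral>\<^sup>+x. ennreal (sqrt (det (transpose (D x) ** H (u x) ** D x))) * indicator S x \<partial>lborel)"
proof -
  obtain \<tau> where "bij_betw \<tau> (UNIV::'a set) (UNIV::'b set)"
    using card by (metis finite_same_card_bij finite)
  then have \<tau>: "bij \<tau>" by simp
  \<comment> \<open>\<open>\<sigma>\<close> names the source coordinates and \<open>\<rho>\<close>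
    the target coordinates by the same ranked type, so that \<open>w\<close> is \<open>u\<close>
    read as a map of one space to itself, with square Jacobian matrix \<open>Dw\<close>.\<close>
  define \<sigma> where "\<sigma> = (of_ranked :: 'a ranked \<Rightarrow> 'a)"
  define \<rho> where "\<rho> = \<tau> \<circ> \<sigma>"
  have \<sigma>: "bij \<sigma>" unfolding \<sigma>_def
    by (metis bijI' of_ranked_inject to_ranked_inverse UNIV_I)
  have \<rho>: "bij \<rho>" unfolding \<rho>_def by (rule bij_comp[OF \<sigma> \<tau>])
  note i\<sigma> = reindex_vec_inverse[OF \<sigma>] and i\<rho> = reindex_vec_inverse[OF \<rho>]
  define R where "R = (reindex_vec (inv \<sigma>) :: real^'a ranked \<Rightarrow> real^'a)"
  define Q where "Q = (reindex_vec (inv \<rho>) :: real^'a ranked \<Rightarrow> real^'b)"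
  define w where "w z = (reindex_vec \<rho> (u (R z)) :: real^'a ranked)" for z
  define Dw where "Dw z = (\<chi> i j. D (R z) $ \<rho> i $ \<sigma> j)" for z
  define Sw where "Sw = (reindex_vec \<sigma> ` S :: (real^'a ranked) set)"
  have [measurable]: "R \<in> borel_measurable borel" "Q \<in> borel_measurable borel"
    by (simp_all add: R_def Q_def)
  have RS: "R z \<in> S \<longleftrightarrow> z \<in> Sw" for z
  proof
    assume "R z \<in> S"
    moreover have "z = reindex_vec \<sigma> (R z)" by (simp add: R_def i\<sigma>)
    ultimately show "z \<in> Sw" unfolding Sw_def by blast
  next
    assume "z \<in> Sw"
    then obtain x where "x \<in> S" "z = reindex_vec \<sigma> x" unfolding Sw_def by blast
    then show "R z \<in> S" by (simp add: R_def i\<sigma>)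
  qed
  have Qu: "Q (w z) = u (R z)" for z by (simp add: Q_def w_def i\<rho>)
  have QuS: "Q y \<in> u ` S \<longleftrightarrow> y \<in> w ` Sw" for y
  proof
    assume "Q y \<in> u ` S"
    then obtain x where x: "x \<in> S" "Q y = u x" by auto
    have "y = w (reindex_vec \<sigma> x)" using x(2) i\<rho>(1)[of y] by (simp add: w_def R_def Q_def i\<sigma>)
    then show "y \<in> w ` Sw" using x(1) by (auto simp: Sw_def)
  next
    assume "y \<in> w ` Sw"
    then show "Q y \<in> u ` S" using Qu RS by auto
  qed
  have Swm: "Sw \<in> sets borel"
  proof -
    have "R -` S \<inter> space borel \<in> sets borel" using S by measurable
    moreover have "R -` S \<inter> space borel = Sw" using RS by auto
    ultimately show ?thesis by simp
  qed
  have injw: "inj_on w Sw"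
  proof (rule inj_onI)
    fix x y assume "x \<in> Sw" "y \<in> Sw" "w x = w y"
    then have "u (R x) = u (R y)" "R x \<in> S" "R y \<in> S" using Qu RS by metis+
    then have "R x = R y" using inj by (auto dest: inj_onD)
    then show "x = y" unfolding R_def using i\<sigma>(1) by metis
  qed
  have mat: "matrix (\<lambda>v. reindex_vec \<rho> (D x *v R v) :: real^'a ranked) = (\<chi> i j. D x $ \<rho> i $ \<sigma> j)" for x
  proof -
    have "R (axis j 1) $ k = axis (\<sigma> j) 1 $ k" for j k
      using bij_inv_eq_iff[OF \<sigma>, of j k] by (auto simp: R_def reindex_vec_def axis_def)
    then have "R (axis j 1) = axis (\<sigma> j) 1" for j by (simp only: vec_eq_iff) simp
    then show ?thesis
      by (simp add: matrix_def reindex_vec_def matrix_vector_mul_component inner_axis)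
  qed
  have derw: "(w has_derivative (\<lambda>v. reindex_vec \<rho> (D (R z) *v R v))) (at z within Sw)" if "z \<in> Sw" for z
  proof -
    have "R z \<in> S" using that RS by simp
    note d = der[OF this]
    have "(R has_derivative R) (at z)" unfolding R_def
      by (rule bounded_linear_imp_has_derivative[OF bounded_linear_reindex_vec])
    from has_derivative_compose[OF this d]
    have "((\<lambda>z. u (R z)) has_derivative (\<lambda>v. D (R z) *v R v)) (at z)" .
    from bounded_linear.has_derivative[OF bounded_linear_reindex_vec this]
    show ?thesis unfolding w_def by (rule has_derivative_at_withinI)
  qed
  \<comment> \<open>Reindexing does not alter Gram determinants, and for the square matrix
    \<open>Dw\<close> the Gram determinant factors as (det Dw)^2 det H.\<close>
  have dets: "\<bar>det (Dw z)\<bar> * sqrt (det (H (u (R z)))) = sqrt (det (transpose (D (R z)) ** H (u (R z)) ** D (R z)))" for z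
  proof -
    define Hw where "Hw = (\<chi> i j. H (u (R z)) $ \<rho> i $ \<rho> j)"
    have "(transpose (Dw z) ** Hw ** Dw z) $ i $ j = (transpose (D (R z)) ** H (u (R z)) ** D (R z)) $ \<sigma> i $ \<sigma> j" for i j
      using sum.reindex_bij_betw[OF \<rho>]
      by (simp add: matrix_matrix_mult_def transpose_def Dw_def Hw_def)
        (smt (verit, best) sum.cong sum.reindex_bij_betw[OF \<rho>])
    then have "transpose (Dw z) ** Hw ** Dw z = (\<chi> i j. (transpose (D (R z)) ** H (u (R z)) ** D (R z)) $ \<sigma> i $ \<sigma> j)"
      by (simp add: vec_eq_iff)
    then have "det (transpose (D (R z)) ** H (u (R z)) ** D (R z)) = det (transpose (Dw z) ** Hw ** Dw z)"
      by (simp only: det_reindex[OF \<sigma>])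
    also have "\<dots> = (det (Dw z))\<^sup>2 * det (H (u (R z)))"
      by (simp add: det_mul det_transpose Hw_def det_reindex[OF \<rho>] power2_eq_square)
    finally show ?thesis by (simp add: real_sqrt_mult)
  qed
  have "(\<integral>\<^sup>+y. ennreal (sqrt (det (H y))) * indicator (u ` S) y \<partial>lborel)
     = (\<integral>\<^sup>+y. ennreal (indicator (u ` S) y * sqrt (det (H y))) \<partial>lborel)"
    by (intro nn_integral_cong) (auto simp: indicator_def)
  also have "\<dots> = (\<integral>\<^sup>+z. ennreal (indicator (u ` S) (Q z) * sqrt (det (H (Q z)))) \<partial>lborel)"
    unfolding Q_def by (rule nn_integral_reindex_vec[OF bij_imp_bij_inv[OF \<rho>]]) (use m1 in measurable)
  also have "\<dots> = (\<integral>\<^sup>+z. ennreal (sqrt (det (H (Q z)))) * indicator (w ` Sw) z \<partial>lborel)"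
    by (intro nn_integral_cong) (auto simp: indicator_def QuS)
  also have "\<dots> = (\<integral>\<^sup>+z. ennreal (\<bar>det (matrix (\<lambda>v. reindex_vec \<rho> (D (R z) *v R v) :: real^'a ranked))\<bar> * sqrt (det (H (Q (w z))))) * indicator Sw z \<partial>lborel)"
  proof (rule nn_integral_change_of_variables_wellorder[OF Swm derw injw])
    have "(\<lambda>z. indicator (u ` S) (Q z) * sqrt (det (H (Q z)))) \<in> borel_measurable borel"
      using m1 by measurable
    then show "(\<lambda>y. indicator (w ` Sw) y * sqrt (det (H (Q y)))) \<in> borel_measurable borel"
      by (simp add: indicator_def QuS)
    have "(\<lambda>z. indicator S (R z) * sqrt (det (transpose (D (R z)) ** H (u (R z)) ** D (R z)))) \<in> borel_measurable borel"
      using m2 by measurable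
    then show "(\<lambda>z. indicator Sw z * (\<bar>det (matrix (\<lambda>v. reindex_vec \<rho> (D (R z) *v R v) :: real^'a ranked))\<bar> * sqrt (det (H (Q (w z)))))) \<in> borel_measurable borel"
      unfolding mat Qu using dets unfolding Dw_def by (simp add: indicator_def RS)
  qed (use nn in auto)
  also have "\<dots> = (\<integral>\<^sup>+z. ennreal (indicator S (R z) * sqrt (det (transpose (D (R z)) ** H (u (R z)) ** D (R z)))) \<partial>lborel)"
    unfolding mat Qu using dets unfolding Dw_def by (intro nn_integral_cong) (auto simp: indicator_def RS)
  also have "\<dots> = (\<integral>\<^sup>+x. ennreal (indicator S x * sqrt (det (transpose (D x) ** H (u x) ** D x))) \<partial>lborel)"
    unfolding R_def by (rule nn_integral_reindex_vec[OF bij_imp_bij_inv[OF \<sigma>], symmetric]) (use m2 in measurable)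
  also have "\<dots> = (\<integral>\<^sup>+x. ennreal (sqrt (det (transpose (D x) ** H (u x) ** D x))) * indicator S x \<partial>lborel)"
    by (intro nn_integral_cong) (auto simp: indicator_def)
  finally show ?thesis .
qed

lemma borel_Int_vimage:
  assumes "open S" "continuous_on S f" "Y \<in> sets borel"
  shows "S \<inter> f -` Y \<in> sets borel"
proof -
  have f: "f \<in> borel_measurable (restrict_space borel S)"
    by (rule borel_measurable_continuous_on_restrict[OF assms(2)])
  have S: "S \<inter> space borel \<in> sets borel" using assms(1) by simp
  have "f -` Y \<inter> space (restrict_space borel S) \<in> sets (restrict_space borel S)"
    by (rule measurable_sets[OF f assms(3)])
  then have "f -` Y \<inter> S \<in> sets borel"
    using S by (simp add: sets_restrict_space_iff space_restrict_space)
  then show ?thesis by (simp add: Int_commute)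
qed

lemma chart_image_borel:
  assumes "smooth_atlas A" "\<kappa> \<in> A" "X \<in> sets borel" "X \<subseteq> fst \<kappa>"
  shows "snd \<kappa> ` X \<in> sets borel"
proof -
  note c = chart_props[OF assms(1,2)]
  have "snd \<kappa> ` X = snd \<kappa> ` fst \<kappa> \<inter> chart_inv \<kappa> -` X"
    using c(3-5) assms(4) by (auto simp: image_iff)
  then show ?thesis using borel_Int_vimage[OF c(2,7) assms(3)] by simp
qed

text \<open>Stated for Borel sets rather than open ones, because manifolds will be cut into disjoint
  pieces of chart domains.\<close>

lemma chart_change_of_variables:
  fixes A :: "('m::{t2_space, second_countable_topology}, 'a::finite) chart set"
    and B :: "('n::{t2_space, second_countable_topology}, 'b::finite) chart set"
  assumes A: "smooth_atlas A" "\<kappa> \<in> A" and B: "riemannian_manifold B h" "\<kappa>' \<in> B" and card: "CARD('a) = CARD('b)"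
    and X: "X \<in> sets borel" "X \<subseteq> fst \<kappa>" "f ` X \<subseteq> fst \<kappa>'" "f ` X \<in> sets borel" "inj_on f X"
    and f: "differentiable_map A B f"
    and cont: "continuous_on (snd \<kappa> ` X) (\<lambda>x. pullback_metric h \<kappa> \<kappa>' f (chart_inv \<kappa> x))"
  shows "(\<integral>\<^sup>+y. ennreal (sqrt (det (h \<kappa>' (chart_inv \<kappa>' y)))) * indicator (snd \<kappa>' ` f ` X) y \<partial>lborel)
    = (\<integral>\<^sup>+x. ennreal (sqrt (det (pullback_metric h \<kappa> \<kappa>' f (chart_inv \<kappa> x)))) * indicator (snd \<kappa> ` X) x \<partial>lborel)"
proof -
  have h: "smooth_atlas B" "riemannian_metric B h"
    using B(1) by (auto simp: riemannian_manifold_def)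
  note cA = chart_props[OF A] and cB = chart_props[OF h(1) B(2)]
  define u where "u = snd \<kappa>' \<circ> f \<circ> chart_inv \<kappa>"
  define S where "S = snd \<kappa> ` X"
  define D where "D x = differential_matrix \<kappa> \<kappa>' f (chart_inv \<kappa> x)" for x
  \<comment> \<open>Outside the chart image the Gram matrix is arbitrary; the identity matrix is put
    there so that the determinant is nonnegative everywhere.\<close>
  define H where "H y = (if y \<in> snd \<kappa>' ` fst \<kappa>' then h \<kappa>' (chart_inv \<kappa>' y) else mat 1)" for y
  have S: "S \<in> sets borel" unfolding S_def by (rule chart_image_borel[OF A X(1,2)])
  have inv: "chart_inv \<kappa> x \<in> X" "snd \<kappa> (chart_inv \<kappa> x) = x" if "x \<in> S" for x
    using that X(2) cA(3) by (auto simp: S_def)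
  have uS: "u ` S = snd \<kappa>' ` f ` X" using X(2) cA(3) by (force simp: u_def S_def image_iff)
  have uSm: "u ` S \<in> sets borel" unfolding uS by (rule chart_image_borel[OF h(1) B(2) X(4,3)])
  have der: "(u has_derivative (\<lambda>v. D x *v v)) (at x)" if "x \<in> S" for x
  proof -
    have "u differentiable (at (snd \<kappa> (chart_inv \<kappa> x)))"
      using f A(2) B(2) inv[OF that] X(2,3) unfolding u_def differentiable_map_def by (blast dest: subsetD)
    from differential_matrix_has_derivative[OF this[unfolded u_def]] show ?thesis
      by (simp add: inv[OF that] u_def D_def)
  qed
  have inj: "inj_on u S"
  proof (rule inj_onI)
    fix x y assume xy: "x \<in> S" "y \<in> S" "u x = u y"
    have "f (chart_inv \<kappa> x) = f (chart_inv \<kappa> y)"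
      using xy inv(1)[OF xy(1)] inv(1)[OF xy(2)] X(3) cB(8) unfolding u_def by (auto dest!: inj_onD)
    then have "chart_inv \<kappa> x = chart_inv \<kappa> y" using inv(1)[OF xy(1)] inv(1)[OF xy(2)] X(5) by (auto dest: inj_onD)
    then show "x = y" using inv(2) xy by metis
  qed
  have HuS: "H (u x) = h \<kappa>' (f (chart_inv \<kappa> x))" if "x \<in> S" for x
  proof -
    have "f (chart_inv \<kappa> x) \<in> fst \<kappa>'" using inv(1)[OF that] X(3) by blast
    then show ?thesis using cB(3) by (simp add: H_def u_def)
  qed
  have detH: "det (H y) \<ge> 0" for y
    using metric_props(3)[OF h(2) B(2) cB(5)] by (simp add: H_def less_imp_le)
  have sub: "snd \<kappa>' ` f ` X \<subseteq> snd \<kappa>' ` fst \<kappa>'" using X(3) by blast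
  have contH: "continuous_on (u ` S) H"
    by (rule continuous_on_eq[OF continuous_on_subset[OF smooth_on_continuous[OF metric_smooth[OF h(2) B(2)]] sub[folded uS]]])
       (use sub in \<open>auto simp: H_def uS\<close>)
  have cdet: "continuous_on T (\<lambda>x. sqrt (det (M x)))" if "continuous_on T M" for T :: "(real^'c) set" and M :: "_ \<Rightarrow> real^'d^'d"
  proof -
    have "continuous_on UNIV (\<lambda>A :: real^'d^'d. det A)"
      by (rule smooth_on_continuous[OF smooth_on_det[OF open_UNIV smooth_on_bounded_linear[OF bounded_linear_ident open_UNIV]]])
    from continuous_on_compose2[OF this that] show ?thesis by (intro continuous_intros) auto
  qed
  have DH: "transpose (D x) ** H (u x) ** D x = pullback_metric h \<kappa> \<kappa>' f (chart_inv \<kappa> x)" if "x \<in> S" for x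
    by (simp add: D_def HuS[OF that] pullback_metric_def)
  have "(\<integral>\<^sup>+y. ennreal (sqrt (det (H y))) * indicator (u ` S) y \<partial>lborel)
    = (\<integral>\<^sup>+x. ennreal (sqrt (det (transpose (D x) ** H (u x) ** D x))) * indicator S x \<partial>lborel)"
  proof (rule nn_integral_change_of_variables_metric[OF card S der inj detH])
    show "(\<lambda>y. indicator (u ` S) y * sqrt (det (H y))) \<in> borel_measurable borel"
      using borel_measurable_continuous_on_indicator[OF uSm cdet[OF contH]] by simp
    have "(\<lambda>x. indicator S x * sqrt (det (pullback_metric h \<kappa> \<kappa>' f (chart_inv \<kappa> x)))) \<in> borel_measurable borel"
      using borel_measurable_continuous_on_indicator[OF S cdet[OF cont[folded S_def]]] by simp
    then show "(\<lambda>x. indicator S x * sqrt (det (transpose (D x) ** H (u x) ** D x))) \<in> borel_measurable borel"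
      by (rule measurable_cong[THEN iffD1, rotated]) (auto simp: indicator_def DH)
  qed
  moreover have "(\<integral>\<^sup>+y. ennreal (sqrt (det (H y))) * indicator (u ` S) y \<partial>lborel)
     = (\<integral>\<^sup>+y. ennreal (sqrt (det (h \<kappa>' (chart_inv \<kappa>' y)))) * indicator (snd \<kappa>' ` f ` X) y \<partial>lborel)"
    unfolding uS using sub by (intro nn_integral_cong) (auto simp: indicator_def H_def)
  moreover have "(\<integral>\<^sup>+x. ennreal (sqrt (det (transpose (D x) ** H (u x) ** D x))) * indicator S x \<partial>lborel)
    = (\<integral>\<^sup>+x. ennreal (sqrt (det (pullback_metric h \<kappa> \<kappa>' f (chart_inv \<kappa> x)))) * indicator (snd \<kappa> ` X) x \<partial>lborel)"
    by (intro nn_integral_cong) (auto simp: indicator_def DH S_def)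
  ultimately show ?thesis by simp
qed

section \<open>The Riemannian measure\<close>

definition vol_density :: "('m, 'a::finite) metric \<Rightarrow> ('m, 'a) chart \<Rightarrow> real ^ 'a \<Rightarrow> real" where
  "vol_density g \<kappa> x = sqrt (det (g \<kappa> (chart_inv \<kappa> x)))"

text \<open>The part of the Riemannian measure carried by a piece \<open>D\<close> of the chart
  domain, pushed from coordinates to the manifold. Off the chart image, where the density vanishes,
  the pushing map is constantly \<open>undefined\<close>, which keeps it Borel measurable.\<close>

definition chart_measure :: "('m::topological_space, 'a::finite) metric \<Rightarrow> ('m, 'a) chart \<Rightarrow> 'm set \<Rightarrow> 'm measure" where
  "chart_measure g \<kappa> D = distr (density lborel (\<lambda>x. ennreal (vol_density g \<kappa> x) * indicator (snd \<kappa> ` D) x)) borel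
     (\<lambda>x. if x \<in> snd \<kappa> ` fst \<kappa> then chart_inv \<kappa> x else undefined)"

lemma vol_density_continuous:
  assumes "riemannian_manifold A g" "\<kappa> \<in> A"
  shows "continuous_on (snd \<kappa> ` fst \<kappa>) (vol_density g \<kappa>)"
proof -
  have g: "smooth_atlas A" "riemannian_metric A g"
    using assms(1) by (auto simp: riemannian_manifold_def)
  note c = chart_props[OF g(1) assms(2)]
  show ?thesis unfolding vol_density_def
    by (rule smooth_on_continuous[OF smooth_on_sqrt[OF c(2) smooth_on_det[OF c(2) metric_smooth[OF g(2) assms(2)]] metric_props(3)[OF g(2) assms(2) c(5)]]])
qed

lemma chart_density_measurable:
  assumes "riemannian_manifold A g" "\<kappa> \<in> A" "D \<in> sets borel" "D \<subseteq> fst \<kappa>"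
  shows "(\<lambda>x. ennreal (vol_density g \<kappa> x) * indicator (snd \<kappa> ` D) x) \<in> borel_measurable borel"
proof -
  have g: "smooth_atlas A" using assms(1) by (auto simp: riemannian_manifold_def)
  have "(\<lambda>x. indicator (snd \<kappa> ` D) x *\<^sub>R vol_density g \<kappa> x) \<in> borel_measurable borel"
    by (rule borel_measurable_continuous_on_indicator[OF chart_image_borel[OF g assms(2-4)]
          continuous_on_subset[OF vol_density_continuous[OF assms(1,2)]]]) (use assms(4) in blast)
  then have "(\<lambda>x. ennreal (indicator (snd \<kappa> ` D) x *\<^sub>R vol_density g \<kappa> x)) \<in> borel_measurable borel" by simp
  then show ?thesis
    by (rule measurable_cong[THEN iffD1, rotated]) (auto simp: indicator_def)
qed

lemma chart_inv_measurable:
  assumes "smooth_atlas A" "\<kappa> \<in> A"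
  shows "(\<lambda>x. if x \<in> snd \<kappa> ` fst \<kappa> then chart_inv \<kappa> x else undefined) \<in> borel_measurable borel"
proof (rule measurableI)
  note c = chart_props[OF assms]
  let ?i = "\<lambda>x. if x \<in> snd \<kappa> ` fst \<kappa> then chart_inv \<kappa> x else undefined"
  fix Y :: "'a set" assume Y: "Y \<in> sets borel"
  have "?i -` Y \<inter> space borel = (snd \<kappa> ` fst \<kappa> \<inter> chart_inv \<kappa> -` Y) \<union> (if undefined \<in> Y then - snd \<kappa> ` fst \<kappa> else {})"
    by (auto split: if_splits)
  also have "\<dots> \<in> sets borel"
    using borel_Int_vimage[OF c(2,7) Y] c(2) by auto
  finally show "?i -` Y \<inter> space borel \<in> sets borel" .
qed simp

lemma emeasure_chart_measure:
  assumes "riemannian_manifold A g" "\<kappa> \<in> A" "D \<in> sets borel" "D \<subseteq> fst \<kappa>" "X \<in> sets borel"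
  shows "emeasure (chart_measure g \<kappa> D) X = (\<integral>\<^sup>+x. ennreal (vol_density g \<kappa> x) * indicator (snd \<kappa> ` (D \<inter> X)) x \<partial>lborel)"
proof -
  have g: "smooth_atlas A" using assms(1) by (auto simp: riemannian_manifold_def)
  note c = chart_props[OF g assms(2)]
  let ?i = "\<lambda>x. if x \<in> snd \<kappa> ` fst \<kappa> then chart_inv \<kappa> x else undefined"
  note [measurable] = chart_inv_measurable[OF g assms(2)] chart_density_measurable[OF assms(1-4)] assms(5)
  have "emeasure (chart_measure g \<kappa> D) X = emeasure (density lborel (\<lambda>x. ennreal (vol_density g \<kappa> x) * indicator (snd \<kappa> ` D) x)) (?i -` X)"
    unfolding chart_measure_def by (subst emeasure_distr) auto
  also have "\<dots> = (\<integral>\<^sup>+x. ennreal (vol_density g \<kappa> x) * indicator (snd \<kappa> ` D) x * indicator (?i -` X) x \<partial>lborel)"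
    by (rule emeasure_density) (use measurable_sets[OF chart_inv_measurable[OF g assms(2)] assms(5)] in auto)
  also have "\<dots> = (\<integral>\<^sup>+x. ennreal (vol_density g \<kappa> x) * indicator (snd \<kappa> ` (D \<inter> X)) x \<partial>lborel)"
  proof (rule nn_integral_cong)
    fix x
    have i: "?i (snd \<kappa> d) = d" if "d \<in> D" for d
      using that assms(4) c(3) by auto
    have "x \<in> snd \<kappa> ` D \<and> ?i x \<in> X \<longleftrightarrow> x \<in> snd \<kappa> ` (D \<inter> X)"
    proof
      assume "x \<in> snd \<kappa> ` D \<and> ?i x \<in> X"
      then obtain d where "d \<in> D" "x = snd \<kappa> d" "?i x \<in> X" by blast
      then show "x \<in> snd \<kappa> ` (D \<inter> X)" using i[of d] by auto
    next
      assume "x \<in> snd \<kappa> ` (D \<inter> X)"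
      then obtain d where "d \<in> D" "d \<in> X" "x = snd \<kappa> d" by blast
      then show "x \<in> snd \<kappa> ` D \<and> ?i x \<in> X" using i[of d] by auto
    qed
    then have eq: "x \<in> snd \<kappa> ` D \<and> x \<in> ?i -` X \<longleftrightarrow> x \<in> snd \<kappa> ` (D \<inter> X)" by (simp only: vimage_eq)
    show "ennreal (vol_density g \<kappa> x) * indicator (snd \<kappa> ` D) x * indicator (?i -` X) x
      = ennreal (vol_density g \<kappa> x) * indicator (snd \<kappa> ` (D \<inter> X)) x"
    proof (cases "x \<in> snd \<kappa> ` (D \<inter> X)")
      case True
      with eq have a: "x \<in> snd \<kappa> ` D" and b: "x \<in> ?i -` X" by blast+
      show ?thesis by (simp only: indicator_simps(1)[OF a] indicator_simps(1)[OF b] indicator_simps(1)[OF True] mult_1_right)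
    next
      case False
      with eq have "x \<notin> snd \<kappa> ` D \<or> x \<notin> ?i -` X" by blast
      then show ?thesis
      proof
        assume a: "x \<notin> snd \<kappa> ` D"
        show ?thesis by (simp only: indicator_simps(2)[OF a] indicator_simps(2)[OF False] mult_zero_right mult_zero_left)
      next
        assume a: "x \<notin> ?i -` X"
        show ?thesis by (simp only: indicator_simps(2)[OF a] indicator_simps(2)[OF False] mult_zero_right)
      qed
    qed
  qed
  finally show ?thesis .
qed

text \<open>Existence matters because \<open>riemannian_measure\<close> is a choice among the
  measures with the right chart densities. Countably many charts cover the manifold; their domains
  are made disjoint and the chart measures of the pieces are added. That the sum has the right
  density in every other chart is the substitution rule for the identity map between two
  charts.\<close>

lemma riemannian_measure_exists:
  fixes A :: "('m::{t2_space, second_countable_topology}, 'a::finite) chart set"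
  assumes A: "riemannian_manifold A g"
  shows "\<exists>\<nu>. is_riemannian_measure A g \<nu>"
proof -
  have g: "smooth_atlas A" "riemannian_metric A g"
    using A by (auto simp: riemannian_manifold_def)
  have opn: "S \<in> fst ` A \<Longrightarrow> open S" for S using chart_props(1)[OF g(1)] by blast
  obtain F where F: "F \<subseteq> fst ` A" "countable F" "\<Union>F = \<Union>(fst ` A)"
    using Lindelof[of "fst ` A"] opn by metis
  have cover: "\<Union>F = UNIV" using F(3) g(1) unfolding smooth_atlas_def by simp
  then have "F \<noteq> {}" by auto
  then have rng: "range (from_nat_into F) = F" using F(2) by (rule range_from_nat_into)
  then have "\<forall>i. \<exists>\<kappa>\<in>A. fst \<kappa> = from_nat_into F i"
    using F(1) by (metis (no_types, lifting) imageE rangeI subsetD)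
  then obtain K where K: "\<And>i. K i \<in> A" "\<And>i. fst (K i) = from_nat_into F i" by metis
  have UK: "(\<Union>i. fst (K i)) = UNIV" using K(2) rng cover by auto
  define D where "D i = disjointed (\<lambda>i. fst (K i)) i" for i
  have Dsub: "D i \<subseteq> fst (K i)" for i unfolding D_def by (rule disjointed_subset)
  have UD: "(\<Union>i. D i) = UNIV" unfolding D_def UN_disjointed_eq UK ..
  have disj: "disjoint_family D" unfolding D_def by (rule disjoint_family_disjointed)
  have Ds: "D i \<in> sets borel" for i
    unfolding D_def disjointed_def using chart_props(1)[OF g(1) K(1)] by (intro sets.Diff sets.finite_UN) auto
  define \<mu> where "\<mu> X = (\<Sum>i. emeasure (chart_measure g (K i) (D i)) X)" for X
  define \<nu> where "\<nu> = measure_of (UNIV::'m set) (sets borel) \<mu>"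
  have ss: "sigma_sets (UNIV::'m set) (sets borel) = sets borel"
    using sets.sigma_sets_eq[of borel] by simp
  have sets: "sets \<nu> = sets borel" unfolding \<nu>_def by (simp add: sets_measure_of_conv ss)
  have scm: "sets (chart_measure g (K i) (D i)) = sets borel" for i by (simp add: chart_measure_def)
  have em: "emeasure \<nu> X = \<mu> X" if X: "X \<in> sets borel" for X
    unfolding \<nu>_def
  proof (rule emeasure_measure_of_sigma[OF _ _ _ X])
    show "sigma_algebra (UNIV::'m set) (sets borel)"
      using sets.sigma_algebra_axioms[of borel] by simp
    show "positive (sets borel) \<mu>" by (simp add: positive_def \<mu>_def)
    show "countably_additive (sets borel) \<mu>"
    proof (rule countably_additiveI)
      fix Y :: "nat \<Rightarrow> 'm set" assume Y: "range Y \<subseteq> sets borel" "disjoint_family Y"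
      \<comment> \<open>The sum over the pieces is read as an integral over the counting measure,
        which permits the exchange of the two infinite sums.\<close>
      have "(\<Sum>n. \<mu> (Y n)) = (\<Sum>n. \<integral>\<^sup>+i. emeasure (chart_measure g (K i) (D i)) (Y n) \<partial>count_space UNIV)"
        by (simp add: \<mu>_def nn_integral_count_space_nat)
      also have "\<dots> = (\<integral>\<^sup>+i. (\<Sum>n. emeasure (chart_measure g (K i) (D i)) (Y n)) \<partial>count_space UNIV)"
        by (rule nn_integral_suminf[symmetric]) simp
      also have "\<dots> = (\<integral>\<^sup>+i. emeasure (chart_measure g (K i) (D i)) (\<Union>n. Y n) \<partial>count_space UNIV)"
        using Y scm by (intro nn_integral_cong suminf_emeasure) auto
      also have "\<dots> = \<mu> (\<Union>n. Y n)" by (simp add: \<mu>_def nn_integral_count_space_nat)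
      finally show "(\<Sum>n. \<mu> (Y n)) = \<mu> (\<Union>n. Y n)" .
    qed
  qed
  have "is_riemannian_measure A g \<nu>"
    unfolding is_riemannian_measure_def
  proof (intro conjI ballI impI)
    fix \<kappa> X assume k: "\<kappa> \<in> A" and X: "X \<in> sets borel" "X \<subseteq> fst \<kappa>"
    let ?\<rho> = "vol_density g \<kappa>"
    have piece: "emeasure (chart_measure g (K i) (D i)) X = (\<integral>\<^sup>+x. ennreal (?\<rho> x) * indicator (snd \<kappa> ` (D i \<inter> X)) x \<partial>lborel)" for i
    proof -
      let ?Y = "D i \<inter> X"
      have Y: "?Y \<in> sets borel" "?Y \<subseteq> fst \<kappa>" "id ` ?Y \<subseteq> fst (K i)" "id ` ?Y \<in> sets borel" "inj_on id ?Y"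
        using Ds X Dsub by auto
      \<comment> \<open>The transformation law of a metric says precisely that the identity, seen in
        two charts, pulls \<open>g\<close> back to itself.\<close>
      have pb: "pullback_metric g \<kappa> (K i) id (chart_inv \<kappa> x) = g \<kappa> (chart_inv \<kappa> x)" if "x \<in> snd \<kappa> ` ?Y" for x
      proof -
        have "chart_inv \<kappa> x \<in> ?Y" using that Y(2) chart_props(3)[OF g(1) k] by (auto dest: subsetD)
        then have q: "chart_inv \<kappa> x \<in> fst \<kappa>" "chart_inv \<kappa> x \<in> fst (K i)" using Y(2) Dsub[of i] by auto
        show ?thesis
          unfolding pullback_metric_def using metric_props(4)[OF g(2) k q(1) K(1) q(2)] by simp
      qed
      have sub: "snd \<kappa> ` ?Y \<subseteq> snd \<kappa> ` fst \<kappa>" using X(2) by blast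
      have cont: "continuous_on (snd \<kappa> ` ?Y) (\<lambda>x. pullback_metric g \<kappa> (K i) id (chart_inv \<kappa> x))"
        by (rule continuous_on_eq[OF continuous_on_subset[OF smooth_on_continuous[OF metric_smooth[OF g(2) k]] sub]])
           (simp add: pb)
      have "emeasure (chart_measure g (K i) (D i)) X = (\<integral>\<^sup>+y. ennreal (sqrt (det (g (K i) (chart_inv (K i) y)))) * indicator (snd (K i) ` id ` ?Y) y \<partial>lborel)"
        using emeasure_chart_measure[OF A K(1) Ds Dsub X(1)] by (simp add: vol_density_def)
      also have "\<dots> = (\<integral>\<^sup>+x. ennreal (sqrt (det (pullback_metric g \<kappa> (K i) id (chart_inv \<kappa> x)))) * indicator (snd \<kappa> ` ?Y) x \<partial>lborel)"
        by (rule chart_change_of_variables[OF g(1) k A K(1) refl Y differentiable_map_id[OF g(1)] cont])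
      also have "\<dots> = (\<integral>\<^sup>+x. ennreal (?\<rho> x) * indicator (snd \<kappa> ` ?Y) x \<partial>lborel)"
        by (intro nn_integral_cong) (auto simp: indicator_def pb vol_density_def)
      finally show ?thesis .
    qed
    have "emeasure \<nu> X = (\<Sum>i. \<integral>\<^sup>+x. ennreal (?\<rho> x) * indicator (snd \<kappa> ` (D i \<inter> X)) x \<partial>lborel)"
      by (simp add: em[OF X(1)] \<mu>_def piece)
    also have "\<dots> = (\<integral>\<^sup>+x. (\<Sum>i. ennreal (?\<rho> x) * indicator (snd \<kappa> ` (D i \<inter> X)) x) \<partial>lborel)"
    proof (rule nn_integral_suminf[symmetric])
      fix i
      have "(\<lambda>x. ennreal (?\<rho> x) * indicator (snd \<kappa> ` (D i \<inter> X)) x) \<in> borel_measurable borel"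
        by (rule chart_density_measurable[OF A k]) (use Ds X in auto)
      then show "(\<lambda>x. ennreal (?\<rho> x) * indicator (snd \<kappa> ` (D i \<inter> X)) x) \<in> borel_measurable lborel" by simp
    qed
    also have "\<dots> = (\<integral>\<^sup>+x. ennreal (?\<rho> x) * indicator (snd \<kappa> ` X) x \<partial>lborel)"
    proof (rule nn_integral_cong)
      fix x
      have dj: "disjoint_family (\<lambda>i. snd \<kappa> ` (D i \<inter> X))"
        unfolding disjoint_family_on_def
      proof (intro ballI impI)
        fix i j :: nat assume "i \<noteq> j"
        then have "D i \<inter> D j = {}" using disj by (auto simp: disjoint_family_on_def)
        then show "snd \<kappa> ` (D i \<inter> X) \<inter> snd \<kappa> ` (D j \<inter> X) = {}"
          using inj_on_image_Int[OF chart_props(8)[OF g(1) k], of "D i \<inter> X" "D j \<inter> X"] X(2) by auto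
      qed
      have "(\<Sum>i. indicator (snd \<kappa> ` (D i \<inter> X)) x :: ennreal) = indicator (\<Union>i. snd \<kappa> ` (D i \<inter> X)) x"
        by (rule suminf_indicator[OF dj])
      also have "(\<Union>i. snd \<kappa> ` (D i \<inter> X)) = snd \<kappa> ` X" using UD by blast
      finally show "(\<Sum>i. ennreal (?\<rho> x) * indicator (snd \<kappa> ` (D i \<inter> X)) x) = ennreal (?\<rho> x) * indicator (snd \<kappa> ` X) x"
        by (simp only: ennreal_suminf_cmult)
    qed
    finally show "emeasure \<nu> X = (\<integral>\<^sup>+x. ennreal (sqrt (det (g \<kappa> (chart_inv \<kappa> x)))) * indicator (snd \<kappa> ` X) x \<partial>lborel)"
      by (simp add: vol_density_def)
  qed (rule sets)
  then show ?thesis by blast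
qed

lemma riemannian_measure_spec:
  fixes A :: "('m::{t2_space, second_countable_topology}, 'a::finite) chart set"
  assumes "riemannian_manifold A g"
  shows "sets (riemannian_measure A g) = sets borel" "space (riemannian_measure A g) = UNIV"
    "\<kappa> \<in> A \<Longrightarrow> X \<in> sets borel \<Longrightarrow> X \<subseteq> fst \<kappa> \<Longrightarrow> emeasure (riemannian_measure A g) X = (\<integral>\<^sup>+ x. ennreal (vol_density g \<kappa> x) * indicator (snd \<kappa> ` X) x \<partial>lborel)"
proof -
  have *: "is_riemannian_measure A g (riemannian_measure A g)"
    unfolding riemannian_measure_def by (rule someI_ex[OF riemannian_measure_exists[OF assms]])
  then show s: "sets (riemannian_measure A g) = sets borel" by (simp add: is_riemannian_measure_def)
  from sets_eq_imp_space_eq[OF s] show "space (riemannian_measure A g) = UNIV" by simp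
  show "\<kappa> \<in> A \<Longrightarrow> X \<in> sets borel \<Longrightarrow> X \<subseteq> fst \<kappa> \<Longrightarrow> emeasure (riemannian_measure A g) X = (\<integral>\<^sup>+ x. ennreal (vol_density g \<kappa> x) * indicator (snd \<kappa> ` X) x \<partial>lborel)"
    using * by (simp add: is_riemannian_measure_def vol_density_def)
qed

text \<open>Restricted to \<open>X\<close>, the Riemannian measure agrees with the chart measure on
  all Borel sets; equality of measures carries over to integrals.\<close>

lemma nn_integral_riemannian_chart:
  fixes A :: "('m::{t2_space, second_countable_topology}, 'a::finite) chart set"
  assumes A: "riemannian_manifold A g" "\<kappa> \<in> A" and X: "X \<in> sets borel" "X \<subseteq> fst \<kappa>" and F: "F \<in> borel_measurable borel"
  shows "(\<integral>\<^sup>+p. F p * indicator X p \<partial>riemannian_measure A g)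
    = (\<integral>\<^sup>+x. ennreal (vol_density g \<kappa> x) * F (chart_inv \<kappa> x) * indicator (snd \<kappa> ` X) x \<partial>lborel)"
proof -
  have g: "smooth_atlas A" using A(1) by (auto simp: riemannian_manifold_def)
  let ?\<nu> = "riemannian_measure A g"
  note spec = riemannian_measure_spec[OF A(1)]
  note [measurable_cong] = spec(1)
  note [measurable] = X(1) F chart_inv_measurable[OF g A(2)] chart_density_measurable[OF A X]
  have "density ?\<nu> (indicator X) = chart_measure g \<kappa> X"
  proof (rule measure_eqI)
    fix Y assume "Y \<in> sets (density ?\<nu> (indicator X))"
    then have Y: "Y \<in> sets borel" by (simp add: spec)
    then have "emeasure (density ?\<nu> (indicator X)) Y = emeasure ?\<nu> (X \<inter> Y)"
      using X(1) by (subst emeasure_density) (auto simp: spec indicator_inter_arith[symmetric])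
    also have "\<dots> = emeasure (chart_measure g \<kappa> X) Y"
      using X Y by (subst spec(3)[OF A(2)]) (auto simp: emeasure_chart_measure[OF A X Y])
    finally show "emeasure (density ?\<nu> (indicator X)) Y = emeasure (chart_measure g \<kappa> X) Y" .
  qed (simp add: chart_measure_def spec)
  then have "(\<integral>\<^sup>+p. F p \<partial>density ?\<nu> (indicator X)) = (\<integral>\<^sup>+p. F p \<partial>chart_measure g \<kappa> X)" by simp
  moreover have "(\<integral>\<^sup>+p. F p \<partial>density ?\<nu> (indicator X)) = (\<integral>\<^sup>+p. F p * indicator X p \<partial>?\<nu>)"
    by (subst nn_integral_density) (auto simp: mult.commute)
  moreover have "(\<integral>\<^sup>+p. F p \<partial>chart_measure g \<kappa> X) = (\<integral>\<^sup>+x. ennreal (vol_density g \<kappa> x) * indicator (snd \<kappa> ` X) x * F (if x \<in> snd \<kappa> ` fst \<kappa> then chart_inv \<kappa> x else undefined) \<partial>lborel)"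
    unfolding chart_measure_def by (subst nn_integral_distr, simp, simp, subst nn_integral_density) auto
  moreover have "\<dots> = (\<integral>\<^sup>+x. ennreal (vol_density g \<kappa> x) * F (chart_inv \<kappa> x) * indicator (snd \<kappa> ` X) x \<partial>lborel)"
    using X(2) by (intro nn_integral_cong) (auto simp: indicator_def)
  ultimately show ?thesis by simp
qed

text \<open>The density is bounded on a small closed coordinate ball, so each point has a
  neighbourhood of finite volume, and finitely many of these cover the manifold.\<close>

lemma riemannian_measure_finite:
  fixes A :: "('m::{t2_space, second_countable_topology}, 'a::finite) chart set"
  assumes A: "riemannian_manifold A g" and comp: "compact (UNIV :: 'm set)"
  shows "finite_measure (riemannian_measure A g)"
proof
  have g: "smooth_atlas A" using A(1) by (auto simp: riemannian_manifold_def)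
  let ?\<nu> = "riemannian_measure A g"
  note spec = riemannian_measure_spec[OF A(1)]
  have "\<exists>V. open V \<and> p \<in> V \<and> emeasure ?\<nu> V < \<infinity>" for p
  proof -
    define \<kappa> where "\<kappa> = chart_at A p"
    have k: "\<kappa> \<in> A" "p \<in> fst \<kappa>" using chart_at_props[OF g] by (auto simp: \<kappa>_def)
    note c = chart_props[OF g k(1)]
    obtain r where r: "r > 0" "cball (snd \<kappa> p) r \<subseteq> snd \<kappa> ` fst \<kappa>"
      using c(2) k(2) open_contains_cball by blast
    have "compact (vol_density g \<kappa> ` cball (snd \<kappa> p) r)"
      by (intro compact_continuous_image continuous_on_subset[OF vol_density_continuous[OF A k(1)] r(2)]) simp
    then obtain C where C: "\<And>x. x \<in> cball (snd \<kappa> p) r \<Longrightarrow> vol_density g \<kappa> x \<le> C"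
      by (meson bounded_imp_bdd_above compact_imp_bounded bdd_above.unfold imageI)
    define V where "V = fst \<kappa> \<inter> snd \<kappa> -` ball (snd \<kappa> p) r"
    have V: "open V" unfolding V_def by (rule continuous_open_preimage[OF c(6) c(1) open_ball])
    have Vb: "snd \<kappa> ` V \<subseteq> cball (snd \<kappa> p) r" by (auto simp: V_def)
    have "emeasure ?\<nu> V = (\<integral>\<^sup>+ x. ennreal (vol_density g \<kappa> x) * indicator (snd \<kappa> ` V) x \<partial>lborel)"
      by (rule spec(3)[OF k(1)]) (use V in \<open>auto simp: V_def\<close>)
    also have "\<dots> \<le> (\<integral>\<^sup>+ x. ennreal C * indicator (cball (snd \<kappa> p) r) x \<partial>lborel)"
      using Vb C by (intro nn_integral_mono) (auto simp: indicator_def intro!: ennreal_leI dest: subsetD)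
    also have "\<dots> = ennreal C * emeasure lborel (cball (snd \<kappa> p) r)"
      by (simp add: nn_integral_cmult_indicator)
    also have "\<dots> < \<infinity>" using emeasure_bounded_finite[OF bounded_cball, of "snd \<kappa> p" r]
      by (simp add: ennreal_mult_less_top)
    finally show ?thesis using V k(2) r(1) by (intro exI[of _ V]) (auto simp: V_def)
  qed
  then obtain V where V: "\<And>p. open (V p)" "\<And>p. p \<in> V p" "\<And>p. emeasure ?\<nu> (V p) < \<infinity>" by metis
  have "(UNIV :: 'm set) \<subseteq> (\<Union>p\<in>UNIV. V p)" using V(2) by blast
  then obtain P where P: "finite P" "(UNIV :: 'm set) \<subseteq> (\<Union>p\<in>P. V p)"
    by (rule compactE_image[OF comp V(1)])
  have "emeasure ?\<nu> (space ?\<nu>) \<le> emeasure ?\<nu> (\<Union>p\<in>P. V p)"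
    using P V(1) by (intro emeasure_mono) (auto simp: spec)
  also have "\<dots> \<le> (\<Sum>p\<in>P. emeasure ?\<nu> (V p))"
    using P V(1) by (intro emeasure_subadditive_finite) (auto simp: spec)
  also have "\<dots> < \<infinity>" using P V(3) by (simp add: less_top)
  finally show "emeasure ?\<nu> (space ?\<nu>) \<noteq> \<infinity>" by simp
qed

text \<open>Area formula for an injective piece: in coordinates sqrt (det P) = sqrt (det G) sqrt
  (det (G^-1 P)), the volume density of \<open>g\<close> times the Jacobian.\<close>

lemma volume_image:
  fixes A :: "('m::{t2_space, second_countable_topology}, 'a::finite) chart set"
    and B :: "('n::{t2_space, second_countable_topology}, 'b::finite) chart set"
  assumes A: "riemannian_manifold A g" "\<kappa> \<in> A" and B: "riemannian_manifold B h" "\<kappa>' \<in> B" and card: "CARD('a) = CARD('b)"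
    and X: "X \<in> sets borel" "X \<subseteq> fst \<kappa>" "f ` X \<subseteq> fst \<kappa>'" "f ` X \<in> sets borel" "inj_on f X"
    and f: "differentiable_map A B f"
    and cont: "continuous_on (snd \<kappa> ` X) (\<lambda>x. pullback_metric h \<kappa> \<kappa>' f (chart_inv \<kappa> x))"
    and meas: "(\<lambda>p. det (map_op A g B h f p)) \<in> borel_measurable borel"
  shows "emeasure (riemannian_measure B h) (f ` X)
    = (\<integral>\<^sup>+p. ennreal (sqrt (det (map_op A g B h f p))) * indicator X p \<partial>riemannian_measure A g)"
proof -
  have g: "smooth_atlas A" "riemannian_metric A g" and h: "smooth_atlas B" "riemannian_metric B h"
    using A(1) B(1) by (auto simp: riemannian_manifold_def)
  have "emeasure (riemannian_measure B h) (f ` X) = (\<integral>\<^sup>+x. ennreal (sqrt (det (pullback_metric h \<kappa> \<kappa>' f (chart_inv \<kappa> x)))) * indicator (snd \<kappa> ` X) x \<partial>lborel)"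
    using riemannian_measure_spec(3)[OF B(1,2) X(4,3)] chart_change_of_variables[OF g(1) A(2) B card X f cont]
    by (simp add: vol_density_def)
  also have "\<dots> = (\<integral>\<^sup>+x. ennreal (vol_density g \<kappa> x) * ennreal (sqrt (det (map_op A g B h f (chart_inv \<kappa> x)))) * indicator (snd \<kappa> ` X) x \<partial>lborel)"
  proof (rule nn_integral_cong)
    fix x
    show "ennreal (sqrt (det (pullback_metric h \<kappa> \<kappa>' f (chart_inv \<kappa> x)))) * indicator (snd \<kappa> ` X) x
      = ennreal (vol_density g \<kappa> x) * ennreal (sqrt (det (map_op A g B h f (chart_inv \<kappa> x)))) * indicator (snd \<kappa> ` X) x"
    proof (cases "x \<in> snd \<kappa> ` X")
      case True
      then have p: "chart_inv \<kappa> x \<in> X" using X(2) chart_props(3)[OF g(1) A(2)] by (auto dest: subsetD)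
      then have p': "chart_inv \<kappa> x \<in> fst \<kappa>" "f (chart_inv \<kappa> x) \<in> fst \<kappa>'" using X by auto
      let ?G = "g \<kappa> (chart_inv \<kappa> x)" and ?P = "pullback_metric h \<kappa> \<kappa>' f (chart_inv \<kappa> x)"
      have G: "det ?G > 0" by (rule metric_props(3)[OF g(2) A(2) p'(1)])
      have "det (matrix_inv ?G) * det ?G = 1" using matrix_inv_cancel(2)[of ?G] G by (metis det_I det_mul less_irrefl)
      moreover have "det (map_op A g B h f (chart_inv \<kappa> x)) = det (matrix_inv ?G) * det ?P"
        using map_op_chart[where I=det, OF A p'(1) B p'(2) f conj_invariant_basic(2)] by (simp add: pullback_op_def det_mul)
      ultimately have "det ?G * det (map_op A g B h f (chart_inv \<kappa> x)) = det ?P" by (metis mult.assoc mult.commute mult_1)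
      then have "sqrt (det ?P) = vol_density g \<kappa> x * sqrt (det (map_op A g B h f (chart_inv \<kappa> x)))"
        by (simp add: vol_density_def flip: real_sqrt_mult)
      moreover have "vol_density g \<kappa> x \<ge> 0" using G by (simp add: vol_density_def)
      ultimately show ?thesis by (simp add: ennreal_mult')
    qed simp
  qed
  also have "\<dots> = (\<integral>\<^sup>+p. ennreal (sqrt (det (map_op A g B h f p))) * indicator X p \<partial>riemannian_measure A g)"
    by (rule nn_integral_riemannian_chart[OF A X(1,2), symmetric]) (use meas in measurable)
  finally show ?thesis .
qed

section \<open>Differentiation under the integral\<close>

text \<open>The derivative in the parameter with the point held fixed. No chart of the manifold
  enters, so it can be iterated and integrated globally.\<close>

definition dir_deriv :: "('t::real_normed_vector \<Rightarrow> 'm \<Rightarrow> real) \<Rightarrow> 't \<Rightarrow> 't \<Rightarrow> 'm \<Rightarrow> real" where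
  "dir_deriv F b \<tau> p = frechet_derivative (\<lambda>t. F t p) (at \<tau>) b"

lemma smooth_functions_slice:
  assumes A: "smooth_atlas A" and F: "smooth_functions T A F" and k: "\<kappa> \<in> A" "p \<in> fst \<kappa>" and \<tau>: "\<tau> \<in> T"
  shows "((\<lambda>t. F t p) has_derivative (\<lambda>v. frechet_derivative (\<lambda>(t, x). F t (chart_inv \<kappa> x)) (at (\<tau>, snd \<kappa> p)) (v, 0))) (at \<tau>)"
proof -
  have "smooth_on (T \<times> snd \<kappa> ` fst \<kappa>) (\<lambda>(t, x). F t (chart_inv \<kappa> x))"
    using F k unfolding smooth_functions_def by blast
  from smooth_on_has_derivative[OF this, of "(\<tau>, snd \<kappa> p)"]
  have "((\<lambda>(t, x). F t (chart_inv \<kappa> x)) has_derivative frechet_derivative (\<lambda>(t, x). F t (chart_inv \<kappa> x)) (at (\<tau>, snd \<kappa> p))) (at (\<tau>, snd \<kappa> p))"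
    using k \<tau> by simp
  moreover have "((\<lambda>t. (t, snd \<kappa> p)) has_derivative (\<lambda>v. (v, 0))) (at \<tau>)"
    by (auto intro!: derivative_eq_intros)
  ultimately have "((\<lambda>t. (\<lambda>(t, x). F t (chart_inv \<kappa> x)) (t, snd \<kappa> p)) has_derivative (\<lambda>v. frechet_derivative (\<lambda>(t, x). F t (chart_inv \<kappa> x)) (at (\<tau>, snd \<kappa> p)) (v, 0))) (at \<tau>)"
    by (rule has_derivative_compose[rotated])
  then show ?thesis by (simp add: chart_props(3)[OF A k])
qed

lemma smooth_functions_has_derivative:
  assumes A: "smooth_atlas A" and F: "smooth_functions T A F" and \<tau>: "\<tau> \<in> T"
  shows "((\<lambda>t. F t p) has_derivative (\<lambda>v. dir_deriv F v \<tau> p)) (at \<tau>)"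
proof -
  note d = smooth_functions_slice[OF A F chart_at_props[OF A, of p] \<tau>]
  show ?thesis unfolding dir_deriv_def frechet_derivative_eqI[OF d] by (rule d)
qed

text \<open>In a chart this is the derivative of a jointly smooth function in the direction (b, 0).
  Closure under \<open>dir_deriv\<close> is what allows second variations to be formed.\<close>

lemma smooth_functions_dir_deriv:
  assumes A: "smooth_atlas A" and T: "open T" and F: "smooth_functions T A F"
  shows "smooth_functions T A (dir_deriv F b)"
  unfolding smooth_functions_def
proof
  fix \<kappa> assume k: "\<kappa> \<in> A"
  note c = chart_props[OF A k]
  have op: "open (T \<times> snd \<kappa> ` fst \<kappa>)" using T c(2) by (rule open_Times)
  have "smooth_on (T \<times> snd \<kappa> ` fst \<kappa>) (\<lambda>(t, x). F t (chart_inv \<kappa> x))"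
    using F k unfolding smooth_functions_def by blast
  from smooth_on_frechet[OF this, of "(b, 0)"]
  show "smooth_on (T \<times> snd \<kappa> ` fst \<kappa>) (\<lambda>(t, x). dir_deriv F b t (chart_inv \<kappa> x))"
  proof (rule smooth_on_cong[OF op, rotated])
    fix z assume "z \<in> T \<times> snd \<kappa> ` fst \<kappa>"
    then obtain t x where z: "z = (t, x)" "t \<in> T" "x \<in> snd \<kappa> ` fst \<kappa>" by auto
    show "frechet_derivative (\<lambda>(t, x). F t (chart_inv \<kappa> x)) (at z) (b, 0) = (case z of (t, x) \<Rightarrow> dir_deriv F b t (chart_inv \<kappa> x))"
      using frechet_derivative_eqI[OF smooth_functions_slice[OF A F k c(5)[OF z(3)] z(2)]]
      by (simp add: z(1) dir_deriv_def c(4)[OF z(3)])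
  qed
qed

lemma smooth_functions_continuous:
  assumes A: "smooth_atlas A" and T: "open T" and F: "smooth_functions T A F"
  shows "continuous_on (T \<times> UNIV) (\<lambda>(t, p). F t p)"
proof -
  have "continuous_on (T \<times> fst \<kappa>) (\<lambda>(t, p). F t p)" if k: "\<kappa> \<in> A" for \<kappa>
  proof -
    note c = chart_props[OF A k]
    have 1: "continuous_on (T \<times> snd \<kappa> ` fst \<kappa>) (\<lambda>(t, x). F t (chart_inv \<kappa> x))"
      using F k unfolding smooth_functions_def by (intro smooth_on_continuous) blast
    have "continuous_on (T \<times> fst \<kappa>) (\<lambda>z. snd \<kappa> (snd z))"
      by (rule continuous_on_compose2[OF c(6) continuous_on_snd[OF continuous_on_id]]) auto
    then have 2: "continuous_on (T \<times> fst \<kappa>) (\<lambda>z. (fst z, snd \<kappa> (snd z)))"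
      by (intro continuous_on_Pair continuous_on_fst continuous_on_id)
    have "continuous_on (T \<times> fst \<kappa>) (\<lambda>z. (\<lambda>(t, x). F t (chart_inv \<kappa> x)) (fst z, snd \<kappa> (snd z)))"
      by (rule continuous_on_compose2[OF 1 2]) auto
    then show ?thesis by (rule continuous_on_eq) (auto simp: c(3))
  qed
  then have "continuous_on (\<Union>\<kappa>\<in>A. T \<times> fst \<kappa>) (\<lambda>(t, p). F t p)"
    using T chart_props(1)[OF A] by (intro continuous_on_open_UN open_Times)
  moreover have "(\<Union>\<kappa>\<in>A. T \<times> fst \<kappa>) = T \<times> UNIV"
    using A unfolding smooth_atlas_def by auto
  ultimately show ?thesis by simp
qed

lemma smooth_functions_slice_continuous:
  assumes A: "smooth_atlas A" and T: "open T" and F: "smooth_functions T A F" and \<tau>: "\<tau> \<in> T"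
  shows "continuous_on UNIV (F \<tau>)"
proof -
  have "continuous_on UNIV (\<lambda>p. (\<tau>, p))" by (intro continuous_intros)
  from continuous_on_compose2[OF smooth_functions_continuous[OF A T F] this] \<tau>
  show ?thesis by auto
qed

lemma continuous_integrable_compact:
  fixes f :: "'m::topological_space \<Rightarrow> real"
  assumes "finite_measure \<nu>" "sets \<nu> = sets borel" "compact (UNIV :: 'm set)" "continuous_on UNIV f"
  shows "integrable \<nu> f"
proof -
  interpret finite_measure \<nu> by fact
  have "compact (range f)" by (rule compact_continuous_image[OF assms(4,3)])
  then obtain C where "\<And>p. norm (f p) \<le> C"
    using compact_imp_bounded[of "range f"] unfolding bounded_iff by blast
  moreover have "f \<in> borel_measurable \<nu>"
    using borel_measurable_continuous_onI[OF assms(4)] measurable_cong_sets[OF assms(2) refl] by blast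
  ultimately show ?thesis by (intro integrable_const_bound[of _ C]) auto
qed

text \<open>Dominated convergence: on a closed ball of parameters times the compact manifold the
  derivative is bounded by a constant, which by the mean value theorem also bounds the difference
  quotients and is integrable for a finite measure.\<close>

lemma integral_dir_deriv:
  fixes A :: "('m::{t2_space, second_countable_topology}, 'a::finite) chart set" and T :: "'t::euclidean_space set"
  assumes A: "smooth_atlas A" and T: "open T" and F: "smooth_functions T A F" and \<tau>: "\<tau> \<in> T"
    and \<nu>: "finite_measure \<nu>" "sets \<nu> = sets borel" and comp: "compact (UNIV :: 'm set)"
  shows "((\<lambda>r. \<integral>p. F (\<tau> + r *\<^sub>R b) p \<partial>\<nu>) has_real_derivative (\<integral>p. dir_deriv F b \<tau> p \<partial>\<nu>)) (at 0)"
proof -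
  interpret finite_measure \<nu> by fact
  note F' = smooth_functions_dir_deriv[OF A T F, of b]
  have int: "integrable \<nu> (F \<sigma>)" "integrable \<nu> (dir_deriv F b \<sigma>)" if "\<sigma> \<in> T" for \<sigma>
    using continuous_integrable_compact[OF \<nu> comp] smooth_functions_slice_continuous[OF A T F that]
      smooth_functions_slice_continuous[OF A T F' that] by auto
  obtain \<rho> where \<rho>: "\<rho> > 0" "cball \<tau> \<rho> \<subseteq> T" using T \<tau> open_contains_cball by blast
  have "compact ((\<lambda>(t, p). dir_deriv F b t p) ` (cball \<tau> \<rho> \<times> UNIV))"
    by (intro compact_continuous_image compact_Times compact_cball comp
        continuous_on_subset[OF smooth_functions_continuous[OF A T F']]) (use \<rho> in auto)
  then obtain C where "\<forall>y \<in> (\<lambda>(t, p). dir_deriv F b t p) ` (cball \<tau> \<rho> \<times> UNIV). norm y \<le> C"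
    using compact_imp_bounded[of "(\<lambda>(t, p). dir_deriv F b t p) ` (cball \<tau> \<rho> \<times> UNIV)"] unfolding bounded_iff by meson
  then have C: "\<bar>dir_deriv F b \<sigma> p\<bar> \<le> C" if "\<sigma> \<in> cball \<tau> \<rho>" for \<sigma> p using that by force
  \<comment> \<open>For |r| < \<delta> the point \<open>\<tau> + r *\<^sub>R b\<close> stays in the
    closed ball of radius \<open>\<rho>\<close>; the summand 1 covers b = 0.\<close>
  define \<delta> where "\<delta> = \<rho> / (1 + norm b)"
  have nb: "1 + norm b > 0" by (simp add: add_pos_nonneg)
  have \<delta>: "\<delta> > 0" using \<rho> nb by (simp add: \<delta>_def)
  have near: "\<tau> + r *\<^sub>R b \<in> cball \<tau> \<rho>" if "\<bar>r\<bar> < \<delta>" for r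
  proof -
    have "\<bar>r\<bar> * norm b \<le> \<delta> * (1 + norm b)" using that \<delta> by (intro mult_mono) auto
    also have "\<dots> = \<rho>" using nb by (simp add: \<delta>_def)
    finally show ?thesis by (simp add: dist_norm)
  qed
  have line: "((\<lambda>r. F (\<tau> + r *\<^sub>R b) p) has_real_derivative dir_deriv F b (\<tau> + r *\<^sub>R b) p) (at r)" if "\<bar>r\<bar> < \<delta>" for r p
  proof -
    have t: "\<tau> + r *\<^sub>R b \<in> T" using near[OF that] \<rho>(2) by blast
    note d = smooth_functions_has_derivative[OF A F t, of p]
    have "((\<lambda>r. \<tau> + r *\<^sub>R b) has_derivative (\<lambda>s. s *\<^sub>R b)) (at r)" by (auto intro!: derivative_eq_intros)
    from has_derivative_compose[OF this d]
    have "((\<lambda>r. F (\<tau> + r *\<^sub>R b) p) has_derivative (\<lambda>s. dir_deriv F (s *\<^sub>R b) (\<tau> + r *\<^sub>R b) p)) (at r)" .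
    moreover have "(\<lambda>s. dir_deriv F (s *\<^sub>R b) (\<tau> + r *\<^sub>R b) p) = (*) (dir_deriv F b (\<tau> + r *\<^sub>R b) p)"
      using linear_scale[OF has_derivative_linear[OF d]] by auto
    ultimately show ?thesis by (simp add: has_field_derivative_def)
  qed
  define q where "q r p = (F (\<tau> + r *\<^sub>R b) p - F \<tau> p) / r" for r p
  have qb: "\<bar>q r p\<bar> \<le> C" if r: "\<bar>r\<bar> < \<delta>" "r \<noteq> 0" for r p
  proof -
    have "norm (F (\<tau> + r *\<^sub>R b) p - F (\<tau> + 0 *\<^sub>R b) p) \<le> C * norm (r - 0)"
    proof (rule field_differentiable_bound[where S="{-\<delta><..<\<delta>}" and f'="\<lambda>r. dir_deriv F b (\<tau> + r *\<^sub>R b) p"])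
      show "((\<lambda>r. F (\<tau> + r *\<^sub>R b) p) has_real_derivative dir_deriv F b (\<tau> + z *\<^sub>R b) p) (at z within {-\<delta><..<\<delta>})"
        if "z \<in> {-\<delta><..<\<delta>}" for z
      proof -
        from that have "\<bar>z\<bar> < \<delta>" by auto
        from line[OF this] show ?thesis by (rule has_field_derivative_at_within)
      qed
      show "norm (dir_deriv F b (\<tau> + z *\<^sub>R b) p) \<le> C" if "z \<in> {-\<delta><..<\<delta>}" for z
      proof -
        from that have "\<bar>z\<bar> < \<delta>" by auto
        from C[OF near[OF this]] show ?thesis by simp
      qed
      show "r \<in> {-\<delta><..<\<delta>}" using r(1) by auto
    qed (use \<delta> in auto)
    then show ?thesis using r by (simp add: q_def divide_le_eq)
  qed
  have "((\<lambda>r. ((\<integral>p. F (\<tau> + r *\<^sub>R b) p \<partial>\<nu>) - (\<integral>p. F (\<tau> + 0 *\<^sub>R b) p \<partial>\<nu>)) / (r - 0)) \<longlongrightarrow> (\<integral>p. dir_deriv F b \<tau> p \<partial>\<nu>)) (at 0)"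
    unfolding tendsto_at_iff_sequentially
  proof (intro allI impI)
    fix X :: "nat \<Rightarrow> real" assume X: "\<forall>i. X i \<in> UNIV - {0}" "X \<longlonglongrightarrow> 0"
    obtain N where N: "\<And>n. n \<ge> N \<Longrightarrow> \<bar>X n\<bar> < \<delta>"
      using LIMSEQ_D[OF X(2) \<delta>] by auto
    \<comment> \<open>The quotients are bounded for |r| < \<delta>, so the first \<open>N\<close>
      terms of the sequence are dropped.\<close>
    define Y where "Y n = X (n + N)" for n
    have Y: "\<bar>Y n\<bar> < \<delta>" "Y n \<noteq> 0" for n using N[of "n + N"] X(1) by (auto simp: Y_def)
    have Y0: "Y \<longlonglongrightarrow> 0" unfolding Y_def by (rule LIMSEQ_ignore_initial_segment[OF X(2)])
    have YT: "\<tau> + Y n *\<^sub>R b \<in> T" for n using near[OF Y(1)] \<rho>(2) by blast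
    have "(\<lambda>n. \<integral>p. q (Y n) p \<partial>\<nu>) \<longlonglongrightarrow> (\<integral>p. dir_deriv F b \<tau> p \<partial>\<nu>)"
    proof (rule integral_dominated_convergence[where w="\<lambda>_. C"])
      show "dir_deriv F b \<tau> \<in> borel_measurable \<nu>" using int(2)[OF \<tau>] by auto
      show "q (Y n) \<in> borel_measurable \<nu>" for n
        unfolding q_def using int(1)[OF YT] int(1)[OF \<tau>] by (intro borel_measurable_divide borel_measurable_diff) auto
      show "AE p in \<nu>. (\<lambda>n. q (Y n) p) \<longlonglongrightarrow> dir_deriv F b \<tau> p"
      proof (rule AE_I2)
        fix p
        have "((\<lambda>r. (F (\<tau> + r *\<^sub>R b) p - F (\<tau> + 0 *\<^sub>R b) p) / (r - 0)) \<longlongrightarrow> dir_deriv F b (\<tau> + 0 *\<^sub>R b) p) (at 0)"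
          using line[of 0 p] \<delta> unfolding has_field_derivative_iff by simp
        then have "((\<lambda>r. q r p) \<longlongrightarrow> dir_deriv F b \<tau> p) (at 0)" by (simp add: q_def)
        then show "(\<lambda>n. q (Y n) p) \<longlonglongrightarrow> dir_deriv F b \<tau> p"
          unfolding tendsto_at_iff_sequentially o_def using Y(2) Y0 by simp
      qed
    qed (use qb[OF Y] in auto)
    moreover have "(\<integral>p. q (Y n) p \<partial>\<nu>) = ((\<integral>p. F (\<tau> + Y n *\<^sub>R b) p \<partial>\<nu>) - (\<integral>p. F \<tau> p \<partial>\<nu>)) / Y n" for n
      unfolding q_def using int(1)[OF YT] int(1)[OF \<tau>] by simp
    ultimately have "(\<lambda>n. ((\<integral>p. F (\<tau> + X (n + N) *\<^sub>R b) p \<partial>\<nu>) - (\<integral>p. F \<tau> p \<partial>\<nu>)) / X (n + N)) \<longlonglongrightarrow> (\<integral>p. dir_deriv F b \<tau> p \<partial>\<nu>)"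
      by (simp add: Y_def)
    from LIMSEQ_offset[where k=N, OF this]
    show "((\<lambda>r. ((\<integral>p. F (\<tau> + r *\<^sub>R b) p \<partial>\<nu>) - (\<integral>p. F (\<tau> + 0 *\<^sub>R b) p \<partial>\<nu>)) / (r - 0)) \<circ> X) \<longlonglongrightarrow> (\<integral>p. dir_deriv F b \<tau> p \<partial>\<nu>)"
      by (simp add: o_def)
  qed
  then show ?thesis unfolding has_field_derivative_iff by simp
qed

section \<open>Local injectivity and openness of families\<close>

text \<open>Turns continuity of finitely many directional derivatives into continuity in operator
  norm, the form in which the local injectivity theorem asks for it.\<close>

lemma onorm_le_Basis:
  fixes f :: "'a::euclidean_space \<Rightarrow> 'b::real_normed_vector"
  assumes "linear f" shows "onorm f \<le> (\<Sum>b\<in>Basis. norm (f b))"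
proof (rule onorm_bound)
  fix v
  have "f v = (\<Sum>b\<in>Basis. (v \<bullet> b) *\<^sub>R f b)"
  proof -
    have "f (\<Sum>b\<in>Basis. (v \<bullet> b) *\<^sub>R b) = (\<Sum>b\<in>Basis. (v \<bullet> b) *\<^sub>R f b)"
      by (simp only: linear_sum[OF assms] linear_scale[OF assms])
    then show ?thesis by (simp only: euclidean_representation)
  qed
  then have "norm (f v) = norm (\<Sum>b\<in>Basis. (v \<bullet> b) *\<^sub>R f b)" by (rule arg_cong)
  also have "\<dots> \<le> (\<Sum>b\<in>Basis. \<bar>v \<bullet> b\<bar> * norm (f b))" by (simp add: sum_norm_le)
  also have "\<dots> \<le> (\<Sum>b\<in>Basis. norm v * norm (f b))"
    by (intro sum_mono mult_right_mono Basis_le_norm) auto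
  finally show "norm (f v) \<le> (\<Sum>b\<in>Basis. norm (f b)) * norm v" by (simp add: sum_distrib_left mult.commute)
qed (simp add: sum_nonneg)

text \<open>Finitely many product neighbourhoods cover the compact slice, and the least of their
  radii works for all. This supplies parameter radii that are uniform over \<open>K\<close>.\<close>

lemma tube:
  fixes W :: "('t::metric_space \<times> 'm::topological_space) set"
  assumes "open W" "compact K" "{\<tau>} \<times> K \<subseteq> W"
  shows "\<exists>r>0. ball \<tau> r \<times> K \<subseteq> W"
proof -
  have "\<exists>r V. r > 0 \<and> open V \<and> p \<in> V \<and> ball \<tau> r \<times> V \<subseteq> W" if "p \<in> K" for p
  proof -
    have "(\<tau>, p) \<in> W" using assms(3) that by blast
    obtain S V where SV: "open S" "open V" "(\<tau>, p) \<in> S \<times> V" "S \<times> V \<subseteq> W"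
      by (rule open_prod_elim[OF assms(1) \<open>(\<tau>, p) \<in> W\<close>])
    from SV(3) have "\<tau> \<in> S" by simp
    then obtain r where r: "r > 0" "ball \<tau> r \<subseteq> S"
      using SV(1) unfolding open_contains_ball by blast
    have "ball \<tau> r \<times> V \<subseteq> W" using r(2) SV(4) by blast
    then show ?thesis using r(1) SV by (intro exI[of _ r] exI[of _ V]) simp
  qed
  then obtain r V where rV: "\<And>p. p \<in> K \<Longrightarrow> r p > (0::real)" "\<And>p. p \<in> K \<Longrightarrow> open (V p)" "\<And>p. p \<in> K \<Longrightarrow> p \<in> V p"
    "\<And>p. p \<in> K \<Longrightarrow> ball \<tau> (r p) \<times> V p \<subseteq> W" by metis
  have cov: "K \<subseteq> (\<Union>p\<in>K. V p)" using rV(3) by blast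
  have "\<exists>P\<subseteq>K. finite P \<and> K \<subseteq> (\<Union>p\<in>P. V p)"
    by (rule compactE_image[OF assms(2) _ cov]) (use rV(2) in blast)+
  then obtain P where P: "P \<subseteq> K" "finite P" "K \<subseteq> (\<Union>p\<in>P. V p)" by blast
  \<comment> \<open>Inserting 1 keeps the minimum defined when \<open>P\<close> is empty.\<close>
  define R where "R = Min (insert 1 (r ` P))"
  have "R > 0" using P rV(1) by (auto simp: R_def subset_iff)
  moreover have "R \<le> r p" if "p \<in> P" for p using P(2) that by (simp add: R_def)
  then have "ball \<tau> R \<times> K \<subseteq> W"
  proof (clarify)
    fix t p assume *: "\<And>p. p \<in> P \<Longrightarrow> R \<le> r p" "t \<in> ball \<tau> R" "p \<in> K"
    then obtain p' where "p' \<in> P" "p \<in> V p'" using P(3) by blast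
    moreover have "t \<in> ball \<tau> (r p')" using *(1)[OF \<open>p' \<in> P\<close>] *(2) by simp
    moreover have "p' \<in> K" using P(1) \<open>p' \<in> P\<close> by blast
    ultimately show "(t, p) \<in> W" using rV(4)[of p'] by blast
  qed
  ultimately show ?thesis by blast
qed

text \<open>The graph map (t, x) \<mapsto> (t, u (t, x)) has a block triangular derivative, which is
  invertible as soon as the differential of the slice is. Applied to the graph map instead of a
  single slice, inverse function arguments become uniform in the parameter.\<close>

lemma family_graph_derivative:
  fixes A :: "('m::{t2_space, second_countable_topology}, 'a::finite) chart set"
    and B :: "('n::{t2_space, second_countable_topology}, 'b::finite) chart set" and T :: "'t::euclidean_space set"
  assumes A: "riemannian_manifold A g" "\<kappa> \<in> A" "p \<in> fst \<kappa>" and B: "riemannian_manifold B h" "\<kappa>' \<in> B" "\<Phi> \<tau> p \<in> fst \<kappa>'"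
    and card: "CARD('a) = CARD('b)"
    and T: "open T" "\<tau> \<in> T" and \<Phi>: "smooth_family T A B \<Phi>" and det: "det (map_op A g B h (\<Phi> \<tau>) p) \<noteq> 0"
  defines "u \<equiv> fam_expr \<kappa> \<kappa>' \<Phi>"
  shows "bij (\<lambda>v :: 't \<times> (real ^ 'a). (fst v, frechet_derivative u (at (\<tau>, snd \<kappa> p)) v) :: 't \<times> (real ^ 'b))"
    and "linear (\<lambda>v :: 't \<times> (real ^ 'a). (fst v, frechet_derivative u (at (\<tau>, snd \<kappa> p)) v) :: 't \<times> (real ^ 'b))"
proof -
  have g: "smooth_atlas A" "riemannian_metric A g" and h: "smooth_atlas B" "riemannian_metric B h"
    using A(1) B(1) by (auto simp: riemannian_manifold_def)
  note sm = smooth_family_props(2)[OF \<Phi> A(2) B(2)]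
  let ?f' = "\<lambda>v :: 't \<times> (real ^ 'a). (fst v, frechet_derivative u (at (\<tau>, snd \<kappa> p)) v) :: 't \<times> (real ^ 'b)"
  let ?D = "differential_matrix \<kappa> \<kappa>' (\<Phi> \<tau>) p"
  have inv: "chart_inv \<kappa> (snd \<kappa> p) = p" by (rule chart_props(3)[OF g(1) A(2,3)])
  have z: "(\<tau>, snd \<kappa> p) \<in> fam_dom T \<kappa> \<kappa>' \<Phi>" using A B T inv by (simp add: fam_dom_def)
  have lu: "linear (frechet_derivative u (at (\<tau>, snd \<kappa> p)))"
    unfolding u_def using has_derivative_linear[OF smooth_on_has_derivative[OF sm z]] .
  have slice: "((snd \<kappa>' \<circ> \<Phi> \<tau> \<circ> chart_inv \<kappa>) has_derivative (\<lambda>v. frechet_derivative u (at (\<tau>, snd \<kappa> p)) (0, v))) (at (snd \<kappa> p))"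
    unfolding u_def by (rule fam_slice_derivative[OF sm z])
  have D: "?D *v v = frechet_derivative u (at (\<tau>, snd \<kappa> p)) (0, v)" for v
    unfolding differential_matrix_eqI[OF slice]
    by (rule matrix_works[OF linear_matrix_vector_mul_eq[THEN iffD2, OF has_derivative_linear[OF slice]]])
  show lin: "linear ?f'"
    using lu by (intro linearI) (simp_all add: linear_add linear_scale)
  have "v = 0" if v: "?f' v = 0" for v
  proof -
    obtain s w where sw: "v = (s, w)" by fastforce
    have "s = 0" using v by (simp add: sw zero_prod_def)
    with v have Dw: "?D *v w = 0" by (simp add: sw D zero_prod_def)
    have "det (pullback_op g h \<kappa> \<kappa>' (\<Phi> \<tau>) p) \<noteq> 0"
      using det map_op_chart[where I=det, OF A B family_differentiable_map[OF g(1) \<Phi> T(2)] conj_invariant_basic(2)] by simp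
    moreover have "pullback_op g h \<kappa> \<kappa>' (\<Phi> \<tau>) p *v w = 0"
      by (simp add: pullback_op_def pullback_metric_def Dw flip: matrix_vector_mul_assoc)
    ultimately have "w = 0"
      using invertible_det_nz[of "pullback_op g h \<kappa> \<kappa>' (\<Phi> \<tau>) p"] matrix_left_invertible_ker unfolding invertible_def by blast
    with \<open>s = 0\<close> show ?thesis by (simp add: sw zero_prod_def)
  qed
  then have inj: "inj ?f'" using linear_injective_0[OF lin] by blast
  moreover have "surj ?f'"
  proof -
    have "dim (range ?f') = DIM('t \<times> (real ^ 'b))"
      using dim_image_eq[OF lin, of UNIV] inj card by (simp add: dim_UNIV)
    then have "span (range ?f') = UNIV" by (rule dim_eq_full[THEN iffD1])
    moreover have "span (range ?f') = range ?f'"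
      using linear_subspace_image[OF lin subspace_UNIV] by (simp add: span_eq_iff)
    ultimately show ?thesis by simp
  qed
  ultimately show "bij ?f'" by (simp add: bij_def)
qed

text \<open>A ball on which the graph map is injective contains a product of smaller balls; there,
  all slices with nearby parameters are injective on one and the same \<open>V\<close>.\<close>

lemma family_locally_injective:
  fixes A :: "('m::{t2_space, second_countable_topology}, 'a::finite) chart set"
    and B :: "('n::{t2_space, second_countable_topology}, 'b::finite) chart set" and T :: "'t::euclidean_space set"
  assumes A: "riemannian_manifold A g" "\<kappa> \<in> A" "p \<in> fst \<kappa>" and B: "riemannian_manifold B h" "\<kappa>' \<in> B" "\<Phi> \<tau> p \<in> fst \<kappa>'"
    and card: "CARD('a) = CARD('b)"
    and T: "open T" "\<tau> \<in> T" and \<Phi>: "smooth_family T A B \<Phi>" and det: "det (map_op A g B h (\<Phi> \<tau>) p) \<noteq> 0"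
  shows "\<exists>r>0. \<exists>V. open V \<and> p \<in> V \<and> V \<subseteq> fst \<kappa> \<and> ball \<tau> r \<subseteq> T \<and> (\<forall>t\<in>ball \<tau> r. \<Phi> t ` V \<subseteq> fst \<kappa>' \<and> inj_on (\<Phi> t) V)"
proof -
  have g: "smooth_atlas A" "riemannian_metric A g" and h: "smooth_atlas B" "riemannian_metric B h"
    using A(1) B(1) by (auto simp: riemannian_manifold_def)
  define u where "u = fam_expr \<kappa> \<kappa>' \<Phi>"
  define \<Omega> where "\<Omega> = fam_dom T \<kappa> \<kappa>' \<Phi>"
  define x where "x = snd \<kappa> p"
  note c = chart_props[OF g(1) A(2)]
  have sm: "smooth_on \<Omega> u" unfolding u_def \<Omega>_def by (rule smooth_family_props(2)[OF \<Phi> A(2) B(2)])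
  have op: "open \<Omega>" unfolding \<Omega>_def by (rule fam_dom_open[OF g(1) A(2) h(1) B(2) T(1) \<Phi>])
  have z: "(\<tau>, x) \<in> \<Omega>" using A B T c(3)[OF A(3)] by (simp add: \<Omega>_def fam_dom_def x_def)
  let ?f = "\<lambda>v. (fst v, u v)"
  let ?f' = "\<lambda>z v. (fst v, frechet_derivative u (at z) v)"
  note gd = family_graph_derivative[OF A B card T \<Phi> det, folded u_def x_def]
  have "linear (inv (?f' (\<tau>, x)))"
    using gd by (metis (no_types, lifting) bij_is_inj bij_is_surj linear_injective_left_inverse inv_o_cancel comp_assoc fun.map_id surj_iff comp_id id_comp o_assoc)
  then have blg: "bounded_linear (inv (?f' (\<tau>, x)))" by (simp add: linear_conv_bounded_linear)
  have der: "(?f has_derivative ?f' z) (at z)" if "z \<in> \<Omega>" for z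
    by (intro has_derivative_Pair has_derivative_fst has_derivative_ident smooth_on_has_derivative[OF sm that])
  have cont: "\<exists>d>0. \<forall>y. dist (\<tau>, x) y < d \<longrightarrow> onorm (\<lambda>v. ?f' y v - ?f' (\<tau>, x) v) < e" if e: "e > 0" for e
  proof -
    define N where "N y = (\<Sum>b\<in>Basis. norm (frechet_derivative u (at y) b - frechet_derivative u (at (\<tau>, x)) b))" for y
    have cb: "continuous_on \<Omega> (\<lambda>y. frechet_derivative u (at y) b)" for b
      by (rule smooth_on_continuous[OF smooth_on_frechet[OF sm]])
    have "continuous_on \<Omega> N" unfolding N_def by (intro continuous_intros cb)
    then have "isCont N (\<tau>, x)" using op z continuous_on_eq_continuous_at by blast
    moreover have "N (\<tau>, x) = 0" by (simp add: N_def)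
    ultimately obtain d1 where d1: "d1 > 0" "\<And>y. dist y (\<tau>, x) < d1 \<Longrightarrow> \<bar>N y\<bar> < e"
      using e unfolding continuous_at_eps_delta dist_real_def by (metis diff_zero)
    obtain d2 where d2: "d2 > 0" "ball (\<tau>, x) d2 \<subseteq> \<Omega>" using op z open_contains_ball by blast
    have "onorm (\<lambda>v. ?f' y v - ?f' (\<tau>, x) v) < e" if y: "dist (\<tau>, x) y < min d1 d2" for y
    proof -
      have yO: "y \<in> \<Omega>" using y d2(2) by auto
      have "linear (\<lambda>v. ?f' y v - ?f' (\<tau>, x) v)"
        by (rule linear_compose_sub[OF has_derivative_linear[OF der[OF yO]] has_derivative_linear[OF der[OF z]]])
      from onorm_le_Basis[OF this] have "onorm (\<lambda>v. ?f' y v - ?f' (\<tau>, x) v) \<le> N y"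
        by (simp add: N_def norm_Pair)
      also have "N y < e" using d1(2)[of y] y by (simp add: dist_commute)
      finally show ?thesis .
    qed
    then show ?thesis using d1(1) d2(1) by (intro exI[of _ "min d1 d2"]) auto
  qed
  obtain r where r: "r > 0" "ball (\<tau>, x) r \<subseteq> \<Omega>" "inj_on ?f (ball (\<tau>, x) r)"
  proof (rule has_derivative_locally_injective[OF z op blg _ der cont])
    show "inv (?f' (\<tau>, x)) \<circ> ?f' (\<tau>, x) = id" using gd(1) by (simp add: bij_is_inj)
  qed
  \<comment> \<open>Half the radius for the parameter and half for the point: the distance in the
    product is at most the sum of the two distances.\<close>
  define V where "V = fst \<kappa> \<inter> snd \<kappa> -` ball x (r/2)"
  have V: "open V" unfolding V_def by (rule continuous_open_preimage[OF c(6) c(1) open_ball])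
  have zin: "(t, snd \<kappa> q) \<in> ball (\<tau>, x) r" if "t \<in> ball \<tau> (r/2)" "q \<in> V" for t q
  proof -
    have "dist (\<tau>, x) (t, snd \<kappa> q) \<le> dist \<tau> t + dist x (snd \<kappa> q)"
      unfolding dist_Pair_Pair by (rule sqrt_sum_squares_le_sum) auto
    then show ?thesis using that by (simp add: V_def)
  qed
  have uz: "u (t, snd \<kappa> q) = snd \<kappa>' (\<Phi> t q)" if "q \<in> V" for t q
    using that c(3)[of q] by (simp add: u_def fam_expr_def V_def)
  have dz: "t \<in> T \<and> \<Phi> t q \<in> fst \<kappa>'" if "t \<in> ball \<tau> (r/2)" "q \<in> V" for t q
    using zin[OF that] r(2) c(3)[of q] that(2) by (auto simp: \<Omega>_def fam_dom_def V_def)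
  have "inj_on (\<Phi> t) V" if t: "t \<in> ball \<tau> (r/2)" for t
  proof (rule inj_onI)
    fix q q' assume q: "q \<in> V" "q' \<in> V" "\<Phi> t q = \<Phi> t q'"
    have "?f (t, snd \<kappa> q) = ?f (t, snd \<kappa> q')" using q by (simp add: uz)
    then have "(t, snd \<kappa> q) = (t, snd \<kappa> q')"
      by (rule inj_onD[OF r(3) _ zin[OF t q(1)] zin[OF t q(2)]])
    then have "snd \<kappa> q = snd \<kappa> q'" by simp
    then show "q = q'" using c(8) q by (auto simp: V_def dest: inj_onD)
  qed
  moreover have pV: "p \<in> V" using A(3) r(1) by (simp add: V_def x_def)
  moreover have "ball \<tau> (r/2) \<subseteq> T" using dz[OF _ pV] by blast
  ultimately show ?thesis
    using V r(1) dz by (intro exI[of _ "r/2"] conjI exI[of _ V]) (auto simp: V_def)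
qed

text \<open>The graph map is open at the point over \<open>p\<close>, so the value of the slice
  \<open>\<tau>\<close> at \<open>p\<close> is still attained within \<open>V\<close> after a small
  move of the parameter: a preimage persists.\<close>

lemma family_locally_surjective:
  fixes A :: "('m::{t2_space, second_countable_topology}, 'a::finite) chart set"
    and B :: "('n::{t2_space, second_countable_topology}, 'b::finite) chart set" and T :: "'t::euclidean_space set"
  assumes A: "riemannian_manifold A g" and B: "riemannian_manifold B h"
    and card: "CARD('a) = CARD('b)"
    and T: "open T" "\<tau> \<in> T" and \<Phi>: "smooth_family T A B \<Phi>" and det: "det (map_op A g B h (\<Phi> \<tau>) p) \<noteq> 0"
    and V: "open V" "p \<in> V"
  shows "\<exists>r>0. \<forall>t\<in>ball \<tau> r. \<Phi> \<tau> p \<in> \<Phi> t ` V"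
proof -
  have g: "smooth_atlas A" "riemannian_metric A g" and h: "smooth_atlas B" "riemannian_metric B h"
    using A(1) B(1) by (auto simp: riemannian_manifold_def)
  define \<kappa> where "\<kappa> = chart_at A p"
  define \<kappa>' where "\<kappa>' = chart_at B (\<Phi> \<tau> p)"
  have k: "\<kappa> \<in> A" "p \<in> fst \<kappa>" and k': "\<kappa>' \<in> B" "\<Phi> \<tau> p \<in> fst \<kappa>'"
    using chart_at_props[OF g(1)] chart_at_props[OF h(1)] by (auto simp: \<kappa>_def \<kappa>'_def)
  define u where "u = fam_expr \<kappa> \<kappa>' \<Phi>"
  define \<Omega> where "\<Omega> = fam_dom T \<kappa> \<kappa>' \<Phi>"
  define x where "x = snd \<kappa> p"
  note c = chart_props[OF g(1) k(1)] and c' = chart_props[OF h(1) k'(1)]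
  have sm: "smooth_on \<Omega> u" unfolding u_def \<Omega>_def by (rule smooth_family_props(2)[OF \<Phi> k(1) k'(1)])
  have op: "open \<Omega>" unfolding \<Omega>_def by (rule fam_dom_open[OF g(1) k(1) h(1) k'(1) T(1) \<Phi>])
  have z: "(\<tau>, x) \<in> \<Omega>" using k k' T c(3)[OF k(2)] by (simp add: \<Omega>_def fam_dom_def x_def)
  let ?f = "\<lambda>v. (fst v, u v)"
  let ?f' = "\<lambda>v. (fst v, frechet_derivative u (at (\<tau>, x)) v)"
  note gd = family_graph_derivative[OF A k B k' card T \<Phi> det, folded u_def x_def]
  obtain g' where g': "linear g'" "?f' \<circ> g' = id"
    using linear_surjective_right_inverse[OF gd(2) bij_is_surj[OF gd(1)]] by blast
  have der: "(?f has_derivative ?f') (at (\<tau>, x))"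
    by (intro has_derivative_Pair has_derivative_fst has_derivative_ident smooth_on_has_derivative[OF sm z])
  define W where "W = \<Omega> \<inter> UNIV \<times> snd \<kappa> ` (fst \<kappa> \<inter> V)"
  have W: "open W" unfolding W_def
    by (intro open_Int op open_Times open_UNIV chart_open_image[OF g(1) k(1) V(1)])
  have zW: "(\<tau>, x) \<in> W" using z k V by (auto simp: W_def x_def)
  have contf: "continuous_on \<Omega> ?f" by (intro continuous_intros smooth_on_continuous[OF sm])
  have "?f (\<tau>, x) \<in> interior (?f ` W)"
  proof (rule sussmann_open_mapping[OF op contf z der g'(1)[unfolded linear_conv_bounded_linear] g'(2)])
    show "W \<subseteq> \<Omega>" by (simp add: W_def)
    show "(\<tau>, x) \<in> interior W" using zW by (simp add: interior_open[OF W])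
  qed
  then obtain r where r: "r > 0" "ball (?f (\<tau>, x)) r \<subseteq> ?f ` W" unfolding mem_interior by blast
  have "\<Phi> \<tau> p \<in> \<Phi> t ` V" if t: "t \<in> ball \<tau> r" for t
  proof -
    \<comment> \<open>The target value is kept and the parameter component alone is moved; a point
      of \<open>W\<close> over this pair is the displaced preimage.\<close>
    have "(t, u (\<tau>, x)) \<in> ball (?f (\<tau>, x)) r" using t by (simp add: dist_Pair_Pair)
    then obtain y where y: "y \<in> W" "(t, u (\<tau>, x)) = ?f y" using r(2) by blast
    obtain x' where x': "y = (t, x')" "u (t, x') = u (\<tau>, x)" using y(2) by (metis fst_conv prod.collapse snd_conv)
    have "x' \<in> snd \<kappa> ` (fst \<kappa> \<inter> V)" using y(1) by (auto simp: W_def x')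
    then obtain q where q: "q \<in> fst \<kappa>" "q \<in> V" "x' = snd \<kappa> q" by blast
    have "\<Phi> t q \<in> fst \<kappa>'" using y(1) c(3)[OF q(1)] by (auto simp: W_def x' \<Omega>_def fam_dom_def q(3))
    moreover have "snd \<kappa>' (\<Phi> t q) = snd \<kappa>' (\<Phi> \<tau> p)"
      using x'(2) c(3)[OF q(1)] c(3)[OF k(2)] by (simp add: u_def fam_expr_def q(3) x_def)
    ultimately have "\<Phi> t q = \<Phi> \<tau> p" using c'(8) k'(2) by (auto dest: inj_onD)
    then show ?thesis using q(2) by (metis imageI)
  qed
  then show ?thesis using r(1) by blast
qed

section \<open>Invariance of the weighted volume\<close>

lemma smooth_family_subset:
  assumes "smooth_family T A B \<Phi>" "T' \<subseteq> T" shows "smooth_family T' A B \<Phi>"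
  unfolding smooth_family_def
proof (intro conjI ballI)
  have "T' \<times> UNIV \<subseteq> T \<times> UNIV" using assms(2) by blast
  then show "continuous_on (T' \<times> UNIV) (\<lambda>(t, p). \<Phi> t p)"
    by (rule continuous_on_subset[OF smooth_family_props(1)[OF assms(1)]])
next
  fix \<kappa> \<kappa>' assume k: "\<kappa> \<in> A" "\<kappa>' \<in> B"
  have "fam_dom T' \<kappa> \<kappa>' \<Phi> \<subseteq> fam_dom T \<kappa> \<kappa>' \<Phi>" using assms(2) by (auto simp: fam_dom_def)
  from smooth_on_subset[OF smooth_family_props(2)[OF assms(1) k] this]
  show "smooth_on {(t, x). t \<in> T' \<and> x \<in> snd \<kappa> ` fst \<kappa> \<and> \<Phi> t (chart_inv \<kappa> x) \<in> fst \<kappa>'} (\<lambda>(t, x). snd \<kappa>' (\<Phi> t (chart_inv \<kappa> x)))"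
    unfolding fam_dom_def fam_expr_def .
qed

text \<open>Compactness of the manifold makes the radius in the parameter uniform over all
  points.\<close>

lemma smooth_functions_pos_nbhd:
  fixes A :: "('m::{t2_space, second_countable_topology}, 'a::finite) chart set" and T :: "'t::euclidean_space set"
  assumes A: "smooth_atlas A" and T: "open T" "\<tau> \<in> T" and F: "smooth_functions T A F"
    and comp: "compact (UNIV :: 'm set)" and pos: "\<And>p. F \<tau> p > 0"
  shows "\<exists>r>0. ball \<tau> r \<subseteq> T \<and> (\<forall>t\<in>ball \<tau> r. \<forall>p. F t p > 0)"
proof -
  define W where "W = T \<times> UNIV \<inter> (\<lambda>(t, p). F t p) -` {0<..}"
  have "open W" unfolding W_def
    by (rule continuous_open_preimage[OF smooth_functions_continuous[OF A T(1) F] open_Times[OF T(1) open_UNIV] open_greaterThan])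
  moreover have "{\<tau>} \<times> UNIV \<subseteq> W" using T(2) pos by (auto simp: W_def)
  ultimately obtain r where r: "r > 0" "ball \<tau> r \<times> (UNIV :: 'm set) \<subseteq> W"
    using tube[OF _ comp, of W \<tau>] by blast
  have "t \<in> T \<and> F t p > 0" if "t \<in> ball \<tau> r" for t p
  proof -
    have "(t, p) \<in> W" using r(2) that by blast
    then show ?thesis by (simp add: W_def)
  qed
  then show ?thesis using r(1) by (intro exI[of _ r]) auto
qed

lemma finite_disjoint_nbhds:
  fixes S :: "'m::t2_space set"
  assumes "finite S"
  shows "\<exists>U. (\<forall>p\<in>S. open (U p) \<and> p \<in> U p) \<and> (\<forall>p\<in>S. \<forall>p'\<in>S. p \<noteq> p' \<longrightarrow> U p \<inter> U p' = {})"
  using assms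
proof (induction S)
  case (insert x S)
  obtain U where U': "\<forall>p\<in>S. open (U p) \<and> p \<in> U p" "\<forall>p\<in>S. \<forall>p'\<in>S. p \<noteq> p' \<longrightarrow> U p \<inter> U p' = {}"
    using insert.IH by (elim exE conjE)
  have U: "\<And>p. p \<in> S \<Longrightarrow> open (U p) \<and> p \<in> U p"
    "\<And>p p'. p \<in> S \<Longrightarrow> p' \<in> S \<Longrightarrow> p \<noteq> p' \<Longrightarrow> U p \<inter> U p' = {}"
    using U' by simp_all
  have "\<exists>X Y. open X \<and> open Y \<and> x \<in> X \<and> p \<in> Y \<and> X \<inter> Y = {}" if "p \<in> S" for p
  proof -
    have "x \<noteq> p" using insert.hyps(2) that by blast
    then show ?thesis by (rule hausdorff)
  qed
  then have "\<forall>p\<in>S. \<exists>Z. open (fst Z) \<and> open (snd Z) \<and> x \<in> fst Z \<and> p \<in> snd Z \<and> fst Z \<inter> snd Z = {}"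
    by fastforce
  from bchoice[OF this] obtain Z where Z: "\<forall>p\<in>S. open (fst (Z p)) \<and> open (snd (Z p)) \<and> x \<in> fst (Z p) \<and> p \<in> snd (Z p) \<and> fst (Z p) \<inter> snd (Z p) = {}" ..
  define X where "X p = fst (Z p)" for p
  define Y where "Y p = snd (Z p)" for p
  have XY: "\<And>p. p \<in> S \<Longrightarrow> open (X p) \<and> open (Y p) \<and> x \<in> X p \<and> p \<in> Y p \<and> X p \<inter> Y p = {}"
    using Z by (simp add: X_def Y_def)
  define U' where "U' p = (if p = x then (\<Inter>p\<in>S. X p) else U p \<inter> Y p)" for p
  have Ux: "U' x = (\<Inter>p\<in>S. X p)" and Up: "p \<in> S \<Longrightarrow> U' p = U p \<inter> Y p" for p
    using insert.hyps(2) by (auto simp: U'_def)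
  have dx: "U' x \<inter> U' p = {}" if "p \<in> S" for p
    using XY[OF that] that by (auto simp: Ux Up)
  show ?case
  proof (intro exI[of _ U'] conjI ballI impI)
    fix p assume p: "p \<in> insert x S"
    have "open (\<Inter>p\<in>S. X p)" using XY insert.hyps(1) by (intro open_INT) auto
    then show "open (U' p)" using p U XY Ux Up by (cases "p = x") auto
    show "p \<in> U' p" using p U XY Ux Up by (cases "p = x") auto
  next
    fix p p' assume p: "p \<in> insert x S" "p' \<in> insert x S" "p \<noteq> p'"
    show "U' p \<inter> U' p' = {}"
    proof (cases "p = x \<or> p' = x")
      case True
      then show ?thesis using dx p by auto
    next
      case False
      then show ?thesis using p U(2)[of p p'] by (auto simp: Up)
    qed
  qed
qed simp

lemma continuous_on_locally_constant:
  fixes c :: "'m::t2_space \<Rightarrow> 'b::topological_space"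
  assumes "\<And>p. \<exists>V. open V \<and> p \<in> V \<and> (\<forall>q\<in>V. c q = c p)"
  shows "continuous_on UNIV c"
proof (rule continuous_at_imp_continuous_on, rule ballI)
  fix p
  obtain V where V: "open V" "p \<in> V" "\<forall>q\<in>V. c q = c p" using assms[of p] by (elim exE conjE)
  have "continuous_on V c" by (rule continuous_on_eq[OF continuous_on_const]) (rule sym, erule bspec[OF V(3)])
  then show "isCont c p" using V(1,2) by (simp add: continuous_on_eq_continuous_at)
qed

section \<open>Counting preimages along a family\<close>

text \<open>A positive determinant makes every slice a local diffeomorphism between manifolds of
  equal dimension. The weight \<open>c\<close> is kept as a general positive locally constant
  function; the power of the dilation is put in later.\<close>

locale family_data =
  fixes A :: "('m::{t2_space, second_countable_topology}, 'a::finite) chart set" and g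
    and B :: "('n::{t2_space, second_countable_topology}, 'b::finite) chart set" and h
    and T :: "'t::euclidean_space set" and \<Phi> :: "'t \<Rightarrow> 'm \<Rightarrow> 'n" and c :: "'m \<Rightarrow> real"
  assumes A: "riemannian_manifold A g" and B: "riemannian_manifold B h"
    and card: "CARD('a) = CARD('b)" and comp: "compact (UNIV :: 'm set)"
    and T: "open T" and \<Phi>: "smooth_family T A B \<Phi>"
    and det: "\<And>\<tau> p. \<tau> \<in> T \<Longrightarrow> det (map_op A g B h (\<Phi> \<tau>) p) > 0"
    and c_local: "\<And>p. \<exists>V. open V \<and> p \<in> V \<and> (\<forall>q\<in>V. c q = c p)" and c_pos: "\<And>p. c p > 0"
begin

lemma gA: "smooth_atlas A" "riemannian_metric A g" and hB: "smooth_atlas B" "riemannian_metric B h"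
  using A B by (auto simp: riemannian_manifold_def)

text \<open>One \<open>V\<close> serves all slices near \<open>\<tau>\<close> as far as injectivity
  is concerned, which is what allows preimages to be followed; containment in a target chart is
  claimed for the slice \<open>\<tau>\<close> itself.\<close>

lemma good_nbhd:
  assumes "\<tau> \<in> T"
  shows "\<exists>r V. r > 0 \<and> open V \<and> p \<in> V \<and> V \<subseteq> fst (chart_at A p) \<and> \<Phi> \<tau> ` V \<subseteq> fst (chart_at B (\<Phi> \<tau> p)) \<and>
     (\<forall>q\<in>V. c q = c p) \<and> (\<forall>t\<in>ball \<tau> r. inj_on (\<Phi> t) V)"
proof -
  have nz: "det (map_op A g B h (\<Phi> \<tau>) p) \<noteq> 0" using det[OF assms, of p] by simp
  obtain r V where V: "r > 0" "open V" "p \<in> V" "V \<subseteq> fst (chart_at A p)"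
    "\<forall>t\<in>ball \<tau> r. \<Phi> t ` V \<subseteq> fst (chart_at B (\<Phi> \<tau> p)) \<and> inj_on (\<Phi> t) V"
    using family_locally_injective[OF A chart_at_props[OF gA(1), of p] B chart_at_props[OF hB(1), of "\<Phi> \<tau> p"] card T assms \<Phi> nz] by blast
  obtain V' where V': "open V'" "p \<in> V'" "\<forall>q\<in>V'. c q = c p" using c_local[of p] by blast
  have t: "\<tau> \<in> ball \<tau> r" using V(1) by simp
  show ?thesis
  proof (intro exI conjI)
    show "r > 0" "open (V \<inter> V')" "p \<in> V \<inter> V'" "V \<inter> V' \<subseteq> fst (chart_at A p)" using V V' by auto
    show "\<Phi> \<tau> ` (V \<inter> V') \<subseteq> fst (chart_at B (\<Phi> \<tau> p))" using V(5) t by blast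
    show "\<forall>q\<in>V \<inter> V'. c q = c p" using V' by blast
    show "\<forall>t\<in>ball \<tau> r. inj_on (\<Phi> t) (V \<inter> V')" using V(5) inj_on_subset[of _ V "V \<inter> V'"] by blast
  qed
qed

lemma slice_continuous: "\<tau> \<in> T \<Longrightarrow> continuous_on UNIV (\<Phi> \<tau>)"
  using family_differentiable_map[OF gA(1) \<Phi>] by (simp add: differentiable_map_def)

definition fiber :: "'t \<Rightarrow> 'n \<Rightarrow> 'm set" where "fiber \<tau> q = {p. \<Phi> \<tau> p = q}"

definition weight :: "'t \<Rightarrow> 'n \<Rightarrow> real" where "weight \<tau> q = (\<Sum>p\<in>fiber \<tau> q. c p)"

text \<open>The fibre meets each member of a finite cover by injectivity neighbourhoods at most
  once.\<close>

lemma finite_fiber: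
  assumes "\<tau> \<in> T" shows "finite (fiber \<tau> q)"
proof -
  have "\<exists>V. open V \<and> p \<in> V \<and> inj_on (\<Phi> \<tau>) V" for p
  proof -
    from good_nbhd[OF assms, of p] show ?thesis
      by (elim exE conjE) (intro exI conjI, assumption+, simp)
  qed
  then obtain V where V: "\<And>p. open (V p)" "\<And>p. p \<in> V p" "\<And>p. inj_on (\<Phi> \<tau>) (V p)" by metis
  have "UNIV \<subseteq> (\<Union>p\<in>UNIV. V p)" using V(2) by blast
  then obtain P where P: "finite P" "UNIV \<subseteq> (\<Union>p\<in>P. V p)"
    by (rule compactE_image[OF comp V(1)])
  have "finite (V p \<inter> fiber \<tau> q)" for p
  proof -
    have "inj_on (\<Phi> \<tau>) (V p \<inter> fiber \<tau> q)" by (rule inj_on_subset[OF V(3)[of p]]) simp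
    moreover have "finite (\<Phi> \<tau> ` (V p \<inter> fiber \<tau> q))" by (rule finite_subset[of _ "{q}"]) (auto simp: fiber_def)
    ultimately show ?thesis by (rule finite_imageD[rotated])
  qed
  then have "finite (\<Union>p\<in>P. V p \<inter> fiber \<tau> q)" using P(1) by blast
  moreover have "fiber \<tau> q \<subseteq> (\<Union>p\<in>P. V p \<inter> fiber \<tau> q)" using P(2) by blast
  ultimately show ?thesis by (rule finite_subset[rotated])
qed

text \<open>The target point \<open>q\<close> is fixed and the parameter moves. Around each preimage
  a nearby slice has a preimage of \<open>q\<close> by openness and no second one by injectivity,
  and on the compact rest of the manifold \<open>q\<close> stays avoided. So the fibres correspond
  bijectively, with equal weights.\<close>

lemma weight_locally_constant:
  assumes \<tau>: "\<tau> \<in> T"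
  shows "\<exists>r>0. \<forall>t\<in>ball \<tau> r. weight t q = weight \<tau> q"
proof -
  let ?S = "fiber \<tau> q"
  note fin = finite_fiber[OF \<tau>, of q]
  have "\<forall>p. \<exists>r V. r > 0 \<and> open V \<and> p \<in> V \<and> (\<forall>q\<in>V. c q = c p) \<and> (\<forall>t\<in>ball \<tau> r. inj_on (\<Phi> t) V)"
  proof
    fix p
    from good_nbhd[OF \<tau>, of p]
    show "\<exists>r V. r > 0 \<and> open V \<and> p \<in> V \<and> (\<forall>q\<in>V. c q = c p) \<and> (\<forall>t\<in>ball \<tau> r. inj_on (\<Phi> t) V)"
      by (elim exE conjE) (intro exI conjI, assumption+)
  qed
  then obtain r V where V: "\<And>p. r p > 0" "\<And>p. open (V p)" "\<And>p. p \<in> V p" "\<And>p q. q \<in> V p \<Longrightarrow> c q = c p"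
    "\<And>p t. t \<in> ball \<tau> (r p) \<Longrightarrow> inj_on (\<Phi> t) (V p)" by metis
  obtain U where U': "\<forall>p\<in>?S. open (U p) \<and> p \<in> U p" "\<forall>p\<in>?S. \<forall>p'\<in>?S. p \<noteq> p' \<longrightarrow> U p \<inter> U p' = {}"
    using finite_disjoint_nbhds[OF fin] by (elim exE conjE)
  have U: "\<And>p. p \<in> ?S \<Longrightarrow> open (U p) \<and> p \<in> U p"
    "\<And>p p'. p \<in> ?S \<Longrightarrow> p' \<in> ?S \<Longrightarrow> p \<noteq> p' \<Longrightarrow> U p \<inter> U p' = {}"
    using U' by simp_all
  define N where "N p = U p \<inter> V p" for p
  have N: "open (N p)" "p \<in> N p" if "p \<in> ?S" for p using U(1)[OF that] V by (auto simp: N_def)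
  have "\<exists>s>0. \<forall>t\<in>ball \<tau> s. q \<in> \<Phi> t ` N p" if "p \<in> ?S" for p
  proof -
    have nz: "det (map_op A g B h (\<Phi> \<tau>) p) \<noteq> 0" using det[OF \<tau>, of p] by simp
    have "\<Phi> \<tau> p = q" using that by (simp add: fiber_def)
    with family_locally_surjective[OF A B card T \<tau> \<Phi> nz N[OF that]] show ?thesis by simp
  qed
  then obtain s where s: "\<And>p. p \<in> ?S \<Longrightarrow> s p > 0" "\<And>p t. p \<in> ?S \<Longrightarrow> t \<in> ball \<tau> (s p) \<Longrightarrow> q \<in> \<Phi> t ` N p" by metis
  \<comment> \<open>Away from the chosen neighbourhoods the slice \<open>\<tau>\<close> misses
    \<open>q\<close>; by compactness of \<open>K\<close> nearby slices miss it there too.\<close>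
  define K where "K = - (\<Union>p\<in>?S. N p)"
  have "closed K" unfolding K_def using N(1) by (intro closed_Compl open_UN) auto
  then have K: "compact K" using compact_Int_closed[OF comp, of K] by simp
  define W where "W = T \<times> UNIV \<inter> (\<lambda>(t, p). \<Phi> t p) -` (- {q})"
  have "open W" unfolding W_def
    by (rule continuous_open_preimage[OF smooth_family_props(1)[OF \<Phi>] open_Times[OF T open_UNIV]]) (intro open_Compl closed_singleton)
  moreover have "\<Phi> \<tau> p \<noteq> q" if "p \<in> K" for p
  proof
    assume "\<Phi> \<tau> p = q"
    then have "p \<in> ?S" by (simp add: fiber_def)
    with N(2)[OF this] that show False by (auto simp: K_def)
  qed
  then have "{\<tau>} \<times> K \<subseteq> W" using \<tau> by (auto simp: W_def)
  ultimately obtain r3 where r3: "r3 > 0" "ball \<tau> r3 \<times> K \<subseteq> W" using tube[OF _ K] by blast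
  define R where "R = Min (insert r3 (r ` ?S \<union> s ` ?S))"
  have "\<forall>x\<in>insert r3 (r ` ?S \<union> s ` ?S). x > 0" using V(1) s(1) r3(1) by auto
  then have R: "R > 0" unfolding R_def using fin by (subst Min_gr_iff) auto
  have Rle: "R \<le> r3" "\<And>p. p \<in> ?S \<Longrightarrow> R \<le> r p" "\<And>p. p \<in> ?S \<Longrightarrow> R \<le> s p"
    using fin by (auto simp: R_def)
  have "weight t q = weight \<tau> q" if t: "t \<in> ball \<tau> R" for t
  proof -
    have "\<forall>p\<in>?S. \<exists>p'. p' \<in> N p \<and> \<Phi> t p' = q"
    proof
      fix p assume p: "p \<in> ?S"
      have "t \<in> ball \<tau> (s p)" using t Rle(3)[OF p] by simp
      from s(2)[OF p this] show "\<exists>p'. p' \<in> N p \<and> \<Phi> t p' = q" by blast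
    qed
    \<comment> \<open>\<open>f\<close> sends a preimage of \<open>q\<close> under the slice
      \<open>\<tau>\<close> to a preimage under the slice \<open>t\<close> in the same
      neighbourhood. Disjointness of the neighbourhoods makes it injective.\<close>
    then obtain f where f: "\<And>p. p \<in> ?S \<Longrightarrow> f p \<in> N p" "\<And>p. p \<in> ?S \<Longrightarrow> \<Phi> t (f p) = q" by metis
    have "inj_on f ?S"
    proof (rule inj_onI)
      fix p p' assume p: "p \<in> ?S" "p' \<in> ?S" "f p = f p'"
      show "p = p'"
      proof (rule ccontr)
        assume "p \<noteq> p'"
        from U(2)[OF p(1,2) this] f(1)[OF p(1)] f(1)[OF p(2)] p(3) show False by (auto simp: N_def)
      qed
    qed
    moreover have "fiber t q = f ` ?S"
    proof (intro equalityI subsetI)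
      fix p' assume p': "p' \<in> fiber t q"
      then have e: "\<Phi> t p' = q" by (simp add: fiber_def)
      have "p' \<notin> K"
      proof
        assume "p' \<in> K"
        moreover have "t \<in> ball \<tau> r3" using t Rle(1) by simp
        ultimately have "(t, p') \<in> W" using r3(2) by blast
        then show False using e by (simp add: W_def)
      qed
      then obtain p where p: "p \<in> ?S" "p' \<in> N p" by (auto simp: K_def)
      have "t \<in> ball \<tau> (r p)" using t Rle(2)[OF p(1)] by simp
      from inj_onD[OF V(5)[OF this], of p' "f p"] have "p' = f p"
        using e f[OF p(1)] p(2) by (simp add: N_def)
      then show "p' \<in> f ` ?S" using p(1) by blast
    qed (use f(2) in \<open>auto simp: fiber_def\<close>)
    ultimately have "weight t q = (\<Sum>p\<in>?S. c (f p))" unfolding weight_def by (simp add: sum.reindex)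
    also have "\<dots> = weight \<tau> q" unfolding weight_def
    proof (rule sum.cong[OF refl])
      fix p assume "p \<in> ?S"
      then have "f p \<in> V p" using f(1) by (auto simp: N_def)
      then show "c (f p) = c p" by (rule V(4))
    qed
    finally show ?thesis .
  qed
  then show ?thesis using R by blast
qed

text \<open>By invariance of domain the chart expression of the slice is a homeomorphism onto an
  open set, so the image of a Borel set is a preimage under the continuous inverse.\<close>

lemma image_borel:
  assumes \<tau>: "\<tau> \<in> T" and V: "open V" "V \<subseteq> fst \<kappa>" "\<Phi> \<tau> ` V \<subseteq> fst \<kappa>'" "inj_on (\<Phi> \<tau>) V"
    and k: "\<kappa> \<in> A" "\<kappa>' \<in> B" and X: "X \<in> sets borel" "X \<subseteq> V"
  shows "\<Phi> \<tau> ` X \<in> sets borel"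
proof -
  note cA = chart_props[OF gA(1) k(1)] and cB = chart_props[OF hB(1) k(2)]
  define S where "S = snd \<kappa> ` V"
  define u where "u = snd \<kappa>' \<circ> \<Phi> \<tau> \<circ> chart_inv \<kappa>"
  have "V = fst \<kappa> \<inter> V" using V(2) by blast
  then have S: "open S" unfolding S_def using chart_open_image[OF gA(1) k(1) V(1)] by simp
  have SV: "chart_inv \<kappa> x \<in> V" "snd \<kappa> (chart_inv \<kappa> x) = x" if "x \<in> S" for x
    using that V(2) cA(3) by (auto simp: S_def subset_iff)
  have SU: "S \<subseteq> snd \<kappa> ` fst \<kappa>" unfolding S_def using V(2) by blast
  have iS: "chart_inv \<kappa> ` S \<subseteq> V" using SV(1) by blast
  have c1: "continuous_on S (\<Phi> \<tau> \<circ> chart_inv \<kappa>)"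
    by (intro continuous_on_compose continuous_on_subset[OF cA(7) SU] continuous_on_subset[OF slice_continuous[OF \<tau>]]) simp
  have "(\<Phi> \<tau> \<circ> chart_inv \<kappa>) ` S \<subseteq> fst \<kappa>'" using iS V(3) by (auto simp: o_def)
  then have u: "continuous_on S u" unfolding u_def comp_assoc
    by (intro continuous_on_compose c1 continuous_on_subset[OF cB(6)])
  have inj: "inj_on u S"
  proof (rule inj_onI)
    fix x y assume xy: "x \<in> S" "y \<in> S" "u x = u y"
    have "\<Phi> \<tau> (chart_inv \<kappa> x) \<in> fst \<kappa>'" "\<Phi> \<tau> (chart_inv \<kappa> y) \<in> fst \<kappa>'"
      using SV(1)[OF xy(1)] SV(1)[OF xy(2)] V(3) by auto
    then have "\<Phi> \<tau> (chart_inv \<kappa> x) = \<Phi> \<tau> (chart_inv \<kappa> y)"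
      using xy(3) by (intro inj_onD[OF cB(8)]) (simp_all add: u_def)
    then have "chart_inv \<kappa> x = chart_inv \<kappa> y"
      by (rule inj_onD[OF V(4) _ SV(1)[OF xy(1)] SV(1)[OF xy(2)]])
    then show "x = y" using SV(2)[OF xy(1)] SV(2)[OF xy(2)] by metis
  qed
  have dim: "DIM(real^'b) \<le> DIM(real^'a)" using card by simp
  obtain w where w: "homeomorphism S (u ` S) u w"
    by (rule invariance_of_domain_homeomorphism[OF S u dim inj])
  have "open (u ` S)" by (rule invariance_of_domain_gen[OF S u inj dim])
  moreover have Xm: "snd \<kappa> ` X \<in> sets borel" using X V(2) by (intro chart_image_borel[OF gA(1) k(1)]) auto
  moreover have "continuous_on (u ` S) w" using w by (rule homeomorphism_cont2)
  ultimately have m: "u ` S \<inter> w -` (snd \<kappa> ` X) \<in> sets borel" by (intro borel_Int_vimage)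
  have wu: "w (u x) = x" if "x \<in> S" for x using w that by (simp add: homeomorphism_apply1)
  have XS: "snd \<kappa> ` X \<subseteq> S" unfolding S_def using X(2) by blast
  have "u ` S \<inter> w -` (snd \<kappa> ` X) = u ` (snd \<kappa> ` X)" using wu XS by (force simp: image_iff)
  with m have m': "u ` (snd \<kappa> ` X) \<in> sets borel" by simp
  have ux: "u (snd \<kappa> x) = snd \<kappa>' (\<Phi> \<tau> x)" if "x \<in> X" for x
    using that X(2) V(2) cA(3)[of x] by (auto simp: u_def)
  have "\<Phi> \<tau> ` X = fst \<kappa>' \<inter> snd \<kappa>' -` (u ` (snd \<kappa> ` X))"
  proof (intro equalityI subsetI)
    fix y assume "y \<in> \<Phi> \<tau> ` X"
    then obtain x where x: "x \<in> X" "y = \<Phi> \<tau> x" by blast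
    then have "y \<in> fst \<kappa>'" using X(2) V(3) by blast
    moreover have "snd \<kappa>' y \<in> u ` (snd \<kappa> ` X)" unfolding x(2) ux[OF x(1), symmetric] using x(1) by blast
    ultimately show "y \<in> fst \<kappa>' \<inter> snd \<kappa>' -` (u ` (snd \<kappa> ` X))" by simp
  next
    fix y assume y: "y \<in> fst \<kappa>' \<inter> snd \<kappa>' -` (u ` (snd \<kappa> ` X))"
    then obtain x where x: "x \<in> X" "snd \<kappa>' y = u (snd \<kappa> x)" by auto
    then have "snd \<kappa>' y = snd \<kappa>' (\<Phi> \<tau> x)" using ux by simp
    moreover have "\<Phi> \<tau> x \<in> fst \<kappa>'" using x(1) X(2) V(3) by blast
    ultimately have "y = \<Phi> \<tau> x" using y by (intro inj_onD[OF cB(8)]) auto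
    then show "y \<in> \<Phi> \<tau> ` X" using x(1) by blast
  qed
  moreover have "fst \<kappa>' \<inter> snd \<kappa>' -` (u ` (snd \<kappa> ` X)) \<in> sets borel"
    by (rule borel_Int_vimage[OF cB(1,6) m'])
  ultimately show ?thesis by simp
qed

section \<open>The weighted area formula and constancy of the weighted volume\<close>

definition jac :: "'t \<Rightarrow> 'm \<Rightarrow> real" where "jac \<tau> p = sqrt (det (map_op A g B h (\<Phi> \<tau>) p))"

lemma det_functions: "smooth_functions T A (\<lambda>\<tau> p. det (map_op A g B h (\<Phi> \<tau>) p))"
  by (rule smooth_functions_op[OF A B T \<Phi> smooth_invariant_basic(2)])

lemma det_continuous: "\<tau> \<in> T \<Longrightarrow> continuous_on UNIV (\<lambda>p. det (map_op A g B h (\<Phi> \<tau>) p))"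
  by (rule smooth_functions_slice_continuous[OF gA(1) T det_functions])

lemmas c_continuous = continuous_on_locally_constant[of c, OF c_local]

lemma pullback_chart_continuous:
  assumes \<tau>: "\<tau> \<in> T" and k: "\<kappa> \<in> A" "\<kappa>' \<in> B" and X: "X \<subseteq> fst \<kappa>" "\<Phi> \<tau> ` X \<subseteq> fst \<kappa>'"
  shows "continuous_on (snd \<kappa> ` X) (\<lambda>x. pullback_metric h \<kappa> \<kappa>' (\<Phi> \<tau>) (chart_inv \<kappa> x))"
proof -
  note sm = smooth_on_continuous[OF family_op_smooth(2)[OF A k(1) B k(2) T \<Phi>]]
  have "continuous_on (snd \<kappa> ` X) (\<lambda>x. (\<tau>, x))" by (intro continuous_intros)
  moreover have "(\<lambda>x. (\<tau>, x)) ` (snd \<kappa> ` X) \<subseteq> fam_dom T \<kappa> \<kappa>' \<Phi>"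
    using \<tau> X chart_props(3)[OF gA(1) k(1)] by (auto simp: fam_dom_def subset_iff)
  ultimately have "continuous_on (snd \<kappa> ` X) (\<lambda>x. (\<lambda>(t, x). pullback_metric h \<kappa> \<kappa>' (\<Phi> t) (chart_inv \<kappa> x)) (\<tau>, x))"
    by (rule continuous_on_compose2[OF sm])
  then show ?thesis by simp
qed

text \<open>Area formula with multiplicity: the manifold is cut into finitely many Borel pieces on
  which the slice is injective and \<open>c\<close> is constant. Each contributes its value of
  \<open>c\<close> times the volume of its image, and the weighted indicators of the images add up
  to the weighted number of preimages.\<close>

lemma integral_jac_weight:
  assumes \<tau>: "\<tau> \<in> T"
  shows "(\<integral>\<^sup>+p. ennreal (c p * jac \<tau> p) \<partial>riemannian_measure A g) = (\<integral>\<^sup>+q. ennreal (weight \<tau> q) \<partial>riemannian_measure B h)"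
proof -
  let ?\<nu> = "riemannian_measure A g" and ?\<eta> = "riemannian_measure B h"
  note specA = riemannian_measure_spec[OF A] and specB = riemannian_measure_spec[OF B]
  note [measurable_cong] = specA(1) specB(1)
  have "\<forall>p. \<exists>V. open V \<and> p \<in> V \<and> V \<subseteq> fst (chart_at A p) \<and> \<Phi> \<tau> ` V \<subseteq> fst (chart_at B (\<Phi> \<tau> p)) \<and>
     (\<forall>q\<in>V. c q = c p) \<and> inj_on (\<Phi> \<tau>) V"
  proof
    fix p
    from good_nbhd[OF \<tau>, of p]
    show "\<exists>V. open V \<and> p \<in> V \<and> V \<subseteq> fst (chart_at A p) \<and> \<Phi> \<tau> ` V \<subseteq> fst (chart_at B (\<Phi> \<tau> p)) \<and>
     (\<forall>q\<in>V. c q = c p) \<and> inj_on (\<Phi> \<tau>) V"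
      by (elim exE conjE) (intro exI conjI, assumption+, simp)
  qed
  then obtain V where V: "\<And>p. open (V p)" "\<And>p. p \<in> V p" "\<And>p. V p \<subseteq> fst (chart_at A p)"
    "\<And>p. \<Phi> \<tau> ` V p \<subseteq> fst (chart_at B (\<Phi> \<tau> p))" "\<And>p q. q \<in> V p \<Longrightarrow> c q = c p" "\<And>p. inj_on (\<Phi> \<tau>) (V p)" by metis
  have "UNIV \<subseteq> (\<Union>p\<in>UNIV. V p)" using V(2) by blast
  then obtain P where P: "finite P" "UNIV \<subseteq> (\<Union>p\<in>P. V p)"
    by (rule compactE_image[OF comp V(1)])
  obtain e where e: "bij_betw e {0..<card P} P" using ex_bij_betw_nat_finite[OF P(1)] by blast
  define n where "n = card P"
  \<comment> \<open>Each neighbourhood loses those that come before it, so every point lies in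
    exactly one piece with index below \<open>n\<close>, that of the least index containing
    it.\<close>
  define D where "D i = V (e i) - (\<Union>j<i. V (e j))" for i
  have DV: "D i \<subseteq> V (e i)" for i by (auto simp: D_def)
  have Dm: "D i \<in> sets borel" for i
    unfolding D_def using V(1) by (intro sets.Diff sets.finite_UN) auto
  have ind: "\<exists>i0<n. \<forall>i. i < n \<longrightarrow> indicator (D i) p = (if i = i0 then 1 else 0 :: real)" for p
  proof -
    obtain p' where "p' \<in> P" "p \<in> V p'" using P(2) by blast
    have "P = e ` {0..<n}" using e by (simp add: bij_betw_def n_def)
    with \<open>p' \<in> P\<close> obtain i1 where "i1 < n" "p' = e i1" by auto
    with \<open>p \<in> V p'\<close> have i1: "i1 < n" "p \<in> V (e i1)" by auto
    define i0 where "i0 = (LEAST i. p \<in> V (e i))"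
    have i0: "p \<in> V (e i0)" unfolding i0_def by (rule LeastI[of "\<lambda>i. p \<in> V (e i)", OF i1(2)])
    have le: "i0 \<le> i" if "p \<in> V (e i)" for i unfolding i0_def by (rule Least_le[of "\<lambda>i. p \<in> V (e i)", OF that])
    have "p \<in> D i \<longleftrightarrow> i = i0" for i
    proof
      assume "p \<in> D i"
      then have "p \<in> V (e i)" "\<And>j. j < i \<Longrightarrow> p \<notin> V (e j)" by (auto simp: D_def)
      then show "i = i0" using le[of i] i0 by (metis le_neq_implies_less)
    next
      assume "i = i0"
      then show "p \<in> D i" using i0 le by (force simp: D_def)
    qed
    moreover have "i0 < n" using le[OF i1(2)] i1(1) by simp
    ultimately show ?thesis by (intro exI[of _ i0]) (auto simp: indicator_def)
  qed
  have one: "(\<Sum>i<n. indicator (D i) p) = (1::real)" for p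
  proof -
    obtain i0 where "i0 < n" "\<forall>i. i < n \<longrightarrow> indicator (D i) p = (if i = i0 then 1 else 0 :: real)" using ind by blast
    then show ?thesis by simp
  qed
  have cm: "c \<in> borel_measurable borel" by (rule borel_measurable_continuous_onI[OF c_continuous])
  have detm: "(\<lambda>p. det (map_op A g B h (\<Phi> \<tau>) p)) \<in> borel_measurable borel"
    by (rule borel_measurable_continuous_onI[OF det_continuous[OF \<tau>]])
  have jm: "jac \<tau> \<in> borel_measurable borel" unfolding jac_def using detm by measurable
  note [measurable] = cm jm Dm
  have im: "\<Phi> \<tau> ` D i \<in> sets borel" for i
    by (rule image_borel[OF \<tau> V(1,3,4,6) chart_at_props(1)[OF gA(1)] chart_at_props(1)[OF hB(1)] Dm DV])
  note [measurable] = im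
  have "(\<integral>\<^sup>+p. ennreal (c p * jac \<tau> p) \<partial>?\<nu>) = (\<integral>\<^sup>+p. (\<Sum>i<n. ennreal (c p * jac \<tau> p) * indicator (D i) p) \<partial>?\<nu>)"
  proof (rule nn_integral_cong)
    fix p
    have "(\<Sum>i<n. indicator (D i) p :: ennreal) = (\<Sum>i<n. ennreal (indicator (D i) p))" by (intro sum.cong) (auto simp: indicator_def)
    also have "\<dots> = ennreal (\<Sum>i<n. indicator (D i) p)" by (rule sum_ennreal) simp
    finally have "(\<Sum>i<n. indicator (D i) p :: ennreal) = 1" by (simp add: one)
    then show "ennreal (c p * jac \<tau> p) = (\<Sum>i<n. ennreal (c p * jac \<tau> p) * indicator (D i) p)"
      by (simp flip: sum_distrib_left)
  qed
  also have "\<dots> = (\<Sum>i<n. \<integral>\<^sup>+p. ennreal (c p * jac \<tau> p) * indicator (D i) p \<partial>?\<nu>)"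
    by (rule nn_integral_sum) measurable
  also have "\<dots> = (\<Sum>i<n. \<integral>\<^sup>+q. ennreal (c (e i)) * indicator (\<Phi> \<tau> ` D i) q \<partial>?\<eta>)"
  proof (rule sum.cong[OF refl])
    fix i
    have sub: "D i \<subseteq> fst (chart_at A (e i))" "\<Phi> \<tau> ` D i \<subseteq> fst (chart_at B (\<Phi> \<tau> (e i)))"
      using DV[of i] V(3,4)[of "e i"] by blast+
    have inj: "inj_on (\<Phi> \<tau>) (D i)" using V(6) DV by (rule inj_on_subset)
    have vi: "emeasure ?\<eta> (\<Phi> \<tau> ` D i) = (\<integral>\<^sup>+p. ennreal (jac \<tau> p) * indicator (D i) p \<partial>?\<nu>)"
      unfolding jac_def
      by (rule volume_image[OF A chart_at_props(1)[OF gA(1)] B chart_at_props(1)[OF hB(1)] card Dm sub im inj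
          family_differentiable_map[OF gA(1) \<Phi> \<tau>] pullback_chart_continuous[OF \<tau> chart_at_props(1)[OF gA(1)] chart_at_props(1)[OF hB(1)] sub] detm])
    have "(\<integral>\<^sup>+p. ennreal (c p * jac \<tau> p) * indicator (D i) p \<partial>?\<nu>) = (\<integral>\<^sup>+p. ennreal (c (e i)) * (ennreal (jac \<tau> p) * indicator (D i) p) \<partial>?\<nu>)"
    proof (rule nn_integral_cong)
      fix p
      have "p \<in> D i \<Longrightarrow> c p = c (e i)" using V(5)[of p "e i"] DV[of i] by blast
      then show "ennreal (c p * jac \<tau> p) * indicator (D i) p = ennreal (c (e i)) * (ennreal (jac \<tau> p) * indicator (D i) p)"
        using c_pos[of "e i"] by (auto simp: indicator_def ennreal_mult')
    qed
    also have "\<dots> = ennreal (c (e i)) * emeasure ?\<eta> (\<Phi> \<tau> ` D i)"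
      unfolding vi by (rule nn_integral_cmult) measurable
    also have "\<dots> = (\<integral>\<^sup>+q. ennreal (c (e i)) * indicator (\<Phi> \<tau> ` D i) q \<partial>?\<eta>)"
      using im by (subst nn_integral_cmult_indicator) (simp_all add: specB)
    finally show "(\<integral>\<^sup>+p. ennreal (c p * jac \<tau> p) * indicator (D i) p \<partial>?\<nu>) = (\<integral>\<^sup>+q. ennreal (c (e i)) * indicator (\<Phi> \<tau> ` D i) q \<partial>?\<eta>)" .
  qed
  also have "\<dots> = (\<integral>\<^sup>+q. (\<Sum>i<n. ennreal (c (e i)) * indicator (\<Phi> \<tau> ` D i) q) \<partial>?\<eta>)"
    by (rule nn_integral_sum[symmetric]) measurable
  also have "\<dots> = (\<integral>\<^sup>+q. ennreal (weight \<tau> q) \<partial>?\<eta>)"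
  proof (rule nn_integral_cong)
    fix q
    \<comment> \<open>By injectivity a piece contains at most one point of the fibre over
      \<open>q\<close>.\<close>
    have piece: "(\<Sum>p\<in>fiber \<tau> q. c p * indicator (D i) p) = c (e i) * indicator (\<Phi> \<tau> ` D i) q" for i
    proof (cases "q \<in> \<Phi> \<tau> ` D i")
      case True
      then obtain p0 where p0: "p0 \<in> D i" "\<Phi> \<tau> p0 = q" by blast
      have "c p * indicator (D i) p = (if p = p0 then c (e i) else 0)" if "p \<in> fiber \<tau> q" for p
      proof (cases "p \<in> D i")
        case pD: True
        have "p = p0"
          by (rule inj_onD[OF inj_on_subset[OF V(6) DV] _ pD p0(1)]) (use p0 that in \<open>simp add: fiber_def\<close>)
        moreover have "c p0 = c (e i)" using V(5) DV p0(1) by blast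
        ultimately show ?thesis using p0(1) by simp
      next
        case False
        then show ?thesis using p0(1) by auto
      qed
      then have "(\<Sum>p\<in>fiber \<tau> q. c p * indicator (D i) p) = (\<Sum>p\<in>fiber \<tau> q. if p = p0 then c (e i) else 0)"
        by (intro sum.cong) auto
      also have "\<dots> = c (e i)" using p0(2) finite_fiber[OF \<tau>, of q] by (simp add: fiber_def)
      finally show ?thesis using True by simp
    next
      case False
      then have "p \<notin> D i" if "p \<in> fiber \<tau> q" for p using that by (auto simp: fiber_def)
      then have "(\<Sum>p\<in>fiber \<tau> q. c p * indicator (D i) p) = 0" by (intro sum.neutral) simp
      then show ?thesis using False by simp
    qed
    have "weight \<tau> q = (\<Sum>p\<in>fiber \<tau> q. \<Sum>i<n. c p * indicator (D i) p)"
      unfolding weight_def sum_distrib_left[symmetric] one by simp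
    also have "\<dots> = (\<Sum>i<n. c (e i) * indicator (\<Phi> \<tau> ` D i) q)"
      by (subst sum.swap) (simp only: piece)
    finally have "ennreal (weight \<tau> q) = ennreal (\<Sum>i<n. c (e i) * indicator (\<Phi> \<tau> ` D i) q)" by simp
    also have "\<dots> = (\<Sum>i<n. ennreal (c (e i) * indicator (\<Phi> \<tau> ` D i) q))"
      using c_pos by (intro sum_ennreal[symmetric]) (simp add: less_imp_le)
    also have "\<dots> = (\<Sum>i<n. ennreal (c (e i)) * indicator (\<Phi> \<tau> ` D i) q)"
      by (intro sum.cong) (auto simp: indicator_def)
    finally show "(\<Sum>i<n. ennreal (c (e i)) * indicator (\<Phi> \<tau> ` D i) q) = ennreal (weight \<tau> q)" by simp
  qed
  finally show ?thesis .
qed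

text \<open>The two integrands on the target agree point by point, since for each \<open>q\<close>
  the weight is locally constant on the connected set \<open>T\<close>. The comparison takes place
  between nonnegative integrals, whatever the volume of the target.\<close>

lemma volume_invariant:
  assumes conn: "connected T" and \<tau>: "\<tau> \<in> T" "\<tau>' \<in> T"
  shows "(\<integral>p. c p * jac \<tau> p \<partial>riemannian_measure A g) = (\<integral>p. c p * jac \<tau>' p \<partial>riemannian_measure A g)"
proof -
  have w: "weight \<tau> q = weight \<tau>' q" for q
  proof (rule connected_local_const[OF conn \<tau>])
    show "\<forall>t\<in>T. eventually (\<lambda>t'. weight t q = weight t' q) (at t within T)"
    proof
      fix t assume "t \<in> T"
      then obtain r where r: "r > 0" "\<forall>t'\<in>ball t r. weight t' q = weight t q" using weight_locally_constant by blast
      show "eventually (\<lambda>t'. weight t q = weight t' q) (at t within T)"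
        unfolding eventually_at
      proof (intro exI[of _ r] conjI ballI impI r(1))
        fix t' assume "t' \<noteq> t \<and> dist t' t < r"
        then have "t' \<in> ball t r" by (simp add: dist_commute)
        then show "weight t q = weight t' q" by (rule bspec[OF r(2), symmetric])
      qed
    qed
  qed
  have eq: "(\<integral>p. c p * jac t p \<partial>riemannian_measure A g) = enn2real (\<integral>\<^sup>+p. ennreal (c p * jac t p) \<partial>riemannian_measure A g)" if t: "t \<in> T" for t
  proof (rule integral_eq_nn_integral)
    have "continuous_on UNIV (\<lambda>p. c p * jac t p)"
      unfolding jac_def using det_continuous[OF t] by (intro continuous_intros c_continuous)
    then show "(\<lambda>p. c p * jac t p) \<in> borel_measurable (riemannian_measure A g)"
      unfolding measurable_cong_sets[OF riemannian_measure_spec(1)[OF A] refl] by (rule borel_measurable_continuous_onI)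
    show "AE p in riemannian_measure A g. 0 \<le> c p * jac t p"
      using c_pos det[OF t] by (intro AE_I2) (simp add: jac_def less_imp_le)
  qed
  show ?thesis unfolding eq[OF \<tau>(1)] eq[OF \<tau>(2)] integral_jac_weight[OF \<tau>(1)] integral_jac_weight[OF \<tau>(2)] w ..
qed

end

section \<open>Second variation of the invariants\<close>

lemma frechet_derivative_cong_eqI:
  assumes "open S" "x \<in> S" "\<And>y. y \<in> S \<Longrightarrow> f y = k y" "(k has_derivative D) (at x)"
  shows "frechet_derivative f (at x) = D"
  by (rule frechet_derivative_eqI[OF has_derivative_transform_within_open[OF assms(4,1,2)]]) (simp add: assms(3))

lemma bounded_linear_trace: "bounded_linear (trace :: real^'n^'n \<Rightarrow> real)"
  unfolding linear_conv_bounded_linear[symmetric]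
  by (rule linearI) (simp_all add: trace_def sum.distrib sum_distrib_left)

lemma bounded_bilinear_matrix_mult: "bounded_bilinear ((**) :: real^'n^'m \<Rightarrow> real^'k^'n \<Rightarrow> real^'k^'m)"
  unfolding bilinear_conv_bounded_bilinear[symmetric] bilinear_def
  by (intro conjI allI linearI)
    (simp_all add: matrix_add_ldistrib matrix_matrix_mult_def vec_eq_iff sum.distrib sum_distrib_left algebra_simps)

lemma trace_scaleR: "trace (r *\<^sub>R M) = r * trace M" for M :: "real^'n^'n"
  by (simp add: trace_def sum_distrib_left)

lemma scaleR_mat_mult: "(r *\<^sub>R mat 1) ** M = r *\<^sub>R M" for M :: "real^'n^'n"
  by (simp flip: scalar_matrix_assoc)

lemma det_scaleR_mat: "det (r *\<^sub>R mat 1 :: real^'n^'n) = r ^ CARD('n)"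
  by (subst det_diagonal) (simp_all add: mat_def)

lemma matrix_inv_scaleR_mat: "r \<noteq> 0 \<Longrightarrow> matrix_inv (r *\<^sub>R mat 1 :: real^'n^'n) = inverse r *\<^sub>R mat 1"
  by (rule matrix_inv_unique) (simp add: scaleR_mat_mult)

text \<open>\<open>M\<close> stands for the operator of a family at one fixed point and in fixed
  charts, as a function of the parameter alone.\<close>

context
  fixes S :: "'t::euclidean_space set" and M :: "'t \<Rightarrow> real^'n^'n"
  assumes S: "open S" and M: "smooth_on S M"
begin

lemma M_der: "\<tau> \<in> S \<Longrightarrow> (M has_derivative frechet_derivative M (at \<tau>)) (at \<tau>)"
  by (rule smooth_on_has_derivative[OF M])

lemma Mb_der: "\<tau> \<in> S \<Longrightarrow> ((\<lambda>\<tau>. frechet_derivative M (at \<tau>) b) has_derivative frechet_derivative (\<lambda>\<tau>. frechet_derivative M (at \<tau>) b) (at \<tau>)) (at \<tau>)"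
  by (rule smooth_on_has_derivative[OF smooth_on_frechet[OF M]])

lemma trace_deriv:
  assumes "\<tau> \<in> S" shows "frechet_derivative (\<lambda>\<tau>. trace (M \<tau>)) (at \<tau>) b = trace (frechet_derivative M (at \<tau>) b)"
  by (rule fun_cong[OF frechet_derivative_eqI[OF bounded_linear.has_derivative[OF bounded_linear_trace M_der[OF assms]]]])

lemma trace_deriv2:
  assumes "\<tau> \<in> S"
  shows "frechet_derivative (\<lambda>\<tau>. frechet_derivative (\<lambda>\<tau>. trace (M \<tau>)) (at \<tau>) b) (at \<tau>) a
    = trace (frechet_derivative (\<lambda>\<tau>. frechet_derivative M (at \<tau>) b) (at \<tau>) a)"
  by (rule fun_cong[OF frechet_derivative_cong_eqI[OF S assms trace_deriv bounded_linear.has_derivative[OF bounded_linear_trace Mb_der[OF assms]]]])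

lemma elem2_deriv:
  assumes "\<tau> \<in> S"
  shows "frechet_derivative (\<lambda>\<tau>. elem2 (M \<tau>)) (at \<tau>) b
    = trace (M \<tau>) * trace (frechet_derivative M (at \<tau>) b) - trace (M \<tau> ** frechet_derivative M (at \<tau>) b)"
proof -
  note d = M_der[OF assms]
  note t = bounded_linear.has_derivative[OF bounded_linear_trace d]
  note m = bounded_linear.has_derivative[OF bounded_linear_trace bounded_bilinear.FDERIV[OF bounded_bilinear_matrix_mult d d]]
  have "((\<lambda>\<tau>. (1/2) * (trace (M \<tau>) * trace (M \<tau>) - trace (M \<tau> ** M \<tau>))) has_derivative
     (\<lambda>b. (1/2) * ((trace (M \<tau>) * trace (frechet_derivative M (at \<tau>) b) + trace (frechet_derivative M (at \<tau>) b) * trace (M \<tau>))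
        - trace (M \<tau> ** frechet_derivative M (at \<tau>) b + frechet_derivative M (at \<tau>) b ** M \<tau>)))) (at \<tau>)"
    by (rule has_derivative_mult_right[OF has_derivative_diff[OF has_derivative_mult[OF t t] m]])
  moreover have "elem2 (M \<tau>) = (1/2) * (trace (M \<tau>) * trace (M \<tau>) - trace (M \<tau> ** M \<tau>))" for \<tau>
    by (simp add: elem2_def power2_eq_square)
  ultimately have "((\<lambda>\<tau>. elem2 (M \<tau>)) has_derivative (\<lambda>b. (1/2) * ((trace (M \<tau>) * trace (frechet_derivative M (at \<tau>) b) + trace (frechet_derivative M (at \<tau>) b) * trace (M \<tau>))
        - trace (M \<tau> ** frechet_derivative M (at \<tau>) b + frechet_derivative M (at \<tau>) b ** M \<tau>)))) (at \<tau>)"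
    by (simp only:)
  from fun_cong[OF frechet_derivative_eqI[OF this], of b] show ?thesis
    using trace_mul_sym[of "frechet_derivative M (at \<tau>) b" "M \<tau>"] by (simp add: trace_add algebra_simps)
qed

lemma elem2_deriv2:
  fixes a b :: 't
  assumes "\<tau> \<in> S"
  defines "R \<equiv> frechet_derivative (\<lambda>\<tau>. frechet_derivative M (at \<tau>) b) (at \<tau>) a"
    and "Qa \<equiv> frechet_derivative M (at \<tau>) a" and "Qb \<equiv> frechet_derivative M (at \<tau>) b"
  shows "frechet_derivative (\<lambda>\<tau>. frechet_derivative (\<lambda>\<tau>. elem2 (M \<tau>)) (at \<tau>) b) (at \<tau>) a
    = trace Qa * trace Qb + trace (M \<tau>) * trace R - (trace (M \<tau> ** R) + trace (Qa ** Qb))"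
proof -
  note d = M_der[OF assms(1)] and d2 = Mb_der[OF assms(1), of b]
  note t = bounded_linear.has_derivative[OF bounded_linear_trace]
  note m = t[OF bounded_bilinear.FDERIV[OF bounded_bilinear_matrix_mult d d2]]
  have "((\<lambda>\<tau>. trace (M \<tau>) * trace (frechet_derivative M (at \<tau>) b) - trace (M \<tau> ** frechet_derivative M (at \<tau>) b)) has_derivative
     (\<lambda>a. (trace (M \<tau>) * trace (frechet_derivative (\<lambda>\<tau>. frechet_derivative M (at \<tau>) b) (at \<tau>) a) + trace (frechet_derivative M (at \<tau>) a) * trace (frechet_derivative M (at \<tau>) b))
       - trace (M \<tau> ** frechet_derivative (\<lambda>\<tau>. frechet_derivative M (at \<tau>) b) (at \<tau>) a + frechet_derivative M (at \<tau>) a ** frechet_derivative M (at \<tau>) b))) (at \<tau>)"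
    by (rule has_derivative_diff[OF has_derivative_mult[OF t[OF d] t[OF d2]] m])
  from fun_cong[OF frechet_derivative_cong_eqI[OF S assms(1) elem2_deriv this], of a]
  show ?thesis by (simp add: R_def Qa_def Qb_def trace_add)
qed

context
  assumes pos: "\<And>\<tau>. \<tau> \<in> S \<Longrightarrow> det (M \<tau>) > 0"
begin

lemma sqrt_det_has_derivative:
  assumes "\<tau> \<in> S"
  shows "((\<lambda>\<tau>. sqrt (det (M \<tau>))) has_derivative (\<lambda>b. sqrt (det (M \<tau>)) / 2 * trace (matrix_inv (M \<tau>) ** frechet_derivative M (at \<tau>) b))) (at \<tau>)"
proof -
  have p: "det (M \<tau>) > 0" by (rule pos[OF assms])
  have "((\<lambda>\<tau>. det (M \<tau>)) has_derivative (\<lambda>b. det (M \<tau>) * trace (matrix_inv (M \<tau>) ** frechet_derivative M (at \<tau>) b))) (at \<tau>)"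
    by (rule has_derivative_compose[OF M_der[OF assms] has_derivative_det]) (use p in simp)
  from has_derivative_real_sqrt[OF p this]
  have "((\<lambda>\<tau>. sqrt (det (M \<tau>))) has_derivative (\<lambda>b. det (M \<tau>) * trace (matrix_inv (M \<tau>) ** frechet_derivative M (at \<tau>) b) * (inverse (sqrt (det (M \<tau>))) / 2))) (at \<tau>)"
    by simp
  moreover have e: "det (M \<tau>) * inverse (sqrt (det (M \<tau>))) = sqrt (det (M \<tau>))"
    using p by (metis divide_inverse less_imp_le real_div_sqrt)
  have "det (M \<tau>) * x * (inverse (sqrt (det (M \<tau>))) / 2) = (det (M \<tau>) * inverse (sqrt (det (M \<tau>)))) / 2 * x" for x
    by simp
  then have "det (M \<tau>) * x * (inverse (sqrt (det (M \<tau>))) / 2) = sqrt (det (M \<tau>)) / 2 * x" for x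
    by (simp only: e)
  ultimately show ?thesis by (simp only:)
qed

lemma sqrt_det_deriv:
  assumes "\<tau> \<in> S"
  shows "frechet_derivative (\<lambda>\<tau>. sqrt (det (M \<tau>))) (at \<tau>) b = sqrt (det (M \<tau>)) / 2 * trace (matrix_inv (M \<tau>) ** frechet_derivative M (at \<tau>) b)"
  by (rule fun_cong[OF frechet_derivative_eqI[OF sqrt_det_has_derivative[OF assms]]])

text \<open>The evaluation takes place at a multiple of the identity, whose inverse is again one. In
  the application \<open>l\<close> is the square of the dilation. The factor \<open>l^2\<close>
  clears the denominators that arise from differentiating the inverse.\<close>

lemma sqrt_det_deriv2:
  fixes a b :: 't
  assumes \<tau>: "\<tau> \<in> S" and l: "l > 0" "M \<tau> = l *\<^sub>R mat 1"
  defines "R \<equiv> frechet_derivative (\<lambda>\<tau>. frechet_derivative M (at \<tau>) b) (at \<tau>) a"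
    and "Qa \<equiv> frechet_derivative M (at \<tau>) a" and "Qb \<equiv> frechet_derivative M (at \<tau>) b"
  shows "l\<^sup>2 * frechet_derivative (\<lambda>\<tau>. frechet_derivative (\<lambda>\<tau>. sqrt (det (M \<tau>))) (at \<tau>) b) (at \<tau>) a
    = sqrt (det (M \<tau>)) / 2 * (trace Qa * trace Qb / 2 - trace (Qa ** Qb) + l * trace R)"
proof -
  define N where "N = (\<lambda>\<tau>. matrix_inv (M \<tau>))"
  note N = smooth_on_has_derivative[OF smooth_on_matrix_inv[OF S M pos] \<tau>, folded N_def]
  define Na where "Na = frechet_derivative N (at \<tau>) a"
  define J where "J = sqrt (det (M \<tau>))"
  note d = M_der[OF \<tau>] and d2 = Mb_der[OF \<tau>, of b]
  have N0: "N \<tau> = inverse l *\<^sub>R mat 1" unfolding N_def l(2) by (rule matrix_inv_scaleR_mat) (use l in simp)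
  \<comment> \<open>Differentiating \<open>M \<tau> ** N \<tau> = mat 1\<close> determines the
    derivative of the inverse; at a scalar matrix the result is Qa = - l^2 Na.\<close>
  have "((\<lambda>\<tau>. M \<tau> ** N \<tau>) has_derivative (\<lambda>a. M \<tau> ** frechet_derivative N (at \<tau>) a + frechet_derivative M (at \<tau>) a ** N \<tau>)) (at \<tau>)"
    by (rule bounded_bilinear.FDERIV[OF bounded_bilinear_matrix_mult d N])
  moreover have "((\<lambda>\<tau>. M \<tau> ** N \<tau>) has_derivative (\<lambda>a. 0)) (at \<tau>)"
    by (rule has_derivative_transform_within_open[OF has_derivative_const S \<tau>, of "mat 1"])
       (use pos in \<open>force simp: N_def matrix_inv_cancel\<close>)
  ultimately have "M \<tau> ** frechet_derivative N (at \<tau>) a + frechet_derivative M (at \<tau>) a ** N \<tau> = 0"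
    by (rule fun_cong[OF has_derivative_unique])
  then have "l *\<^sub>R Na + inverse l *\<^sub>R Qa = 0"
    unfolding Na_def Qa_def l(2) N0 by (simp add: scaleR_mat_mult matrix_scalar_ac flip: scalar_matrix_assoc)
  then have "l *\<^sub>R (l *\<^sub>R Na + inverse l *\<^sub>R Qa) = 0" by simp
  then have "l\<^sup>2 *\<^sub>R Na + Qa = 0" using l(1) by (simp add: scaleR_add_right power2_eq_square)
  then have Na: "Qa = - (l\<^sup>2 *\<^sub>R Na)" by (simp add: add_eq_0_iff)
  note t = bounded_linear.has_derivative[OF bounded_linear_trace bounded_bilinear.FDERIV[OF bounded_bilinear_matrix_mult N d2]]
  note j = has_derivative_mult[OF has_derivative_mult_right[OF sqrt_det_has_derivative[OF \<tau>], of "1/2"] t]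
  have k: "frechet_derivative (\<lambda>\<tau>. sqrt (det (M \<tau>))) (at t) b = 1 / 2 * sqrt (det (M t)) * trace (N t ** frechet_derivative M (at t) b)"
    if "t \<in> S" for t using that by (simp add: sqrt_det_deriv N_def)
  have "frechet_derivative (\<lambda>\<tau>. frechet_derivative (\<lambda>\<tau>. sqrt (det (M \<tau>))) (at \<tau>) b) (at \<tau>) a
    = (1/2) * J * trace (N \<tau> ** R + Na ** Qb) + (1/2) * (J / 2 * trace (N \<tau> ** Qa)) * trace (N \<tau> ** Qb)"
    using fun_cong[OF frechet_derivative_cong_eqI[OF S \<tau> k j], of a]
    by (simp add: R_def Qa_def Qb_def Na_def J_def N_def)
  moreover have "trace (N \<tau> ** X) = inverse l * trace X" for X :: "real^'n^'n"
    by (simp add: N0 scaleR_mat_mult trace_scaleR)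
  moreover have "trace (Qa ** Qb) = - l\<^sup>2 * trace (Na ** Qb)"
  proof -
    have "Qa ** Qb = (- (l\<^sup>2)) *\<^sub>R (Na ** Qb)" by (simp add: Na flip: scalar_matrix_assoc scaleR_minus_left)
    then show ?thesis by (simp only: trace_scaleR)
  qed
  ultimately show ?thesis
    unfolding J_def[symmetric] using l(1) by (simp add: trace_add power2_eq_square field_simps)
qed

end

end

text \<open>Here \<open>l\<close> is the dilation itself, and \<open>c\<close> is \<lambda>^(4-n),
  written as a quotient since the exponent may be negative. In the last two claims \<open>a\<close>
  and \<open>b\<close> share their first derivative, as happens for equal variation fields, so
  products of first derivatives become squares. The second claim drops (tr Q)^2 / 2; in the third
  the symmetric form \<open>P\<close> gives access to Cauchy--Schwarz.\<close>

lemma second_variation_inequalities: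
  fixes M :: "'t::euclidean_space \<Rightarrow> real^'n^'n" and G :: "real^'n^'n"
  assumes S: "open S" and M: "smooth_on S M" and pos: "\<And>\<tau>. \<tau> \<in> S \<Longrightarrow> det (M \<tau>) > 0" and \<tau>: "\<tau> \<in> S"
    and l: "l > 0" "M \<tau> = l\<^sup>2 *\<^sub>R mat 1"
  defines "c \<equiv> l ^ 4 / l ^ CARD('n)"
    and "der \<equiv> \<lambda>I b. frechet_derivative (\<lambda>\<tau>. I (M \<tau>)) (at \<tau>) b"
    and "der2 \<equiv> \<lambda>I b a. frechet_derivative (\<lambda>\<tau>. frechet_derivative (\<lambda>\<tau>. I (M \<tau>)) (at \<tau>) b) (at \<tau>) a"
  shows "der elem2 b = 2 * (real CARD('n) - 1) * (c * der (\<lambda>A. sqrt (det A)) b)"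
    and "frechet_derivative M (at \<tau>) a = frechet_derivative M (at \<tau>) b \<Longrightarrow>
      der2 elem2 b a \<ge> 2 * (c * der2 (\<lambda>A. sqrt (det A)) b a) + (real CARD('n) - 2) * (l\<^sup>2 * der2 trace b a)"
    and "frechet_derivative M (at \<tau>) a = frechet_derivative M (at \<tau>) b \<Longrightarrow>
      frechet_derivative M (at \<tau>) b = matrix_inv G ** P \<Longrightarrow> posdef G \<Longrightarrow> transpose P = P \<Longrightarrow> CARD('n) \<le> 4 \<Longrightarrow>
      der2 elem2 b a \<ge> 2 * (real CARD('n) - 1) * (c * der2 (\<lambda>A. sqrt (det A)) b a)"
proof -
  define n where "n = real CARD('n)"
  have l2: "l\<^sup>2 > 0" using l by simp
  define Q where "Q = frechet_derivative M (at \<tau>) b"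
  define R where "R = frechet_derivative (\<lambda>\<tau>. frechet_derivative M (at \<tau>) b) (at \<tau>) a"
  have J: "sqrt (det (M \<tau>)) = l ^ CARD('n)"
    unfolding l(2) det_scaleR_mat real_sqrt_power using l(1) by simp
  have cJ: "c * l ^ CARD('n) = l ^ 4" using l(1) by (simp add: c_def)
  have l4: "l ^ 4 = l\<^sup>2 * l\<^sup>2" by (simp add: power4_eq_xxxx power2_eq_square)
  have trM: "trace (M \<tau>) = n * l\<^sup>2" by (simp add: l(2) trace_scaleR trace_I n_def)
  have trMX: "trace (M \<tau> ** X) = l\<^sup>2 * trace X" for X by (simp add: l(2) scaleR_mat_mult trace_scaleR)
  have "der elem2 b = (n - 1) * (l\<^sup>2 * trace Q)"
    unfolding der_def elem2_deriv[OF S M \<tau>] trM trMX Q_def by (simp add: algebra_simps)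
  moreover have "der (\<lambda>A. sqrt (det A)) b = sqrt (det (M \<tau>)) / 2 * trace (matrix_inv (M \<tau>) ** Q)"
    unfolding der_def Q_def by (rule sqrt_det_deriv[OF S M pos \<tau>])
  then have "l\<^sup>2 * der (\<lambda>A. sqrt (det A)) b = l ^ CARD('n) / 2 * trace Q"
    unfolding J using l2 by (simp add: l(2) matrix_inv_scaleR_mat scaleR_mat_mult trace_scaleR) (simp add: field_simps)
  then have "l\<^sup>2 * (c * der (\<lambda>A. sqrt (det A)) b) = (c * l ^ CARD('n)) / 2 * trace Q" by (simp add: mult_ac)
  then have "l\<^sup>2 * (c * der (\<lambda>A. sqrt (det A)) b) = l\<^sup>2 * (l\<^sup>2 / 2 * trace Q)" unfolding cJ l4 by (simp only: mult.assoc times_divide_eq_right times_divide_eq_left)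
  then have "c * der (\<lambda>A. sqrt (det A)) b = l\<^sup>2 / 2 * trace Q"
    by (rule mult_left_cancel[THEN iffD1, rotated]) (use l2 in simp)
  ultimately show "der elem2 b = 2 * (real CARD('n) - 1) * (c * der (\<lambda>A. sqrt (det A)) b)"
    unfolding n_def by (simp only:)
  assume ab: "frechet_derivative M (at \<tau>) a = frechet_derivative M (at \<tau>) b"
  define q where "q = trace (Q ** Q)"
  have e2: "der2 elem2 b a = (trace Q)\<^sup>2 - q + (n - 1) * (l\<^sup>2 * trace R)"
    unfolding der2_def elem2_deriv2[OF S M \<tau>] trM trMX ab
    unfolding Q_def[symmetric] R_def[symmetric] q_def by (simp add: algebra_simps power2_eq_square)
  have "(l\<^sup>2)\<^sup>2 * der2 (\<lambda>A. sqrt (det A)) b a = l ^ CARD('n) / 2 * ((trace Q)\<^sup>2 / 2 - q + l\<^sup>2 * trace R)"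
    using sqrt_det_deriv2[OF S M pos \<tau> l2 l(2), of b a] unfolding J ab
    unfolding Q_def[symmetric] R_def[symmetric] q_def der2_def by (simp add: power2_eq_square)
  then have "(l\<^sup>2)\<^sup>2 * (c * der2 (\<lambda>A. sqrt (det A)) b a) = (c * l ^ CARD('n)) / 2 * ((trace Q)\<^sup>2 / 2 - q + l\<^sup>2 * trace R)"
    by (simp add: mult_ac)
  then have "(l\<^sup>2)\<^sup>2 * (c * der2 (\<lambda>A. sqrt (det A)) b a) = (l\<^sup>2)\<^sup>2 * (((trace Q)\<^sup>2 / 2 - q + l\<^sup>2 * trace R) / 2)"
    by (simp add: cJ)
  then have J2: "c * der2 (\<lambda>A. sqrt (det A)) b a = ((trace Q)\<^sup>2 / 2 - q + l\<^sup>2 * trace R) / 2"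
    using l2 by (metis mult_left_cancel less_irrefl zero_less_power)
  have t2: "der2 trace b a = trace R" unfolding der2_def trace_deriv2[OF S M \<tau>] R_def ..
  show "der2 elem2 b a \<ge> 2 * (c * der2 (\<lambda>A. sqrt (det A)) b a) + (real CARD('n) - 2) * (l\<^sup>2 * der2 trace b a)"
    unfolding e2 J2 t2 n_def[symmetric] using zero_le_power2[of "trace Q"] by (simp add: field_simps)
  assume G: "frechet_derivative M (at \<tau>) b = matrix_inv G ** P" "posdef G" "transpose P = P" and n4: "CARD('n) \<le> 4"
  have cs: "(trace Q)\<^sup>2 \<le> n * q"
    using trace_square_ge[OF G(2,3)] unfolding Q_def q_def G(1) n_def .
  have n: "n \<ge> 1" "n \<le> 4" using n4 by (auto simp: n_def)
  have nn: "n \<in> {1, 2, 3, 4}"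
  proof -
    have "CARD('n) > 0" by simp
    with n4 have "CARD('n) = 1 \<or> CARD('n) = 2 \<or> CARD('n) = 3 \<or> CARD('n) = 4" by arith
    then show ?thesis unfolding n_def by auto
  qed
  \<comment> \<open>For n = 4 this is exactly the Cauchy--Schwarz inequality \<open>cs\<close>, and
    for n > 4 it fails at nonzero multiples of the identity. For n = 3 it says q \<ge> 0 and for n =
    2 that a square is nonnegative. For n = 1 the coefficient of \<open>q\<close> is negative, but
    there \<open>q\<close> equals (tr Q)^2.\<close>
  have "(n - 2) * q - (n - 3) / 2 * (trace Q)\<^sup>2 \<ge> 0"
  proof -
    have t0: "(trace Q)\<^sup>2 \<ge> 0" by simp
    show ?thesis using nn
    proof (elim insertE emptyE)
      assume n1: "n = 1"
      have "CARD('n) = 1" using n1 by (simp add: n_def)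
      then obtain i :: 'n where i: "UNIV = {i}" by (metis card_1_singletonE)
      have "q = (trace Q)\<^sup>2" unfolding q_def trace_def matrix_matrix_mult_def by (simp add: i power2_eq_square)
      then show ?thesis using n1 by simp
    next
      assume "n = 2" then show ?thesis using t0 by simp
    next
      assume "n = 3" then show ?thesis using order_trans[OF t0 cs] by simp
    next
      assume "n = 4" then show ?thesis using cs by simp
    qed
  qed
  then show "der2 elem2 b a \<ge> 2 * (real CARD('n) - 1) * (c * der2 (\<lambda>A. sqrt (det A)) b a)"
    unfolding e2 J2 n_def[symmetric] by (simp add: field_simps)
qed

section \<open>Homothetic local diffeomorphisms\<close>

text \<open>In charts the map becomes a continuous injection of a nonempty open set, to which
  invariance of dimension applies.\<close>

lemma card_le_of_injective:
  fixes A :: "('m::{t2_space, second_countable_topology}, 'a::finite) chart set"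
    and B :: "('n::{t2_space, second_countable_topology}, 'b::finite) chart set" and f :: "'m \<Rightarrow> 'n"
  assumes A: "smooth_atlas A" and B: "smooth_atlas B" and S: "open S" "p \<in> S"
    and f: "continuous_on S f" "inj_on f S"
  shows "CARD('a) \<le> CARD('b)"
proof -
  define \<kappa> where "\<kappa> = chart_at A p"
  define \<kappa>' where "\<kappa>' = chart_at B (f p)"
  have k: "\<kappa> \<in> A" "p \<in> fst \<kappa>" and k': "\<kappa>' \<in> B" "f p \<in> fst \<kappa>'"
    using chart_at_props[OF A] chart_at_props[OF B] by (auto simp: \<kappa>_def \<kappa>'_def)
  note c = chart_props[OF A k(1)] and c' = chart_props[OF B k'(1)]
  define V where "V = S \<inter> f -` fst \<kappa>'"
  have V: "open V" unfolding V_def by (rule continuous_open_preimage[OF f(1) S(1) c'(1)])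
  define O' where "O' = snd \<kappa> ` (fst \<kappa> \<inter> V)"
  have O': "open O'" unfolding O'_def by (rule chart_open_image[OF A k(1) V])
  have OV: "chart_inv \<kappa> x \<in> V" "snd \<kappa> (chart_inv \<kappa> x) = x" "x \<in> snd \<kappa> ` fst \<kappa>" if "x \<in> O'" for x
    using that c(3) by (auto simp: O'_def)
  define u where "u = snd \<kappa>' \<circ> (f \<circ> chart_inv \<kappa>)"
  have im: "chart_inv \<kappa> ` O' \<subseteq> S" using OV(1) by (auto simp: V_def)
  have im': "(f \<circ> chart_inv \<kappa>) ` O' \<subseteq> fst \<kappa>'" using OV(1) by (auto simp: V_def)
  have O'sub: "O' \<subseteq> snd \<kappa> ` fst \<kappa>" using OV(3) by blast
  have "continuous_on O' u" unfolding u_def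
    by (rule continuous_on_compose[OF continuous_on_compose[OF continuous_on_subset[OF c(7) O'sub] continuous_on_subset[OF f(1) im]] continuous_on_subset[OF c'(6) im']])
  moreover have "inj_on u O'"
  proof (rule inj_onI)
    fix x y assume xy: "x \<in> O'" "y \<in> O'" "u x = u y"
    have "f (chart_inv \<kappa> x) = f (chart_inv \<kappa> y)"
      using xy(3) OV(1)[OF xy(1)] OV(1)[OF xy(2)] by (intro inj_onD[OF c'(8)]) (simp_all add: u_def V_def)
    then have "chart_inv \<kappa> x = chart_inv \<kappa> y"
      by (rule inj_onD[OF f(2)]) (use OV(1)[OF xy(1)] OV(1)[OF xy(2)] in \<open>simp_all add: V_def\<close>)
    then show "x = y" using OV(2)[OF xy(1)] OV(2)[OF xy(2)] by metis
  qed
  moreover have "snd \<kappa> p \<in> O'" using k k' S by (simp add: O'_def V_def)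
  then have "O' \<noteq> {}" by blast
  ultimately have "DIM(real^'a) \<le> DIM(real^'b)" using invariance_of_dimension[OF _ O'] by blast
  then show ?thesis by simp
qed

text \<open>The map and its local inverse are both continuous and injective on open sets, so each
  dimension bounds the other. The point \<open>undefined\<close> is an arbitrary one.\<close>

lemma local_diffeomorphism_card:
  fixes A :: "('m::{t2_space, second_countable_topology}, 'a::finite) chart set"
    and B :: "('n::{t2_space, second_countable_topology}, 'b::finite) chart set"
  assumes A: "smooth_atlas A" and B: "smooth_atlas B" and \<phi>: "local_diffeomorphism A B \<phi>"
  shows "CARD('a) = CARD('b)"
proof -
  obtain S where S: "open S" "undefined \<in> S" "open (\<phi> ` S)" "inj_on \<phi> S" "smooth_map_on A B S \<phi>" "smooth_map_on B A (\<phi> ` S) (inv_into S \<phi>)"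
    using \<phi> unfolding local_diffeomorphism_def by blast
  have "continuous_on S \<phi>" "continuous_on (\<phi> ` S) (inv_into S \<phi>)"
    using S(5,6) by (simp_all add: smooth_map_on_def)
  moreover have "\<phi> undefined \<in> \<phi> ` S" using S(2) by (rule imageI)
  ultimately show ?thesis
    using card_le_of_injective[OF A B S(1,2) _ S(4)] card_le_of_injective[OF B A S(3) _ _ inj_on_inv_into[OF order_refl]] by (intro antisym) auto
qed

lemma local_diffeomorphism_smooth:
  assumes A: "smooth_atlas A" and B: "smooth_atlas B" and \<phi>: "local_diffeomorphism A B \<phi>"
  shows "smooth_map_on A B UNIV \<phi>"
proof -
  have ex: "\<exists>S. open S \<and> p \<in> S \<and> smooth_map_on A B S \<phi>" for p
    using \<phi> unfolding local_diffeomorphism_def by blast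
  have cont: "continuous_on UNIV \<phi>"
  proof (rule continuous_at_imp_continuous_on, rule ballI)
    fix p
    obtain S where S: "open S" "p \<in> S" "smooth_map_on A B S \<phi>" using ex by blast
    then have "continuous_on S \<phi>" by (simp add: smooth_map_on_def)
    then show "isCont \<phi> p" using S(1,2) by (simp add: continuous_on_eq_continuous_at)
  qed
  show ?thesis unfolding smooth_map_on_def
  proof (intro conjI cont ballI smooth_on_local)
    fix \<kappa> \<kappa>' x assume k: "\<kappa> \<in> A" "\<kappa>' \<in> B" and x: "x \<in> snd \<kappa> ` (fst \<kappa> \<inter> UNIV \<inter> \<phi> -` fst \<kappa>')"
    then obtain p where p: "p \<in> fst \<kappa>" "\<phi> p \<in> fst \<kappa>'" "x = snd \<kappa> p" by auto
    obtain S where S: "open S" "p \<in> S" "smooth_map_on A B S \<phi>" using ex by blast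
    let ?U = "snd \<kappa> ` (fst \<kappa> \<inter> S \<inter> \<phi> -` fst \<kappa>')"
    have "open ?U" unfolding Int_assoc
      by (rule chart_open_image[OF A k(1) open_Int[OF S(1) open_vimage[OF chart_props(1)[OF B k(2)] cont]]])
    moreover have "x \<in> ?U" using p S(2) by blast
    moreover have "smooth_on ?U (snd \<kappa>' \<circ> \<phi> \<circ> chart_inv \<kappa>)" using S(3) k unfolding smooth_map_on_def by blast
    ultimately show "\<exists>U. open U \<and> x \<in> U \<and> smooth_on U (snd \<kappa>' \<circ> \<phi> \<circ> chart_inv \<kappa>)" by blast
  qed
qed

text \<open>The Gram matrix is invertible, so a zero gradient means zero partial derivatives, and
  \<open>f\<close> is constant on a coordinate ball.\<close>

lemma gradient_zero_locally_constant:
  assumes A: "riemannian_manifold A g" and f: "smooth_function A f"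
    and gr: "\<And>\<kappa> p. \<kappa> \<in> A \<Longrightarrow> p \<in> fst \<kappa> \<Longrightarrow> gradient g f \<kappa> p = 0"
  shows "\<exists>V. open V \<and> p \<in> V \<and> (\<forall>q\<in>V. f q = f p)"
proof -
  have g: "smooth_atlas A" "riemannian_metric A g" using A by (auto simp: riemannian_manifold_def)
  define \<kappa> where "\<kappa> = chart_at A p"
  have k: "\<kappa> \<in> A" "p \<in> fst \<kappa>" using chart_at_props[OF g(1)] by (auto simp: \<kappa>_def)
  note c = chart_props[OF g(1) k(1)]
  let ?u = "f \<circ> chart_inv \<kappa>"
  have sm: "smooth_on (snd \<kappa> ` fst \<kappa>) ?u" using f k(1) unfolding smooth_function_def by blast
  have zero: "(?u has_derivative (\<lambda>v. 0)) (at x)" if x: "x \<in> snd \<kappa> ` fst \<kappa>" for x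
  proof -
    have d: "(?u has_derivative frechet_derivative ?u (at x)) (at x)" by (rule smooth_on_has_derivative[OF sm x])
    let ?G = "g \<kappa> (chart_inv \<kappa> x)" and ?w = "\<chi> j. frechet_derivative ?u (at x) (axis j 1)"
    have "matrix_inv ?G *v ?w = 0"
      using gr[OF k(1) c(5)[OF x]] by (simp add: gradient_def c(4)[OF x])
    moreover have "?G ** matrix_inv ?G = mat 1"
      using metric_props(3)[OF g(2) k(1) c(5)[OF x]] by (intro matrix_inv_cancel) simp
    ultimately have "?w = 0" by (metis matrix_vector_mul_assoc matrix_vector_mul_lid matrix_vector_mult_0_right)
    then have ax: "frechet_derivative ?u (at x) (axis j 1) = 0" for j by (simp add: vec_eq_iff)
    have "frechet_derivative ?u (at x) v = 0" for v
    proof -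
      have "frechet_derivative ?u (at x) (\<Sum>j\<in>UNIV. v $ j *\<^sub>R axis j 1) = 0"
        by (simp only: linear_sum[OF has_derivative_linear[OF d]] linear_scale[OF has_derivative_linear[OF d]] ax scaleR_zero_right sum.neutral_const)
      then show ?thesis using basis_expansion[of v] by (simp add: scalar_mult_eq_scaleR)
    qed
    then have "frechet_derivative ?u (at x) = (\<lambda>v. 0)" by (rule ext)
    with d show ?thesis by simp
  qed
  obtain r where r: "r > 0" "ball (snd \<kappa> p) r \<subseteq> snd \<kappa> ` fst \<kappa>" using c(2) k(2) open_contains_ball by blast
  have "\<exists>a. \<forall>x\<in>ball (snd \<kappa> p) r. ?u x = a"
    by (rule has_derivative_zero_constant[OF convex_ball]) (use zero r(2) in \<open>blast intro: has_derivative_at_withinI\<close>)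
  then obtain a where a: "\<forall>x\<in>ball (snd \<kappa> p) r. ?u x = a" ..
  have fa: "f q = a" if "q \<in> fst \<kappa>" "snd \<kappa> q \<in> ball (snd \<kappa> p) r" for q
    using bspec[OF a that(2)] c(3)[OF that(1)] by simp
  show ?thesis
  proof (intro exI conjI ballI)
    show "open (fst \<kappa> \<inter> snd \<kappa> -` ball (snd \<kappa> p) r)" by (rule continuous_open_preimage[OF c(6) c(1) open_ball])
    show "p \<in> fst \<kappa> \<inter> snd \<kappa> -` ball (snd \<kappa> p) r" using k(2) r(1) by simp
    fix q assume "q \<in> fst \<kappa> \<inter> snd \<kappa> -` ball (snd \<kappa> p) r"
    then show "f q = f p" using fa[of q] fa[of p] k(2) r(1) by simp
  qed
qed

lemma map_op_conformal:
  assumes A: "riemannian_manifold A g" and B: "riemannian_manifold B h"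
    and conf: "\<And>\<kappa> \<kappa>' p. \<kappa> \<in> A \<Longrightarrow> \<kappa>' \<in> B \<Longrightarrow> p \<in> fst \<kappa> \<inter> \<phi> -` fst \<kappa>' \<Longrightarrow> pullback_metric h \<kappa> \<kappa>' \<phi> p = (l p)\<^sup>2 *\<^sub>R g \<kappa> p"
    and k: "\<kappa> \<in> A" "\<kappa>' \<in> B" "p \<in> fst \<kappa>" "\<phi> p \<in> fst \<kappa>'"
  shows "pullback_op g h \<kappa> \<kappa>' \<phi> p = (l p)\<^sup>2 *\<^sub>R mat 1"
proof -
  have "riemannian_metric A g" using A by (simp add: riemannian_manifold_def)
  from metric_props(3)[OF this k(1,3)] have "matrix_inv (g \<kappa> p) ** g \<kappa> p = mat 1" by (intro matrix_inv_cancel) simp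
  moreover have "pullback_metric h \<kappa> \<kappa>' \<phi> p = (l p)\<^sup>2 *\<^sub>R g \<kappa> p" using conf k by simp
  ultimately show ?thesis by (simp add: pullback_op_def matrix_scalar_ac flip: scalar_matrix_assoc)
qed

section \<open>Slices of smooth families\<close>

text \<open>\<open>G\<close> is the expression of \<open>F\<close> at the fixed point
  \<open>p\<close> in fixed charts, valid on an open set \<open>S\<close> of parameters. The matrix
  calculus is done for \<open>G\<close>; this transfers its first and second derivatives to the
  globally defined \<open>F\<close>.\<close>

lemma dir_deriv_slice:
  fixes T :: "'t::euclidean_space set"
  assumes A: "smooth_atlas A" and T: "open T" and F: "smooth_functions T A F"
    and S: "open S" "S \<subseteq> T" and eq: "\<And>\<tau>. \<tau> \<in> S \<Longrightarrow> F \<tau> p = G \<tau>" and \<tau>: "\<tau> \<in> S"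
  shows "frechet_derivative G (at \<tau>) b = dir_deriv F b \<tau> p"
    and "frechet_derivative (\<lambda>\<tau>. frechet_derivative G (at \<tau>) b) (at \<tau>) a = dir_deriv (dir_deriv F b) a \<tau> p"
proof -
  have 1: "frechet_derivative G (at t) b = dir_deriv F b t p" if t: "t \<in> S" for t b
  proof -
    have "t \<in> T" using t S(2) by blast
    note d = smooth_functions_has_derivative[OF A F this, of p]
    show ?thesis
      by (rule fun_cong[OF frechet_derivative_cong_eqI[OF S(1) t eq[symmetric] d]])
  qed
  then show "frechet_derivative G (at \<tau>) b = dir_deriv F b \<tau> p" using \<tau> by blast
  have "\<tau> \<in> T" using \<tau> S(2) by blast
  note d = smooth_functions_has_derivative[OF A smooth_functions_dir_deriv[OF A T F] this, of b p]
  show "frechet_derivative (\<lambda>\<tau>. frechet_derivative G (at \<tau>) b) (at \<tau>) a = dir_deriv (dir_deriv F b) a \<tau> p"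
    by (rule fun_cong[OF frechet_derivative_cong_eqI[OF S(1) \<tau> 1 d]])
qed

lemma smooth_functions_cmult:
  fixes T :: "'t::euclidean_space set"
  assumes A: "smooth_atlas A" and T: "open T" and F: "smooth_functions T A F"
    and c: "\<And>p. \<exists>V. open V \<and> p \<in> V \<and> (\<forall>q\<in>V. c q = c p)"
  shows "smooth_functions T A (\<lambda>\<tau> p. c p * F \<tau> p)"
    and "\<tau> \<in> T \<Longrightarrow> dir_deriv (\<lambda>\<tau> p. c p * F \<tau> p) b \<tau> p = c p * dir_deriv F b \<tau> p"
proof -
  show "smooth_functions T A (\<lambda>\<tau> p. c p * F \<tau> p)" unfolding smooth_functions_def
  proof (intro ballI smooth_on_local)
    fix \<kappa> z assume k: "\<kappa> \<in> A" and z: "z \<in> T \<times> snd \<kappa> ` fst \<kappa>"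
    note ch = chart_props[OF A k]
    obtain t q where tq: "t \<in> T" "q \<in> fst \<kappa>" "z = (t, snd \<kappa> q)" using z by auto
    obtain V where V: "open V" "q \<in> V" "\<forall>q'\<in>V. c q' = c q" using c by blast
    let ?U = "T \<times> snd \<kappa> ` (fst \<kappa> \<inter> V)"
    have op: "open ?U" by (rule open_Times[OF T chart_open_image[OF A k V(1)]])
    have sub: "?U \<subseteq> T \<times> snd \<kappa> ` fst \<kappa>" by blast
    have F': "smooth_on (T \<times> snd \<kappa> ` fst \<kappa>) (\<lambda>(t, x). F t (chart_inv \<kappa> x))" using F k unfolding smooth_functions_def by blast
    have "smooth_on ?U (\<lambda>z. c q * (\<lambda>(t, x). F t (chart_inv \<kappa> x)) z)"
      by (rule smooth_on_mult[OF op smooth_on_const smooth_on_subset[OF F' sub]])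
    then have "smooth_on ?U (\<lambda>(t, x). c (chart_inv \<kappa> x) * F t (chart_inv \<kappa> x))"
    proof (rule smooth_on_cong[OF op, rotated])
      fix z assume "z \<in> ?U"
      then obtain t q' where "z = (t, snd \<kappa> q')" "q' \<in> fst \<kappa>" "q' \<in> V" by auto
      then show "c q * (\<lambda>(t, x). F t (chart_inv \<kappa> x)) z = (case z of (t, x) \<Rightarrow> c (chart_inv \<kappa> x) * F t (chart_inv \<kappa> x))"
        using bspec[OF V(3), of q'] ch(3)[of q'] by simp
    qed
    moreover have "z \<in> ?U" using tq V(2) by blast
    ultimately show "\<exists>U. open U \<and> z \<in> U \<and> smooth_on U (\<lambda>(t, x). c (chart_inv \<kappa> x) * F t (chart_inv \<kappa> x))"
      using op by blast
  qed
  show "\<tau> \<in> T \<Longrightarrow> dir_deriv (\<lambda>\<tau> p. c p * F \<tau> p) b \<tau> p = c p * dir_deriv F b \<tau> p"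
    using fun_cong[OF frechet_derivative_eqI[OF has_derivative_mult_right[OF smooth_functions_has_derivative[OF A F], of \<tau> "c p" p]], of b]
    by (simp add: dir_deriv_def)
qed

lemma bounded_linear_transpose: "bounded_linear (transpose :: real^'n^'m \<Rightarrow> real^'m^'n)"
  unfolding linear_conv_bounded_linear[symmetric]
  by (rule linearI) (simp_all add: transpose_def vec_eq_iff)

lemma slice_open:
  assumes A: "smooth_atlas A" and B: "smooth_atlas B" and T: "open T" and \<Phi>: "smooth_family T A B \<Phi>" and k: "\<kappa>' \<in> B"
  shows "open {\<tau>\<in>T. \<Phi> \<tau> p \<in> fst \<kappa>'}"
proof -
  have "continuous_on T (\<lambda>t. (t, p))" by (intro continuous_intros)
  then have "continuous_on T (\<lambda>t. (\<lambda>(t, p). \<Phi> t p) (t, p))"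
    by (rule continuous_on_compose2[OF smooth_family_props(1)[OF \<Phi>]]) auto
  then have "continuous_on T (\<lambda>t. \<Phi> t p)" by simp
  from continuous_open_preimage[OF this T chart_props(1)[OF B k]]
  have "open (T \<inter> (\<lambda>t. \<Phi> t p) -` fst \<kappa>')" .
  moreover have "T \<inter> (\<lambda>t. \<Phi> t p) -` fst \<kappa>' = {\<tau>\<in>T. \<Phi> \<tau> p \<in> fst \<kappa>'}" by auto
  ultimately show ?thesis by simp
qed

lemma smooth_on_slice:
  fixes f :: "'t::euclidean_space \<times> 'b::euclidean_space \<Rightarrow> 'c::real_normed_vector"
  assumes "smooth_on W f" "open S" "(\<lambda>t. (t, x)) ` S \<subseteq> W"
  shows "smooth_on S (\<lambda>t. f (t, x))"
proof -
  have "smooth_on S (\<lambda>t. (t, 0) + (0, x) :: 't \<times> 'b)"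
    by (rule smooth_on_add[OF assms(2) smooth_on_bounded_linear[OF _ assms(2)] smooth_on_const])
       (intro bounded_linear_Pair bounded_linear_ident bounded_linear_zero)
  then have "smooth_on S (\<lambda>t. (t, x) :: 't \<times> 'b)" by simp
  from smooth_on_compose[OF assms(2,1) this assms(3)] show ?thesis .
qed

lemma slice_op_smooth:
  assumes A: "riemannian_manifold A g" "\<kappa> \<in> A" "p \<in> fst \<kappa>" and B: "riemannian_manifold B h" "\<kappa>' \<in> B"
    and T: "open T" and \<Phi>: "smooth_family T A B \<Phi>"
  shows "smooth_on {\<tau>\<in>T. \<Phi> \<tau> p \<in> fst \<kappa>'} (\<lambda>\<tau>. pullback_op g h \<kappa> \<kappa>' (\<Phi> \<tau>) p)"
    and "smooth_on {\<tau>\<in>T. \<Phi> \<tau> p \<in> fst \<kappa>'} (\<lambda>\<tau>. pullback_metric h \<kappa> \<kappa>' (\<Phi> \<tau>) p)"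
    and "smooth_on {\<tau>\<in>T. \<Phi> \<tau> p \<in> fst \<kappa>'} (\<lambda>\<tau>. differential_matrix \<kappa> \<kappa>' (\<Phi> \<tau>) p)"
proof -
  have g: "smooth_atlas A" and h: "smooth_atlas B"
    using A(1) B(1) by (auto simp: riemannian_manifold_def)
  let ?S = "{\<tau>\<in>T. \<Phi> \<tau> p \<in> fst \<kappa>'}"
  have S: "open ?S" by (rule slice_open[OF g h T \<Phi> B(2)])
  have inv: "chart_inv \<kappa> (snd \<kappa> p) = p" by (rule chart_props(3)[OF g A(2,3)])
  have sub: "(\<lambda>t. (t, snd \<kappa> p)) ` ?S \<subseteq> fam_dom T \<kappa> \<kappa>' \<Phi>" using A(3) inv by (auto simp: fam_dom_def)
  show "smooth_on ?S (\<lambda>\<tau>. pullback_op g h \<kappa> \<kappa>' (\<Phi> \<tau>) p)"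
    using smooth_on_slice[OF family_op_smooth(1)[OF A(1,2) B T \<Phi>] S sub] by (simp add: inv)
  show "smooth_on ?S (\<lambda>\<tau>. pullback_metric h \<kappa> \<kappa>' (\<Phi> \<tau>) p)"
    using smooth_on_slice[OF family_op_smooth(2)[OF A(1,2) B T \<Phi>] S sub] by (simp add: inv)
  show "smooth_on ?S (\<lambda>\<tau>. differential_matrix \<kappa> \<kappa>' (\<Phi> \<tau>) p)"
    using smooth_on_slice[OF family_differential_smooth[OF g A(2) h B(2) T \<Phi>] S sub] by (simp add: inv)
qed

text \<open>
  By the symmetry of second derivatives, the differential is stationary in a direction whose variation
  field vanishes identically.
\<close>

lemma op_direction_zero:
  fixes T :: "'t::euclidean_space set" and A :: "('m::{t2_space, second_countable_topology}, 'a::finite) chart set"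
    and B :: "('n::{t2_space, second_countable_topology}, 'b::finite) chart set"
  assumes A: "riemannian_manifold A g" "\<kappa> \<in> A" "p \<in> fst \<kappa>" and B: "riemannian_manifold B h" "\<kappa>' \<in> B" "\<Phi> \<tau> p \<in> fst \<kappa>'"
    and T: "open T" "\<tau> \<in> T" and \<Phi>: "smooth_family T A B \<Phi>"
    and zero: "\<And>y. (\<tau>, y) \<in> fam_dom T \<kappa> \<kappa>' \<Phi> \<Longrightarrow> frechet_derivative (fam_expr \<kappa> \<kappa>' \<Phi>) (at (\<tau>, y)) (e, 0) = 0"
  shows "frechet_derivative (\<lambda>t. pullback_op g h \<kappa> \<kappa>' (\<Phi> t) p) (at \<tau>) e = 0"
proof -
  have g: "smooth_atlas A" and h: "smooth_atlas B" "riemannian_metric B h"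
    using A(1) B(1) by (auto simp: riemannian_manifold_def)
  let ?S = "{\<tau>\<in>T. \<Phi> \<tau> p \<in> fst \<kappa>'}" and ?\<Omega> = "fam_dom T \<kappa> \<kappa>' \<Phi>" and ?U = "fam_expr \<kappa> \<kappa>' \<Phi>"
  define x where "x = snd \<kappa> p"
  have S: "open ?S" by (rule slice_open[OF g h(1) T(1) \<Phi> B(2)])
  have \<tau>S: "\<tau> \<in> ?S" using T(2) B(3) by simp
  have inv: "chart_inv \<kappa> x = p" unfolding x_def by (rule chart_props(3)[OF g A(2,3)])
  have SO: "(t, x) \<in> ?\<Omega>" if "t \<in> ?S" for t using that A(3) inv by (auto simp: fam_dom_def x_def)
  note op = fam_dom_open[OF g A(2) h(1) B(2) T(1) \<Phi>] and sm = smooth_family_props(2)[OF \<Phi> A(2) B(2)]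
  have pair: "((\<lambda>t. (t, x)) has_derivative (\<lambda>v. (v, 0))) (at t)" for t :: 't
    by (auto intro!: derivative_eq_intros)
  have pair2: "((\<lambda>y. (\<tau>, y)) has_derivative (\<lambda>v. (0, v))) (at x)"
    by (auto intro!: derivative_eq_intros)
  \<comment> \<open>Over the parameter \<open>\<tau>\<close> the derivative in direction
    \<open>e\<close> is identically zero in the chart, so its derivative in direction (0, w)
    vanishes as well; then the order of differentiation is exchanged.\<close>
  have mixed: "frechet_derivative (\<lambda>z. frechet_derivative ?U (at z) (0, w)) (at (\<tau>, x)) (e, 0) = 0" for w
  proof -
    let ?k = "\<lambda>z. frechet_derivative ?U (at z) (e, 0)"
    have d: "((\<lambda>y. ?k (\<tau>, y)) has_derivative (\<lambda>v. frechet_derivative ?k (at (\<tau>, x)) (0, v))) (at x)"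
      by (rule has_derivative_compose[OF pair2 smooth_on_has_derivative[OF smooth_on_frechet[OF sm] SO[OF \<tau>S]]])
    have "continuous_on UNIV (\<lambda>y::real^'a. (\<tau>, y))" by (intro continuous_intros)
    from open_vimage[OF op this] have o2: "open ((\<lambda>y. (\<tau>, y)) -` ?\<Omega>)" .
    have "((\<lambda>y. ?k (\<tau>, y)) has_derivative (\<lambda>v. 0)) (at x)"
      by (rule has_derivative_transform_within_open[OF has_derivative_const o2]) (use SO[OF \<tau>S] zero in auto)
    from fun_cong[OF has_derivative_unique[OF d this], of w]
    have "frechet_derivative ?k (at (\<tau>, x)) (0, w) = 0" .
    then show ?thesis
      using frechet_mixed_symmetric[OF op sm SO[OF \<tau>S], of "(e, 0)" "(0, w)"] by simp
  qed
  define D where "D t = differential_matrix \<kappa> \<kappa>' (\<Phi> t) p" for t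
  have D: "(D has_derivative frechet_derivative D (at \<tau>)) (at \<tau>)"
    using smooth_on_has_derivative[OF slice_op_smooth(3)[OF A B(1,2) T(1) \<Phi>] \<tau>S] unfolding D_def .
  have De: "frechet_derivative D (at \<tau>) e = 0"
  proof -
    have "frechet_derivative D (at \<tau>) e $ i $ j = 0" for i j
    proof -
      have 1: "((\<lambda>t. D t $ i $ j) has_derivative (\<lambda>v. frechet_derivative D (at \<tau>) v $ i $ j)) (at \<tau>)"
        by (rule bounded_linear.has_derivative[OF bounded_linear_vec_nth bounded_linear.has_derivative[OF bounded_linear_vec_nth D]])
      let ?k = "\<lambda>z. frechet_derivative ?U (at z) (0, axis j 1)"
      have "((\<lambda>t. ?k (t, x)) has_derivative (\<lambda>v. frechet_derivative ?k (at (\<tau>, x)) (v, 0))) (at \<tau>)"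
        by (rule has_derivative_compose[OF pair smooth_on_has_derivative[OF smooth_on_frechet[OF sm] SO[OF \<tau>S]]])
      then have "((\<lambda>t. ?k (t, x) $ i) has_derivative (\<lambda>v. frechet_derivative ?k (at (\<tau>, x)) (v, 0) $ i)) (at \<tau>)"
        by (rule bounded_linear.has_derivative[OF bounded_linear_vec_nth])
      then have 2: "((\<lambda>t. D t $ i $ j) has_derivative (\<lambda>v. frechet_derivative ?k (at (\<tau>, x)) (v, 0) $ i)) (at \<tau>)"
      proof (rule has_derivative_transform_within_open[OF _ S \<tau>S])
        fix t assume t: "t \<in> ?S"
        have "D t = matrix (\<lambda>v. frechet_derivative ?U (at (t, x)) (0, v))"
          unfolding D_def using differential_matrix_eqI[of \<kappa>' "\<Phi> t" \<kappa> _ p] fam_slice_derivative[OF sm SO[OF t]] by (simp add: x_def)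
        then show "?k (t, x) $ i = D t $ i $ j" by (simp add: matrix_def)
      qed
      from fun_cong[OF has_derivative_unique[OF 1 2], of e] mixed[of "axis j 1"] show ?thesis by simp
    qed
    then show ?thesis by (simp add: vec_eq_iff)
  qed
  \<comment> \<open>The Gram matrix of \<open>h\<close> is taken at the moving target point and so
    depends on the parameter too; its derivative in direction \<open>e\<close> vanishes because the
    velocity of that point does.\<close>
  let ?hh = "\<lambda>y. h \<kappa>' (chart_inv \<kappa>' y)"
  have UK: "?U (t, x) = snd \<kappa>' (\<Phi> t p)" for t by (simp add: fam_expr_def inv)
  have "?U (\<tau>, x) \<in> snd \<kappa>' ` fst \<kappa>'" using B(3) by (simp add: UK)
  from smooth_on_has_derivative[OF metric_smooth[OF h(2) B(2)] this]
  have hd: "(?hh has_derivative frechet_derivative ?hh (at (?U (\<tau>, x)))) (at (?U (\<tau>, x)))" .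
  have Ud: "((\<lambda>t. ?U (t, x)) has_derivative (\<lambda>v. frechet_derivative ?U (at (\<tau>, x)) (v, 0))) (at \<tau>)"
    by (rule has_derivative_compose[OF pair smooth_on_has_derivative[OF sm SO[OF \<tau>S]]])
  have "((\<lambda>t. ?hh (?U (t, x))) has_derivative (\<lambda>v. frechet_derivative ?hh (at (?U (\<tau>, x))) (frechet_derivative ?U (at (\<tau>, x)) (v, 0)))) (at \<tau>)"
    by (rule has_derivative_compose[OF Ud hd])
  then have Hd: "((\<lambda>t. h \<kappa>' (\<Phi> t p)) has_derivative (\<lambda>v. frechet_derivative ?hh (at (?U (\<tau>, x))) (frechet_derivative ?U (at (\<tau>, x)) (v, 0)))) (at \<tau>)"
    by (rule has_derivative_transform_within_open[OF _ S \<tau>S]) (simp add: UK chart_props(3)[OF h(1) B(2)])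
  have He: "frechet_derivative ?hh (at (?U (\<tau>, x))) (frechet_derivative ?U (at (\<tau>, x)) (e, 0)) = 0"
    using zero[OF SO[OF \<tau>S]] linear_0[OF has_derivative_linear[OF hd]] by simp
  note mm = bounded_bilinear.FDERIV[OF bounded_bilinear_matrix_mult]
  note all = mm[OF has_derivative_const mm[OF mm[OF bounded_linear.has_derivative[OF bounded_linear_transpose D] Hd] D], of "matrix_inv (g \<kappa> p)"]
  have "(\<lambda>t. pullback_op g h \<kappa> \<kappa>' (\<Phi> t) p) = (\<lambda>t. matrix_inv (g \<kappa> p) ** (transpose (D t) ** h \<kappa>' (\<Phi> t p) ** D t))"
    by (simp add: pullback_op_def pullback_metric_def D_def)
  with fun_cong[OF frechet_derivative_eqI[OF all], of e] show ?thesis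
    by (simp add: De He transpose_def[of 0] zero_vec_def[symmetric] bounded_bilinear.zero_left[OF bounded_bilinear_matrix_mult] bounded_bilinear.zero_right[OF bounded_bilinear_matrix_mult] linear_0[OF bounded_linear.linear[OF bounded_linear_transpose]])
qed

text \<open>The pullback metric is symmetric for every parameter, hence so is its derivative, while
  \<open>g \<kappa> p\<close> does not depend on the parameter. This puts the first derivative of
  the operator into the form to which \<open>trace_square_ge\<close> applies.\<close>

lemma op_derivative_symmetric:
  fixes T :: "'t::euclidean_space set"
  assumes A: "riemannian_manifold A g" "\<kappa> \<in> A" "p \<in> fst \<kappa>" and B: "riemannian_manifold B h" "\<kappa>' \<in> B" "\<Phi> \<tau> p \<in> fst \<kappa>'"
    and T: "open T" "\<tau> \<in> T" and \<Phi>: "smooth_family T A B \<Phi>"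
  shows "\<exists>P. transpose P = P \<and> frechet_derivative (\<lambda>t. pullback_op g h \<kappa> \<kappa>' (\<Phi> t) p) (at \<tau>) b = matrix_inv (g \<kappa> p) ** P"
proof -
  have g: "smooth_atlas A" and h: "smooth_atlas B" "riemannian_metric B h"
    using A(1) B(1) by (auto simp: riemannian_manifold_def)
  let ?S = "{\<tau>\<in>T. \<Phi> \<tau> p \<in> fst \<kappa>'}"
  define P where "P t = pullback_metric h \<kappa> \<kappa>' (\<Phi> t) p" for t
  have S: "open ?S" by (rule slice_open[OF g h(1) T(1) \<Phi> B(2)])
  have \<tau>S: "\<tau> \<in> ?S" using T(2) B(3) by simp
  have d: "(P has_derivative frechet_derivative P (at \<tau>)) (at \<tau>)"
    using smooth_on_has_derivative[OF slice_op_smooth(2)[OF A B(1,2) T(1) \<Phi>] \<tau>S] unfolding P_def .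
  have "(P has_derivative (\<lambda>v. transpose (frechet_derivative P (at \<tau>) v))) (at \<tau>)"
  proof (rule has_derivative_transform_within_open[OF bounded_linear.has_derivative[OF bounded_linear_transpose d] S \<tau>S])
    fix t assume "t \<in> ?S"
    then show "transpose (P t) = P t"
      unfolding P_def using metric_props(2)[OF h(2) B(2), of "\<Phi> t p"] by (intro pullback_symmetric) simp
  qed
  from fun_cong[OF has_derivative_unique[OF this d], of b]
  have sy: "transpose (frechet_derivative P (at \<tau>) b) = frechet_derivative P (at \<tau>) b" .
  have "((\<lambda>t. matrix_inv (g \<kappa> p) ** P t) has_derivative (\<lambda>v. matrix_inv (g \<kappa> p) ** frechet_derivative P (at \<tau>) v)) (at \<tau>)"
    by (rule bounded_linear.has_derivative[OF bounded_bilinear.bounded_linear_right[OF bounded_bilinear_matrix_mult] d])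
  from fun_cong[OF frechet_derivative_eqI[OF this], of b]
  have "frechet_derivative (\<lambda>t. pullback_op g h \<kappa> \<kappa>' (\<Phi> t) p) (at \<tau>) b = matrix_inv (g \<kappa> p) ** frechet_derivative P (at \<tau>) b"
    by (simp add: pullback_op_def P_def)
  with sy show ?thesis by blast
qed

section \<open>The first and second variation of the energies\<close>

text \<open>The conformality condition is placed at the parameter 0, where the homothetic map sits;
  connectedness of \<open>T\<close> serves the invariance of the volume. Parameters range over any
  Euclidean space, so that one- and two-parameter variations share the results.\<close>

locale homothetic_family = family_data A g B h T \<Phi> c
  for A :: "('m::{t2_space, second_countable_topology}, 'a::finite) chart set" and g
    and B :: "('n::{t2_space, second_countable_topology}, 'b::finite) chart set" and h
    and T :: "'t::euclidean_space set" and \<Phi> :: "'t \<Rightarrow> 'm \<Rightarrow> 'n" and c +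
  fixes l :: "'m \<Rightarrow> real"
  assumes conn: "connected T" and zero: "0 \<in> T" and l_pos: "\<And>p. l p > 0"
    and c_eq: "\<And>p. c p = l p ^ 4 / l p ^ CARD('a)"
    and conf: "\<And>\<kappa> \<kappa>' p. \<kappa> \<in> A \<Longrightarrow> \<kappa>' \<in> B \<Longrightarrow> p \<in> fst \<kappa> \<Longrightarrow> \<Phi> 0 p \<in> fst \<kappa>' \<Longrightarrow>
        pullback_op g h \<kappa> \<kappa>' (\<Phi> 0) p = (l p)\<^sup>2 *\<^sub>R mat 1"
begin

definition sig :: "'t \<Rightarrow> 'm \<Rightarrow> real" where "sig \<tau> p = elem2 (map_op A g B h (\<Phi> \<tau>) p)"

definition dens :: "'t \<Rightarrow> 'm \<Rightarrow> real" where "dens \<tau> p = trace (map_op A g B h (\<Phi> \<tau>) p)"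

abbreviation \<nu> where "\<nu> \<equiv> riemannian_measure A g"

lemma sig_functions: "smooth_functions T A sig"
  unfolding sig_def by (rule smooth_functions_op[OF A B T \<Phi> smooth_invariant_basic(3)])

lemma dens_functions: "smooth_functions T A dens"
  unfolding dens_def by (rule smooth_functions_op[OF A B T \<Phi> smooth_invariant_basic(1)])

lemma jac_functions: "smooth_functions T A jac"
  unfolding smooth_functions_def
proof
  fix \<kappa> assume k: "\<kappa> \<in> A"
  note ch = chart_props[OF gA(1) k]
  have "smooth_on (T \<times> snd \<kappa> ` fst \<kappa>) (\<lambda>z. sqrt ((\<lambda>(t, x). det (map_op A g B h (\<Phi> t) (chart_inv \<kappa> x))) z))"
  proof (rule smooth_on_sqrt[OF open_Times[OF T ch(2)]])
    show "smooth_on (T \<times> snd \<kappa> ` fst \<kappa>) (\<lambda>(t, x). det (map_op A g B h (\<Phi> t) (chart_inv \<kappa> x)))"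
      using det_functions k unfolding smooth_functions_def by blast
  qed (use det in auto)
  then show "smooth_on (T \<times> snd \<kappa> ` fst \<kappa>) (\<lambda>(t, x). jac t (chart_inv \<kappa> x))"
    by (simp add: jac_def case_prod_unfold)
qed

text \<open>The matrix inequalities are applied at each point in charts around it and carried back
  to the chart-free functions. The premise about \<open>a - b\<close> says that the variation fields
  in the directions \<open>a\<close> and \<open>b\<close> coincide, which makes the first
  derivatives of the operator in these directions equal.\<close>

lemma variation_inequalities:
  fixes p a b
  shows "dir_deriv sig b 0 p = 2 * (real CARD('a) - 1) * (c p * dir_deriv jac b 0 p)"
    and "(\<And>\<kappa> \<kappa>' y. \<kappa> \<in> A \<Longrightarrow> \<kappa>' \<in> B \<Longrightarrow> (0, y) \<in> fam_dom T \<kappa> \<kappa>' \<Phi> \<Longrightarrow> frechet_derivative (fam_expr \<kappa> \<kappa>' \<Phi>) (at (0, y)) (a - b, 0) = 0) \<Longrightarrow>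
      dir_deriv (dir_deriv sig b) a 0 p \<ge> 2 * (c p * dir_deriv (dir_deriv jac b) a 0 p) + (real CARD('a) - 2) * ((l p)\<^sup>2 * dir_deriv (dir_deriv dens b) a 0 p)"
    and "(\<And>\<kappa> \<kappa>' y. \<kappa> \<in> A \<Longrightarrow> \<kappa>' \<in> B \<Longrightarrow> (0, y) \<in> fam_dom T \<kappa> \<kappa>' \<Phi> \<Longrightarrow> frechet_derivative (fam_expr \<kappa> \<kappa>' \<Phi>) (at (0, y)) (a - b, 0) = 0) \<Longrightarrow> CARD('a) \<le> 4 \<Longrightarrow>
      dir_deriv (dir_deriv sig b) a 0 p \<ge> 2 * (real CARD('a) - 1) * (c p * dir_deriv (dir_deriv jac b) a 0 p)"
proof -
  define \<kappa> where "\<kappa> = chart_at A p"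
  define \<kappa>' where "\<kappa>' = chart_at B (\<Phi> 0 p)"
  have k: "\<kappa> \<in> A" "p \<in> fst \<kappa>" and k': "\<kappa>' \<in> B" "\<Phi> 0 p \<in> fst \<kappa>'"
    using chart_at_props[OF gA(1)] chart_at_props[OF hB(1)] by (auto simp: \<kappa>_def \<kappa>'_def)
  define S where "S = {\<tau>\<in>T. \<Phi> \<tau> p \<in> fst \<kappa>'}"
  define M where "M \<tau> = pullback_op g h \<kappa> \<kappa>' (\<Phi> \<tau>) p" for \<tau>
  have S: "open S" unfolding S_def by (rule slice_open[OF gA(1) hB(1) T \<Phi> k'(1)])
  have ST: "S \<subseteq> T" by (auto simp: S_def)
  have zS: "0 \<in> S" using zero k'(2) by (simp add: S_def)
  have M: "smooth_on S M" unfolding S_def M_def by (rule slice_op_smooth(1)[OF A k B k'(1) T \<Phi>])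
  have inv: "I (map_op A g B h (\<Phi> \<tau>) p) = I (M \<tau>)" if "conj_invariant I" "\<tau> \<in> S" for I \<tau>
    unfolding M_def using that(2) ST
    by (intro map_op_chart[OF A k B k'(1) _ family_differentiable_map[OF gA(1) \<Phi>] that(1)]) (auto simp: S_def)
  have pos: "det (M \<tau>) > 0" if "\<tau> \<in> S" for \<tau>
    using inv[OF conj_invariant_basic(2) that] det[of \<tau> p] that ST by auto
  have M0: "M 0 = (l p)\<^sup>2 *\<^sub>R mat 1" unfolding M_def by (rule conf[OF k(1) k'(1) k(2) k'(2)])
  note slice = dir_deriv_slice[OF gA(1) T _ S ST _ zS]
  have s: "sig \<tau> p = elem2 (M \<tau>)" if "\<tau> \<in> S" for \<tau> unfolding sig_def by (rule inv[OF conj_invariant_basic(3) that])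
  have d: "dens \<tau> p = trace (M \<tau>)" if "\<tau> \<in> S" for \<tau> unfolding dens_def by (rule inv[OF conj_invariant_basic(1) that])
  have j: "jac \<tau> p = sqrt (det (M \<tau>))" if "\<tau> \<in> S" for \<tau> unfolding jac_def inv[OF conj_invariant_basic(2) that] ..
  note ineq = second_variation_inequalities[OF S M pos zS l_pos M0, folded c_eq]
  note slices = slice[OF sig_functions s] slice[OF dens_functions d] slice[OF jac_functions j]
  show "dir_deriv sig b 0 p = 2 * (real CARD('a) - 1) * (c p * dir_deriv jac b 0 p)"
    using ineq(1)[of b] by (simp only: slices)
  assume V: "\<And>\<kappa> \<kappa>' y. \<kappa> \<in> A \<Longrightarrow> \<kappa>' \<in> B \<Longrightarrow> (0, y) \<in> fam_dom T \<kappa> \<kappa>' \<Phi> \<Longrightarrow> frechet_derivative (fam_expr \<kappa> \<kappa>' \<Phi>) (at (0, y)) (a - b, 0) = 0"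
  have "frechet_derivative M (at 0) (a - b) = 0"
    unfolding M_def by (rule op_direction_zero[OF A k B k' T zero \<Phi> V[OF k(1) k'(1)]])
  then have ab: "frechet_derivative M (at 0) a = frechet_derivative M (at 0) b"
    using linear_diff[OF has_derivative_linear[OF smooth_on_has_derivative[OF M zS]], of a b] by simp
  show "dir_deriv (dir_deriv sig b) a 0 p \<ge> 2 * (c p * dir_deriv (dir_deriv jac b) a 0 p) + (real CARD('a) - 2) * ((l p)\<^sup>2 * dir_deriv (dir_deriv dens b) a 0 p)"
    using ineq(2)[OF _ ab] by (simp only: slices)
  assume n: "CARD('a) \<le> 4"
  obtain P where P: "transpose P = P" "frechet_derivative M (at 0) b = matrix_inv (g \<kappa> p) ** P"
    using op_derivative_symmetric[OF A k B k' T zero \<Phi>, of b] unfolding M_def by blast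
  show "dir_deriv (dir_deriv sig b) a 0 p \<ge> 2 * (real CARD('a) - 1) * (c p * dir_deriv (dir_deriv jac b) a 0 p)"
    using ineq(3)[OF _ ab P(2) metric_props(1)[OF gA(2) k] P(1) n] by (simp only: slices)
qed

lemma integral_constant_deriv:
  assumes F: "smooth_functions T A F" and const: "\<And>\<tau>. \<tau> \<in> T \<Longrightarrow> (\<integral>p. F \<tau> p \<partial>\<nu>) = k" and \<tau>: "\<tau> \<in> T"
  shows "(\<integral>p. dir_deriv F b \<tau> p \<partial>\<nu>) = 0"
proof -
  have "((\<lambda>r. \<integral>p. F (\<tau> + r *\<^sub>R b) p \<partial>\<nu>) has_real_derivative (\<integral>p. dir_deriv F b \<tau> p \<partial>\<nu>)) (at 0)"
    by (rule integral_dir_deriv[OF gA(1) T F \<tau> riemannian_measure_finite[OF A comp] riemannian_measure_spec(1)[OF A] comp])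
  moreover have "((\<lambda>r. \<integral>p. F (\<tau> + r *\<^sub>R b) p \<partial>\<nu>) has_real_derivative 0) (at 0)"
  proof (rule has_field_derivative_transform_within_open[OF DERIV_const[of k]])
    show "open ((\<lambda>r. \<tau> + r *\<^sub>R b) -` T)" by (intro open_vimage T continuous_intros)
    show "0 \<in> (\<lambda>r. \<tau> + r *\<^sub>R b) -` T" using \<tau> by simp
  qed (simp add: const)
  ultimately show ?thesis by (rule DERIV_unique)
qed

text \<open>The first derivative of the constant volume vanishes at every parameter in
  \<open>T\<close> and not just at 0, so it may be differentiated again.\<close>

lemma integral_jac_deriv:
  shows "\<tau> \<in> T \<Longrightarrow> (\<integral>p. c p * dir_deriv jac b \<tau> p \<partial>\<nu>) = 0"
    and "\<tau> \<in> T \<Longrightarrow> (\<integral>p. c p * dir_deriv (dir_deriv jac b) a \<tau> p \<partial>\<nu>) = 0"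
proof -
  note cm = smooth_functions_cmult[OF gA(1) T _ c_local]
  note jb = smooth_functions_dir_deriv[OF gA(1) T jac_functions]
  show 1: "(\<integral>p. c p * dir_deriv jac b \<tau> p \<partial>\<nu>) = 0" if "\<tau> \<in> T" for \<tau>
    using integral_constant_deriv[OF cm(1)[OF jac_functions] volume_invariant[OF conn _ zero] that, of b]
    by (simp only: cm(2)[OF jac_functions that])
  show "(\<integral>p. c p * dir_deriv (dir_deriv jac b) a \<tau> p \<partial>\<nu>) = 0" if "\<tau> \<in> T"
    using integral_constant_deriv[OF cm(1)[OF jb] 1 that, of a]
    by (simp only: cm(2)[OF jb that])
qed

lemma integrable_family: "smooth_functions T A F \<Longrightarrow> integrable \<nu> (F 0)"
  by (rule continuous_integrable_compact[OF riemannian_measure_finite[OF A comp] riemannian_measure_spec(1)[OF A] comp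
        smooth_functions_slice_continuous[OF gA(1) T _ zero]])

lemma integral_sig_deriv: "(\<integral>p. dir_deriv sig b 0 p \<partial>\<nu>) = 0"
  unfolding variation_inequalities(1) using integral_jac_deriv(1)[OF zero, of b] by simp

lemma integrable_jac2: "integrable \<nu> (\<lambda>p. c p * dir_deriv (dir_deriv jac b) a 0 p)"
  by (rule integrable_family[OF smooth_functions_cmult(1)[OF gA(1) T
        smooth_functions_dir_deriv[OF gA(1) T smooth_functions_dir_deriv[OF gA(1) T jac_functions]] c_local]])

lemma integrable_sig2: "integrable \<nu> (dir_deriv (dir_deriv sig b) a 0)"
  by (rule integrable_family[OF smooth_functions_dir_deriv[OF gA(1) T smooth_functions_dir_deriv[OF gA(1) T sig_functions]]])

lemma integral_sig_nonneg:
  assumes "\<And>\<kappa> \<kappa>' y. \<kappa> \<in> A \<Longrightarrow> \<kappa>' \<in> B \<Longrightarrow> (0, y) \<in> fam_dom T \<kappa> \<kappa>' \<Phi> \<Longrightarrow> frechet_derivative (fam_expr \<kappa> \<kappa>' \<Phi>) (at (0, y)) (a - b, 0) = 0"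
    and "CARD('a) \<le> 4"
  shows "(\<integral>p. dir_deriv (dir_deriv sig b) a 0 p \<partial>\<nu>) \<ge> 0"
proof -
  have "(\<integral>p. 2 * (real CARD('a) - 1) * (c p * dir_deriv (dir_deriv jac b) a 0 p) \<partial>\<nu>) \<le> (\<integral>p. dir_deriv (dir_deriv sig b) a 0 p \<partial>\<nu>)"
    by (rule integral_mono[OF integrable_mult_right[OF integrable_jac2] integrable_sig2 variation_inequalities(3)[OF assms]])
  then show ?thesis using integral_jac_deriv(2)[OF zero, of b a] by simp
qed

text \<open>The squared dilation stays under the integral, as it may differ between components of
  the manifold; a rescaled variation will account for it.\<close>

lemma integral_sig_ge_dens:
  assumes "\<And>\<kappa> \<kappa>' y. \<kappa> \<in> A \<Longrightarrow> \<kappa>' \<in> B \<Longrightarrow> (0, y) \<in> fam_dom T \<kappa> \<kappa>' \<Phi> \<Longrightarrow> frechet_derivative (fam_expr \<kappa> \<kappa>' \<Phi>) (at (0, y)) (a - b, 0) = 0"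
    and l_local: "\<And>p. \<exists>V. open V \<and> p \<in> V \<and> (\<forall>q\<in>V. (l q)\<^sup>2 = (l p)\<^sup>2)"
  shows "(\<integral>p. dir_deriv (dir_deriv sig b) a 0 p \<partial>\<nu>) \<ge> (real CARD('a) - 2) * (\<integral>p. (l p)\<^sup>2 * dir_deriv (dir_deriv dens b) a 0 p \<partial>\<nu>)"
proof -
  have d: "integrable \<nu> (\<lambda>p. (l p)\<^sup>2 * dir_deriv (dir_deriv dens b) a 0 p)"
    by (rule integrable_family[OF smooth_functions_cmult(1)[OF gA(1) T
        smooth_functions_dir_deriv[OF gA(1) T smooth_functions_dir_deriv[OF gA(1) T dens_functions]] l_local]])
  have "(\<integral>p. 2 * (c p * dir_deriv (dir_deriv jac b) a 0 p) + (real CARD('a) - 2) * ((l p)\<^sup>2 * dir_deriv (dir_deriv dens b) a 0 p) \<partial>\<nu>) \<le> (\<integral>p. dir_deriv (dir_deriv sig b) a 0 p \<partial>\<nu>)"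
    by (rule integral_mono[OF Bochner_Integration.integrable_add[OF integrable_mult_right[OF integrable_jac2] integrable_mult_right[OF d]] integrable_sig2 variation_inequalities(2)[OF assms(1)]])
  also have "(\<integral>p. 2 * (c p * dir_deriv (dir_deriv jac b) a 0 p) + (real CARD('a) - 2) * ((l p)\<^sup>2 * dir_deriv (dir_deriv dens b) a 0 p) \<partial>\<nu>)
    = 2 * (\<integral>p. c p * dir_deriv (dir_deriv jac b) a 0 p \<partial>\<nu>) + (real CARD('a) - 2) * (\<integral>p. (l p)\<^sup>2 * dir_deriv (dir_deriv dens b) a 0 p \<partial>\<nu>)"
    by (subst Bochner_Integration.integral_add[OF integrable_mult_right[OF integrable_jac2] integrable_mult_right[OF d]]) simp
  finally show ?thesis using integral_jac_deriv(2)[OF zero, of b a] by simp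
qed

end

text \<open>At the parameter 0 the determinant is a positive power of the dilation, and by
  compactness it stays positive at all points for a whole ball of parameters. A ball is also
  connected.\<close>

lemma homothetic_family_exists:
  fixes A :: "('m::{t2_space, second_countable_topology}, 'a::finite) chart set"
    and B :: "('n::{t2_space, second_countable_topology}, 'b::finite) chart set" and T :: "'t::euclidean_space set"
  assumes A: "riemannian_manifold A g" and B: "riemannian_manifold B h"
    and card: "CARD('a) = CARD('b)" and comp: "compact (UNIV :: 'm set)"
    and T: "open T" "0 \<in> T" and \<Phi>: "smooth_family T A B \<Phi>"
    and l: "\<And>p. l p > 0" "\<And>p. \<exists>V. open V \<and> p \<in> V \<and> (\<forall>q\<in>V. l q = l p)"
    and conf: "\<And>\<kappa> \<kappa>' p. \<kappa> \<in> A \<Longrightarrow> \<kappa>' \<in> B \<Longrightarrow> p \<in> fst \<kappa> \<Longrightarrow> \<Phi> 0 p \<in> fst \<kappa>' \<Longrightarrow>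
        pullback_op g h \<kappa> \<kappa>' (\<Phi> 0) p = (l p)\<^sup>2 *\<^sub>R mat 1"
  shows "\<exists>T'. open T' \<and> 0 \<in> T' \<and> T' \<subseteq> T \<and> homothetic_family A g B h T' \<Phi> (\<lambda>p. l p ^ 4 / l p ^ CARD('a)) l"
proof -
  have g: "smooth_atlas A" and h: "smooth_atlas B"
    using A B by (auto simp: riemannian_manifold_def)
  have pos: "det (map_op A g B h (\<Phi> 0) p) > 0" for p
    unfolding map_op_def conf[OF chart_at_props(1)[OF g] chart_at_props(1)[OF h] chart_at_props(2)[OF g] chart_at_props(2)[OF h]]
    using l(1)[of p] by (simp add: det_scaleR_mat)
  obtain r where r: "r > 0" "ball 0 r \<subseteq> T" "\<forall>t\<in>ball 0 r. \<forall>p. det (map_op A g B h (\<Phi> t) p) > 0"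
    using smooth_functions_pos_nbhd[OF g T smooth_functions_op[OF A B T(1) \<Phi> smooth_invariant_basic(2)] comp pos] by (elim exE conjE)
  have "homothetic_family A g B h (ball 0 r) \<Phi> (\<lambda>p. l p ^ 4 / l p ^ CARD('a)) l"
  proof
    show "smooth_family (ball 0 r) A B \<Phi>" by (rule smooth_family_subset[OF \<Phi> r(2)])
    show "\<exists>V. open V \<and> p \<in> V \<and> (\<forall>q\<in>V. l q ^ 4 / l q ^ CARD('a) = l p ^ 4 / l p ^ CARD('a))" for p
    proof -
      obtain V where V: "open V" "p \<in> V" "\<forall>q\<in>V. l q = l p" using l(2)[of p] by (elim exE conjE)
      show ?thesis
      proof (intro exI[of _ V] conjI ballI V(1,2))
        fix q assume "q \<in> V"
        then have e: "l q = l p" by (rule bspec[OF V(3)])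
        show "l q ^ 4 / l q ^ CARD('a) = l p ^ 4 / l p ^ CARD('a)" unfolding e ..
      qed
    qed
    show "0 < l p ^ 4 / l p ^ CARD('a)" for p using l(1)[of p] by simp
    show "connected (ball (0::'t) r)" by (rule convex_connected[OF convex_ball])
  qed (use A B card comp r l(1) conf in auto)
  then show ?thesis using r(1,2) by (intro exI[of _ "ball 0 r"]) simp
qed

section \<open>From integrals of derivatives to the Hessians of the energies\<close>

lemma sigma2_energy_eq:
  assumes "riemannian_manifold A g" "riemannian_manifold B h"
  shows "sigma2_energy A g B h f = 1 / 2 * (\<integral>p. elem2 (map_op A g B h f p) \<partial>riemannian_measure A g)"
  unfolding sigma2_energy_def sigma2_eq[OF assms] ..

lemma dirichlet_energy_eq:
  assumes "riemannian_manifold A g" "riemannian_manifold B h"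
  shows "dirichlet_energy A g B h f = 1 / 2 * (\<integral>p. trace (map_op A g B h f p) \<partial>riemannian_measure A g)"
  unfolding dirichlet_energy_def differential_norm_sq_eq[OF assms] ..

text \<open>The inner derivative is computed at all parameters (t, 0) near 0, so that it can be
  differentiated in t under the integral again. The direction (0, 1) belongs to s and (1, 0) to
  t.\<close>

lemma hessian_integral:
  fixes A :: "('m::{t2_space, second_countable_topology}, 'a::finite) chart set" and T :: "(real \<times> real) set"
  assumes A: "riemannian_manifold A g" and comp: "compact (UNIV :: 'm set)" and T: "open T" "0 \<in> T"
    and F: "smooth_functions T A F" and E: "\<And>\<tau>. E (\<Phi> \<tau>) = 1 / 2 * (\<integral>p. F \<tau> p \<partial>riemannian_measure A g)"
  shows "deriv (\<lambda>t. deriv (\<lambda>s. E (\<Phi> (t, s))) 0) 0 = 1 / 2 * (\<integral>p. dir_deriv (dir_deriv F (0, 1)) (1, 0) 0 p \<partial>riemannian_measure A g)"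
proof -
  let ?\<nu> = "riemannian_measure A g"
  have g: "smooth_atlas A" using A by (simp add: riemannian_manifold_def)
  note leib = integral_dir_deriv[OF g T(1) _ _ riemannian_measure_finite[OF A comp] riemannian_measure_spec(1)[OF A] comp]
  have inner: "deriv (\<lambda>s. E (\<Phi> (t, s))) 0 = 1 / 2 * (\<integral>p. dir_deriv F (0, 1) (t, 0) p \<partial>?\<nu>)" if "(t, 0) \<in> T" for t
    using DERIV_imp_deriv[OF DERIV_cmult[OF leib[OF F that, of "(0, 1)"], of "1/2"]] by (simp add: E)
  let ?S = "(\<lambda>t. (t, 0::real)) -` T"
  have S: "open ?S" by (intro open_vimage T continuous_intros)
  have "((\<lambda>r. \<integral>p. dir_deriv F (0, 1) (0 + r *\<^sub>R (1, 0)) p \<partial>?\<nu>) has_real_derivative (\<integral>p. dir_deriv (dir_deriv F (0, 1)) (1, 0) 0 p \<partial>?\<nu>)) (at 0)"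
    by (rule leib[OF smooth_functions_dir_deriv[OF g T(1) F] T(2)])
  from DERIV_cmult[OF this, of "1/2"]
  have "((\<lambda>t. 1/2 * (\<integral>p. dir_deriv F (0, 1) (t, 0) p \<partial>?\<nu>)) has_real_derivative 1/2 * (\<integral>p. dir_deriv (dir_deriv F (0, 1)) (1, 0) 0 p \<partial>?\<nu>)) (at 0)"
    by simp
  then have "((\<lambda>t. deriv (\<lambda>s. E (\<Phi> (t, s))) 0) has_real_derivative 1/2 * (\<integral>p. dir_deriv (dir_deriv F (0, 1)) (1, 0) 0 p \<partial>?\<nu>)) (at 0)"
    by (rule has_field_derivative_transform_within_open[OF _ S]) (use T(2) inner in \<open>auto simp: zero_prod_def\<close>)
  then show ?thesis by (rule DERIV_imp_deriv)
qed

text \<open>Both variation fields are the same \<open>v\<close>, so at every point the chart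
  expression has equal derivatives in the directions (1, 0) and (0, 1).\<close>

lemma variation_direction:
  fixes \<Phi> :: "real \<times> real \<Rightarrow> 'm::{t2_space, second_countable_topology} \<Rightarrow> 'n::{t2_space, second_countable_topology}"
    and A :: "('m, 'a::finite) chart set" and B :: "('n, 'b::finite) chart set"
  assumes A: "smooth_atlas A" and var: "two_parameter_variation A B \<phi> v v \<Phi>" and \<Phi>: "smooth_family T A B \<Phi>"
    and k: "\<kappa> \<in> A" "\<kappa>' \<in> B" and y: "(0, y) \<in> fam_dom T \<kappa> \<kappa>' \<Phi>"
  shows "frechet_derivative (fam_expr \<kappa> \<kappa>' \<Phi>) (at (0, y)) ((1, 0) - (0, 1), 0) = 0"
proof -
  let ?U = "fam_expr \<kappa> \<kappa>' \<Phi>"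
  let ?q = "chart_inv \<kappa> y"
  have \<phi>: "\<Phi> (0, 0) = \<phi>" and var': "\<And>\<kappa>' p. \<kappa>' \<in> B \<Longrightarrow> p \<in> \<phi> -` fst \<kappa>' \<Longrightarrow>
        ((\<lambda>t. snd \<kappa>' (\<Phi> (t, 0) p)) has_vector_derivative v \<kappa>' p) (at 0) \<and>
        ((\<lambda>s. snd \<kappa>' (\<Phi> (0, s) p)) has_vector_derivative v \<kappa>' p) (at 0)"
    using var unfolding two_parameter_variation_def by auto
  have q: "?q \<in> \<phi> -` fst \<kappa>'" using y \<phi> by (auto simp: fam_dom_def zero_prod_def)
  have d: "(?U has_derivative frechet_derivative ?U (at (0, y))) (at (0, y))"
    by (rule smooth_on_has_derivative[OF smooth_family_props(2)[OF \<Phi> k] y])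
  have dir: "frechet_derivative ?U (at (0, y)) (w, 0) = u"
    if "((\<lambda>t. snd \<kappa>' (\<Phi> (t *\<^sub>R w) ?q)) has_vector_derivative u) (at 0)" for w :: "real \<times> real" and u
  proof -
    have "((\<lambda>t::real. (t *\<^sub>R w, y)) has_derivative (\<lambda>t. (t *\<^sub>R w, 0))) (at 0)"
      by (auto intro!: derivative_eq_intros)
    from has_derivative_compose[OF this, of ?U "frechet_derivative ?U (at (0, y))"] d
    have "((\<lambda>t. snd \<kappa>' (\<Phi> (t *\<^sub>R w) ?q)) has_derivative (\<lambda>t. frechet_derivative ?U (at (0, y)) (t *\<^sub>R w, 0))) (at 0)"
      by (simp add: fam_expr_def)
    from fun_cong[OF has_derivative_unique[OF this that[unfolded has_vector_derivative_def]], of 1] show ?thesis by simp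
  qed
  have "frechet_derivative ?U (at (0, y)) ((1, 0), 0) = v \<kappa>' ?q" "frechet_derivative ?U (at (0, y)) ((0, 1), 0) = v \<kappa>' ?q"
    using var'[OF k(2) q] by (auto intro!: dir)
  moreover have "((1, 0) - (0, 1), 0) = (((1, 0), 0) - ((0, 1), 0) :: (real \<times> real) \<times> (real ^ 'a))" by simp
  ultimately show ?thesis using linear_diff[OF has_derivative_linear[OF d]] by (metis diff_self)
qed

section \<open>Rescaling a variation by the dilation\<close>

text \<open>A rescaled family agrees with a slice of the original one near a given point, where the
  dilation is constant, but not globally; the operator at that point does not see the
  difference.\<close>

lemma map_op_local:
  fixes A :: "('m::{t2_space, second_countable_topology}, 'a::finite) chart set"
    and B :: "('n::{t2_space, second_countable_topology}, 'b::finite) chart set"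
  assumes A: "smooth_atlas A" and B: "smooth_atlas B" and V: "open V" "p \<in> V" "\<And>q. q \<in> V \<Longrightarrow> f q = f' q" and f: "differentiable_map A B f"
  shows "map_op A g B h f p = map_op A g B h f' p"
proof -
  define \<kappa> where "\<kappa> = chart_at A p"
  define \<kappa>' where "\<kappa>' = chart_at B (f p)"
  have k: "\<kappa> \<in> A" "p \<in> fst \<kappa>" and k': "\<kappa>' \<in> B" "f p \<in> fst \<kappa>'"
    using chart_at_props[OF A] chart_at_props[OF B] by (auto simp: \<kappa>_def \<kappa>'_def)
  have "(snd \<kappa>' \<circ> f \<circ> chart_inv \<kappa>) differentiable (at (snd \<kappa> p))"
    using f k k' by (simp add: differentiable_map_def)
  note d = differential_matrix_has_derivative[OF this]
  have "((snd \<kappa>' \<circ> f' \<circ> chart_inv \<kappa>) has_derivative (\<lambda>v. differential_matrix \<kappa> \<kappa>' f p *v v)) (at (snd \<kappa> p))"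
    by (rule has_derivative_transform_within_open[OF d chart_open_image[OF A k(1) V(1)]])
       (use k V(2,3) chart_props(3)[OF A k(1)] in auto)
  from differential_matrix_eqI[OF this] have "differential_matrix \<kappa> \<kappa>' f' p = differential_matrix \<kappa> \<kappa>' f p"
    by (simp add: matrix_of_matrix_vector_mul)
  then show ?thesis
    unfolding map_op_def pullback_op_def pullback_metric_def V(3)[OF V(2), symmetric] \<kappa>_def \<kappa>'_def by simp
qed

text \<open>Near a given point \<open>l\<close> is constant, so there the new family is the old one
  precomposed with a linear map of the parameter.\<close>

lemma reparametrized_family:
  fixes A :: "('m::{t2_space, second_countable_topology}, 'a::finite) chart set"
    and B :: "('n::{t2_space, second_countable_topology}, 'b::finite) chart set" and T :: "'t::euclidean_space set"
  assumes A: "smooth_atlas A" and B: "smooth_atlas B" and T: "open T" and T': "open T'" and \<Phi>: "smooth_family T A B \<Phi>"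
    and sub: "\<And>\<tau> p. \<tau> \<in> T' \<Longrightarrow> l p *\<^sub>R \<tau> \<in> T"
    and l: "\<And>p. \<exists>V. open V \<and> p \<in> V \<and> (\<forall>q\<in>V. l q = l p)"
  shows "smooth_family T' A B (\<lambda>\<tau> p. \<Phi> (l p *\<^sub>R \<tau>) p)"
proof -
  have lc: "continuous_on UNIV l" by (rule continuous_on_locally_constant[of l, OF l])
  have "continuous_on (T' \<times> UNIV) (\<lambda>z. l (snd z))"
    by (rule continuous_on_compose2[OF lc continuous_on_snd[OF continuous_on_id]]) auto
  then have "continuous_on (T' \<times> UNIV) (\<lambda>z. (l (snd z) *\<^sub>R fst z, snd z))"
    by (intro continuous_on_Pair continuous_on_scaleR continuous_on_fst continuous_on_snd continuous_on_id)
  then have "continuous_on (T' \<times> UNIV) (\<lambda>z. (\<lambda>(t, p). \<Phi> t p) (l (snd z) *\<^sub>R fst z, snd z))"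
    by (rule continuous_on_compose2[OF smooth_family_props(1)[OF \<Phi>]]) (use sub in auto)
  then have cont: "continuous_on (T' \<times> UNIV) (\<lambda>(t, p). \<Phi> (l p *\<^sub>R t) p)" by (simp add: case_prod_unfold)
  show ?thesis unfolding smooth_family_def
  proof (intro conjI cont ballI smooth_on_local)
    fix \<kappa> \<kappa>' z assume k: "\<kappa> \<in> A" "\<kappa>' \<in> B"
      and z: "z \<in> {(t, x). t \<in> T' \<and> x \<in> snd \<kappa> ` fst \<kappa> \<and> \<Phi> (l (chart_inv \<kappa> x) *\<^sub>R t) (chart_inv \<kappa> x) \<in> fst \<kappa>'}"
    note c = chart_props[OF A k(1)]
    obtain t q where tq: "z = (t, snd \<kappa> q)" "t \<in> T'" "q \<in> fst \<kappa>" using z by auto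
    have zq: "\<Phi> (l q *\<^sub>R t) q \<in> fst \<kappa>'" using z tq c(3)[OF tq(3)] by auto
    obtain V where V: "open V" "q \<in> V" "\<forall>q'\<in>V. l q' = l q" using l by blast
    define L where "L = (\<lambda>z :: 't \<times> (real ^ 'a). (l q *\<^sub>R fst z, snd z))"
    have L: "bounded_linear L" unfolding L_def
      by (intro bounded_linear_Pair bounded_linear_scaleR_right[THEN bounded_linear_compose] bounded_linear_fst bounded_linear_snd)
    have op: "open (fam_dom T \<kappa> \<kappa>' \<Phi>)" by (rule fam_dom_open[OF A k(1) B k(2) T \<Phi>])
    define W where "W = T' \<times> snd \<kappa> ` (fst \<kappa> \<inter> V) \<inter> L -` fam_dom T \<kappa> \<kappa>' \<Phi>"
    have W: "open W" unfolding W_def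
      by (intro open_Int open_Times T' chart_open_image[OF A k(1) V(1)] open_vimage[OF op] linear_continuous_on L)
    have "smooth_on W (\<lambda>z. fam_expr \<kappa> \<kappa>' \<Phi> (L z))"
      by (rule smooth_on_compose[OF W smooth_family_props(2)[OF \<Phi> k] smooth_on_bounded_linear[OF L W]]) (auto simp: W_def)
    then have "smooth_on W (\<lambda>(t, x). snd \<kappa>' (\<Phi> (l (chart_inv \<kappa> x) *\<^sub>R t) (chart_inv \<kappa> x)))"
    proof (rule smooth_on_cong[OF W, rotated])
      fix z assume "z \<in> W"
      then obtain t q' where "z = (t, snd \<kappa> q')" "q' \<in> fst \<kappa>" "q' \<in> V" by (auto simp: W_def)
      then show "fam_expr \<kappa> \<kappa>' \<Phi> (L z) = (case z of (t, x) \<Rightarrow> snd \<kappa>' (\<Phi> (l (chart_inv \<kappa> x) *\<^sub>R t) (chart_inv \<kappa> x)))"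
        using bspec[OF V(3), of q'] c(3)[of q'] by (simp add: fam_expr_def L_def)
    qed
    moreover have "z \<in> W"
      using tq V(2) zq sub[OF tq(2)] c(3)[OF tq(3)] by (auto simp: W_def L_def fam_dom_def)
    ultimately show "\<exists>U. open U \<and> z \<in> U \<and> smooth_on U (\<lambda>(t, x). snd \<kappa>' (\<Phi> (l (chart_inv \<kappa> x) *\<^sub>R t) (chart_inv \<kappa> x)))"
      using W by blast
  qed
qed

text \<open>This is the origin of the factor \<lambda>^2 in front of the second derivative of the
  Dirichlet density.\<close>

lemma dir_deriv_rescaled:
  fixes T :: "'t::euclidean_space set"
  assumes A: "smooth_atlas A" and T: "open T" "0 \<in> T" and T': "open T'" "0 \<in> T'" and F: "smooth_functions T A F" and F': "smooth_functions T' A F'"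
    and eq: "\<And>\<tau>. \<tau> \<in> T' \<Longrightarrow> k *\<^sub>R \<tau> \<in> T \<Longrightarrow> F' \<tau> p = F (k *\<^sub>R \<tau>) p"
  shows "dir_deriv (dir_deriv F' b) a 0 p = k\<^sup>2 * dir_deriv (dir_deriv F b) a 0 p"
proof -
  define S where "S = T' \<inter> (\<lambda>\<tau>. k *\<^sub>R \<tau>) -` T"
  have S: "open S" unfolding S_def by (intro open_Int T' open_vimage T continuous_intros)
  \<comment> \<open>One differentiation with an extra factor \<open>r\<close>, so that it can be
    used twice: with r = 1 and then with r = k, each time producing a factor
    \<open>k\<close>.\<close>
  have step: "dir_deriv H' b \<tau> p = r * (k * dir_deriv H b (k *\<^sub>R \<tau>) p)"
    if H: "smooth_functions T A H" and eqH: "\<And>\<tau>. \<tau> \<in> S \<Longrightarrow> H' \<tau> p = r * H (k *\<^sub>R \<tau>) p" and \<tau>: "\<tau> \<in> S" for H H' r b \<tau>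
  proof -
    have "k *\<^sub>R \<tau> \<in> T" using \<tau> by (simp add: S_def)
    note d = smooth_functions_has_derivative[OF A H this, of p]
    have "((\<lambda>\<tau>. k *\<^sub>R \<tau>) has_derivative (\<lambda>v. k *\<^sub>R v)) (at \<tau>)" by (auto intro!: derivative_eq_intros)
    from has_derivative_mult_right[OF has_derivative_compose[OF this d], of r]
    have "((\<lambda>\<tau>. r * H (k *\<^sub>R \<tau>) p) has_derivative (\<lambda>v. r * dir_deriv H (k *\<^sub>R v) (k *\<^sub>R \<tau>) p)) (at \<tau>)" .
    from fun_cong[OF frechet_derivative_cong_eqI[OF S \<tau> eqH this], of b]
    show ?thesis unfolding dir_deriv_def[of H'] using linear_scale[OF has_derivative_linear[OF d]] by simp
  qed
  have "dir_deriv F' b \<tau> p = 1 * (k * dir_deriv F b (k *\<^sub>R \<tau>) p)" if "\<tau> \<in> S" for \<tau>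
    by (rule step[OF F _ that]) (simp add: eq S_def)
  then have 1: "dir_deriv F' b \<tau> p = k * dir_deriv F b (k *\<^sub>R \<tau>) p" if "\<tau> \<in> S" for \<tau> using that by simp
  have "0 \<in> S" using T(2) T'(2) by (simp add: S_def)
  have "dir_deriv (dir_deriv F' b) a 0 p = k * (k * dir_deriv (dir_deriv F b) a (k *\<^sub>R 0) p)"
    by (rule step[OF smooth_functions_dir_deriv[OF A T(1) F] _ \<open>0 \<in> S\<close>]) (rule 1)
  then show ?thesis by (simp add: power2_eq_square)
qed

text \<open>Supplies a variation with the fields \<open>l v\<close> and \<open>l w\<close>, at which
  stability for the Dirichlet energy is to be tested. Compactness bounds \<open>l\<close>, so one
  square of parameters works for all points.\<close>

lemma reparametrized_variation:
  fixes A :: "('m::{t2_space, second_countable_topology}, 'a::finite) chart set"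
    and B :: "('n::{t2_space, second_countable_topology}, 'b::finite) chart set" and T :: "(real \<times> real) set"
  assumes A: "smooth_atlas A" and B: "smooth_atlas B" and comp: "compact (UNIV :: 'm set)"
    and T: "open T" "0 \<in> T" and \<Phi>: "smooth_family T A B \<Phi>" and var: "two_parameter_variation A B \<phi> v w \<Phi>"
    and l: "\<And>p. l p > 0" "\<And>p. \<exists>V. open V \<and> p \<in> V \<and> (\<forall>q\<in>V. l q = l p)" "continuous_on UNIV l"
  defines "\<Psi> \<equiv> \<lambda>\<tau> p. \<Phi> (l p *\<^sub>R \<tau>) p"
  shows "two_parameter_variation A B \<phi> (\<lambda>\<kappa>' p. l p *\<^sub>R v \<kappa>' p) (\<lambda>\<kappa>' p. l p *\<^sub>R w \<kappa>' p) \<Psi>"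
    and "\<exists>T'. open T' \<and> 0 \<in> T' \<and> smooth_family T' A B \<Psi>"
proof -
  have "compact (range l)" by (rule compact_continuous_image[OF l(3) comp])
  then obtain L where L: "\<And>p. norm (l p) \<le> L"
    using compact_imp_bounded[of "range l"] unfolding bounded_iff by blast
  have Lpos: "L > 0" using L[of undefined] l(1)[of undefined] by simp
  obtain r where r: "r > 0" "ball 0 r \<subseteq> T" using T open_contains_ball by blast
  \<comment> \<open>A parameter in the square of half-width \<epsilon> has norm below 2 \<epsilon>;
    after rescaling by at most \<open>L\<close> its norm is below \<open>r\<close>.\<close>
  define \<epsilon> where "\<epsilon> = r / (2 * L)"
  have \<epsilon>: "\<epsilon> > 0" using r(1) Lpos by (simp add: \<epsilon>_def)
  let ?T = "{-\<epsilon><..<\<epsilon>} \<times> {-\<epsilon><..<\<epsilon>}"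
  have sub: "l p *\<^sub>R \<tau> \<in> T" if \<tau>: "\<tau> \<in> ?T" for \<tau> p
  proof -
    obtain a b where ab: "\<tau> = (a, b)" "\<bar>a\<bar> < \<epsilon>" "\<bar>b\<bar> < \<epsilon>" using \<tau> by (auto simp: abs_less_iff)
    have "norm \<tau> \<le> \<bar>a\<bar> + \<bar>b\<bar>" unfolding ab(1) using norm_Pair_le[of a b] by simp
    also have "\<dots> < 2 * \<epsilon>" using ab by simp
    finally have n: "norm \<tau> < 2 * \<epsilon>" .
    have "norm (l p *\<^sub>R \<tau>) \<le> L * norm \<tau>" using L[of p] by (simp add: mult_right_mono)
    also have "\<dots> < L * (2 * \<epsilon>)" using n Lpos by simp
    also have "\<dots> = r" using Lpos by (simp add: \<epsilon>_def)
    finally show ?thesis using r(2) by auto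
  qed
  have T': "open ?T" by (intro open_Times open_greaterThanLessThan)
  have fam: "smooth_family ?T A B \<Psi>" unfolding \<Psi>_def by (rule reparametrized_family[OF A B T(1) T' \<Phi> sub l(2)])
  show "\<exists>T'. open T' \<and> 0 \<in> T' \<and> smooth_family T' A B \<Psi>"
    using T' fam \<epsilon> by (intro exI[of _ ?T]) (simp add: zero_prod_def)
  have \<phi>: "\<Phi> (0, 0) = \<phi>" and var': "\<And>\<kappa>' p. \<kappa>' \<in> B \<Longrightarrow> p \<in> \<phi> -` fst \<kappa>' \<Longrightarrow>
        ((\<lambda>t. snd \<kappa>' (\<Phi> (t, 0) p)) has_vector_derivative v \<kappa>' p) (at 0) \<and>
        ((\<lambda>s. snd \<kappa>' (\<Phi> (0, s) p)) has_vector_derivative w \<kappa>' p) (at 0)"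
    using var unfolding two_parameter_variation_def by auto
  have scale: "((\<lambda>t. f (l p * t)) has_vector_derivative l p *\<^sub>R f') (at 0)"
    if "(f has_vector_derivative f') (at 0)" for f :: "real \<Rightarrow> real ^ 'b" and f' p
  proof -
    have "((\<lambda>t. l p * t) has_vector_derivative l p) (at 0)"
      by (auto intro!: derivative_eq_intros simp flip: has_real_derivative_iff_has_vector_derivative)
    from vector_diff_chain_at[OF this, of f f'] that show ?thesis by (simp add: o_def)
  qed
  show "two_parameter_variation A B \<phi> (\<lambda>\<kappa>' p. l p *\<^sub>R v \<kappa>' p) (\<lambda>\<kappa>' p. l p *\<^sub>R w \<kappa>' p) \<Psi>"
    unfolding two_parameter_variation_def
  proof (intro conjI ballI)
    show "\<exists>\<epsilon>>0. smooth_family ({-\<epsilon><..<\<epsilon>} \<times> {-\<epsilon><..<\<epsilon>}) A B \<Psi>" using fam \<epsilon> by blast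
    show "\<Psi> (0, 0) = \<phi>" by (simp add: \<Psi>_def \<phi> fun_eq_iff)
    fix \<kappa>' p assume "\<kappa>' \<in> B" "p \<in> \<phi> -` fst \<kappa>'"
    note d = var'[OF this]
    show "((\<lambda>t. snd \<kappa>' (\<Psi> (t, 0) p)) has_vector_derivative l p *\<^sub>R v \<kappa>' p) (at 0)"
      using scale[OF conjunct1[OF d]] by (simp add: \<Psi>_def)
    show "((\<lambda>s. snd \<kappa>' (\<Psi> (0, s) p)) has_vector_derivative l p *\<^sub>R w \<kappa>' p) (at 0)"
      using scale[OF conjunct2[OF d]] by (simp add: \<Psi>_def)
  qed
qed

lemma section_along_scaled:
  fixes A :: "('m::{t2_space, second_countable_topology}, 'a::finite) chart set"
    and B :: "('n::{t2_space, second_countable_topology}, 'b::finite) chart set"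
  assumes A: "smooth_atlas A" and B: "smooth_atlas B" and \<phi>: "continuous_on UNIV \<phi>" and l: "smooth_function A l"
    and v: "section_along A B \<phi> v"
  shows "section_along A B \<phi> (\<lambda>\<kappa>' p. l p *\<^sub>R v \<kappa>' p)"
  unfolding section_along_def
proof (intro conjI ballI)
  fix \<kappa> \<kappa>' assume k: "\<kappa> \<in> A" "\<kappa>' \<in> B"
  let ?S = "snd \<kappa> ` (fst \<kappa> \<inter> \<phi> -` fst \<kappa>')"
  have S: "open ?S" by (rule chart_open_image[OF A k(1) open_vimage[OF chart_props(1)[OF B k(2)] \<phi>]])
  have sub: "?S \<subseteq> snd \<kappa> ` fst \<kappa>" by blast
  have "smooth_on (snd \<kappa> ` fst \<kappa>) (l \<circ> chart_inv \<kappa>)" using l k(1) unfolding smooth_function_def by blast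
  from smooth_on_subset[OF this sub] have 1: "smooth_on ?S (l \<circ> chart_inv \<kappa>)" .
  have 2: "smooth_on ?S (v \<kappa>' \<circ> chart_inv \<kappa>)" using v k unfolding section_along_def by blast
  show "smooth_on ?S ((\<lambda>p. l p *\<^sub>R v \<kappa>' p) \<circ> chart_inv \<kappa>)"
    using smooth_on_bilinear[OF bounded_bilinear_scaleR S 1 2] by (simp add: o_def)
next
  fix \<kappa>' \<kappa>'' p assume k: "\<kappa>' \<in> B" "\<kappa>'' \<in> B" "p \<in> \<phi> -` (fst \<kappa>' \<inter> fst \<kappa>'')"
  have "v \<kappa>'' p = differential_matrix \<kappa>' \<kappa>'' id (\<phi> p) *v v \<kappa>' p" using v k unfolding section_along_def by blast
  then show "l p *\<^sub>R v \<kappa>'' p = differential_matrix \<kappa>' \<kappa>'' id (\<phi> p) *v (l p *\<^sub>R v \<kappa>' p)"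
    by (simp add: matrix_vector_mult_scaleR)
qed

theorem proposition4p2:
  fixes A :: "('m::{t2_space, second_countable_topology}, 'a::finite) chart set"
    and g :: "('m, 'a) metric"
    and B :: "('n::{t2_space, second_countable_topology}, 'b::finite) chart set"
    and h :: "('n, 'b) metric"
    and \<phi> :: "'m \<Rightarrow> 'n"
  assumes "riemannian_manifold A g"
    and "riemannian_manifold B h"
    and "compact (UNIV :: 'm set)"
    and "local_diffeomorphism A B \<phi>"
    and "homothetic A g B h \<phi>"
  shows "(CARD('a) \<in> {2, 3, 4} \<longrightarrow> stable_critical_map (sigma2_energy A g B h) A B \<phi>) \<and>
         (stable_critical_map (dirichlet_energy A g B h) A B \<phi> \<longrightarrow>
            stable_critical_map (sigma2_energy A g B h) A B \<phi>)"
proof -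
  note A = assms(1) and B = assms(2) and comp = assms(3)
  have atl: "smooth_atlas A" "smooth_atlas B" using A B by (simp_all add: riemannian_manifold_def)
  let ?E = "sigma2_energy A g B h" and ?\<nu> = "riemannian_measure A g"
  obtain l where l: "smooth_function A l" and l_pos: "\<And>p. l p > 0"
    and grad: "\<And>\<kappa> p. \<kappa> \<in> A \<Longrightarrow> p \<in> fst \<kappa> \<Longrightarrow> gradient g l \<kappa> p = 0"
    and pb: "\<And>\<kappa> \<kappa>' p. \<kappa> \<in> A \<Longrightarrow> \<kappa>' \<in> B \<Longrightarrow> p \<in> fst \<kappa> \<inter> \<phi> -` fst \<kappa>' \<Longrightarrow> pullback_metric h \<kappa> \<kappa>' \<phi> p = (l p)\<^sup>2 *\<^sub>R g \<kappa> p"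
    using assms(5) unfolding homothetic_def by metis
  have l_local: "\<exists>V. open V \<and> p \<in> V \<and> (\<forall>q\<in>V. l q = l p)" for p
    by (rule gradient_zero_locally_constant[OF A l grad])
  note card = local_diffeomorphism_card[OF atl assms(4)]
  have conf: "pullback_op g h \<kappa> \<kappa>' \<phi> p = (l p)\<^sup>2 *\<^sub>R mat 1"
    if "\<kappa> \<in> A" "\<kappa>' \<in> B" "p \<in> fst \<kappa>" "\<phi> p \<in> fst \<kappa>'" for \<kappa> \<kappa>' p
    by (rule map_op_conformal[OF A B pb that])
  note sm = local_diffeomorphism_smooth[OF atl assms(4)]
  have \<phi>c: "continuous_on UNIV \<phi>" using sm by (simp add: smooth_map_on_def)
  have lc: "continuous_on UNIV l" by (rule continuous_on_locally_constant[of l, OF l_local])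
  let ?c = "\<lambda>p. l p ^ 4 / l p ^ CARD('a)"
  have crit: "critical_map ?E A B \<phi>"
    unfolding critical_map_def
  proof (intro conjI sm allI impI)
    fix \<Phi> assume "one_parameter_variation A B \<phi> \<Phi>"
    then obtain \<epsilon> where \<epsilon>: "\<epsilon> > 0" "smooth_family {-\<epsilon><..<\<epsilon>} A B \<Phi>" and \<Phi>0: "\<Phi> 0 = \<phi>"
      unfolding one_parameter_variation_def by blast
    obtain T where T: "homothetic_family A g B h T \<Phi> ?c l"
      using homothetic_family_exists[OF A B card comp open_greaterThanLessThan _ \<epsilon>(2) l_pos l_local] \<epsilon>(1) conf \<Phi>0 by auto
    interpret homothetic_family A g B h T \<Phi> ?c l by (rule T)
    have "((\<lambda>r. \<integral>p. sig (0 + r *\<^sub>R 1) p \<partial>?\<nu>) has_real_derivative (\<integral>p. dir_deriv sig 1 0 p \<partial>?\<nu>)) (at 0)"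
      by (rule integral_dir_deriv[OF gA(1) family_data_axioms[THEN family_data.T] sig_functions zero riemannian_measure_finite[OF A comp] riemannian_measure_spec(1)[OF A] comp])
    from DERIV_cmult[OF this, of "1/2"]
    show "((\<lambda>t. ?E (\<Phi> t)) has_real_derivative 0) (at 0)"
      by (simp add: integral_sig_deriv sigma2_energy_eq[OF A B] sig_def)
  qed
  \<comment> \<open>Dimensions up to 4 are handled outright, and Dirichlet stability serves the
    rest. In the second alternative n \<ge> 2 gives the factor n - 2 of the Dirichlet term its
    sign.\<close>
  have stable: "stable_critical_map ?E A B \<phi>"
    if alt: "CARD('a) \<le> 4 \<or> CARD('a) \<ge> 2 \<and> stable_critical_map (dirichlet_energy A g B h) A B \<phi>"
    unfolding stable_critical_map_def
  proof (intro conjI crit allI impI)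
    fix v r assume v: "section_along A B \<phi> v" and "hessian_value ?E A B \<phi> v v r"
    then obtain \<Phi> where var: "two_parameter_variation A B \<phi> v v \<Phi>" and r: "r = deriv (\<lambda>t. deriv (\<lambda>s. ?E (\<Phi> (t, s))) 0) 0"
      unfolding hessian_value_def by blast
    obtain \<epsilon> where \<epsilon>: "\<epsilon> > 0" "smooth_family ({-\<epsilon><..<\<epsilon>} \<times> {-\<epsilon><..<\<epsilon>}) A B \<Phi>" and \<Phi>0: "\<Phi> 0 = \<phi>"
      using var unfolding two_parameter_variation_def zero_prod_def by blast
    have zT: "0 \<in> {-\<epsilon><..<\<epsilon>} \<times> {-\<epsilon><..<\<epsilon>}" using \<epsilon>(1) by (simp add: zero_prod_def)
    obtain T where T: "homothetic_family A g B h T \<Phi> ?c l"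
      using homothetic_family_exists[OF A B card comp open_Times[OF open_greaterThanLessThan open_greaterThanLessThan] zT \<epsilon>(2) l_pos l_local] conf \<Phi>0 by auto
    interpret homothetic_family A g B h T \<Phi> ?c l by (rule T)
    note T = family_data_axioms[THEN family_data.T] and \<Phi> = family_data_axioms[THEN family_data.\<Phi>]
    note V = variation_direction[OF atl(1) var \<Phi>]
    have r_eq: "r = 1 / 2 * (\<integral>p. dir_deriv (dir_deriv sig (0, 1)) (1, 0) 0 p \<partial>?\<nu>)"
      unfolding r by (rule hessian_integral[OF A comp T zero sig_functions]) (simp only: sigma2_energy_eq[OF A B] sig_def)
    show "r \<ge> 0"
    proof (cases "CARD('a) \<le> 4")
      case True
      with integral_sig_nonneg[OF V] show ?thesis unfolding r_eq by simp
    next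
      case False
      with alt have n: "CARD('a) \<ge> 2" and st: "stable_critical_map (dirichlet_energy A g B h) A B \<phi>" by auto
      \<comment> \<open>The point \<open>p\<close> runs through the given variation at speed
        \<open>l p\<close>, so \<Psi> has the variation field \<open>l v\<close>, and its Dirichlet
        density has \<open>(l p)^2\<close> times the second derivative of that of \<Phi>.\<close>
      define \<Psi> where "\<Psi> = (\<lambda>\<tau> p. \<Phi> (l p *\<^sub>R \<tau>) p)"
      note rep = reparametrized_variation[OF atl comp T zero \<Phi> var l_pos l_local lc, folded \<Psi>_def]
      obtain T' where T': "open T'" "0 \<in> T'" "smooth_family T' A B \<Psi>" using rep(2) by blast
      define F where "F \<tau> p = trace (map_op A g B h (\<Psi> \<tau>) p)" for \<tau> p
      have F: "smooth_functions T' A F"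
        unfolding F_def by (rule smooth_functions_op[OF A B T'(1,3) smooth_invariant_basic(1)])
      have "hessian_value (dirichlet_energy A g B h) A B \<phi> (\<lambda>\<kappa>' p. l p *\<^sub>R v \<kappa>' p) (\<lambda>\<kappa>' p. l p *\<^sub>R v \<kappa>' p)
         (deriv (\<lambda>t. deriv (\<lambda>s. dirichlet_energy A g B h (\<Psi> (t, s))) 0) 0)"
        unfolding hessian_value_def using rep(1) by blast
      then have "deriv (\<lambda>t. deriv (\<lambda>s. dirichlet_energy A g B h (\<Psi> (t, s))) 0) 0 \<ge> 0"
        using st section_along_scaled[OF atl \<phi>c l v] unfolding stable_critical_map_def by blast
      moreover have "deriv (\<lambda>t. deriv (\<lambda>s. dirichlet_energy A g B h (\<Psi> (t, s))) 0) 0 = 1 / 2 * (\<integral>p. dir_deriv (dir_deriv F (0, 1)) (1, 0) 0 p \<partial>?\<nu>)"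
        by (rule hessian_integral[OF A comp T'(1,2) F]) (simp only: dirichlet_energy_eq[OF A B] F_def)
      moreover have "dir_deriv (dir_deriv F (0, 1)) (1, 0) 0 p = (l p)\<^sup>2 * dir_deriv (dir_deriv dens (0, 1)) (1, 0) 0 p" for p
      proof (rule dir_deriv_rescaled[OF atl(1) T zero T'(1,2) dens_functions F])
        fix \<tau> assume \<tau>: "\<tau> \<in> T'" "l p *\<^sub>R \<tau> \<in> T"
        obtain U where U: "open U" "p \<in> U" "\<forall>q\<in>U. l q = l p" using l_local[of p] by (elim exE conjE)
        have "map_op A g B h (\<Psi> \<tau>) p = map_op A g B h (\<Phi> (l p *\<^sub>R \<tau>)) p"
        proof (rule map_op_local[OF atl U(1,2) _ family_differentiable_map[OF atl(1) T'(3) \<tau>(1)]])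
          fix q assume "q \<in> U"
          then have "l q = l p" by (rule bspec[OF U(3)])
          then show "\<Psi> \<tau> q = \<Phi> (l p *\<^sub>R \<tau>) q" by (simp add: \<Psi>_def)
        qed
        then show "F \<tau> p = dens (l p *\<^sub>R \<tau>) p" by (simp add: F_def dens_def)
      qed
      ultimately have D: "(\<integral>p. (l p)\<^sup>2 * dir_deriv (dir_deriv dens (0, 1)) (1, 0) 0 p \<partial>?\<nu>) \<ge> 0" by simp
      have l2: "\<exists>V. open V \<and> p \<in> V \<and> (\<forall>q\<in>V. (l q)\<^sup>2 = (l p)\<^sup>2)" for p
      proof -
        obtain U where U: "open U" "p \<in> U" "\<forall>q\<in>U. l q = l p" using l_local[of p] by (elim exE conjE)
        show ?thesis
        proof (intro exI[of _ U] conjI ballI U(1,2))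
          fix q assume "q \<in> U"
          then have e: "l q = l p" by (rule bspec[OF U(3)])
          show "(l q)\<^sup>2 = (l p)\<^sup>2" unfolding e ..
        qed
      qed
      have "(real CARD('a) - 2) * (\<integral>p. (l p)\<^sup>2 * dir_deriv (dir_deriv dens (0, 1)) (1, 0) 0 p \<partial>?\<nu>) \<ge> 0"
        using D n by (intro mult_nonneg_nonneg) auto
      also have "\<dots> \<le> (\<integral>p. dir_deriv (dir_deriv sig (0, 1)) (1, 0) 0 p \<partial>?\<nu>)"
        by (rule integral_sig_ge_dens[OF V l2])
      finally show ?thesis unfolding r_eq by simp
    qed
  qed
  \<comment> \<open>Every dimension satisfies one of the two bounds, so a map that is stable for the
    Dirichlet energy always meets one of the alternatives of \<open>stable\<close>.\<close>
  have "CARD('a) \<le> 4 \<or> CARD('a) \<ge> 2" by linarith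
  with stable show ?thesis by auto
qed

end
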